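(* Assume that $a_0,a_1$ are bounded on $V\times V$, that $a_0(v,v)\ge 0$ for all $v\in V$ (no positive lower bound is assumed), that $a_1(v,v)\ge\beta|v|_V^2$ for all $v\in V$ with some $\beta>0$, and that $0<M_0=\nu([0,\infty))<\infty$. Let $u_0\in H$ and $f\in L^1(0,T;H)$, and for $\varepsilon\in[0,1]$ let $$X^\varepsilon(t)=(u^\varepsilon(t),\zeta^\varepsilon(t))=S_\varepsilon(t)(u_0,0)+\int_0^tS_\varepsilon(t-s)(f(s),0)\,ds,$$ where $(S_\varepsilon(t))_{t\ge0}$ is the contraction semigroup generated by $\mathcal A_\varepsilon$ on $\mathcal W$ (so all problems have the same initial datum $(u_0,0)$ and the same forcing $f$). Assume in addition that $u^0\in L^2(0,T;V)$. Set $e^\varepsilon=u^\varepsilon-u^0$ and $z^\varepsilon=\zeta^\varepsilon-\zeta^0$. Then for every $t\in[0,T]$, $$\|e^\varepsilon(t)\|_H^2+\|z^\varepsilon(t)\|_{\mathcal K}^2+2\int_0^ta_0(e^\varepsilon,e^\varepsilon)\,ds+\varepsilon\int_0^ta_{\mathrm v}(e^\varepsilon,e^\varepsilon)\,ds+2\int_0^t\int_{[0,\infty)}\lambda\,a_1(z^\varepsilon(\lambda,s),z^\varepsilon(\lambda,s))\,d\nu(\lambda)\,ds\le\varepsilon\int_0^ta_{\mathrm v}(u^0(s),u^0(s))\,ds.$$ In particular, $$\sup_{t\in[0,T]}\left[\|e^\varepsilon(t)\|_H^2+\|z^\varepsilon(t)\|_{\mathcal K}^2\right]\le\varepsilon\int_0^Ta_{\mathrm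 v}(u^0(t),u^0(t))\,dt$$ and $$\|X^\varepsilon-X^0\|_{C([0,T];\mathcal W)}\le\varepsilon^{1/2}\left(\int_0^Ta_{\mathrm v}(u^0(t),u^0(t))\,dt\right)^{1/2},$$ so the convergence rate in the norm of $C([0,T];\mathcal W)$ is $O(\varepsilon^{1/2})$.
   Context: Setting. $\Omega\subset\mathbb R^d$, $d\in\{1,2,3\}$, is a bounded Lipschitz domain; $H=L^2(\Omega)$, $V=H^1_0(\Omega)$ (real spaces), $|v|_V=\|\nabla v\|_{L^2(\Omega)}$, $\|v\|_V^2=\|v\|_H^2+|v|_V^2$; $H$ is identified with a subspace of $V'$; $T>0$. $A_0,A_1\in L^\infty(\Omega)^{d\times d}$ are symmetric matrix fields, $A_1$ pointwise positive semidefinite a.e., $a_i(w,v)=\int_\Omega A_i\nabla w\cdot\nabla v\,dx$, and $\mathsf A_i:V\to V'$ is given by $\langle\mathsf A_iw,v\rangle=a_i(w,v)$, $i=0,1$. $\nu$ is a non-zero non-negative Borel measure on $[0,\infty)$ (the Bernstein representing measure of the completely monotone kernel $k(t)=\int e^{-\lambda t}d\nu(\lambda)$). Spaces and operators. $\mathcal K$ is the Hilbert space of strongly $\nu$-measurable $\zeta:[0,\infty)\to V$ with $\|\zeta\|_{\mathcal K}^2=\int_{[0,\infty)}a_1(\zeta(\lambda),\zeta(\lambda))\,d\nu(\lambda)<\infty$; $\mathcal W=H\times\mathcal K$ with $\|(u,\zeta)\|_{\mathcal W}^2=\|u\|_H^2+\|\zeta\|_{\mathcal K}^2$. $J:\mathcal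 K\to V$, $J\zeta=\int\zeta\,d\nu$; $E:V\to\mathcal K$, $(Eu)(\lambda)=u$; $(\Lambda\zeta)(\lambda)=\lambda\zeta(\lambda)$. We write $z(\lambda,t)$ for $z(t)(\lambda)$. Perturbed family. $a_{\mathrm v}:V\times V\to\mathbb R$ is a bounded symmetric coercive bilinear form: $|a_{\mathrm v}(v,w)|\le C_{\mathrm v}\|v\|_V\|w\|_V$ and $a_{\mathrm v}(v,v)\ge\beta_{\mathrm v}|v|_V^2$ with $C_{\mathrm v},\beta_{\mathrm v}>0$; $\mathsf B:V\to V'$, $\langle\mathsf Bv,w\rangle=a_{\mathrm v}(v,w)$. For $\varepsilon\in[0,1]$, $\mathsf A_0^\varepsilon=\mathsf A_0+\varepsilon\mathsf B$, and $\mathcal A_\varepsilon(u,\zeta)=(-\mathsf A_0^\varepsilon u-\mathsf A_1J\zeta,\;Eu-\Lambda\zeta)$ with domain $D(\mathcal A_\varepsilon)=\{(u,\zeta)\in V\times\mathcal K:\ \mathsf A_0^\varepsilon u+\mathsf A_1J\zeta\in H,\ Eu-\Lambda\zeta\in\mathcal K\}$. Under the stated assumptions each $\mathcal A_\varepsilon$ is densely defined and $m$-dissipative, hence generates a $C_0$-semigroup of contractions on $\mathcal W$. *)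

theory Defs
  imports
    "HOL-Analysis.Analysis"
    "HOL-Library.Function_Algebras"
    "HOL-Library.Landau_Symbols"
begin

text \<open>
  Elements of $L^2(\Omega)$, $H^1_0(\Omega)$, $\mathcal K$ and $\mathcal W$ are represented by
  functions. Each of these spaces is a linear subspace \<open>S\<close> of a space of functions together with
  a seminorm \<open>N\<close>, and the Hilbert space in question is the quotient of \<open>S\<close> by the null space
  of \<open>N\<close>. Equality of elements is \<open>N (x - y) = 0\<close>; all notions below respect it.
\<close>

instantiation "fun" :: (type, real_vector) real_vector
begin

definition scaleR_fun :: "real \<Rightarrow> ('a \<Rightarrow> 'b) \<Rightarrow> 'a \<Rightarrow> 'b" where
  "scaleR_fun c f = (\<lambda>x. c *\<^sub>R f x)"

instance
  by standard (auto simp: scaleR_fun_def fun_eq_iff algebra_simps)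

end


section \<open>Vector-valued integration in a seminormed space\<close>

text \<open>
  The library's Bochner integral needs the target to be a type of class \<open>real_normed_vector\<close>;
  the following transcribes it to a subspace \<open>S\<close> of a \<open>real_vector\<close> type with seminorm \<open>N\<close>.
\<close>

definition strongly_measurable_in ::
  "'a measure \<Rightarrow> 'b::real_vector set \<Rightarrow> ('b \<Rightarrow> real) \<Rightarrow> ('a \<Rightarrow> 'b) \<Rightarrow> bool" where
  "strongly_measurable_in M S N f \<longleftrightarrow>
     (AE x in M. f x \<in> S) \<and>
     (\<exists>s. (\<forall>i::nat. simple_function M (s i) \<and> s i ` space M \<subseteq> S) \<and>
          (AE x in M. (\<lambda>i. N (f x - s i x)) \<longlonglongrightarrow> 0))"

definition Bochner_Lp ::
  "nat \<Rightarrow> 'a measure \<Rightarrow> 'b::real_vector set \<Rightarrow> ('b \<Rightarrow> real) \<Rightarrow> ('a \<Rightarrow> 'b) set" where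
  "Bochner_Lp p M S N =
     {f. strongly_measurable_in M S N f \<and> (\<integral>\<^sup>+x. ennreal (N (f x) ^ p) \<partial>M) < \<infinity>}"

definition has_bochner_integral_in ::
  "'a measure \<Rightarrow> 'b::real_vector set \<Rightarrow> ('b \<Rightarrow> real) \<Rightarrow> ('a \<Rightarrow> 'b) \<Rightarrow> 'b \<Rightarrow> bool" where
  "has_bochner_integral_in M S N f w \<longleftrightarrow>
     strongly_measurable_in M S N f \<and> w \<in> S \<and>
     (\<exists>s. (\<forall>i::nat. Bochner_Integration.simple_bochner_integrable M (s i) \<and> s i ` space M \<subseteq> S) \<and>
          (\<lambda>i. \<integral>\<^sup>+x. ennreal (N (f x - s i x)) \<partial>M) \<longlonglongrightarrow> 0 \<and>
          (\<lambda>i. N (Bochner_Integration.simple_bochner_integral M (s i) - w)) \<longlonglongrightarrow> 0)"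

definition bochner_integral_in ::
  "'a measure \<Rightarrow> 'b::real_vector set \<Rightarrow> ('b \<Rightarrow> real) \<Rightarrow> ('a \<Rightarrow> 'b) \<Rightarrow> 'b" where
  "bochner_integral_in M S N f = (SOME w. has_bochner_integral_in M S N f w)"


section \<open>Contraction semigroups on a seminormed space\<close>

definition contraction_semigroup ::
  "'w::real_vector set \<Rightarrow> ('w \<Rightarrow> real) \<Rightarrow> (real \<Rightarrow> 'w \<Rightarrow> 'w) \<Rightarrow> bool" where
  "contraction_semigroup S N T \<longleftrightarrow>
     (\<forall>t\<ge>0. \<forall>x\<in>S. T t x \<in> S) \<and>
     (\<forall>t\<ge>0. \<forall>x\<in>S. \<forall>y\<in>S. N (T t (x + y) - (T t x + T t y)) = 0) \<and>
     (\<forall>t\<ge>0. \<forall>c. \<forall>x\<in>S. N (T t (c *\<^sub>R x) - c *\<^sub>R T t x) = 0) \<and>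
     (\<forall>x\<in>S. N (T 0 x - x) = 0) \<and>
     (\<forall>t\<ge>0. \<forall>s\<ge>0. \<forall>x\<in>S. N (T (t + s) x - T t (T s x)) = 0) \<and>
     (\<forall>x\<in>S. ((\<lambda>t. N (T t x - x)) \<longlongrightarrow> 0) (at_right 0)) \<and>
     (\<forall>t\<ge>0. \<forall>x\<in>S. N (T t x) \<le> N x)"

text \<open>An unbounded operator is given by its graph.\<close>

definition generates ::
  "'w::real_vector set \<Rightarrow> ('w \<Rightarrow> real) \<Rightarrow> ('w \<times> 'w) set \<Rightarrow> (real \<Rightarrow> 'w \<Rightarrow> 'w) \<Rightarrow> bool" where
  "generates S N G T \<longleftrightarrow>
     G = {(x, y). x \<in> S \<and> y \<in> S \<and>
            ((\<lambda>h. N ((1 / h) *\<^sub>R (T h x - x) - y)) \<longlongrightarrow> 0) (at_right 0)}"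

definition mild_solution ::
  "'w::real_vector set \<Rightarrow> ('w \<Rightarrow> real) \<Rightarrow> (real \<Rightarrow> 'w \<Rightarrow> 'w) \<Rightarrow> 'w \<Rightarrow> (real \<Rightarrow> 'w) \<Rightarrow> real \<Rightarrow> 'w" where
  "mild_solution S N T x0 F t =
     T t x0 + bochner_integral_in (lebesgue_on {0..t}) S N (\<lambda>s. T (t - s) (F s))"

definition continuous_path_in ::
  "real \<Rightarrow> 'w::real_vector set \<Rightarrow> ('w \<Rightarrow> real) \<Rightarrow> (real \<Rightarrow> 'w) \<Rightarrow> bool" where
  "continuous_path_in T S N X \<longleftrightarrow>
     (\<forall>t\<in>{0..T}. X t \<in> S \<and> ((\<lambda>s. N (X s - X t)) \<longlongrightarrow> 0) (at t within {0..T}))"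

definition sup_norm_path :: "real \<Rightarrow> ('w \<Rightarrow> real) \<Rightarrow> (real \<Rightarrow> 'w) \<Rightarrow> real" where
  "sup_norm_path T N X = (SUP t\<in>{0..T}. N (X t))"


section \<open>Lipschitz domains and Sobolev spaces\<close>

text \<open>
  Near every boundary point, and with respect to some unit direction \<open>n\<close>, the domain is the
  epigraph of a Lipschitz function on the hyperplane orthogonal to \<open>n\<close>.
\<close>

definition bounded_lipschitz_domain :: "(real^'d) set \<Rightarrow> bool" where
  "bounded_lipschitz_domain \<Omega> \<longleftrightarrow>
     open \<Omega> \<and> connected \<Omega> \<and> bounded \<Omega> \<and> \<Omega> \<noteq> {} \<and>
     (\<forall>p\<in>frontier \<Omega>. \<exists>n r L \<gamma>. norm n = 1 \<and> r > 0 \<and>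
        L-lipschitz_on {y. y \<bullet> n = 0} \<gamma> \<and>
        \<Omega> \<inter> ball p r = {x \<in> ball p r. x \<bullet> n > \<gamma> (x - (x \<bullet> n) *\<^sub>R n)})"

definition partial_deriv :: "'d \<Rightarrow> (real^'d \<Rightarrow> real) \<Rightarrow> real^'d \<Rightarrow> real" where
  "partial_deriv i f x = frechet_derivative f (at x) (axis i 1)"

primrec Ck :: "nat \<Rightarrow> (real^'d \<Rightarrow> real) \<Rightarrow> bool" where
  "Ck 0 f \<longleftrightarrow> continuous_on UNIV f"
| "Ck (Suc k) f \<longleftrightarrow> f differentiable_on UNIV \<and> (\<forall>i. Ck k (partial_deriv i f))"

definition test_functions :: "(real^'d) set \<Rightarrow> (real^'d \<Rightarrow> real) set" where
  "test_functions \<Omega> =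
     {\<phi>. (\<forall>k. Ck k \<phi>) \<and> compact (closure {x. \<phi> x \<noteq> 0}) \<and> closure {x. \<phi> x \<noteq> 0} \<subseteq> \<Omega>}"

definition L2 :: "(real^'d) set \<Rightarrow> (real^'d \<Rightarrow> 'b::euclidean_space) set" where
  "L2 \<Omega> = {u \<in> borel_measurable (lebesgue_on \<Omega>). integrable (lebesgue_on \<Omega>) (\<lambda>x. (norm (u x))\<^sup>2)}"

definition L2_inner ::
  "(real^'d) set \<Rightarrow> (real^'d \<Rightarrow> 'b::euclidean_space) \<Rightarrow> (real^'d \<Rightarrow> 'b) \<Rightarrow> real" where
  "L2_inner \<Omega> u v = (LINT x|lebesgue_on \<Omega>. u x \<bullet> v x)"

definition L2_norm :: "(real^'d) set \<Rightarrow> (real^'d \<Rightarrow> 'b::euclidean_space) \<Rightarrow> real" where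
  "L2_norm \<Omega> u = sqrt (L2_inner \<Omega> u u)"

definition is_weak_gradient ::
  "(real^'d) set \<Rightarrow> (real^'d \<Rightarrow> real) \<Rightarrow> (real^'d \<Rightarrow> real^'d) \<Rightarrow> bool" where
  "is_weak_gradient \<Omega> v g \<longleftrightarrow> g \<in> L2 \<Omega> \<and>
     (\<forall>\<phi>\<in>test_functions \<Omega>. \<forall>i.
        (LINT x|lebesgue_on \<Omega>. v x * partial_deriv i \<phi> x) =
        - (LINT x|lebesgue_on \<Omega>. (g x $ i) * \<phi> x))"

definition grad :: "(real^'d) set \<Rightarrow> (real^'d \<Rightarrow> real) \<Rightarrow> real^'d \<Rightarrow> real^'d" where
  "grad \<Omega> v = (SOME g. is_weak_gradient \<Omega> v g)"

definition H1 :: "(real^'d) set \<Rightarrow> (real^'d \<Rightarrow> real) set" where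
  "H1 \<Omega> = {v \<in> L2 \<Omega>. \<exists>g. is_weak_gradient \<Omega> v g}"

definition V_seminorm :: "(real^'d) set \<Rightarrow> (real^'d \<Rightarrow> real) \<Rightarrow> real" where
  "V_seminorm \<Omega> v = L2_norm \<Omega> (grad \<Omega> v)"

definition V_norm :: "(real^'d) set \<Rightarrow> (real^'d \<Rightarrow> real) \<Rightarrow> real" where
  "V_norm \<Omega> v = sqrt ((L2_norm \<Omega> v)\<^sup>2 + (V_seminorm \<Omega> v)\<^sup>2)"

definition H10 :: "(real^'d) set \<Rightarrow> (real^'d \<Rightarrow> real) set" where
  "H10 \<Omega> = {v \<in> H1 \<Omega>. \<exists>\<phi>. (\<forall>i::nat. \<phi> i \<in> test_functions \<Omega>) \<and>
                              (\<lambda>i. V_norm \<Omega> (\<phi> i - v)) \<longlonglongrightarrow> 0}"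


section \<open>Coefficients and forms\<close>

definition symmetric_Linfty_field :: "(real^'d) set \<Rightarrow> (real^'d \<Rightarrow> real^'d^'d) \<Rightarrow> bool" where
  "symmetric_Linfty_field \<Omega> A \<longleftrightarrow>
     A \<in> borel_measurable (lebesgue_on \<Omega>) \<and>
     (\<exists>C. AE x in lebesgue_on \<Omega>. norm (A x) \<le> C) \<and>
     (AE x in lebesgue_on \<Omega>. transpose (A x) = A x)"

definition coeff_form ::
  "(real^'d) set \<Rightarrow> (real^'d \<Rightarrow> real^'d^'d) \<Rightarrow> (real^'d \<Rightarrow> real) \<Rightarrow> (real^'d \<Rightarrow> real) \<Rightarrow> real" where
  "coeff_form \<Omega> A w v = (LINT x|lebesgue_on \<Omega>. (A x *v grad \<Omega> w x) \<bullet> grad \<Omega> v x)"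

definition symmetric_bilinear_on :: "'v::real_vector set \<Rightarrow> ('v \<Rightarrow> 'v \<Rightarrow> real) \<Rightarrow> bool" where
  "symmetric_bilinear_on V a \<longleftrightarrow>
     (\<forall>v\<in>V. \<forall>w\<in>V. a v w = a w v) \<and>
     (\<forall>v\<in>V. \<forall>v'\<in>V. \<forall>w\<in>V. a (v + v') w = a v w + a v' w) \<and>
     (\<forall>c. \<forall>v\<in>V. \<forall>w\<in>V. a (c *\<^sub>R v) w = c * a v w)"


section \<open>The memory space and the extended system\<close>

text \<open>
  \<open>\<nu>\<close> is a measure on the Borel sets of \<open>{0..}\<close>. Its integrands below are nonnegative, and
  \<open>nn_integral\<close> does not see null sets, so the a.e. notion of strong measurability suffices.
\<close>

definition K_space ::
  "(real^'d) set \<Rightarrow> ((real^'d \<Rightarrow> real) \<Rightarrow> (real^'d \<Rightarrow> real) \<Rightarrow> real) \<Rightarrow> real measure \<Rightarrow>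
   (real \<Rightarrow> real^'d \<Rightarrow> real) set" where
  "K_space \<Omega> a1 \<nu> =
     {\<zeta>. strongly_measurable_in \<nu> (H10 \<Omega>) (V_norm \<Omega>) \<zeta> \<and>
          (\<integral>\<^sup>+l. ennreal (a1 (\<zeta> l) (\<zeta> l)) \<partial>\<nu>) < \<infinity>}"

definition K_norm ::
  "('v \<Rightarrow> 'v \<Rightarrow> real) \<Rightarrow> real measure \<Rightarrow> (real \<Rightarrow> 'v) \<Rightarrow> real" where
  "K_norm a1 \<nu> \<zeta> = sqrt (enn2real (\<integral>\<^sup>+l. ennreal (a1 (\<zeta> l) (\<zeta> l)) \<partial>\<nu>))"

definition W_space ::
  "(real^'d) set \<Rightarrow> ((real^'d \<Rightarrow> real) \<Rightarrow> (real^'d \<Rightarrow> real) \<Rightarrow> real) \<Rightarrow> real measure \<Rightarrow>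
   ((real^'d \<Rightarrow> real) \<times> (real \<Rightarrow> real^'d \<Rightarrow> real)) set" where
  "W_space \<Omega> a1 \<nu> = L2 \<Omega> \<times> K_space \<Omega> a1 \<nu>"

definition W_norm ::
  "(real^'d) set \<Rightarrow> ((real^'d \<Rightarrow> real) \<Rightarrow> (real^'d \<Rightarrow> real) \<Rightarrow> real) \<Rightarrow> real measure \<Rightarrow>
   (real^'d \<Rightarrow> real) \<times> (real \<Rightarrow> real^'d \<Rightarrow> real) \<Rightarrow> real" where
  "W_norm \<Omega> a1 \<nu> x = sqrt ((L2_norm \<Omega> (fst x))\<^sup>2 + (K_norm a1 \<nu> (snd x))\<^sup>2)"

definition J_op :: "(real^'d) set \<Rightarrow> real measure \<Rightarrow> (real \<Rightarrow> real^'d \<Rightarrow> real) \<Rightarrow> real^'d \<Rightarrow> real" where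
  "J_op \<Omega> \<nu> \<zeta> = bochner_integral_in \<nu> (H10 \<Omega>) (V_norm \<Omega>) \<zeta>"

definition E_op :: "'v \<Rightarrow> real \<Rightarrow> 'v" where
  "E_op u = (\<lambda>l. u)"

definition Lambda_op :: "(real \<Rightarrow> 'v::real_vector) \<Rightarrow> real \<Rightarrow> 'v" where
  "Lambda_op \<zeta> = (\<lambda>l. l *\<^sub>R \<zeta> l)"

text \<open>
  Graph of $\mathcal A(u,\zeta) = (-\mathsf A u - \mathsf A_1 J\zeta,\, Eu - \Lambda\zeta)$, where
  \<open>a\<close> is the form of $\mathsf A$. Under the identification of $H$ with a subspace of $V'$,
  $\mathsf A u + \mathsf A_1 J\zeta \in H$ means that this functional on $V$ is represented by the
  $H$-inner product with an element of $H$, namely with $-g$.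
\<close>

definition A_graph ::
  "(real^'d) set \<Rightarrow> ((real^'d \<Rightarrow> real) \<Rightarrow> (real^'d \<Rightarrow> real) \<Rightarrow> real) \<Rightarrow>
   ((real^'d \<Rightarrow> real) \<Rightarrow> (real^'d \<Rightarrow> real) \<Rightarrow> real) \<Rightarrow> real measure \<Rightarrow>
   (((real^'d \<Rightarrow> real) \<times> (real \<Rightarrow> real^'d \<Rightarrow> real)) \<times>
    ((real^'d \<Rightarrow> real) \<times> (real \<Rightarrow> real^'d \<Rightarrow> real))) set" where
  "A_graph \<Omega> a a1 \<nu> =
     {((u, \<zeta>), (g, \<eta>)).
        u \<in> H10 \<Omega> \<and> \<zeta> \<in> K_space \<Omega> a1 \<nu> \<and>
        g \<in> L2 \<Omega> \<and> (\<forall>v\<in>H10 \<Omega>. L2_inner \<Omega> g v = - a u v - a1 (J_op \<Omega> \<nu> \<zeta>) v) \<and>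
        E_op u - Lambda_op \<zeta> \<in> K_space \<Omega> a1 \<nu> \<and>
        \<eta> \<in> K_space \<Omega> a1 \<nu> \<and> K_norm a1 \<nu> (\<eta> - (E_op u - Lambda_op \<zeta>)) = 0}"

end

theory Submission
  imports Defs
begin

text \<open>
  Both evolutions start at the same state and have the same forcing. If the states were in the domains
  of the generators, the difference \<open>(e, z)\<close> would solve an evolution equation whose only source is
  \<open>- \<epsilon> B u\<^sup>0\<close>. Paired with \<open>(e, z)\<close> in \<open>W\<close>, the terms \<open>a1 (J z) e\<close> and \<open>\<integral> a1 e (z l) d\<nu>\<close>, which couple
  the two components, cancel, and what remains is
  \<open>1/2 d/dt \<parallel>(e, z)\<parallel>\<^sup>2 = - a0 e e - \<epsilon> av u\<^sup>\<epsilon> e - \<integral> l a1 (z l) (z l) d\<nu>\<close>. By Young's inequality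
  \<open>- av u\<^sup>\<epsilon> e = - av e e - av u\<^sup>0 e \<le> - av e e / 2 + av u\<^sup>0 u\<^sup>0 / 2\<close>, and integration in time gives the
  estimate (\<open>dissipation_identity\<close>, \<open>dissipation_inequality\<close>).

  A mild solution \<open>X\<close> need not lie in the domain of the generator, but its time integral \<open>P\<close> does, with
  image \<open>X - x0 - \<integral> F\<close> (\<open>generator_of_primitive\<close>). So the computation applies to the averages of the
  two solutions over \<open>[s, s + h]\<close>: the initial state and the averaged forcing drop out of the
  difference, the average \<open>d\<close> of the error has the difference quotient \<open>r\<close> of the error as its
  derivative (\<open>energy_identity\<close>), and by Jensen's inequality the energy of the average of \<open>u\<^sup>0\<close> is at
  most the average of its energy (\<open>average_energy_le\<close>). As \<open>h\<close> tends to zero, the averages converge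
  uniformly. The terms on the left are lower semicontinuous: \<open>2 a0 + \<epsilon> av\<close> with value \<open>\<infinity>\<close> outside
  \<open>H10\<close>, because bounded sequences in a Hilbert space accumulate weakly (\<open>bounded_weak_limit\<close>), and
  the memory term by Fatou's lemma (\<open>energy_lsc\<close>). This yields \<open>energy_estimate\<close>, and with it the fact
  that the error is in \<open>H10\<close> at almost every time.

  The functional analysis underneath serves to give the integrals a meaning. A mild solution contains an
  integral that is a mere choice unless \<open>W\<close> is complete. Completeness of \<open>W\<close> comes from a
  Riesz--Fischer theorem for functions with values in \<open>H10\<close>, from completeness of \<open>H10\<close>, and from
  Poincare's inequality, which makes the energy norm of \<open>a1\<close> equivalent to the norm of \<open>H10\<close>. The
  gradient is a choice as well, and becomes linear up to null functions once weak gradients are known to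
  be unique; for this the smooth bumps are needed. All spaces consist of representatives, so instead of
  quotients the null elements of the seminorms are carried along. Integrals with values in these spaces
  are handled through bounded functionals, which turn them into real integrals.
\<close>

section \<open>Measurability up to null sets\<close>

lemma measurable_completion_AE:
  assumes g: "g \<in> borel_measurable (completion M)" and ae: "AE x in M. f x = g x"
  shows "f \<in> borel_measurable (completion M)"
proof (rule measurableI)
  fix A assume A: "A \<in> sets (borel :: 'b::topological_space measure)"
  have *: "g -` A \<inter> space M \<in> sets (completion M)"
    using measurable_sets[OF g A] by auto
  have "AE x in completion M. x \<in> g -` A \<inter> space M \<longleftrightarrow> x \<in> f -` A \<inter> space (completion M)"
    using AE_completion[OF ae] by eventually_elim auto
  from completion.in_sets_AE[OF this *] show "f -` A \<inter> space (completion M) \<in> sets (completion M)"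
    by auto
qed auto

lemma AE_LIMSEQ_measurable_completion:
  fixes f :: "'a \<Rightarrow> real"
  assumes s: "\<And>i::nat. s i \<in> borel_measurable M" and ae: "AE x in M. (\<lambda>i. s i x) \<longlonglongrightarrow> f x"
  shows "f \<in> borel_measurable (completion M)"
proof (rule measurable_completion_AE)
  show "(\<lambda>x. lim (\<lambda>i. s i x)) \<in> borel_measurable (completion M)"
    using s by (intro measurable_completion) measurable
  show "AE x in M. f x = lim (\<lambda>i. s i x)"
    using ae by eventually_elim (simp add: limI)
qed

lemma tendsto_zero_dominated:
  fixes f g :: "'a \<Rightarrow> real"
  assumes "(g \<longlongrightarrow> 0) F" "\<And>i. \<bar>f i\<bar> \<le> g i"
  shows "(f \<longlongrightarrow> 0) F"
  by (rule Lim_null_comparison[OF always_eventually assms(1)]) (use assms(2) in auto)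

text \<open>The integrals of the terms have a finite sum, so by monotone convergence the sum is finite almost
  everywhere.\<close>

lemma AE_summable_of_geometric_bound:
  assumes meas: "\<And>k::nat. g k \<in> borel_measurable M" and nn: "\<And>k x. 0 \<le> g k x"
    and bd: "\<And>k. (\<integral>\<^sup>+x. ennreal (g k x) \<partial>M) \<le> ennreal (c * (1/2)^k)" and c: "0 \<le> c"
  shows "AE x in M. summable (\<lambda>k. g k x)"
proof -
  have "(\<integral>\<^sup>+x. (\<Sum>k. ennreal (g k x)) \<partial>M) = (\<Sum>k. \<integral>\<^sup>+x. ennreal (g k x) \<partial>M)"
    using meas by (intro nn_integral_suminf) auto
  also have "\<dots> \<le> (\<Sum>k. ennreal (c * (1/2)^k))"
    using bd by (intro suminf_le) auto
  also have "\<dots> = ennreal (\<Sum>k. c * (1/2)^k)"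
    using c by (intro suminf_ennreal2) (auto intro!: summable_mult)
  also have "\<dots> < \<infinity>" by simp
  finally have fin: "(\<integral>\<^sup>+x. (\<Sum>k. ennreal (g k x)) \<partial>M) \<noteq> \<infinity>" by simp
  have "AE x in M. (\<Sum>k. ennreal (g k x)) \<noteq> \<infinity>"
    using meas by (intro nn_integral_PInf_AE[OF _ fin]) auto
  then show ?thesis
    by eventually_elim (use nn in \<open>auto intro!: summable_suminf_not_top\<close>)
qed

section \<open>Integration in a seminormed subspace\<close>

text \<open>Elements at distance zero are not identified: \<open>N (x - y) = 0\<close> plays the role of equality.\<close>

locale seminormed_space =
  fixes S :: "'b::real_vector set" and N :: "'b \<Rightarrow> real"
  assumes S_subspace: "subspace S"
    and triangle: "\<And>x y. x \<in> S \<Longrightarrow> y \<in> S \<Longrightarrow> N (x + y) \<le> N x + N y"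
    and scale: "\<And>c x. x \<in> S \<Longrightarrow> N (c *\<^sub>R x) = \<bar>c\<bar> * N x"
begin

lemma mem_simps [simp, intro]:
  "0 \<in> S" "x \<in> S \<Longrightarrow> y \<in> S \<Longrightarrow> x + y \<in> S" "x \<in> S \<Longrightarrow> y \<in> S \<Longrightarrow> x - y \<in> S"
  "x \<in> S \<Longrightarrow> c *\<^sub>R x \<in> S" "x \<in> S \<Longrightarrow> - x \<in> S"
  using S_subspace by (auto simp: subspace_0 subspace_add subspace_diff subspace_scale subspace_neg)

lemma mem_sum: "(\<And>i. i \<in> A \<Longrightarrow> f i \<in> S) \<Longrightarrow> sum f A \<in> S"
  using S_subspace by (rule subspace_sum)

lemma N_zero [simp]: "N 0 = 0"
  using scale[of 0 0] by simp

lemma N_minus: "x \<in> S \<Longrightarrow> N (- x) = N x"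
  using scale[of x "-1"] by simp

lemma N_nonneg [simp]: "x \<in> S \<Longrightarrow> 0 \<le> N x"
  using triangle[of x "-x"] N_minus[of x] by simp

lemma N_commute: "x \<in> S \<Longrightarrow> y \<in> S \<Longrightarrow> N (x - y) = N (y - x)"
  using N_minus[of "x - y"] by simp

lemma triangle_diff: "x \<in> S \<Longrightarrow> y \<in> S \<Longrightarrow> z \<in> S \<Longrightarrow> N (x - z) \<le> N (x - y) + N (y - z)"
  using triangle[of "x - y" "y - z"] by simp

lemma triangle_minus: "x \<in> S \<Longrightarrow> y \<in> S \<Longrightarrow> N (x - y) \<le> N x + N y"
  using triangle[of x "-y"] N_minus[of y] by simp

lemma reverse_triangle: "x \<in> S \<Longrightarrow> y \<in> S \<Longrightarrow> \<bar>N x - N y\<bar> \<le> N (x - y)"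
  using triangle_diff[of x y 0] triangle_diff[of y x 0] N_commute[of x y] by simp

lemma N_sum: "(\<And>i. i \<in> A \<Longrightarrow> f i \<in> S) \<Longrightarrow> N (sum f A) \<le> (\<Sum>i\<in>A. N (f i))"
proof (induction A rule: infinite_finite_induct)
  case (insert a A)
  then have "N (f a + sum f A) \<le> N (f a) + N (sum f A)" by (intro triangle mem_sum) auto
  with insert show ?case by fastforce
qed auto

lemma N_tendsto:
  assumes "\<And>i. y i \<in> S" "x \<in> S" "(\<lambda>i. N (x - y i)) \<longlonglongrightarrow> 0"
  shows "(\<lambda>i. N (y i)) \<longlonglongrightarrow> N x"
proof (rule LIM_zero_cancel, rule Lim_null_comparison[OF _ assms(3)])
  show "\<forall>\<^sub>F i in sequentially. norm (N (y i) - N x) \<le> N (x - y i)"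
  proof (intro always_eventually allI)
    fix i show "norm (N (y i) - N x) \<le> N (x - y i)"
      using reverse_triangle[of "y i" x] assms(1,2) N_commute[of x "y i"] by simp
  qed
qed

lemma strongly_measurableI:
  assumes "\<And>i::nat. simple_function M (s i)" "\<And>i. s i ` space M \<subseteq> S"
    "AE x in M. (\<lambda>i. N (f x - s i x)) \<longlonglongrightarrow> 0" "AE x in M. f x \<in> S"
  shows "strongly_measurable_in M S N f"
  unfolding strongly_measurable_in_def using assms by (intro conjI exI[of _ s]) simp_all

lemma strongly_measurableE:
  assumes "strongly_measurable_in M S N f"
  obtains s where "\<forall>i::nat. simple_function M (s i)" "\<forall>i. s i ` space M \<subseteq> S"
    "AE x in M. (\<lambda>i. N (f x - s i x)) \<longlonglongrightarrow> 0" "AE x in M. f x \<in> S"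
  using assms unfolding strongly_measurable_in_def by blast

text \<open>Real functions that are continuous for the seminorm turn strongly measurable functions into
  measurable ones, once null sets are added to the sigma-algebra.\<close>

lemma strongly_measurable_compose:
  assumes f: "strongly_measurable_in M S N f"
    and \<phi>: "\<And>y x. (\<forall>i. y i \<in> S) \<Longrightarrow> x \<in> S \<Longrightarrow> (\<lambda>i. N (x - y i)) \<longlonglongrightarrow> 0 \<Longrightarrow> (\<lambda>i. \<phi> (y i)) \<longlonglongrightarrow> \<phi> x"
  shows "(\<lambda>x. \<phi> (f x) :: real) \<in> borel_measurable (completion M)"
proof -
  obtain s where s: "\<forall>i::nat. simple_function M (s i)" "\<forall>i. s i ` space M \<subseteq> S"
      "AE x in M. (\<lambda>i. N (f x - s i x)) \<longlonglongrightarrow> 0" and fS: "AE x in M. f x \<in> S"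
    by (rule strongly_measurableE[OF f])
  show ?thesis
  proof (rule AE_LIMSEQ_measurable_completion)
    show "(\<lambda>x. \<phi> (s i x)) \<in> borel_measurable M" for i
      using s(1)[rule_format] by (intro borel_measurable_simple_function) (rule simple_function_compose1)
    show "AE x in M. (\<lambda>i. \<phi> (s i x)) \<longlonglongrightarrow> \<phi> (f x)"
      using s(3) fS AE_space by eventually_elim (use s(2) in \<open>auto intro!: \<phi>\<close>)
  qed
qed

lemma strongly_measurable_norm:
  "strongly_measurable_in M S N f \<Longrightarrow> (\<lambda>x. N (f x)) \<in> borel_measurable (completion M)"
  by (rule strongly_measurable_compose) (auto intro: N_tendsto)

lemma strongly_measurable_simple:
  "simple_function M s \<Longrightarrow> s ` space M \<subseteq> S \<Longrightarrow> strongly_measurable_in M S N s"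
  unfolding strongly_measurable_in_def by (auto intro!: exI[of _ "\<lambda>_. s"])

lemma strongly_measurable_const: "x \<in> S \<Longrightarrow> strongly_measurable_in M S N (\<lambda>_. x)"
  by (rule strongly_measurable_simple) auto

lemma strongly_measurable_lincomb:
  assumes "strongly_measurable_in M S N f" "strongly_measurable_in M S N g"
  shows "strongly_measurable_in M S N (\<lambda>x. a *\<^sub>R f x + b *\<^sub>R g x)"
proof -
  obtain s where s: "\<forall>i::nat. simple_function M (s i)" "\<forall>i. s i ` space M \<subseteq> S"
      "AE x in M. (\<lambda>i. N (f x - s i x)) \<longlonglongrightarrow> 0" "AE x in M. f x \<in> S"
    by (rule strongly_measurableE[OF assms(1)])
  obtain t where t: "\<forall>i::nat. simple_function M (t i)" "\<forall>i. t i ` space M \<subseteq> S"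
      "AE x in M. (\<lambda>i. N (g x - t i x)) \<longlonglongrightarrow> 0" "AE x in M. g x \<in> S"
    by (rule strongly_measurableE[OF assms(2)])
  show ?thesis
  proof (rule strongly_measurableI)
  show "AE x in M. (\<lambda>i. N ((a *\<^sub>R f x + b *\<^sub>R g x) - (a *\<^sub>R s i x + b *\<^sub>R t i x))) \<longlonglongrightarrow> 0"
    using s(3,4) t(3,4) AE_space
  proof eventually_elim
    case (elim x)
    have mem: "s i x \<in> S" "t i x \<in> S" for i using s(2) t(2) elim(5) by blast+
    have "(\<lambda>i. \<bar>a\<bar> * N (f x - s i x) + \<bar>b\<bar> * N (g x - t i x)) \<longlonglongrightarrow> 0"
      using elim by (auto intro!: tendsto_eq_intros)
    moreover have "norm (N ((a *\<^sub>R f x + b *\<^sub>R g x) - (a *\<^sub>R s i x + b *\<^sub>R t i x)))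
        \<le> \<bar>a\<bar> * N (f x - s i x) + \<bar>b\<bar> * N (g x - t i x)" for i
    proof -
      have "(a *\<^sub>R f x + b *\<^sub>R g x) - (a *\<^sub>R s i x + b *\<^sub>R t i x) = a *\<^sub>R (f x - s i x) + b *\<^sub>R (g x - t i x)"
        by (simp add: scaleR_diff_right)
      moreover have mem': "f x - s i x \<in> S" "g x - t i x \<in> S" "a *\<^sub>R (f x - s i x) \<in> S" "b *\<^sub>R (g x - t i x) \<in> S"
        "a *\<^sub>R (f x - s i x) + b *\<^sub>R (g x - t i x) \<in> S"
        using elim mem[of i] by blast+
      moreover have "N (a *\<^sub>R (f x - s i x) + b *\<^sub>R (g x - t i x)) \<le> \<bar>a\<bar> * N (f x - s i x) + \<bar>b\<bar> * N (g x - t i x)"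
        using triangle[OF mem'(3,4)] by (simp only: scale[OF mem'(1)] scale[OF mem'(2)])
      ultimately show ?thesis using N_nonneg[OF mem'(5)] by simp
    qed
    ultimately show ?case
      by (elim tendsto_zero_dominated) (simp only: real_norm_def)
  qed
  show "simple_function M (\<lambda>x. a *\<^sub>R s i x + b *\<^sub>R t i x)" for i
    using s(1)[rule_format] t(1)[rule_format] by (rule simple_function_compose2)
  show "(\<lambda>x. a *\<^sub>R s i x + b *\<^sub>R t i x) ` space M \<subseteq> S" for i
  proof (rule image_subsetI)
    fix x assume "x \<in> space M"
    then have "s i x \<in> S" "t i x \<in> S"
      by (rule subsetD[OF s(2)[rule_format] imageI], rule subsetD[OF t(2)[rule_format] imageI])
    then show "a *\<^sub>R s i x + b *\<^sub>R t i x \<in> S" by simp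
  qed
  show "AE x in M. a *\<^sub>R f x + b *\<^sub>R g x \<in> S"
    using s(4) t(4) by eventually_elim auto
  qed
qed

lemma strongly_measurable_diff:
  "strongly_measurable_in M S N f \<Longrightarrow> strongly_measurable_in M S N g \<Longrightarrow>
    strongly_measurable_in M S N (\<lambda>x. f x - g x)"
  using strongly_measurable_lincomb[of M f g 1 "-1"] by simp

lemma strongly_measurable_add:
  "strongly_measurable_in M S N f \<Longrightarrow> strongly_measurable_in M S N g \<Longrightarrow>
    strongly_measurable_in M S N (\<lambda>x. f x + g x)"
  using strongly_measurable_lincomb[of M f g 1 1] by simp

text \<open>The simple functions that converge almost everywhere are cut off where they exceed \<open>2 * N f\<close>
  (or rather a measurable version \<open>g\<close> of \<open>N f\<close>); dominated convergence then applies.\<close>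

lemma simple_L1_approx:
  assumes fin: "finite_measure M" and f: "strongly_measurable_in M S N f"
    and int: "(\<integral>\<^sup>+x. ennreal (N (f x)) \<partial>M) < \<infinity>"
  obtains s where "\<forall>i::nat. Bochner_Integration.simple_bochner_integrable M (s i)"
    "\<forall>i. s i ` space M \<subseteq> S" "(\<lambda>i. \<integral>\<^sup>+x. ennreal (N (f x - s i x)) \<partial>M) \<longlonglongrightarrow> 0"
proof -
  interpret finite_measure M by fact
  obtain s where s: "\<forall>i::nat. simple_function M (s i)" "\<forall>i. s i ` space M \<subseteq> S"
      "AE x in M. (\<lambda>i. N (f x - s i x)) \<longlonglongrightarrow> 0" and fS: "AE x in M. f x \<in> S"
    by (rule strongly_measurableE[OF f])
  obtain g where g: "g \<in> borel_measurable M" and fg: "AE x in M. N (f x) = g x"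
    using completion_ex_borel_measurable_real[OF strongly_measurable_norm[OF f]] by auto
  define t where "t i x = (if N (s i x) \<le> 2 * g x then s i x else 0)" for i x
  have [measurable]: "(\<lambda>x. N (s i x)) \<in> borel_measurable M" for i
    using s(1)[rule_format] by (intro borel_measurable_simple_function) (rule simple_function_compose1)
  have t1: "simple_function M (t i)" for i
  proof -
    have "{x \<in> space M. N (s i x) \<le> 2 * g x} \<in> sets M" using g by measurable
    then have "simple_function M (\<lambda>x. if x \<in> {x \<in> space M. N (s i x) \<le> 2 * g x} then s i x else 0)"
      by (intro simple_function_If_set s(1)[rule_format]) auto
    then show ?thesis
      by (rule simple_function_cong[THEN iffD1, rotated]) (auto simp: t_def)
  qed
  have t2: "t i ` space M \<subseteq> S" for i
    using s(2)[rule_format, of i] by (auto simp: t_def)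
  have Nft: "(\<lambda>x. N (f x - t i x)) \<in> borel_measurable (completion M)" for i
    using t1 t2 by (intro strongly_measurable_norm strongly_measurable_diff f strongly_measurable_simple)
  have "(\<lambda>i. \<integral>\<^sup>+x. ennreal (N (f x - t i x)) \<partial>completion M) \<longlonglongrightarrow> (\<integral>\<^sup>+x. 0 \<partial>completion M)"
  proof (rule nn_integral_dominated_convergence[where w="\<lambda>x. ennreal (3 * N (f x))"])
    show "(\<lambda>x. ennreal (3 * N (f x))) \<in> borel_measurable (completion M)"
      using strongly_measurable_norm[OF f] by measurable
    show "(\<integral>\<^sup>+x. ennreal (3 * N (f x)) \<partial>completion M) < \<infinity>"
    proof -
      have "(\<integral>\<^sup>+x. ennreal (3 * N (f x)) \<partial>completion M) = (\<integral>\<^sup>+x. 3 * ennreal (N (f x)) \<partial>completion M)"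
        by (intro nn_integral_cong) (simp add: ennreal_mult')
      also have "\<dots> = 3 * (\<integral>\<^sup>+x. ennreal (N (f x)) \<partial>completion M)"
        using strongly_measurable_norm[OF f] by (intro nn_integral_cmult) auto
      finally show ?thesis
        using int by (simp add: nn_integral_completion ennreal_mult_less_top)
    qed
    show "AE x in completion M. ennreal (N (f x - t j x)) \<le> ennreal (3 * N (f x))" for j
      using AE_completion[OF fS] AE_completion[OF fg] AE_completion[OF AE_space[of M]]
    proof eventually_elim
      case (elim x)
      then have "t j x \<in> S" using t2[of j] by auto
      moreover have "N (t j x) \<le> 2 * N (f x)" using elim N_nonneg[of "f x"] by (auto simp: t_def)
      ultimately show ?case using triangle_minus[of "f x" "t j x"] elim by (intro ennreal_leI) auto
    qed
    show "AE x in completion M. (\<lambda>i. ennreal (N (f x - t i x))) \<longlonglongrightarrow> 0"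
      using AE_completion[OF fS] AE_completion[OF fg] AE_completion[OF AE_space[of M]] AE_completion[OF s(3)]
    proof eventually_elim
      case (elim x)
      have mem: "s i x \<in> S" for i using s(2)[rule_format, of i] elim by auto
      have "(\<lambda>i. N (f x - t i x)) \<longlonglongrightarrow> 0"
      proof (cases "N (f x) = 0")
        case True
        have "N (f x - t i x) \<le> 0" for i
          using True elim mem[of i] triangle_minus[of "f x" "t i x"] by (auto simp: t_def)
        then have "N (f x - t i x) = 0" for i
          using elim mem[of i] by (intro antisym N_nonneg) (auto simp: t_def)
        then show ?thesis by simp
      next
        case False
        then have pos: "N (f x) > 0" using elim N_nonneg[of "f x"] by simp
        have "\<forall>\<^sub>F i in sequentially. N (f x - s i x) < N (f x)"
          using order_tendstoD(2)[OF elim(4) pos] .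
        then have "\<forall>\<^sub>F i in sequentially. N (f x - s i x) = N (f x - t i x)"
        proof eventually_elim
          case (elim i)
          then show ?case using reverse_triangle[of "f x" "s i x"] \<open>f x \<in> S\<close> mem[of i] \<open>N (f x) = g x\<close>
            by (auto simp: t_def)
        qed
        then show ?thesis using elim(4) by (rule Lim_transform_eventually[rotated])
      qed
      then show ?case using tendsto_ennrealI by fastforce
    qed
  qed (use Nft in auto)
  then have "(\<lambda>i. \<integral>\<^sup>+x. ennreal (N (f x - t i x)) \<partial>M) \<longlonglongrightarrow> 0"
    by (simp add: nn_integral_completion)
  moreover have "Bochner_Integration.simple_bochner_integrable M (t i)" for i
    using t1 by (intro Bochner_Integration.simple_bochner_integrable.intros) auto
  ultimately show ?thesis using t2 that by blast
qed

text \<open>The triangle inequality for finite sums, since a simple integral is one.\<close>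

lemma norm_simple_integral_le:
  assumes s: "Bochner_Integration.simple_bochner_integrable M s" "s ` space M \<subseteq> S"
  shows "Bochner_Integration.simple_bochner_integral M s \<in> S"
    "ennreal (N (Bochner_Integration.simple_bochner_integral M s)) \<le> (\<integral>\<^sup>+x. ennreal (N (s x)) \<partial>M)"
proof -
  have sf: "simple_function M s" using s(1) by (cases) auto
  show "Bochner_Integration.simple_bochner_integral M s \<in> S"
    unfolding Bochner_Integration.simple_bochner_integral_def using s(2) by (intro mem_sum) auto
  define r where "r x = (if x \<in> space M then N (s x) else 0)" for x
  have r: "Bochner_Integration.simple_bochner_integrable M r"
  proof -
    have "Bochner_Integration.simple_bochner_integrable M (\<lambda>x. N (s x))"
      using simple_bochner_integrable_compose2[of "\<lambda>a b. N a", OF _ s(1) s(1)] by simp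
    moreover have "simple_function M r"
      using simple_function_compose1[OF sf, of N]
      by (rule simple_function_cong[THEN iffD1, rotated]) (auto simp: r_def)
    moreover have "{x \<in> space M. r x \<noteq> 0} = {x \<in> space M. N (s x) \<noteq> 0}" by (auto simp: r_def)
    ultimately show ?thesis
      by (auto simp: Bochner_Integration.simple_bochner_integrable.simps)
  qed
  have "N (Bochner_Integration.simple_bochner_integral M s)
      \<le> (\<Sum>y\<in>s ` space M. measure M {x\<in>space M. s x = y} *\<^sub>R N y)"
    unfolding Bochner_Integration.simple_bochner_integral_def using s(2)
    by (intro order_trans[OF N_sum] sum_mono) (auto simp: scale subset_eq)
  also have "\<dots> = Bochner_Integration.simple_bochner_integral M r"
    by (rule simple_bochner_integral_partition[OF r sf, symmetric]) (auto simp: r_def)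
  finally have "ennreal (N (Bochner_Integration.simple_bochner_integral M s))
      \<le> ennreal (Bochner_Integration.simple_bochner_integral M r)" by (rule ennreal_leI)
  also have "\<dots> = (\<integral>\<^sup>+x. ennreal (r x) \<partial>M)"
    using r s(2) by (intro simple_bochner_integral_eq_nn_integral) (auto simp: r_def)
  also have "\<dots> = (\<integral>\<^sup>+x. ennreal (N (s x)) \<partial>M)"
    by (intro nn_integral_cong) (auto simp: r_def)
  finally show "ennreal (N (Bochner_Integration.simple_bochner_integral M s)) \<le> (\<integral>\<^sup>+x. ennreal (N (s x)) \<partial>M)" .
qed

lemma nn_integral_triangle:
  assumes "strongly_measurable_in M S N f" "strongly_measurable_in M S N g" "strongly_measurable_in M S N h"
  shows "(\<integral>\<^sup>+x. ennreal (N (f x - g x)) \<partial>M)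
     \<le> (\<integral>\<^sup>+x. ennreal (N (h x - f x)) \<partial>M) + (\<integral>\<^sup>+x. ennreal (N (h x - g x)) \<partial>M)"
proof -
  have AE: "AE x in M. f x \<in> S" "AE x in M. g x \<in> S" "AE x in M. h x \<in> S"
    using assms unfolding strongly_measurable_in_def by auto
  have m: "(\<lambda>x. N (h x - f x)) \<in> borel_measurable (completion M)" "(\<lambda>x. N (h x - g x)) \<in> borel_measurable (completion M)"
    using assms by (auto intro!: strongly_measurable_norm strongly_measurable_diff)
  have "(\<integral>\<^sup>+x. ennreal (N (f x - g x)) \<partial>completion M)
      \<le> (\<integral>\<^sup>+x. ennreal (N (h x - f x)) + ennreal (N (h x - g x)) \<partial>completion M)"
    using AE[THEN AE_completion]
  proof (intro nn_integral_mono_AE, eventually_elim)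
    case (elim x)
    then show ?case using triangle_diff[of "f x" "h x" "g x"] N_commute[of "f x" "h x"]
      by (simp flip: ennreal_plus)
  qed
  also have "\<dots> = (\<integral>\<^sup>+x. ennreal (N (h x - f x)) \<partial>completion M) + (\<integral>\<^sup>+x. ennreal (N (h x - g x)) \<partial>completion M)"
    using m by (intro nn_integral_add) auto
  finally show ?thesis by (simp add: nn_integral_completion)
qed

text \<open>Bounded functionals commute with the vector-valued integral, which is how the latter is computed.\<close>

definition bounded_functional :: "('b \<Rightarrow> real) \<Rightarrow> bool" where
  "bounded_functional \<l> \<longleftrightarrow> (\<forall>x\<in>S. \<forall>y\<in>S. \<l> (x + y) = \<l> x + \<l> y) \<and> (\<forall>c. \<forall>x\<in>S. \<l> (c *\<^sub>R x) = c * \<l> x) \<and>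
     (\<exists>C. \<forall>x\<in>S. \<bar>\<l> x\<bar> \<le> C * N x)"

lemma bounded_functional_simps:
  assumes "bounded_functional \<l>"
  shows "x \<in> S \<Longrightarrow> y \<in> S \<Longrightarrow> \<l> (x + y) = \<l> x + \<l> y" "x \<in> S \<Longrightarrow> \<l> (c *\<^sub>R x) = c * \<l> x"
    "x \<in> S \<Longrightarrow> y \<in> S \<Longrightarrow> \<l> (x - y) = \<l> x - \<l> y" "\<l> 0 = 0"
proof -
  show a: "\<l> (x + y) = \<l> x + \<l> y" if "x \<in> S" "y \<in> S" for x y using assms that by (auto simp: bounded_functional_def)
  show b: "\<l> (c *\<^sub>R x) = c * \<l> x" if "x \<in> S" for c x using assms that by (auto simp: bounded_functional_def)
  show "x \<in> S \<Longrightarrow> y \<in> S \<Longrightarrow> \<l> (x - y) = \<l> x - \<l> y"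
    using a[of x "(-1) *\<^sub>R y"] b[of y "-1"] by simp
  show "\<l> 0 = 0" using b[of 0 0] by simp
qed

lemma bounded_functional_bound:
  assumes "bounded_functional \<l>" obtains C where "0 < C" "\<And>x. x \<in> S \<Longrightarrow> \<bar>\<l> x\<bar> \<le> C * N x"
proof -
  obtain C where C: "\<forall>x\<in>S. \<bar>\<l> x\<bar> \<le> C * N x" using assms by (auto simp: bounded_functional_def)
  have "\<bar>\<l> x\<bar> \<le> (\<bar>C\<bar> + 1) * N x" if "x \<in> S" for x
  proof -
    have "C * N x \<le> (\<bar>C\<bar> + 1) * N x" using that by (intro mult_right_mono) auto
    with C that show ?thesis by fastforce
  qed
  then show ?thesis by (intro that[of "\<bar>C\<bar> + 1"]) auto
qed

lemma bounded_functional_tendsto: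
  assumes l: "bounded_functional \<l>" and mem: "\<forall>i. y i \<in> S" "x \<in> S" and lim: "((\<lambda>i. N (x - y i)) \<longlongrightarrow> 0) F"
  shows "((\<lambda>i. \<l> (y i)) \<longlongrightarrow> \<l> x) F"
proof -
  obtain C where C: "0 < C" "\<And>x. x \<in> S \<Longrightarrow> \<bar>\<l> x\<bar> \<le> C * N x" using bounded_functional_bound[OF l] by metis
  have bd: "\<bar>\<l> (y i) - \<l> x\<bar> \<le> C * N (x - y i)" for i
    using C(2)[of "x - y i"] mem bounded_functional_simps(3)[OF l, of x "y i"] by auto
  have "((\<lambda>i. C * N (x - y i)) \<longlongrightarrow> 0) F" using tendsto_mult_left[OF lim, of C] by simp
  then have "((\<lambda>i. \<l> (y i) - \<l> x) \<longlongrightarrow> 0) F"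
    by (rule tendsto_zero_dominated) (rule bd)
  then show ?thesis by (rule LIM_zero_cancel)
qed

lemma bounded_functional_measurable:
  assumes "bounded_functional \<l>" "strongly_measurable_in M S N f"
  shows "(\<lambda>x. \<l> (f x)) \<in> borel_measurable (completion M)"
  by (rule strongly_measurable_compose[OF assms(2)]) (rule bounded_functional_tendsto[OF assms(1)])

lemma bounded_functional_simple_integral:
  assumes l: "bounded_functional \<l>" and s: "Bochner_Integration.simple_bochner_integrable M s" "s ` space M \<subseteq> S"
  shows "integrable M (\<lambda>x. \<l> (s x))"
    "(LINT x|M. \<l> (s x)) = \<l> (Bochner_Integration.simple_bochner_integral M s)"
proof -
  have sf: "simple_function M s" using s(1) by (cases) auto
  have ls: "Bochner_Integration.simple_bochner_integrable M (\<lambda>x. \<l> (s x))"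
    using simple_bochner_integrable_compose2[of "\<lambda>a b. \<l> a", OF _ s(1) s(1)] bounded_functional_simps(4)[OF l] by simp
  then show "integrable M (\<lambda>x. \<l> (s x))" by (rule integrableI_simple_bochner_integrable)
  have sum: "\<l> (\<Sum>y\<in>A. c y *\<^sub>R y) = (\<Sum>y\<in>A. c y * \<l> y)" if "finite A" "A \<subseteq> S" for A and c :: "'b \<Rightarrow> real"
    using that
  proof (induction A)
    case (insert a A)
    then have "(\<Sum>y\<in>A. c y *\<^sub>R y) \<in> S" by (intro mem_sum) auto
    with insert show ?case by (simp add: bounded_functional_simps[OF l])
  qed (simp add: bounded_functional_simps[OF l])
  have "(LINT x|M. \<l> (s x)) = Bochner_Integration.simple_bochner_integral M (\<lambda>x. \<l> (s x))"
    using ls by (simp add: simple_bochner_integrable_eq_integral)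
  also have "\<dots> = (\<Sum>y\<in>s ` space M. measure M {x\<in>space M. s x = y} *\<^sub>R \<l> y)"
    by (rule simple_bochner_integral_partition[OF ls sf]) auto
  also have "\<dots> = \<l> (Bochner_Integration.simple_bochner_integral M s)"
    unfolding Bochner_Integration.simple_bochner_integral_def
    using s(2) sf by (subst sum) (auto simp: simple_function_def)
  finally show "(LINT x|M. \<l> (s x)) = \<l> (Bochner_Integration.simple_bochner_integral M s)" .
qed

text \<open>Both sides depend continuously in \<open>L^1\<close> on the integrand, and they agree on simple functions.
  The completed measure appears because \<open>f\<close> is a limit of simple functions only almost everywhere.\<close>

lemma has_bochner_integral_in_functional:
  assumes l: "bounded_functional \<l>" and w: "has_bochner_integral_in M S N f w"
  shows "integrable (completion M) (\<lambda>x. \<l> (f x))" "(LINT x|completion M. \<l> (f x)) = \<l> w"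
proof -
  obtain C where C: "0 < C" "\<And>x. x \<in> S \<Longrightarrow> \<bar>\<l> x\<bar> \<le> C * N x" using bounded_functional_bound[OF l] by metis
  obtain s where f: "strongly_measurable_in M S N f" and wS: "w \<in> S"
    and s: "\<And>i::nat. Bochner_Integration.simple_bochner_integrable M (s i)" "\<And>i. s i ` space M \<subseteq> S"
    and lim: "(\<lambda>i. \<integral>\<^sup>+x. ennreal (N (f x - s i x)) \<partial>M) \<longlonglongrightarrow> 0"
      "(\<lambda>i. N (Bochner_Integration.simple_bochner_integral M (s i) - w)) \<longlonglongrightarrow> 0"
    using w unfolding has_bochner_integral_in_def by blast
  have fS: "AE x in completion M. f x \<in> S"
    using f unfolding strongly_measurable_in_def by (auto intro: AE_completion)
  have [measurable]: "(\<lambda>x. \<l> (f x)) \<in> borel_measurable (completion M)"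
    by (rule bounded_functional_measurable[OF l f])
  have ints: "integrable (completion M) (\<lambda>x. \<l> (s i x))" "(LINT x|completion M. \<l> (s i x)) =
      \<l> (Bochner_Integration.simple_bochner_integral M (s i))" for i
    using bounded_functional_simple_integral[OF l s, of i]
    by (auto simp: integrable_completion integral_completion)
  have bd: "(\<integral>\<^sup>+x. ennreal (norm (\<l> (f x) - \<l> (s i x))) \<partial>completion M)
      \<le> ennreal C * (\<integral>\<^sup>+x. ennreal (N (f x - s i x)) \<partial>M)" for i
  proof -
    have "(\<lambda>x. N (f x - s i x)) \<in> borel_measurable (completion M)"
      using s[of i] by (intro strongly_measurable_norm strongly_measurable_diff[OF f] strongly_measurable_simple)
         (auto elim: Bochner_Integration.simple_bochner_integrable.cases)
    moreover have "(\<integral>\<^sup>+x. ennreal (norm (\<l> (f x) - \<l> (s i x))) \<partial>completion M)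
      \<le> (\<integral>\<^sup>+x. ennreal C * ennreal (N (f x - s i x)) \<partial>completion M)"
      using fS AE_completion[OF AE_space[of M]]
    proof (intro nn_integral_mono_AE, eventually_elim)
      case (elim x)
      then have "s i x \<in> S" using s(2)[rule_format, of i] by auto
      then show ?case using C(1) C(2)[of "f x - s i x"] elim
        by (simp add: bounded_functional_simps[OF l] flip: ennreal_mult')
    qed
    moreover from calculation(1) have "(\<integral>\<^sup>+x. ennreal C * ennreal (N (f x - s i x)) \<partial>completion M)
        = ennreal C * (\<integral>\<^sup>+x. ennreal (N (f x - s i x)) \<partial>completion M)"
      by (intro nn_integral_cmult) auto
    ultimately show ?thesis by (simp add: nn_integral_completion)
  qed
  have lim0: "(\<lambda>i. ennreal C * (\<integral>\<^sup>+x. ennreal (N (f x - s i x)) \<partial>M)) \<longlonglongrightarrow> 0"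
    using ennreal_tendsto_cmult[OF _ lim(1), of "ennreal C"] by simp
  then have "\<forall>\<^sub>F i in sequentially. ennreal C * (\<integral>\<^sup>+x. ennreal (N (f x - s i x)) \<partial>M) < 1"
    by (rule order_tendstoD(2)) simp
  then obtain i where "ennreal C * (\<integral>\<^sup>+x. ennreal (N (f x - s i x)) \<partial>M) < 1"
    by (auto simp: eventually_sequentially)
  then have "(\<integral>\<^sup>+x. ennreal (norm (\<l> (f x) - \<l> (s i x))) \<partial>completion M) < 1"
    using bd[of i] by (rule le_less_trans[rotated])
  then have "(\<integral>\<^sup>+x. ennreal (norm (\<l> (f x) - \<l> (s i x))) \<partial>completion M) < \<infinity>"
    by (rule less_trans) simp
  then have "integrable (completion M) (\<lambda>x. \<l> (f x) - \<l> (s i x))"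
    using ints(1)[of i] by (intro integrableI_bounded) auto
  from Bochner_Integration.integrable_add[OF this ints(1)[of i]]
  show int: "integrable (completion M) (\<lambda>x. \<l> (f x))" by simp
  have "(\<lambda>i. LINT x|completion M. \<l> (s i x)) \<longlonglongrightarrow> (LINT x|completion M. \<l> (f x))"
  proof (rule tendsto_L1_int)
    show "((\<lambda>i. \<integral>\<^sup>+ x. ennreal (norm (\<l> (s i x) - \<l> (f x))) \<partial>completion M) \<longlongrightarrow> 0) sequentially"
      by (rule tendsto_sandwich[OF _ _ tendsto_const lim0])
         (use bd in \<open>auto intro!: always_eventually simp: abs_minus_commute\<close>)
  qed (use ints(1) int in auto)
  moreover have "(\<lambda>i. LINT x|completion M. \<l> (s i x)) \<longlonglongrightarrow> \<l> w"
    unfolding ints(2)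
  proof (rule bounded_functional_tendsto[OF l])
    show mem: "\<forall>i. Bochner_Integration.simple_bochner_integral M (s i) \<in> S"
      using norm_simple_integral_le(1)[OF s] by auto
    show "(\<lambda>i. N (w - Bochner_Integration.simple_bochner_integral M (s i))) \<longlonglongrightarrow> 0"
      using lim(2) N_commute[OF wS mem[rule_format]] by simp
  qed (fact wS)
  ultimately show "(LINT x|completion M. \<l> (f x)) = \<l> w" by (rule LIMSEQ_unique)
qed

text \<open>Simple functions within \<open>2^-k\<close> of \<open>f k\<close> in \<open>L^1\<close> have errors that are summable almost everywhere, so
  they approximate \<open>g\<close> as well.\<close>

lemma strongly_measurable_AE_limit:
  assumes fin: "finite_measure M" and f: "\<And>k::nat. strongly_measurable_in M S N (f k)"
    and int: "\<And>k. (\<integral>\<^sup>+x. ennreal (N (f k x)) \<partial>M) < \<infinity>"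
    and gS: "AE x in M. g x \<in> S" and lim: "AE x in M. (\<lambda>k. N (g x - f k x)) \<longlonglongrightarrow> 0"
  shows "strongly_measurable_in M S N g"
proof -
  have "\<exists>t. simple_function M t \<and> t ` space M \<subseteq> S \<and> (\<integral>\<^sup>+x. ennreal (N (f k x - t x)) \<partial>M) \<le> ennreal (1 * (1/2)^k)" for k
  proof -
    obtain s where s: "\<forall>i::nat. Bochner_Integration.simple_bochner_integrable M (s i)" "\<forall>i. s i ` space M \<subseteq> S"
      and lim: "(\<lambda>i. \<integral>\<^sup>+x. ennreal (N (f k x - s i x)) \<partial>M) \<longlonglongrightarrow> 0"
      by (rule simple_L1_approx[OF fin f int])
    have "\<forall>\<^sub>F i in sequentially. (\<integral>\<^sup>+x. ennreal (N (f k x - s i x)) \<partial>M) < ennreal (1 * (1/2)^k)"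
      by (rule order_tendstoD(2)[OF lim]) simp
    then obtain i where "(\<integral>\<^sup>+x. ennreal (N (f k x - s i x)) \<partial>M) < ennreal (1 * (1/2)^k)"
      by (auto simp: eventually_sequentially)
    then show ?thesis using s by (intro exI[of _ "s i"]) (auto elim: Bochner_Integration.simple_bochner_integrable.cases)
  qed
  then obtain t where t: "\<And>k. simple_function M (t k)" "\<And>k. t k ` space M \<subseteq> S"
     "\<And>k. (\<integral>\<^sup>+x. ennreal (N (f k x - t k x)) \<partial>M) \<le> ennreal (1 * (1/2)^k)" by metis
  have "AE x in completion M. summable (\<lambda>k. max 0 (N (f k x - t k x)))"
  proof (rule AE_summable_of_geometric_bound)
    show "(\<lambda>x. max 0 (N (f k x - t k x))) \<in> borel_measurable (completion M)" for k
      by (intro borel_measurable_max strongly_measurable_norm strongly_measurable_diff f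
          strongly_measurable_simple t) auto
    have "(\<lambda>x. ennreal (max 0 (N (f k x - t k x)))) = (\<lambda>x. ennreal (N (f k x - t k x)))" for k
      by (auto simp: fun_eq_iff max_def ennreal_neg)
    then show "(\<integral>\<^sup>+x. ennreal (max 0 (N (f k x - t k x))) \<partial>completion M) \<le> ennreal (1 * (1/2)^k)" for k
      using t(3)[of k] by (simp add: nn_integral_completion)
  qed auto
  then have sumAE: "AE x in M. summable (\<lambda>k. max 0 (N (f k x - t k x)))" by (simp add: AE_completion_iff)
  have fS: "AE x in M. \<forall>k. f k x \<in> S"
    using f by (auto simp: AE_all_countable strongly_measurable_in_def)
  have "AE x in M. (\<lambda>k. N (g x - t k x)) \<longlonglongrightarrow> 0"
    using gS fS lim sumAE AE_space
  proof eventually_elim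
    case (elim x)
    have tS: "t k x \<in> S" for k using t(2) elim(5) by blast
    have "(\<lambda>k. N (g x - f k x) + max 0 (N (f k x - t k x))) \<longlonglongrightarrow> 0 + 0"
      by (intro tendsto_add elim(3) summable_LIMSEQ_zero elim(4))
    then have "(\<lambda>k. N (g x - f k x) + max 0 (N (f k x - t k x))) \<longlonglongrightarrow> 0" by simp
    then show ?case
    proof (rule tendsto_zero_dominated)
      fix k
      have "0 \<le> N (g x - t k x)" using elim(1) tS[of k] by auto
      then show "\<bar>N (g x - t k x)\<bar> \<le> N (g x - f k x) + max 0 (N (f k x - t k x))"
        using triangle_diff[OF elim(1) elim(2)[rule_format] tS[of k], of k] by simp
    qed
  qed
  then show ?thesis using gS t(1,2) unfolding strongly_measurable_in_def by blast
qed

lemma L1_of_L2: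
  assumes fin: "finite_measure M" and f: "strongly_measurable_in M S N f"
    and int: "(\<integral>\<^sup>+x. ennreal ((N (f x))\<^sup>2) \<partial>M) < \<infinity>"
  shows "(\<integral>\<^sup>+x. ennreal (N (f x)) \<partial>M) < \<infinity>"
proof -
  interpret finite_measure M by fact
  have m: "(\<lambda>x. N (f x)) \<in> borel_measurable (completion M)" by (rule strongly_measurable_norm[OF f])
  have "(\<integral>\<^sup>+x. ennreal (N (f x)) \<partial>completion M) \<le> (\<integral>\<^sup>+x. 1 + ennreal ((N (f x))\<^sup>2) \<partial>completion M)"
  proof (rule nn_integral_mono)
    fix x
    have "2 * N (f x) \<le> (N (f x))\<^sup>2 + 1"
      using zero_le_power2[of "N (f x) - 1"] unfolding power2_diff by simp
    then have "N (f x) \<le> 1 + (N (f x))\<^sup>2" using zero_le_power2[of "N (f x)"] by linarith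
    then have "ennreal (N (f x)) \<le> ennreal (1 + (N (f x))\<^sup>2)" by (rule ennreal_leI)
    then show "ennreal (N (f x)) \<le> 1 + ennreal ((N (f x))\<^sup>2)" by simp
  qed
  also have "\<dots> = (\<integral>\<^sup>+x. 1 \<partial>completion M) + (\<integral>\<^sup>+x. ennreal ((N (f x))\<^sup>2) \<partial>completion M)"
    using m by (intro nn_integral_add) auto
  also have "\<dots> < \<infinity>" using int by (simp add: nn_integral_completion emeasure_eq_measure)
  finally show ?thesis by (simp add: nn_integral_completion)
qed

end

locale complete_seminormed_space = seminormed_space S N for S :: "'b::real_vector set" and N +
  assumes complete: "\<And>x. (\<And>n::nat. x n \<in> S) \<Longrightarrow> (\<And>e. e > 0 \<Longrightarrow> \<exists>k. \<forall>m\<ge>k. \<forall>n\<ge>k. N (x m - x n) < e)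
     \<Longrightarrow> \<exists>l\<in>S. (\<lambda>n. N (x n - l)) \<longlonglongrightarrow> 0"
begin

text \<open>\<open>bochner_integral_in\<close> is a choice; completeness provides an element to choose, namely the limit of
  the simple integrals.\<close>

lemma bochner_integral_exists:
  assumes fin: "finite_measure M" and f: "strongly_measurable_in M S N f"
    and int: "(\<integral>\<^sup>+x. ennreal (N (f x)) \<partial>M) < \<infinity>"
  shows "has_bochner_integral_in M S N f (bochner_integral_in M S N f)"
proof -
  obtain s where s0: "\<forall>i::nat. Bochner_Integration.simple_bochner_integrable M (s i)" "\<forall>i. s i ` space M \<subseteq> S"
    and lim: "(\<lambda>i. \<integral>\<^sup>+x. ennreal (N (f x - s i x)) \<partial>M) \<longlonglongrightarrow> 0"
    by (rule simple_L1_approx[OF fin f int])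
  note s = s0[rule_format]
  let ?w = "\<lambda>i. Bochner_Integration.simple_bochner_integral M (s i)"
  have sm: "strongly_measurable_in M S N (s i)" for i
    using s[of i] by (auto intro!: strongly_measurable_simple elim: Bochner_Integration.simple_bochner_integrable.cases)
  have w: "?w i \<in> S" for i using norm_simple_integral_le(1)[OF s] .
  have "\<exists>l\<in>S. (\<lambda>n. N (?w n - l)) \<longlonglongrightarrow> 0"
  proof (rule complete[OF w])
    fix e :: real assume e: "e > 0"
    then have "\<forall>\<^sub>F i in sequentially. (\<integral>\<^sup>+x. ennreal (N (f x - s i x)) \<partial>M) < ennreal (e/2)"
      by (intro order_tendstoD(2)[OF lim]) simp
    then obtain k where k: "\<And>i. i \<ge> k \<Longrightarrow> (\<integral>\<^sup>+x. ennreal (N (f x - s i x)) \<partial>M) < ennreal (e/2)"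
      by (auto simp: eventually_sequentially)
    have "N (?w m - ?w n) < e" if "m \<ge> k" "n \<ge> k" for m n
    proof -
      have d: "Bochner_Integration.simple_bochner_integrable M (\<lambda>x. s m x - s n x)"
        using simple_bochner_integrable_compose2[of "(-)", OF _ s(1) s(1)] by simp
      have "(\<lambda>x. s m x - s n x) ` space M \<subseteq> S" using s(2)[of m] s(2)[of n] by auto
      from norm_simple_integral_le(2)[OF d this]
      have "ennreal (N (?w m - ?w n)) \<le> (\<integral>\<^sup>+x. ennreal (N (s m x - s n x)) \<partial>M)"
        using s by (simp add: simple_bochner_integral_diff)
      also have "\<dots> \<le> (\<integral>\<^sup>+x. ennreal (N (f x - s m x)) \<partial>M) + (\<integral>\<^sup>+x. ennreal (N (f x - s n x)) \<partial>M)"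
        by (rule nn_integral_triangle[OF sm sm f])
      also have "\<dots> < ennreal (e/2) + ennreal (e/2)"
        using k that by (intro add_strict_mono) auto
      also have "\<dots> = ennreal e" using e by (simp flip: ennreal_plus)
      finally show ?thesis using w[of m] w[of n] by (auto simp: ennreal_less_iff)
    qed
    then show "\<exists>k. \<forall>m\<ge>k. \<forall>n\<ge>k. N (?w m - ?w n) < e" by blast
  qed
  then obtain l where "l \<in> S" "(\<lambda>n. N (?w n - l)) \<longlonglongrightarrow> 0" by blast
  with s lim f have "has_bochner_integral_in M S N f l"
    unfolding has_bochner_integral_in_def by blast
  then show ?thesis unfolding bochner_integral_in_def by (rule someI)
qed

text \<open>The Riesz--Fischer argument: a subsequence whose consecutive distances are summable converges
  almost everywhere, and Fatou's lemma compares the whole sequence with its limit.\<close>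

lemma Bochner_L2_complete:
  assumes fin: "finite_measure M" and f: "\<And>n::nat. strongly_measurable_in M S N (f n)"
    and int: "\<And>n. (\<integral>\<^sup>+x. ennreal ((N (f n x))\<^sup>2) \<partial>M) < \<infinity>"
    and cauchy: "\<And>e. e > 0 \<Longrightarrow> \<exists>k. \<forall>m\<ge>k. \<forall>n\<ge>k. (\<integral>\<^sup>+x. ennreal ((N (f m x - f n x))\<^sup>2) \<partial>M) < ennreal e"
  obtains g where "strongly_measurable_in M S N g" "(\<integral>\<^sup>+x. ennreal ((N (g x))\<^sup>2) \<partial>M) < \<infinity>"
    "(\<lambda>n. \<integral>\<^sup>+x. ennreal ((N (f n x - g x))\<^sup>2) \<partial>M) \<longlonglongrightarrow> 0"
proof -
  have "\<forall>k. \<exists>K. \<forall>m\<ge>K. \<forall>n\<ge>K. (\<integral>\<^sup>+x. ennreal ((N (f m x - f n x))\<^sup>2) \<partial>M) < ennreal ((1/8)^k)"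
    using cauchy by simp
  then obtain K where K: "\<And>k m n. m \<ge> K k \<Longrightarrow> n \<ge> K k \<Longrightarrow>
      (\<integral>\<^sup>+x. ennreal ((N (f m x - f n x))\<^sup>2) \<partial>M) < ennreal ((1/8)^k)" by metis
  define r where "r k = (\<Sum>i\<le>k. K i)" for k
  have rK: "K j \<le> r k" if "j \<le> k" for j k
    unfolding r_def using that by (intro member_le_sum) auto
  have mN: "(\<lambda>x. N (f m x - f n x)) \<in> borel_measurable (completion M)" for m n
    by (intro strongly_measurable_norm strongly_measurable_diff f)
  have fS: "AE x in M. \<forall>k. f k x \<in> S"
    using f by (auto simp: AE_all_countable strongly_measurable_in_def)
  have "AE x in completion M. summable (\<lambda>k. 4^k * (N (f (r k) x - f (r (Suc k)) x))\<^sup>2)"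
  proof (rule AE_summable_of_geometric_bound[where c=1])
    fix k
    \<comment> \<open>The weight \<open>4^k\<close> is weak enough for the integrals, \<open>(4/8)^k\<close>, to be summable, and strong enough to
      make the distances at most \<open>2^-k\<close> eventually.\<close>
    show "(\<lambda>x. 4^k * (N (f (r k) x - f (r (Suc k)) x))\<^sup>2) \<in> borel_measurable (completion M)"
      using mN by measurable
    have "(\<integral>\<^sup>+x. ennreal (4^k * (N (f (r k) x - f (r (Suc k)) x))\<^sup>2) \<partial>completion M)
        = (\<integral>\<^sup>+x. ennreal (4^k) * ennreal ((N (f (r k) x - f (r (Suc k)) x))\<^sup>2) \<partial>completion M)"
      by (intro nn_integral_cong) (simp add: ennreal_mult')
    also have "\<dots> = ennreal (4^k) * (\<integral>\<^sup>+x. ennreal ((N (f (r k) x - f (r (Suc k)) x))\<^sup>2) \<partial>completion M)"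
      using mN by (intro nn_integral_cmult) measurable
    also have "\<dots> \<le> ennreal (4^k) * ennreal ((1/8)^k)"
      using K[OF rK rK, of k k "Suc k"] by (intro mult_left_mono) (auto simp: nn_integral_completion)
    also have "\<dots> = ennreal (1 * (1/2)^k)"
      by (subst ennreal_mult'[symmetric]) (auto simp flip: power_mult_distrib)
    finally show "(\<integral>\<^sup>+x. ennreal (4^k * (N (f (r k) x - f (r (Suc k)) x))\<^sup>2) \<partial>completion M) \<le> ennreal (1 * (1/2)^k)" .
  qed auto
  then have sumAE: "AE x in M. summable (\<lambda>k. 4^k * (N (f (r k) x - f (r (Suc k)) x))\<^sup>2)" by (simp add: AE_completion_iff)
  define g where "g x = (SOME l. l \<in> S \<and> (\<lambda>k. N (f (r k) x - l)) \<longlonglongrightarrow> 0)" for x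
  have gAE: "AE x in M. g x \<in> S \<and> (\<lambda>k. N (f (r k) x - g x)) \<longlonglongrightarrow> 0"
    using fS sumAE
  proof eventually_elim
    case (elim x)
    have "(\<lambda>k. 4^k * (N (f (r k) x - f (r (Suc k)) x))\<^sup>2) \<longlonglongrightarrow> 0"
      using elim(2) by (rule summable_LIMSEQ_zero)
    then have "\<forall>\<^sub>F k in sequentially. 4^k * (N (f (r k) x - f (r (Suc k)) x))\<^sup>2 < 1"
      by (rule order_tendstoD(2)) simp
    then obtain k0 where k0: "\<And>k. k \<ge> k0 \<Longrightarrow> 4^k * (N (f (r k) x - f (r (Suc k)) x))\<^sup>2 < 1"
      by (auto simp: eventually_sequentially)
    have step: "N (f (r k) x - f (r (Suc k)) x) \<le> (1/2)^k" if "k \<ge> k0" for k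
    proof (rule power2_le_imp_le)
      have "(N (f (r k) x - f (r (Suc k)) x))\<^sup>2 \<le> 1 / 4^k"
        using k0[OF that] by (simp add: field_simps)
      also have "\<dots> = ((1/2)^k)\<^sup>2" by (simp add: power2_eq_square power_divide flip: power_mult_distrib)
      finally show "(N (f (r k) x - f (r (Suc k)) x))\<^sup>2 \<le> ((1/2)^k)\<^sup>2" .
    qed simp
    have far: "N (f (r m) x - f (r (m + d)) x) \<le> 2 * (1/2)^m - 2 * (1/2)^(m+d)" if "m \<ge> k0" for m d
    proof (induction d)
      case (Suc d)
      have "N (f (r m) x - f (r (m + Suc d)) x) \<le> N (f (r m) x - f (r (m + d)) x) + N (f (r (m+d)) x - f (r (m + Suc d)) x)"
        using elim by (intro triangle_diff) auto
      moreover have "N (f (r (m + d)) x - f (r (m + Suc d)) x) \<le> (1/2)^(m+d)" using step[of "m+d"] that by simp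
      moreover have "(1/2::real)^(m + Suc d) = (1/2)^(m+d) / 2" by simp
      ultimately show ?case using Suc by linarith
    qed simp
    have "\<exists>l\<in>S. (\<lambda>k. N (f (r k) x - l)) \<longlonglongrightarrow> 0"
    proof (rule complete)
      fix e :: real assume "e > 0"
      then obtain k1 where k1: "(1/2)^k1 < e/2" using real_arch_pow_inv[of "e/2" "1/2"] by auto
      have less: "N (f (r m) x - f (r n) x) < e" if "m \<ge> max k0 k1" "m \<le> n" for m n
      proof -
        have "N (f (r m) x - f (r n) x) \<le> 2 * (1/2)^m - 2 * (1/2)^n" using far[of m "n - m"] that by simp
        also have "\<dots> \<le> 2 * (1/2)^m" by simp
        also have "\<dots> \<le> 2 * (1/2)^k1" using that by (simp add: power_decreasing)
        finally show ?thesis using k1 by simp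
      qed
      have "N (f (r m) x - f (r n) x) < e" if "m \<ge> max k0 k1" "n \<ge> max k0 k1" for m n
        using less[of m n] less[of n m] that N_commute[of "f (r m) x" "f (r n) x"] elim(1) by (cases "m \<le> n") auto
      then show "\<exists>k. \<forall>m\<ge>k. \<forall>n\<ge>k. N (f (r m) x - f (r n) x) < e" by blast
    qed (use elim in auto)
    then have "\<exists>l. l \<in> S \<and> (\<lambda>k. N (f (r k) x - l)) \<longlonglongrightarrow> 0" by blast
    then show ?case unfolding g_def by (rule someI_ex)
  qed
  have fL1: "(\<integral>\<^sup>+x. ennreal (N (f n x)) \<partial>M) < \<infinity>" for n
    by (rule L1_of_L2[OF fin f int])
  have g: "strongly_measurable_in M S N g"
  proof (rule strongly_measurable_AE_limit[where f="\<lambda>k. f (r k)"])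
    show "AE x in M. (\<lambda>k. N (g x - f (r k) x)) \<longlonglongrightarrow> 0"
      using gAE fS
    proof eventually_elim
      case (elim x)
      have "N (g x - f (r k) x) = N (f (r k) x - g x)" for k using elim by (intro N_commute) auto
      with elim show ?case by simp
    qed
    show "AE x in M. g x \<in> S" using gAE by eventually_elim simp
  qed (use fin f fL1 in auto)
  have fatou: "(\<integral>\<^sup>+x. ennreal ((N (f n x - g x))\<^sup>2) \<partial>M) \<le> ennreal ((1/8)^j)" if n: "n \<ge> K j" for n j
  proof -
    have "(\<integral>\<^sup>+x. ennreal ((N (f n x - g x))\<^sup>2) \<partial>completion M)
      \<le> (\<integral>\<^sup>+x. liminf (\<lambda>k. ennreal ((N (f n x - f (r k) x))\<^sup>2)) \<partial>completion M)"
      using AE_completion[OF gAE] AE_completion[OF fS]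
    proof (intro nn_integral_mono_AE, eventually_elim)
      case (elim x)
      have "(\<lambda>k. N (f n x - f (r k) x)) \<longlonglongrightarrow> N (f n x - g x)"
      proof (rule N_tendsto)
        have "(f n x - g x) - (f n x - f (r i) x) = f (r i) x - g x" for i by simp
        then show "(\<lambda>i. N (f n x - g x - (f n x - f (r i) x))) \<longlonglongrightarrow> 0" using elim by simp
      qed (use elim in auto)
      then have "(\<lambda>k. ennreal ((N (f n x - f (r k) x))\<^sup>2)) \<longlonglongrightarrow> ennreal ((N (f n x - g x))\<^sup>2)"
        by (intro tendsto_ennrealI tendsto_power)
      from lim_imp_Liminf[OF _ this] show ?case by simp
    qed
    also have "\<dots> \<le> liminf (\<lambda>k. \<integral>\<^sup>+x. ennreal ((N (f n x - f (r k) x))\<^sup>2) \<partial>completion M)"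
      using mN by (intro nn_integral_liminf) measurable
    also have "\<dots> \<le> limsup (\<lambda>k. \<integral>\<^sup>+x. ennreal ((N (f n x - f (r k) x))\<^sup>2) \<partial>completion M)"
      by (intro Liminf_le_Limsup) simp
    also have "\<dots> \<le> ennreal ((1/8)^j)"
    proof (rule Limsup_bounded)
      show "\<forall>\<^sub>F k in sequentially. (\<integral>\<^sup>+x. ennreal ((N (f n x - f (r k) x))\<^sup>2) \<partial>completion M) \<le> ennreal ((1/8)^j)"
        using eventually_ge_at_top[of j]
        by eventually_elim (use K[OF n rK] in \<open>auto simp: nn_integral_completion less_imp_le\<close>)
    qed
    finally show ?thesis by (simp add: nn_integral_completion)
  qed
  have lim: "(\<lambda>n. \<integral>\<^sup>+x. ennreal ((N (f n x - g x))\<^sup>2) \<partial>M) \<longlonglongrightarrow> 0"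
  proof (rule order_tendstoI)
    fix a :: ennreal assume a: "0 < a"
    have "(\<lambda>j. ennreal ((1/8)^j)) \<longlonglongrightarrow> ennreal 0"
      by (intro tendsto_ennrealI LIMSEQ_realpow_zero) auto
    then have "\<forall>\<^sub>F j in sequentially. ennreal ((1/8)^j) < a" using a by (intro order_tendstoD) auto
    then obtain j where j: "ennreal ((1/8)^j) < a" by (auto simp: eventually_sequentially)
    show "\<forall>\<^sub>F n in sequentially. (\<integral>\<^sup>+x. ennreal ((N (f n x - g x))\<^sup>2) \<partial>M) < a"
      using eventually_ge_at_top[of "K j"]
      by eventually_elim (rule le_less_trans[OF fatou j])
  qed simp
  have "(\<integral>\<^sup>+x. ennreal ((N (g x))\<^sup>2) \<partial>M) < \<infinity>"
  proof -
    let ?n = "K 0"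
    have gm: "(\<lambda>x. N (f ?n x - g x)) \<in> borel_measurable (completion M)" "(\<lambda>x. N (f ?n x)) \<in> borel_measurable (completion M)"
      by (intro strongly_measurable_norm strongly_measurable_diff f g)+
    have "(\<integral>\<^sup>+x. ennreal ((N (g x))\<^sup>2) \<partial>completion M)
        \<le> (\<integral>\<^sup>+x. 2 * ennreal ((N (f ?n x))\<^sup>2) + 2 * ennreal ((N (f ?n x - g x))\<^sup>2) \<partial>completion M)"
      using AE_completion[OF gAE] AE_completion[OF fS]
    proof (intro nn_integral_mono_AE, eventually_elim)
      case (elim x)
      then have nn: "0 \<le> N (g x)" "0 \<le> N (f ?n x)" "0 \<le> N (f ?n x - g x)" by auto
      have "N (g x) \<le> N (f ?n x) + N (f ?n x - g x)"
        using triangle_minus[of "f ?n x" "f ?n x - g x"] elim by simp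
      then have "(N (g x))\<^sup>2 \<le> (N (f ?n x) + N (f ?n x - g x))\<^sup>2" using nn by (intro power_mono) auto
      also have "\<dots> \<le> 2 * (N (f ?n x))\<^sup>2 + 2 * (N (f ?n x - g x))\<^sup>2"
        using zero_le_power2[of "N (f ?n x) - N (f ?n x - g x)"] unfolding power2_sum power2_diff by simp
      finally have "ennreal ((N (g x))\<^sup>2) \<le> ennreal (2 * (N (f ?n x))\<^sup>2 + 2 * (N (f ?n x - g x))\<^sup>2)" by (rule ennreal_leI)
      then show ?case by (simp add: ennreal_mult')
    qed
    also have "\<dots> = 2 * (\<integral>\<^sup>+x. ennreal ((N (f ?n x))\<^sup>2) \<partial>completion M) + 2 * (\<integral>\<^sup>+x. ennreal ((N (f ?n x - g x))\<^sup>2) \<partial>completion M)"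
      using gm by (subst nn_integral_add) (auto simp: nn_integral_cmult)
    also have "\<dots> < \<infinity>"
      using int[of ?n] le_less_trans[OF fatou[OF order_refl, of 0] ennreal_less_top]
      by (simp add: nn_integral_completion ennreal_mult_less_top)
    finally show ?thesis by (simp add: nn_integral_completion)
  qed
  then show ?thesis by (rule that[OF g _ lim])
qed

end

section \<open>Smooth functions with compact support\<close>

lemma partial_deriv_eq:
  "(f has_derivative f') (at x) \<Longrightarrow> partial_deriv i f x = f' (axis i 1)"
  unfolding partial_deriv_def using frechet_derivative_at by metis

lemma differentiable_partial:
  "f differentiable_on UNIV \<Longrightarrow> (f has_derivative frechet_derivative f (at x)) (at x)"
  by (metis UNIV_I differentiable_on_def frechet_derivative_works)

lemma Ck_Suc_imp: "Ck (Suc k) f \<Longrightarrow> Ck k f"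
  by (induction k arbitrary: f) (auto intro: differentiable_imp_continuous_on)

lemma Ck_continuous: "Ck k f \<Longrightarrow> continuous_on UNIV f"
  by (cases k) (auto intro: differentiable_imp_continuous_on)

lemma Ck_const: "Ck k (\<lambda>x::real^'d. c)"
proof (induction k arbitrary: c)
  case (Suc k)
  have "partial_deriv i (\<lambda>x::real^'d. c) = (\<lambda>x. 0)" for i
    by (auto simp: fun_eq_iff intro!: partial_deriv_eq)
  then show ?case using Suc by simp
qed simp

lemma Ck_add: "Ck k f \<Longrightarrow> Ck k g \<Longrightarrow> Ck k (\<lambda>x. f x + g x)"
proof (induction k arbitrary: f g)
  case (Suc k)
  then have d: "f differentiable_on UNIV" "g differentiable_on UNIV" by auto
  have "partial_deriv i (\<lambda>x. f x + g x) = (\<lambda>x. partial_deriv i f x + partial_deriv i g x)" for i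
  proof
    fix x
    show "partial_deriv i (\<lambda>x. f x + g x) x = partial_deriv i f x + partial_deriv i g x"
      using partial_deriv_eq[OF has_derivative_add[OF differentiable_partial[OF d(1)] differentiable_partial[OF d(2)]]]
      by (simp add: partial_deriv_def)
  qed
  with Suc d show ?case by (auto intro: differentiable_on_add)
qed (auto intro: continuous_intros)

lemma Ck_mult: "Ck k f \<Longrightarrow> Ck k g \<Longrightarrow> Ck k (\<lambda>x. f x * g x)"
proof (induction k arbitrary: f g)
  case (Suc k)
  then have d: "f differentiable_on UNIV" "g differentiable_on UNIV" by auto
  have "partial_deriv i (\<lambda>x. f x * g x) = (\<lambda>x. f x * partial_deriv i g x + partial_deriv i f x * g x)" for i
  proof
    fix x
    show "partial_deriv i (\<lambda>x. f x * g x) x = f x * partial_deriv i g x + partial_deriv i f x * g x"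
      using partial_deriv_eq[OF has_derivative_mult[OF differentiable_partial[OF d(1)] differentiable_partial[OF d(2)]]]
      by (simp add: partial_deriv_def)
  qed
  moreover have "Ck k (\<lambda>x. f x * partial_deriv i g x + partial_deriv i f x * g x)" for i
    using Suc.prems by (intro Ck_add Suc.IH) (auto intro: Ck_Suc_imp)
  ultimately show ?case using d by (auto intro: differentiable_on_mult)
qed (auto intro: continuous_intros)

lemma Ck_prod: "finite A \<Longrightarrow> (\<And>i. i \<in> A \<Longrightarrow> Ck k (f i)) \<Longrightarrow> Ck k (\<lambda>x. \<Prod>i\<in>A. f i x)"
  by (induction A rule: finite_induct) (auto intro: Ck_const Ck_mult)

lemma Ck_coord: "Ck k (\<lambda>x. x $ i)"
proof (cases k)
  case (Suc m)
  have "partial_deriv j (\<lambda>x. x $ i) = (\<lambda>x. axis j 1 $ i)" for j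
    by (auto simp: fun_eq_iff intro!: partial_deriv_eq bounded_linear_imp_has_derivative bounded_linear_vec_nth)
  moreover have "(\<lambda>x::real^'a. x $ i) differentiable_on UNIV"
    by (intro bounded_linear_imp_differentiable_on bounded_linear_vec_nth)
  ultimately show ?thesis using Suc by (simp add: Ck_const)
qed (auto intro!: continuous_intros)

text \<open>The functions \<open>x powr (-m) * exp (-1/x)\<close>, extended by zero, are closed under
  differentiation up to linear combinations; for \<open>m = 0\<close> this gives a smooth cut-off at \<open>0\<close>.\<close>

definition flat :: "nat \<Rightarrow> real \<Rightarrow> real" where
  "flat m x = (if x > 0 then (inverse x) ^ m * exp (- inverse x) else 0)"

lemma flat_tendsto_0: "((\<lambda>x. flat m x) \<longlongrightarrow> 0) (at_right 0)"
proof -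
  have "((\<lambda>x. (inverse x) ^ m / exp (inverse x)) \<longlongrightarrow> 0) (at_right (0::real))"
    by (rule filterlim_compose[OF tendsto_power_div_exp_0 filterlim_inverse_at_top_right])
  then show ?thesis
  proof (rule Lim_transform_eventually)
    show "\<forall>\<^sub>F x in at_right 0. (inverse x) ^ m / exp (inverse x) = flat m x"
      unfolding eventually_at_right_field by (auto simp: flat_def exp_minus divide_inverse intro!: exI[of _ 1])
  qed
qed

lemma flat_deriv: "(flat m has_real_derivative flat (m+2) x - m * flat (m+1) x) (at x)"
proof (cases "x = 0")
  case True
  have "((\<lambda>y. (flat m y - flat m 0) / (y - 0)) \<longlongrightarrow> 0) (at_right 0)"
    using flat_tendsto_0[of "Suc m"]
  proof (rule Lim_transform_eventually)
    show "\<forall>\<^sub>F y in at_right 0. flat (Suc m) y = (flat m y - flat m 0) / (y - 0)"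
      unfolding eventually_at_right_field by (auto simp: flat_def field_simps intro!: exI[of _ 1])
  qed
  moreover have "((\<lambda>y. (flat m y - flat m 0) / (y - 0)) \<longlongrightarrow> 0) (at_left 0)"
  proof (rule Lim_transform_eventually[OF tendsto_const])
    show "\<forall>\<^sub>F y in at_left 0. 0 = (flat m y - flat m 0) / (y - 0)"
      unfolding eventually_at_left_field by (auto simp: flat_def intro!: exI[of _ "-1"])
  qed
  ultimately have "((\<lambda>y. (flat m y - flat m 0) / (y - 0)) \<longlongrightarrow> 0) (at 0)"
    by (rule filterlim_split_at[rotated])
  then show ?thesis using True by (simp add: has_field_derivative_iff flat_def)
next
  case False
  show ?thesis
  proof (cases "x > 0")
    case True
    have eq: "inverse x ^ (m+2) * exp (- inverse x) - m * (inverse x ^ (m+1) * exp (- inverse x))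
       = real m * (- (inverse x * 1 * inverse x)) * inverse x ^ (m - Suc 0) * exp (- inverse x)
         + exp (- inverse x) * (inverse x * 1 * inverse x) * inverse x ^ m"
      by (cases m) (auto simp: algebra_simps)
    have "((\<lambda>x. inverse x ^ m * exp (- inverse x)) has_real_derivative
        inverse x ^ (m+2) * exp (- inverse x) - m * (inverse x ^ (m+1) * exp (- inverse x))) (at x)"
      unfolding eq using True by (auto intro!: derivative_eq_intros simp: algebra_simps)
    then have "(flat m has_real_derivative
        inverse x ^ (m+2) * exp (- inverse x) - m * (inverse x ^ (m+1) * exp (- inverse x))) (at x)"
      by (rule has_field_derivative_transform_within_open[of _ _ _ "{0<..}"]) (use True in \<open>auto simp: flat_def\<close>)
    then show ?thesis using True by (simp add: flat_def)
  next
    assume "\<not> x > 0"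
    with False have "x < 0" by simp
    have "((\<lambda>x. 0) has_real_derivative 0) (at x)" by simp
    then have "(flat m has_real_derivative 0) (at x)"
      by (rule has_field_derivative_transform_within_open[of _ _ _ "{..<0}"]) (use \<open>x < 0\<close> in \<open>auto simp: flat_def\<close>)
    then show ?thesis using \<open>x < 0\<close> by (simp add: flat_def)
  qed
qed

text \<open>By \<open>flat_deriv\<close> the derivatives stay in the span of such functions.\<close>

lemma Ck_flat: "Ck k (\<lambda>x. flat m (s * x $ i + a))"
proof (induction k arbitrary: m)
  have der: "((\<lambda>x. flat m (s * x $ i + a)) has_derivative
      (\<lambda>v. (flat (m+2) (s * x $ i + a) - m * flat (m+1) (s * x $ i + a)) * (s * v $ i))) (at x)" for m and x :: "real^'a"
  proof -
    have lin: "((\<lambda>x. s * x $ i + a) has_derivative (\<lambda>v. s * v $ i)) (at x)"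
      by (auto intro!: derivative_eq_intros bounded_linear_imp_has_derivative bounded_linear_vec_nth)
    show ?thesis
      using has_derivative_compose[OF lin flat_deriv[of m "s * x $ i + a", unfolded has_field_derivative_def]] by simp
  qed
  {
    case 0
    have "(\<lambda>x::real^'a. flat m (s * x $ i + a)) differentiable_on UNIV"
      using der unfolding differentiable_on_def differentiable_def by blast
    then show ?case by (auto intro: differentiable_imp_continuous_on)
  next
    case (Suc k)
    have "partial_deriv j (\<lambda>x::real^'a. flat m (s * x $ i + a)) =
       (\<lambda>x. (s * axis j 1 $ i) * flat (m+2) (s * x $ i + a) + (- (s * axis j 1 $ i) * m) * flat (m+1) (s * x $ i + a))" for j
      by (rule ext, subst partial_deriv_eq[OF der]) (simp add: algebra_simps)
    moreover have "(\<lambda>x::real^'a. flat m (s * x $ i + a)) differentiable_on UNIV"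
      using der unfolding differentiable_on_def differentiable_def by blast
    moreover have "Ck k (\<lambda>x::real^'a. (s * axis j 1 $ i) * flat (m+2) (s * x $ i + a) + (- (s * axis j 1 $ i) * m) * flat (m+1) (s * x $ i + a))" for j
      by (intro Ck_add Ck_mult Ck_const Suc.IH)
    ultimately show ?case by simp
  }
qed

text \<open>A smooth function that is positive exactly on \<open>box a b\<close>; the factor \<open>Suc n\<close> makes the transition
  at the faces steeper, so that the indicator of the box results as \<open>n\<close> grows.\<close>

definition bump :: "real^'d \<Rightarrow> real^'d \<Rightarrow> nat \<Rightarrow> real^'d \<Rightarrow> real" where
  "bump a b n x = (\<Prod>i\<in>UNIV. flat 0 (real (Suc n) * (x $ i - a $ i)) * flat 0 (real (Suc n) * (b $ i - x $ i)))"

lemma mem_box_vec: "x \<in> box a b \<longleftrightarrow> (\<forall>i. a $ i < x $ i \<and> x $ i < b $ i)" for x :: "real^'d"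
  by (auto simp: mem_box Basis_vec_def inner_axis)

lemma flat_0_bounds: "0 \<le> flat 0 x" "flat 0 x \<le> 1"
  by (auto simp: flat_def)

lemma bump_bounds: "0 \<le> bump a b n x" "bump a b n x \<le> 1"
  unfolding bump_def by (auto intro!: prod_nonneg prod_le_1 mult_nonneg_nonneg mult_le_one flat_0_bounds)

lemma bump_support: "{x. bump a b n x \<noteq> 0} = box a b"
  by (auto simp: bump_def mem_box_vec flat_def zero_less_mult_iff)

lemma bump_tendsto: "(\<lambda>n. bump a b n x) \<longlonglongrightarrow> indicator (box a b) x"
proof (cases "x \<in> box a b")
  case True
  have *: "(\<lambda>n. flat 0 (real (Suc n) * y)) \<longlonglongrightarrow> 1" if "y > 0" for y
  proof -
    have "(\<lambda>n. inverse (real (Suc n)) * inverse y) \<longlonglongrightarrow> 0 * inverse y"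
      by (intro tendsto_mult LIMSEQ_inverse_real_of_nat tendsto_const)
    then have "(\<lambda>n. exp (- (inverse (real (Suc n)) * inverse y))) \<longlonglongrightarrow> exp (- (0 * inverse y))"
      by (intro tendsto_exp tendsto_minus)
    then show ?thesis using that by (simp add: flat_def zero_less_mult_iff del: of_nat_Suc)
  qed
  have "(\<lambda>n. bump a b n x) \<longlonglongrightarrow> (\<Prod>i\<in>(UNIV::'a set). 1 * 1)"
    unfolding bump_def using True by (intro tendsto_prod tendsto_mult *) (auto simp: mem_box_vec)
  then show ?thesis using True by simp
next
  case False
  then have "bump a b n x = 0" for n using bump_support[of a b n] by blast
  then show ?thesis using False by simp
qed

lemma bump_test_function:
  assumes "cbox a b \<subseteq> \<Omega>" shows "bump a b n \<in> test_functions \<Omega>"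
proof -
  have cl: "closure (box a b) \<subseteq> cbox a b" by (rule closure_minimal[OF box_subset_cbox closed_cbox])
  have "compact (closure (box a b))"
    by (simp add: compact_eq_bounded_closed bounded_closure bounded_box)
  moreover have "Ck k (bump a b n)" for k
  proof -
    have "bump a b n = (\<lambda>x. \<Prod>i\<in>UNIV. flat 0 (real (Suc n) * x $ i + (- real (Suc n) * a $ i)) * flat 0 ((- real (Suc n)) * x $ i + real (Suc n) * b $ i))"
      by (auto simp: bump_def fun_eq_iff algebra_simps)
    then show ?thesis by (simp only:) (intro Ck_prod Ck_mult Ck_flat finite)
  qed
  ultimately show ?thesis unfolding test_functions_def using cl assms by (auto simp: bump_support)
qed

lemma test_functionsD:
  assumes "\<phi> \<in> test_functions \<Omega>"
  shows "Ck k \<phi>" "continuous_on UNIV \<phi>" "compact (closure {x. \<phi> x \<noteq> 0})" "x \<notin> \<Omega> \<Longrightarrow> \<phi> x = 0"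
    "\<phi> differentiable_on UNIV" "continuous_on UNIV (partial_deriv i \<phi>)"
proof -
  show c: "Ck k \<phi>" for k using assms by (auto simp: test_functions_def)
  show "continuous_on UNIV \<phi>" using c[of 0] by simp
  show "compact (closure {x. \<phi> x \<noteq> 0})" using assms by (auto simp: test_functions_def)
  show "\<phi> x = 0" if "x \<notin> \<Omega>"
    using assms that closure_subset[of "{x. \<phi> x \<noteq> 0}"] by (auto simp: test_functions_def)
  show "\<phi> differentiable_on UNIV" using c[of 1] by simp
  show "continuous_on UNIV (partial_deriv i \<phi>)" using c[of 1] by simp
qed

lemma partial_deriv_outside:
  assumes "x \<notin> closure {x. \<phi> x \<noteq> 0}" shows "partial_deriv i \<phi> x = 0"
proof -
  have "(\<phi> has_derivative (\<lambda>_. 0)) (at x)"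
  proof (rule has_derivative_transform_within_open[where f="\<lambda>_. 0" and s="- closure {x. \<phi> x \<noteq> 0}"])
    show "0 = \<phi> y" if "y \<in> - closure {x. \<phi> x \<noteq> 0}" for y
      using that closure_subset[of "{x. \<phi> x \<noteq> 0}"] by auto
  qed (use assms in auto)
  then show ?thesis by (simp add: partial_deriv_eq)
qed

lemma partial_deriv_outside_domain:
  "\<phi> \<in> test_functions \<Omega> \<Longrightarrow> x \<notin> \<Omega> \<Longrightarrow> partial_deriv i \<phi> x = 0"
  by (intro partial_deriv_outside) (auto simp: test_functions_def)

lemma partial_deriv_mult:
  "f differentiable_on UNIV \<Longrightarrow> g differentiable_on UNIV \<Longrightarrow>
    partial_deriv i (\<lambda>x. f x * g x) x = f x * partial_deriv i g x + partial_deriv i f x * g x"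
  using partial_deriv_eq[OF has_derivative_mult[OF differentiable_partial[of f x] differentiable_partial[of g x]]]
  by (simp add: partial_deriv_def)

lemma test_functions_mult:
  assumes f: "\<And>k. Ck k f" and \<phi>: "\<phi> \<in> test_functions \<Omega>"
  shows "(\<lambda>x. f x * \<phi> x) \<in> test_functions \<Omega>"
proof -
  have sub: "closure {x. f x * \<phi> x \<noteq> 0} \<subseteq> closure {x. \<phi> x \<noteq> 0}" by (rule closure_mono) auto
  moreover have "compact (closure {x. f x * \<phi> x \<noteq> 0})"
    using compact_Int_closed[OF test_functionsD(3)[OF \<phi>] closed_closure, of "{x. f x * \<phi> x \<noteq> 0}"] sub
    by (simp add: Int_absorb1)
  ultimately show ?thesis using \<phi> f unfolding test_functions_def by (auto intro!: Ck_mult)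
qed

lemma subspace_test_functions: "subspace (test_functions \<Omega>)"
proof (rule subspaceI)
  show "0 \<in> test_functions \<Omega>" by (auto simp: test_functions_def zero_fun_def Ck_const)
  fix \<phi> \<psi> assume \<phi>: "\<phi> \<in> test_functions \<Omega>" and \<psi>: "\<psi> \<in> test_functions \<Omega>"
  have "closure {x. \<phi> x + \<psi> x \<noteq> 0} \<subseteq> closure ({x. \<phi> x \<noteq> 0} \<union> {x. \<psi> x \<noteq> 0})" by (rule closure_mono) auto
  then have sub: "closure {x. \<phi> x + \<psi> x \<noteq> 0} \<subseteq> closure {x. \<phi> x \<noteq> 0} \<union> closure {x. \<psi> x \<noteq> 0}" by simp
  moreover have "compact (closure {x. \<phi> x + \<psi> x \<noteq> 0})"
    using compact_Int_closed[OF compact_Un[OF test_functionsD(3)[OF \<phi>] test_functionsD(3)[OF \<psi>]] closed_closure, of "{x. \<phi> x + \<psi> x \<noteq> 0}"] sub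
    by (simp add: Int_absorb1)
  ultimately show "\<phi> + \<psi> \<in> test_functions \<Omega>"
    using \<phi> \<psi> unfolding test_functions_def plus_fun_def by (auto intro!: Ck_add)
next
  fix c and \<phi> assume "\<phi> \<in> test_functions \<Omega>"
  from test_functions_mult[OF Ck_const this, of c] show "c *\<^sub>R \<phi> \<in> test_functions \<Omega>"
    by (simp add: scaleR_fun_def)
qed

lemma continuous_compact_support_integrable:
  fixes f :: "real^'d \<Rightarrow> real"
  assumes f: "continuous_on UNIV f" and K: "compact K" "\<And>x. x \<notin> K \<Longrightarrow> f x = 0"
  shows "integrable lborel f"
proof -
  have "integrable lborel (\<lambda>x. indicator K x *\<^sub>R f x)"
    using K(1) continuous_on_subset[OF f] by (intro borel_integrable_compact) auto
  also have "(\<lambda>x. indicator K x *\<^sub>R f x) = f"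
    using K(2) by (auto simp: fun_eq_iff indicator_def)
  finally show ?thesis .
qed

text \<open>Translation invariance gives every difference quotient of \<open>f\<close> integral zero; the quotients
  converge boundedly to the partial derivative.\<close>

lemma integral_partial_deriv_eq_0:
  fixes f :: "real^'d \<Rightarrow> real"
  assumes f: "Ck 1 f" and K: "compact (closure {x. f x \<noteq> 0})"
  shows "integrable lborel (partial_deriv i f)" "(LINT x|lborel. partial_deriv i f x) = 0"
proof -
  have d: "f differentiable_on UNIV" and c: "continuous_on UNIV f" and dc: "continuous_on UNIV (partial_deriv i f)"
    using f Ck_continuous[OF f] by auto
  let ?e = "axis i (1::real) :: real^'d"
  obtain R where R: "R > 0" "closure {x. f x \<noteq> 0} \<subseteq> ball 0 R"
    using bounded_subset_ballD[OF compact_imp_bounded[OF K]] by blast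
  have f0: "f x = 0" if "norm x \<ge> R" for x
    using R(2) that closure_subset[of "{x. f x \<noteq> 0}"] by fastforce
  have int: "integrable lborel f"
    by (rule continuous_compact_support_integrable[OF c compact_cball[of 0 R]]) (auto intro: f0)
  have "compact (partial_deriv i f ` cball 0 (R + 2))"
    by (intro compact_continuous_image continuous_on_subset[OF dc]) auto
  then obtain C where C: "\<And>x. norm x \<le> R + 2 \<Longrightarrow> \<bar>partial_deriv i f x\<bar> \<le> C"
    using compact_imp_bounded by (force simp: bounded_iff)
  have line: "((\<lambda>t. f (x + t *\<^sub>R ?e)) has_real_derivative partial_deriv i f (x + t *\<^sub>R ?e)) (at t)" for x t
  proof -
    have "((\<lambda>t. x + t *\<^sub>R ?e) has_derivative (\<lambda>t. t *\<^sub>R ?e)) (at t)" by (auto intro!: derivative_eq_intros)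
    from has_derivative_compose[OF this differentiable_partial[OF d]]
    have "((\<lambda>t. f (x + t *\<^sub>R ?e)) has_derivative (\<lambda>s. frechet_derivative f (at (x + t *\<^sub>R ?e)) (s *\<^sub>R ?e))) (at t)" .
    moreover have "frechet_derivative f (at (x + t *\<^sub>R ?e)) (s *\<^sub>R ?e) = partial_deriv i f (x + t *\<^sub>R ?e) * s" for s
      using linear_scale[OF has_derivative_linear[OF differentiable_partial[OF d]]] by (simp add: partial_deriv_def)
    ultimately show ?thesis by (simp add: has_field_derivative_def)
  qed
  define h where "h n = inverse (real (Suc n))" for n
  have h: "0 < h n" "h n \<le> 1" for n by (auto simp: h_def divide_simps)
  define q where "q n x = (f (x + h n *\<^sub>R ?e) - f x) / h n" for n x
  have intT: "integrable lborel (\<lambda>x. f (x + v))" "(LINT x|lborel. f (x + v)) = (LINT x|lborel. f x)" for v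
  proof -
    have m: "f \<in> borel_measurable borel" using c by (rule borel_measurable_continuous_onI)
    have "integrable (distr lborel borel ((+) v)) f" using int by (simp add: lborel_distr_plus)
    then show "integrable lborel (\<lambda>x. f (x + v))"
      using m by (subst (asm) integrable_distr_eq) (auto simp: add.commute)
    have "(LINT x|distr lborel borel ((+) v). f x) = (LINT x|lborel. f x)" by (simp add: lborel_distr_plus)
    then show "(LINT x|lborel. f (x + v)) = (LINT x|lborel. f x)"
      using m by (subst (asm) integral_distr) (auto simp: add.commute)
  qed
  have qint: "integrable lborel (q n)" "(LINT x|lborel. q n x) = 0" for n
    unfolding q_def using intT int by (auto simp: Bochner_Integration.integral_diff)
  have bound: "norm (q n x) \<le> C * indicator (cball 0 (R+1)) x" for n x
  proof (cases "norm x \<le> R + 1")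
    case True
    obtain t where t: "0 < t" "t < h n" "f (x + h n *\<^sub>R ?e) - f (x + 0 *\<^sub>R ?e) = (h n - 0) * partial_deriv i f (x + t *\<^sub>R ?e)"
      using MVT2[OF h(1)[of n], where f="\<lambda>t. f (x + t *\<^sub>R ?e)" and f'="\<lambda>t. partial_deriv i f (x + t *\<^sub>R ?e)"] line by blast
    then have "q n x = partial_deriv i f (x + t *\<^sub>R ?e)" using h(1)[of n] by (simp add: q_def)
    moreover have "norm (x + t *\<^sub>R ?e) \<le> R + 2"
      using norm_triangle_ineq[of x "t *\<^sub>R ?e"] t h(2)[of n] True by simp
    ultimately show ?thesis using C[of "x + t *\<^sub>R ?e"] True by simp
  next
    case False
    have "norm x \<le> norm (x + h n *\<^sub>R ?e) + norm (h n *\<^sub>R ?e)"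
      using norm_triangle_ineq4[of "x + h n *\<^sub>R ?e" "h n *\<^sub>R ?e"] by simp
    then have "norm (x + h n *\<^sub>R ?e) \<ge> R" using False h[of n] by simp
    then have "q n x = 0" using False by (simp add: q_def f0)
    then show ?thesis using False by simp
  qed
  have lim: "(\<lambda>n. q n x) \<longlonglongrightarrow> partial_deriv i f x" for x
  proof -
    have "((\<lambda>t. (f (x + t *\<^sub>R ?e) - f (x + 0 *\<^sub>R ?e)) / (t - 0)) \<longlongrightarrow> partial_deriv i f (x + 0 *\<^sub>R ?e)) (at 0)"
      using line[of x 0] unfolding has_field_derivative_iff .
    moreover have "filterlim h (at 0) sequentially"
      unfolding filterlim_at
    proof
      show "h \<longlonglongrightarrow> 0" using LIMSEQ_inverse_real_of_nat unfolding h_def .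
      show "\<forall>\<^sub>F n in sequentially. h n \<in> UNIV \<and> h n \<noteq> 0" using h(1) by (auto intro!: always_eventually simp: less_imp_neq[symmetric])
    qed
    ultimately have "(\<lambda>n. (f (x + h n *\<^sub>R ?e) - f (x + 0 *\<^sub>R ?e)) / (h n - 0)) \<longlonglongrightarrow> partial_deriv i f (x + 0 *\<^sub>R ?e)"
      by (rule filterlim_compose)
    then show ?thesis by (simp add: q_def)
  qed
  have w: "integrable lborel (\<lambda>x. C * indicator (cball 0 (R+1)) x :: real)"
    using emeasure_bounded_finite[of "cball 0 (R+1)"] by (intro integrable_mult_right integrable_real_indicator) auto
  have pm: "partial_deriv i f \<in> borel_measurable lborel"
    using borel_measurable_continuous_onI[OF dc] by simp
  show "integrable lborel (partial_deriv i f)"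
    by (rule integrable_dominated_convergence[OF pm _ w, of q])
       (use qint lim bound in \<open>auto simp: borel_measurable_integrable\<close>)
  have "(\<lambda>n. LINT x|lborel. q n x) \<longlonglongrightarrow> (LINT x|lborel. partial_deriv i f x)"
    by (rule integral_dominated_convergence[OF pm _ w])
       (use qint(1) lim bound in \<open>auto simp: borel_measurable_integrable\<close>)
  then show "(LINT x|lborel. partial_deriv i f x) = 0" using qint(2) by (simp add: LIMSEQ_const_iff)
qed

section \<open>The space $L^2$\<close>

lemma L2_measurable: "u \<in> L2 \<Omega> \<Longrightarrow> u \<in> borel_measurable (lebesgue_on \<Omega>)"
  by (simp add: L2_def)

lemma L2_square_integrable: "u \<in> L2 \<Omega> \<Longrightarrow> integrable (lebesgue_on \<Omega>) (\<lambda>x. (norm (u x))\<^sup>2)"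
  by (simp add: L2_def)

lemma L2_I: "u \<in> borel_measurable (lebesgue_on \<Omega>) \<Longrightarrow> integrable (lebesgue_on \<Omega>) (\<lambda>x. (norm (u x))\<^sup>2) \<Longrightarrow> u \<in> L2 \<Omega>"
  by (simp add: L2_def)

lemma L2_inner_integrable:
  assumes u: "u \<in> L2 \<Omega>" and v: "v \<in> L2 \<Omega>"
  shows "integrable (lebesgue_on \<Omega>) (\<lambda>x. u x \<bullet> v x)"
proof (rule Bochner_Integration.integrable_bound)
  show "integrable (lebesgue_on \<Omega>) (\<lambda>x. (norm (u x))\<^sup>2 + (norm (v x))\<^sup>2)"
    by (intro Bochner_Integration.integrable_add L2_square_integrable u v)
  show "(\<lambda>x. u x \<bullet> v x) \<in> borel_measurable (lebesgue_on \<Omega>)"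
    using L2_measurable[OF u] L2_measurable[OF v] by measurable
  show "AE x in lebesgue_on \<Omega>. norm (u x \<bullet> v x) \<le> norm ((norm (u x))\<^sup>2 + (norm (v x))\<^sup>2)"
  proof (rule AE_I2)
    fix x
    have "\<bar>u x \<bullet> v x\<bar> \<le> norm (u x) * norm (v x)" by (rule Cauchy_Schwarz_ineq2)
    also have "2 * (norm (u x) * norm (v x)) \<le> (norm (u x))\<^sup>2 + (norm (v x))\<^sup>2"
      using sum_squares_bound[of "norm (u x)" "norm (v x)"] by simp
    finally show "norm (u x \<bullet> v x) \<le> norm ((norm (u x))\<^sup>2 + (norm (v x))\<^sup>2)" by simp
  qed
qed

lemma L2_add:
  assumes u: "u \<in> L2 \<Omega>" and v: "v \<in> L2 \<Omega>"
  shows "(\<lambda>x. u x + v x) \<in> L2 \<Omega>"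
proof (rule L2_I)
  show "(\<lambda>x. u x + v x) \<in> borel_measurable (lebesgue_on \<Omega>)"
    using L2_measurable[OF u] L2_measurable[OF v] by measurable
  have "integrable (lebesgue_on \<Omega>) (\<lambda>x. (norm (u x))\<^sup>2 + 2 * (u x \<bullet> v x) + (norm (v x))\<^sup>2)"
    by (intro Bochner_Integration.integrable_add integrable_mult_right L2_square_integrable L2_inner_integrable u v)
  then show "integrable (lebesgue_on \<Omega>) (\<lambda>x. (norm (u x + v x))\<^sup>2)"
    by (simp add: power2_norm_eq_inner inner_add_left inner_add_right inner_commute algebra_simps)
qed

lemma L2_scale: "u \<in> L2 \<Omega> \<Longrightarrow> (\<lambda>x. c *\<^sub>R u x) \<in> L2 \<Omega>"
  by (auto simp: L2_def power_mult_distrib)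

lemma L2_diff: "u \<in> L2 \<Omega> \<Longrightarrow> v \<in> L2 \<Omega> \<Longrightarrow> (\<lambda>x. u x - v x) \<in> L2 \<Omega>"
  using L2_add[of u \<Omega> "\<lambda>x. (-1) *\<^sub>R v x"] L2_scale[of v \<Omega> "-1"] by simp

lemma L2_zero: "(\<lambda>x. 0) \<in> L2 \<Omega>"
  by (auto simp: L2_def)

lemma L2_norm_nonneg [simp]: "0 \<le> L2_norm \<Omega> u"
  by (simp add: L2_norm_def L2_inner_def Bochner_Integration.integral_nonneg)

lemma L2_norm_square: "(L2_norm \<Omega> u)\<^sup>2 = (LINT x|lebesgue_on \<Omega>. (norm (u x))\<^sup>2)"
  by (simp add: L2_norm_def L2_inner_def power2_norm_eq_inner Bochner_Integration.integral_nonneg)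

lemma L2_norm_eq_0_AE:
  assumes "u \<in> L2 \<Omega>" shows "L2_norm \<Omega> u = 0 \<longleftrightarrow> (AE x in lebesgue_on \<Omega>. u x = 0)"
proof -
  have "L2_norm \<Omega> u = 0 \<longleftrightarrow> (LINT x|lebesgue_on \<Omega>. (norm (u x))\<^sup>2) = 0"
    by (metis L2_norm_square power_eq_0_iff zero_less_numeral)
  also have "\<dots> \<longleftrightarrow> (AE x in lebesgue_on \<Omega>. (norm (u x))\<^sup>2 = 0)"
    by (rule integral_nonneg_eq_0_iff_AE[OF L2_square_integrable[OF assms]]) simp
  finally show ?thesis by simp
qed

lemma finite_measure_lebesgue_on:
  fixes \<Omega> :: "'a::euclidean_space set"
  assumes "open \<Omega>" "bounded \<Omega>" shows "finite_measure (lebesgue_on \<Omega>)"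
proof
  have "\<Omega> \<in> lmeasurable" using assms by (intro bounded_set_imp_lmeasurable) auto
  then show "emeasure (lebesgue_on \<Omega>) (space (lebesgue_on \<Omega>)) \<noteq> \<infinity>"
    by (simp add: emeasure_restrict_space fmeasurable_def less_top del: emeasure_completion)
qed

lemma L2_integrable:
  fixes u :: "real^'d \<Rightarrow> 'b::euclidean_space"
  assumes O: "open \<Omega>" "bounded \<Omega>" and u: "u \<in> L2 \<Omega>"
  shows "integrable (lebesgue_on \<Omega>) u"
proof (rule Bochner_Integration.integrable_bound)
  interpret finite_measure "lebesgue_on \<Omega>" by (rule finite_measure_lebesgue_on[OF O])
  show "integrable (lebesgue_on \<Omega>) (\<lambda>x. 1 + (norm (u x))\<^sup>2)"
    by (intro Bochner_Integration.integrable_add L2_square_integrable u integrable_const)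
  show "AE x in lebesgue_on \<Omega>. norm (u x) \<le> norm (1 + (norm (u x))\<^sup>2)"
  proof (rule AE_I2)
    fix x
    have "2 * norm (u x) \<le> 1 + (norm (u x))\<^sup>2" using sum_squares_bound[of 1 "norm (u x)"] by simp
    then show "norm (u x) \<le> norm (1 + (norm (u x))\<^sup>2)" using norm_ge_zero[of "u x"] by (simp del: norm_ge_zero)
  qed
qed (rule L2_measurable[OF u])

lemma integral_lebesgue_on_supported:
  fixes f :: "real^'d \<Rightarrow> real"
  assumes O: "open \<Omega>" and f: "f \<in> borel_measurable borel" and out: "\<And>x. x \<notin> \<Omega> \<Longrightarrow> f x = 0"
  shows "(LINT x|lebesgue_on \<Omega>. f x) = (LINT x|lborel. f x)"
    "integrable lborel f \<Longrightarrow> integrable (lebesgue_on \<Omega>) f"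
proof -
  have eq: "(\<lambda>x. indicator \<Omega> x *\<^sub>R f x) = f" using out by (auto simp: fun_eq_iff indicator_def)
  show "(LINT x|lebesgue_on \<Omega>. f x) = (LINT x|lborel. f x)"
    using O f eq by (subst integral_restrict_space) (auto simp: integral_completion simp del: real_scaleR_def)
  assume "integrable lborel f"
  then have "integrable lebesgue f" using f by (simp add: integrable_completion)
  then show "integrable (lebesgue_on \<Omega>) f"
    using O eq by (subst integrable_restrict_space) (auto simp del: real_scaleR_def)
qed

lemma borel_lebesgue_on: "f \<in> borel_measurable borel \<Longrightarrow> f \<in> borel_measurable (lebesgue_on \<Omega>)"
  by (intro measurable_restrict_space1 measurable_completion) simp

lemma test_function_borel:
  assumes "\<phi> \<in> test_functions \<Omega>"
  shows "\<phi> \<in> borel_measurable borel" "partial_deriv i \<phi> \<in> borel_measurable borel"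
  using test_functionsD[OF assms] borel_measurable_continuous_onI by auto

lemma test_function_L2:
  assumes O: "open \<Omega>" and \<phi>: "\<phi> \<in> test_functions \<Omega>"
  shows "\<phi> \<in> L2 \<Omega>" "partial_deriv i \<phi> \<in> L2 \<Omega>"
proof -
  note b = test_function_borel[OF \<phi>] and c = test_functionsD[OF \<phi>]
  have "integrable lborel (\<lambda>x. (norm (\<phi> x))\<^sup>2)"
    by (rule continuous_compact_support_integrable[OF _ c(3)])
       (use c closure_subset[of "{x. \<phi> x \<noteq> 0}"] in \<open>auto intro!: continuous_intros\<close>)
  then show "\<phi> \<in> L2 \<Omega>"
    using b c(4) by (intro L2_I integral_lebesgue_on_supported[OF O] borel_lebesgue_on) auto
  have "integrable lborel (\<lambda>x. (norm (partial_deriv i \<phi> x))\<^sup>2)"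
    by (rule continuous_compact_support_integrable[OF _ c(3)])
       (use c partial_deriv_outside in \<open>auto intro!: continuous_intros\<close>)
  then show "partial_deriv i \<phi> \<in> L2 \<Omega>"
    using b partial_deriv_outside_domain[OF \<phi>] by (intro L2_I integral_lebesgue_on_supported[OF O] borel_lebesgue_on) auto
qed

section \<open>Uniqueness of weak gradients\<close>

text \<open>Bump functions increase to the indicator of a box, so all integrals over boxes vanish, and boxes
  generate the Borel sets.\<close>

lemma integral_box_eq_0:
  assumes O: "open \<Omega>" and g: "integrable (lebesgue_on \<Omega>) g"
    and orth: "\<And>\<phi>. \<phi> \<in> test_functions \<Omega> \<Longrightarrow> (LINT x|lebesgue_on \<Omega>. g x * \<phi> x) = 0"
    and ab: "cbox a b \<subseteq> \<Omega>"
  shows "(LINT x|lebesgue_on \<Omega>. indicator (box a b) x * g x :: real) = 0"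
proof -
  have "(\<lambda>n. LINT x|lebesgue_on \<Omega>. g x * bump a b n x) \<longlonglongrightarrow> (LINT x|lebesgue_on \<Omega>. g x * indicator (box a b) x)"
  proof (rule integral_dominated_convergence[where w="\<lambda>x. norm (g x)"])
    show "(\<lambda>x. g x * bump a b n x) \<in> borel_measurable (lebesgue_on \<Omega>)" for n
      using borel_measurable_integrable[OF g] borel_lebesgue_on[OF test_function_borel(1)[OF bump_test_function[OF ab]]]
      by measurable
    show "(\<lambda>x. g x * indicator (box a b) x) \<in> borel_measurable (lebesgue_on \<Omega>)"
      by (intro borel_measurable_times borel_measurable_integrable[OF g] borel_lebesgue_on borel_measurable_indicator) simp
    show "AE x in lebesgue_on \<Omega>. (\<lambda>n. g x * bump a b n x) \<longlonglongrightarrow> g x * indicator (box a b) x"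
      by (intro AE_I2 tendsto_mult tendsto_const bump_tendsto)
    show "AE x in lebesgue_on \<Omega>. norm (g x * bump a b n x) \<le> norm (g x)" for n
      by (intro AE_I2) (auto simp: abs_mult abs_of_nonneg[OF bump_bounds(1)] intro!: mult_left_le bump_bounds)
  qed (use g in auto)
  then show ?thesis using orth[OF bump_test_function[OF ab]] by (simp add: LIMSEQ_const_iff mult.commute)
qed

text \<open>Dynkin's lemma: the sets over which \<open>g\<close> has integral zero are closed under complements and disjoint
  unions, and the boxes are closed under intersections.\<close>

lemma integral_borel_eq_0:
  fixes g :: "real^'d \<Rightarrow> real"
  assumes g: "integrable lborel g" and box: "\<And>a b. (LINT x|lborel. indicator (box a b) x * g x) = 0"
    and E: "E \<in> sets borel" and UN: "(LINT x|lborel. g x) = 0"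
  shows "(LINT x|lborel. indicator E x * g x) = 0"
proof -
  have int: "integrable lborel (\<lambda>x. indicator A x * g x)" if "A \<in> sets borel" for A
    using integrable_mult_indicator[OF _ g, of A] that by simp
  have sig: "sigma_sets UNIV (range (\<lambda>(a, b). box a b)) = sets (borel :: (real^'d) measure)"
    by (simp add: borel_eq_box)
  have stable: "Int_stable (range (\<lambda>(a, b::real^'d). box a b))"
    by (auto simp: Int_stable_def box_Int_box)
  show ?thesis
    using stable subset_UNIV[of "range (\<lambda>(a, b::real^'d). box a b)", folded Pow_UNIV] E[folded sig]
  proof (induction rule: sigma_sets_induct_disjoint)
    case (basic A)
    then show ?case using box by auto
  next
    case empty
    then show ?case by simp
  next
    case (compl A)
    have "A \<in> sets borel" using compl(1) by (simp add: sig)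
    have "(\<lambda>x. indicator (UNIV - A) x * g x) = (\<lambda>x. g x - indicator A x * g x)" by (auto simp: indicator_def)
    then have "(LINT x|lborel. indicator (UNIV - A) x * g x) = (LINT x|lborel. g x - indicator A x * g x)" by (rule arg_cong)
    also have "\<dots> = 0"
      using compl(2) UN int[OF \<open>A \<in> sets borel\<close>] g by (simp add: Bochner_Integration.integral_diff)
    finally show ?case .
  next
    case (union A)
    have A: "A i \<in> sets borel" for i using union(2) by (auto simp: sig)
    have "set_integrable lborel (\<Union>i. A i) g" using int[of "\<Union>i. A i"] A by (simp add: set_integrable_def)
    then have "(LINT x:(\<Union>i. A i)|lborel. g x) = (\<Sum>i. (LINT x:(A i)|lborel. g x))"
      using A union(1) by (intro lebesgue_integral_countable_add) (auto simp: disjoint_family_on_def)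
    then show ?case using union(3) by (simp add: set_lebesgue_integral_def)
  qed
qed

lemma AE_eq_0_of_integrals:
  fixes g :: "real^'d \<Rightarrow> real"
  assumes g: "integrable lborel g" and E: "\<And>E. E \<in> sets borel \<Longrightarrow> (LINT x|lborel. indicator E x * g x) = 0"
  shows "AE x in lborel. g x = 0"
proof -
  have gm: "g \<in> borel_measurable borel" using g by auto
  have int: "integrable lborel (\<lambda>x. indicator A x * g x)" if "A \<in> sets borel" for A
    using integrable_mult_indicator[OF _ g, of A] that by simp
  let ?P = "{x. g x > 0}" and ?Q = "{x. g x < 0}"
  have m: "?P \<in> sets borel" "?Q \<in> sets borel" using gm by measurable
  have "AE x in lborel. indicator ?P x * g x = 0"
    using integral_nonneg_eq_0_iff_AE[OF int[OF m(1)]] E[OF m(1)] by (auto simp: indicator_def)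
  moreover have "AE x in lborel. - (indicator ?Q x * g x) = 0"
    using integral_nonneg_eq_0_iff_AE[OF integrable_minus[OF int[OF m(2)]]] E[OF m(2)] by (auto simp: indicator_def)
  ultimately show ?thesis by eventually_elim (auto simp: indicator_def split: if_splits)
qed

text \<open>On a compact box inside \<open>\<Omega>\<close> the function may be replaced by a Borel function on the whole space.
  Countably many such boxes cover \<open>\<Omega>\<close>, and their faces are null sets.\<close>

lemma fundamental_lemma:
  fixes g :: "real^'d \<Rightarrow> real"
  assumes O: "open \<Omega>" and g: "integrable (lebesgue_on \<Omega>) g"
    and orth: "\<And>\<phi>. \<phi> \<in> test_functions \<Omega> \<Longrightarrow> (LINT x|lebesgue_on \<Omega>. g x * \<phi> x) = 0"
  shows "AE x in lebesgue_on \<Omega>. g x = 0"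
proof -
  have Om: "\<Omega> \<inter> space lebesgue \<in> sets lebesgue" using O by simp
  have box: "AE x in lebesgue. x \<in> box a b \<longrightarrow> g x = 0" if ab: "cbox a b \<subseteq> \<Omega>" for a b
  proof -
    have boxO: "box a b \<subseteq> \<Omega>" using ab box_subset_cbox by blast
    let ?g = "\<lambda>x. indicator (box a b) x * g x"
    have eqO: "(\<lambda>x. indicator \<Omega> x *\<^sub>R (indicator (A \<inter> box a b) x * g x)) = (\<lambda>x. indicator A x * (indicator (box a b) x * g x))" for A
      using boxO by (auto simp: fun_eq_iff indicator_def)
    have "integrable (lebesgue_on \<Omega>) (\<lambda>x. indicator (UNIV \<inter> box a b) x *\<^sub>R g x)"
      by (intro integrable_mult_indicator g) (use boxO in \<open>auto simp: sets_restrict_space_iff O\<close>)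
    then have gi: "integrable lebesgue ?g"
      using Om eqO[of UNIV] by (subst (asm) integrable_restrict_space) auto
    obtain g' where g': "g' \<in> borel_measurable lborel" "AE x in lborel. ?g x = g' x"
      using completion_ex_borel_measurable_real[OF borel_measurable_integrable[OF gi]] by auto
    have ae: "AE x in lebesgue. ?g x = g' x" using AE_completion[OF g'(2)] .
    have g'c: "g' \<in> borel_measurable lebesgue" using g'(1) by (rule measurable_completion)
    have "integrable lebesgue g'"
      using gi g'c ae by (subst integrable_cong_AE[of _ _ ?g]) auto
    then have g'i: "integrable lborel g'" using g'(1) by (simp add: integrable_completion)
    have E: "(LINT x|lborel. indicator E x * g' x) = (LINT x|lebesgue_on \<Omega>. indicator (E \<inter> box a b) x * g x)"
      if "E \<in> sets borel" for E
    proof -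
      have "(LINT x|lborel. indicator E x * g' x) = (LINT x|lebesgue. indicator E x * g' x)"
        using that g'(1) by (intro integral_completion[symmetric] borel_measurable_times borel_measurable_indicator) auto
      also have "\<dots> = (LINT x|lebesgue. indicator E x * ?g x)"
      proof (rule integral_cong_AE)
        have E: "indicator E \<in> borel_measurable lebesgue" using that by (intro borel_measurable_indicator) simp
        show "(\<lambda>x. indicator E x * g' x) \<in> borel_measurable lebesgue" by (rule borel_measurable_times[OF E g'c])
        show "(\<lambda>x. indicator E x * ?g x) \<in> borel_measurable lebesgue"
          by (rule borel_measurable_times[OF E borel_measurable_integrable[OF gi]])
        show "AE x in lebesgue. indicator E x * g' x = indicator E x * ?g x" using ae by eventually_elim simp
      qed
      also have "\<dots> = (LINT x|lebesgue_on \<Omega>. indicator (E \<inter> box a b) x * g x)"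
        using Om by (subst integral_restrict_space) (auto simp: eqO[of E, symmetric])
      finally show ?thesis .
    qed
    have zero: "(LINT x|lebesgue_on \<Omega>. indicator (box c d \<inter> box a b) x * g x) = 0" for c d
    proof (cases "box c d \<inter> box a b = {}")
      case False
      let ?l = "\<Sum>i\<in>Basis. max (c \<bullet> i) (a \<bullet> i) *\<^sub>R i" and ?u = "\<Sum>i\<in>Basis. min (d \<bullet> i) (b \<bullet> i) *\<^sub>R i"
      have "box c d \<inter> box a b = box ?l ?u" by (rule box_Int_box)
      moreover have "cbox ?l ?u \<subseteq> cbox a b" by (auto simp: mem_box)
      then have "cbox ?l ?u \<subseteq> \<Omega>" using ab by blast
      ultimately show ?thesis using integral_box_eq_0[OF O g orth, of ?l ?u] by simp
    qed simp
    have "AE x in lborel. g' x = 0"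
    proof (rule AE_eq_0_of_integrals[OF g'i], rule integral_borel_eq_0[OF g'i])
      show "(LINT x|lborel. indicator (box c d) x * g' x) = 0" for c d
        by (simp add: E zero)
      show "(LINT x|lborel. g' x) = 0"
        using E[of UNIV] integral_box_eq_0[OF O g orth ab] by simp
    qed
    then have "AE x in lebesgue. g' x = 0" by (rule AE_completion)
    with ae show ?thesis by eventually_elim (auto simp: indicator_def split: if_splits)
  qed
  obtain D where D: "countable D" "D \<subseteq> Pow \<Omega>" "\<And>X. X \<in> D \<Longrightarrow> \<exists>a b. X = cbox a b" "\<Union>D = \<Omega>"
    using open_countable_Union_open_cbox[OF O] by metis
  have "AE x in lebesgue. \<forall>X\<in>D. x \<in> X \<longrightarrow> g x = 0"
    unfolding AE_ball_countable[OF D(1)]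
  proof
    fix X assume X: "X \<in> D"
    then obtain a b where ab: "X = cbox a b" using D(3) by blast
    have "cbox a b \<subseteq> \<Omega>" using X D(2) ab by blast
    from box[OF this] have "AE x in lebesgue. x \<in> box a b \<longrightarrow> g x = 0" .
    moreover have "AE x in lebesgue. x \<notin> cbox a b - box a b"
      using negligible_frontier_interval[of a b] by (intro AE_not_in) (simp add: negligible_iff_null_sets)
    ultimately show "AE x in lebesgue. x \<in> X \<longrightarrow> g x = 0"
      by eventually_elim (auto simp: ab)
  qed
  then have "AE x in lebesgue. x \<in> \<Omega> \<longrightarrow> g x = 0" by eventually_elim (use D(4) in blast)
  then show ?thesis using Om by (simp add: AE_restrict_space_iff)
qed

lemma L2_nth:
  fixes g :: "real^'d \<Rightarrow> real^'e"
  assumes "g \<in> L2 \<Omega>" shows "(\<lambda>x. g x $ i) \<in> L2 \<Omega>"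
proof (rule L2_I)
  show m: "(\<lambda>x. g x $ i) \<in> borel_measurable (lebesgue_on \<Omega>)"
    using measurable_compose[OF L2_measurable[OF assms] borel_measurable_continuous_onI[of "\<lambda>v::real^'e. v $ i"]]
    by (simp add: continuous_on_component)
  show "integrable (lebesgue_on \<Omega>) (\<lambda>x. (norm (g x $ i))\<^sup>2)"
  proof (rule Bochner_Integration.integrable_bound[OF L2_square_integrable[OF assms]])
    have "(norm (g x $ i))\<^sup>2 \<le> (norm (g x))\<^sup>2" for x
      using component_le_norm_cart[of "g x" i] by (intro power_mono) auto
    then show "AE x in lebesgue_on \<Omega>. norm ((norm (g x $ i))\<^sup>2) \<le> norm ((norm (g x))\<^sup>2)"
      by (intro AE_I2) simp
  qed (use m in measurable)
qed

text \<open>The components of the difference of two weak gradients are integrable, since \<open>\<Omega>\<close> is bounded, and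
  orthogonal to the test functions.\<close>

lemma weak_gradient_unique:
  assumes O: "open \<Omega>" "bounded \<Omega>" and g: "is_weak_gradient \<Omega> v g" and h: "is_weak_gradient \<Omega> v h"
  shows "AE x in lebesgue_on \<Omega>. g x = h x"
proof -
  have L: "g \<in> L2 \<Omega>" "h \<in> L2 \<Omega>" using g h by (auto simp: is_weak_gradient_def)
  have "AE x in lebesgue_on \<Omega>. \<forall>i\<in>UNIV. g x $ i - h x $ i = 0"
  proof (rule AE_finite_allI[OF finite])
    fix i
    show "AE x in lebesgue_on \<Omega>. g x $ i - h x $ i = 0"
    proof (rule fundamental_lemma[OF O(1)])
      show "integrable (lebesgue_on \<Omega>) (\<lambda>x. g x $ i - h x $ i)"
        by (intro L2_integrable[OF O] L2_diff L2_nth L)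
      fix \<phi> assume \<phi>: "\<phi> \<in> test_functions \<Omega>"
      have "integrable (lebesgue_on \<Omega>) (\<lambda>x. (g x $ i) \<bullet> \<phi> x)" "integrable (lebesgue_on \<Omega>) (\<lambda>x. (h x $ i) \<bullet> \<phi> x)"
        by (intro L2_inner_integrable L2_nth L test_function_L2[OF O(1) \<phi>])+
      moreover have "(LINT x|lebesgue_on \<Omega>. (g x $ i) * \<phi> x) = (LINT x|lebesgue_on \<Omega>. (h x $ i) * \<phi> x)"
        using g h \<phi> by (fastforce simp: is_weak_gradient_def)
      ultimately show "(LINT x|lebesgue_on \<Omega>. (g x $ i - h x $ i) * \<phi> x) = 0"
        by (simp add: left_diff_distrib)
    qed
  qed
  then show ?thesis by eventually_elim (simp add: vec_eq_iff)
qed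

lemma weak_gradient_grad: "\<exists>g. is_weak_gradient \<Omega> v g \<Longrightarrow> is_weak_gradient \<Omega> v (grad \<Omega> v)"
  unfolding grad_def by (rule someI_ex[where P="is_weak_gradient \<Omega> v"])

lemma grad_AE_eq:
  "open \<Omega> \<Longrightarrow> bounded \<Omega> \<Longrightarrow> is_weak_gradient \<Omega> v g \<Longrightarrow> AE x in lebesgue_on \<Omega>. grad \<Omega> v x = g x"
  using weak_gradient_unique weak_gradient_grad by blast

lemma weak_gradient_lincomb:
  assumes O: "open \<Omega>" and u: "u \<in> L2 \<Omega>" "is_weak_gradient \<Omega> u g" and v: "v \<in> L2 \<Omega>" "is_weak_gradient \<Omega> v h"
  shows "is_weak_gradient \<Omega> (\<lambda>x. a * u x + b * v x) (\<lambda>x. a *\<^sub>R g x + b *\<^sub>R h x)"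
  unfolding is_weak_gradient_def
proof (intro conjI ballI allI)
  have L: "g \<in> L2 \<Omega>" "h \<in> L2 \<Omega>" using u v by (auto simp: is_weak_gradient_def)
  then show "(\<lambda>x. a *\<^sub>R g x + b *\<^sub>R h x) \<in> L2 \<Omega>" by (intro L2_add L2_scale)
  fix \<phi> i assume \<phi>: "\<phi> \<in> test_functions \<Omega>"
  note tL = test_function_L2[OF O \<phi>]
  have 1: "integrable (lebesgue_on \<Omega>) (\<lambda>x. u x \<bullet> partial_deriv i \<phi> x)" "integrable (lebesgue_on \<Omega>) (\<lambda>x. v x \<bullet> partial_deriv i \<phi> x)"
    by (intro L2_inner_integrable u v tL)+
  have 2: "integrable (lebesgue_on \<Omega>) (\<lambda>x. (g x $ i) \<bullet> \<phi> x)" "integrable (lebesgue_on \<Omega>) (\<lambda>x. (h x $ i) \<bullet> \<phi> x)"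
    by (intro L2_inner_integrable L2_nth L tL)+
  have "(LINT x|lebesgue_on \<Omega>. (a * u x + b * v x) * partial_deriv i \<phi> x) =
      (LINT x|lebesgue_on \<Omega>. a * (u x * partial_deriv i \<phi> x) + b * (v x * partial_deriv i \<phi> x))"
    by (simp add: algebra_simps)
  also have "\<dots> = a * (LINT x|lebesgue_on \<Omega>. u x * partial_deriv i \<phi> x) + b * (LINT x|lebesgue_on \<Omega>. v x * partial_deriv i \<phi> x)"
    using 1 by simp
  also have "\<dots> = - (a * (LINT x|lebesgue_on \<Omega>. (g x $ i) * \<phi> x) + b * (LINT x|lebesgue_on \<Omega>. (h x $ i) * \<phi> x))"
    using u(2) v(2) \<phi> by (simp add: is_weak_gradient_def)
  also have "\<dots> = - (LINT x|lebesgue_on \<Omega>. a * ((g x $ i) * \<phi> x) + b * ((h x $ i) * \<phi> x))"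
    using 2 by simp
  also have "\<dots> = - (LINT x|lebesgue_on \<Omega>. ((a *\<^sub>R g x + b *\<^sub>R h x) $ i) * \<phi> x)"
    by (simp add: algebra_simps)
  finally show "(LINT x|lebesgue_on \<Omega>. (a * u x + b * v x) * partial_deriv i \<phi> x) =
      - (LINT x|lebesgue_on \<Omega>. ((a *\<^sub>R g x + b *\<^sub>R h x) $ i) * \<phi> x)" .
qed

lemma integral_partial_deriv_test_eq_0:
  assumes O: "open \<Omega>" and \<phi>: "\<phi> \<in> test_functions \<Omega>"
  shows "(LINT x|lebesgue_on \<Omega>. partial_deriv i \<phi> x) = 0"
  using integral_lebesgue_on_supported(1)[OF O test_function_borel(2)[OF \<phi>] partial_deriv_outside_domain[OF \<phi>]]
    integral_partial_deriv_eq_0(2)[OF test_functionsD(1,3)[OF \<phi>]] by simp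

lemma integration_by_parts_test:
  assumes O: "open \<Omega>" and \<phi>: "\<phi> \<in> test_functions \<Omega>" and \<psi>: "\<psi> \<in> test_functions \<Omega>"
  shows "(LINT x|lebesgue_on \<Omega>. \<phi> x * partial_deriv i \<psi> x) = - (LINT x|lebesgue_on \<Omega>. partial_deriv i \<phi> x * \<psi> x)"
proof -
  have "(\<lambda>x. \<phi> x * \<psi> x) \<in> test_functions \<Omega>" by (rule test_functions_mult[OF test_functionsD(1)[OF \<phi>] \<psi>])
  from integral_partial_deriv_test_eq_0[OF O this, of i]
  have "(LINT x|lebesgue_on \<Omega>. \<phi> x \<bullet> partial_deriv i \<psi> x + partial_deriv i \<phi> x \<bullet> \<psi> x) = 0"
    by (simp add: partial_deriv_mult test_functionsD(5)[OF \<phi>] test_functionsD(5)[OF \<psi>])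
  then show ?thesis
    using L2_inner_integrable[OF test_function_L2(1)[OF O \<phi>] test_function_L2(2)[OF O \<psi>, of i]]
      L2_inner_integrable[OF test_function_L2(2)[OF O \<phi>, of i] test_function_L2(1)[OF O \<psi>]] by simp
qed

lemma test_function_weak_gradient:
  assumes O: "open \<Omega>" and \<phi>: "\<phi> \<in> test_functions \<Omega>"
  shows "is_weak_gradient \<Omega> \<phi> (\<lambda>x. \<chi> i. partial_deriv i \<phi> x)"
  unfolding is_weak_gradient_def
proof (intro conjI ballI allI)
  have "continuous_on UNIV (\<lambda>x. \<chi> i. partial_deriv i \<phi> x)"
    by (intro continuous_on_vec_lambda test_functionsD(6)[OF \<phi>])
  then have m: "(\<lambda>x. \<chi> i. partial_deriv i \<phi> x) \<in> borel_measurable borel" by (rule borel_measurable_continuous_onI)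
  have "integrable (lebesgue_on \<Omega>) (\<lambda>x. \<Sum>i\<in>UNIV. (norm (partial_deriv i \<phi> x))\<^sup>2)"
    by (intro Bochner_Integration.integrable_sum L2_square_integrable test_function_L2[OF O \<phi>])
  then show "(\<lambda>x. \<chi> i. partial_deriv i \<phi> x) \<in> L2 \<Omega>"
  proof (intro L2_I borel_lebesgue_on m)
    have "(norm (\<chi> i. partial_deriv i \<phi> x))\<^sup>2 = (\<Sum>i\<in>UNIV. (norm (partial_deriv i \<phi> x))\<^sup>2)" for x
      unfolding power2_norm_eq_inner by (simp add: inner_vec_def)
    moreover assume "integrable (lebesgue_on \<Omega>) (\<lambda>x. \<Sum>i\<in>UNIV. (norm (partial_deriv i \<phi> x))\<^sup>2)"
    ultimately show "integrable (lebesgue_on \<Omega>) (\<lambda>x. (norm (\<chi> i. partial_deriv i \<phi> x))\<^sup>2)" by simp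
  qed
qed (simp add: integration_by_parts_test[OF O \<phi>])

text \<open>Integrating the derivative of \<open>x_i * \<phi>\<^sup>2\<close> expresses \<open>\<integral> \<phi>\<^sup>2\<close> through
  \<open>- \<integral> 2 * x_i * \<phi> * \<partial>_i \<phi>\<close>, and \<open>x_i\<close> is bounded on \<open>\<Omega>\<close>.\<close>

lemma Poincare_test:
  assumes O: "open \<Omega>" and R: "\<And>x. x \<in> \<Omega> \<Longrightarrow> norm x \<le> R" and \<phi>: "\<phi> \<in> test_functions \<Omega>"
  shows "(LINT x|lebesgue_on \<Omega>. (\<phi> x)\<^sup>2) \<le> 4 * R\<^sup>2 * (LINT x|lebesgue_on \<Omega>. (partial_deriv i \<phi> x)\<^sup>2)"
proof -
  note d = test_functionsD(5)[OF \<phi>]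
  have dc: "(\<lambda>x::real^'a. x $ i) differentiable_on UNIV" using Ck_coord[of 1 i] by simp
  have c1: "partial_deriv i (\<lambda>x::real^'a. x $ i) x = 1" for x
    using partial_deriv_eq[OF bounded_linear_imp_has_derivative[OF bounded_linear_vec_nth, of i "at x"], of i] by simp
  have d\<phi>\<phi>: "(\<lambda>x. \<phi> x * \<phi> x) differentiable_on UNIV" by (intro differentiable_on_mult d)
  have "(\<lambda>x. \<phi> x * \<phi> x) \<in> test_functions \<Omega>" by (rule test_functions_mult[OF test_functionsD(1)[OF \<phi>] \<phi>])
  then have "(\<lambda>x. x $ i * (\<phi> x * \<phi> x)) \<in> test_functions \<Omega>" by (rule test_functions_mult[OF Ck_coord])
  from integral_partial_deriv_test_eq_0[OF O this, of i]
  have "(LINT x|lebesgue_on \<Omega>. x $ i * (\<phi> x * partial_deriv i \<phi> x + partial_deriv i \<phi> x * \<phi> x) + \<phi> x * \<phi> x) = 0"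
    by (simp add: partial_deriv_mult[OF dc d\<phi>\<phi>] partial_deriv_mult[OF d d] c1)
  note zero = this
  have i1: "integrable (lebesgue_on \<Omega>) (\<lambda>x. (\<phi> x)\<^sup>2)" "integrable (lebesgue_on \<Omega>) (\<lambda>x. (partial_deriv i \<phi> x)\<^sup>2)"
    using L2_square_integrable[OF test_function_L2(1)[OF O \<phi>]] L2_square_integrable[OF test_function_L2(2)[OF O \<phi>, of i]] by auto
  have xt: "(\<lambda>x. x $ i * \<phi> x) \<in> test_functions \<Omega>" by (rule test_functions_mult[OF Ck_coord \<phi>])
  have i2: "integrable (lebesgue_on \<Omega>) (\<lambda>x. x $ i * \<phi> x * partial_deriv i \<phi> x)"
    using L2_inner_integrable[OF test_function_L2(1)[OF O xt] test_function_L2(2)[OF O \<phi>, of i]] by simp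
  have "(LINT x|lebesgue_on \<Omega>. x $ i * (\<phi> x * partial_deriv i \<phi> x + partial_deriv i \<phi> x * \<phi> x) + \<phi> x * \<phi> x)
     = (LINT x|lebesgue_on \<Omega>. 2 * (x $ i * \<phi> x * partial_deriv i \<phi> x) + (\<phi> x)\<^sup>2)"
    by (rule Bochner_Integration.integral_cong) (auto simp: power2_eq_square algebra_simps)
  also have "\<dots> = 2 * (LINT x|lebesgue_on \<Omega>. x $ i * \<phi> x * partial_deriv i \<phi> x) + (LINT x|lebesgue_on \<Omega>. (\<phi> x)\<^sup>2)"
    using i1 i2 by simp
  finally have *: "(LINT x|lebesgue_on \<Omega>. (\<phi> x)\<^sup>2) = - 2 * (LINT x|lebesgue_on \<Omega>. x $ i * \<phi> x * partial_deriv i \<phi> x)"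
    using zero by linarith
  have "- 2 * (LINT x|lebesgue_on \<Omega>. x $ i * \<phi> x * partial_deriv i \<phi> x)
      = (LINT x|lebesgue_on \<Omega>. - 2 * (x $ i * \<phi> x * partial_deriv i \<phi> x))" by simp
  also have "\<dots> \<le> (LINT x|lebesgue_on \<Omega>. (1/2) * (\<phi> x)\<^sup>2 + 2 * R\<^sup>2 * (partial_deriv i \<phi> x)\<^sup>2)"
  proof (rule Bochner_Integration.integral_mono)
    fix x assume "x \<in> space (lebesgue_on \<Omega>)"
    then have "\<bar>x $ i\<bar> \<le> R" using R[of x] component_le_norm_cart[of x i] by simp
    then have "(x $ i)\<^sup>2 * (partial_deriv i \<phi> x)\<^sup>2 \<le> R\<^sup>2 * (partial_deriv i \<phi> x)\<^sup>2"
      by (intro mult_right_mono) (auto simp: abs_le_square_iff[symmetric])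
    moreover have "0 \<le> (\<phi> x + 2 * (x $ i) * partial_deriv i \<phi> x)\<^sup>2" by simp
    ultimately show "- 2 * (x $ i * \<phi> x * partial_deriv i \<phi> x) \<le> (1/2) * (\<phi> x)\<^sup>2 + 2 * R\<^sup>2 * (partial_deriv i \<phi> x)\<^sup>2"
      unfolding power2_sum power_mult_distrib by (simp add: algebra_simps)
  qed (use i1 i2 in auto)
  also have "\<dots> = (1/2) * (LINT x|lebesgue_on \<Omega>. (\<phi> x)\<^sup>2) + 2 * R\<^sup>2 * (LINT x|lebesgue_on \<Omega>. (partial_deriv i \<phi> x)\<^sup>2)"
    using i1 by simp
  finally show ?thesis using * by linarith
qed

section \<open>Semi-inner products\<close>

locale semi_inner =
  fixes S :: "'b::real_vector set" and ip :: "'b \<Rightarrow> 'b \<Rightarrow> real" and N :: "'b \<Rightarrow> real"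
  assumes subspace_S: "subspace S" and bilin: "symmetric_bilinear_on S ip"
    and nonneg: "\<And>x. x \<in> S \<Longrightarrow> 0 \<le> ip x x" and N_eq: "\<And>x. x \<in> S \<Longrightarrow> N x = sqrt (ip x x)"
begin

lemma memS [simp, intro]:
  "0 \<in> S" "x \<in> S \<Longrightarrow> y \<in> S \<Longrightarrow> x + y \<in> S" "x \<in> S \<Longrightarrow> y \<in> S \<Longrightarrow> x - y \<in> S"
  "x \<in> S \<Longrightarrow> c *\<^sub>R x \<in> S" "x \<in> S \<Longrightarrow> - x \<in> S"
  using subspace_S by (auto simp: subspace_0 subspace_add subspace_diff subspace_scale subspace_neg)

lemma ip_commute: "x \<in> S \<Longrightarrow> y \<in> S \<Longrightarrow> ip x y = ip y x"
  using bilin by (auto simp: symmetric_bilinear_on_def)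

lemma ip_left:
  assumes "x \<in> S" "y \<in> S" "z \<in> S"
  shows ip_add_left: "ip (x + y) z = ip x z + ip y z" and ip_scale_left: "ip (c *\<^sub>R x) z = c * ip x z"
    and ip_diff_left: "ip (x - y) z = ip x z - ip y z" and ip_minus_left: "ip (- x) z = - ip x z"
    and ip_zero_left: "ip 0 z = 0"
proof -
  have a: "ip (u + v) z = ip u z + ip v z" if "u \<in> S" "v \<in> S" for u v
    using bilin assms that by (auto simp: symmetric_bilinear_on_def)
  have b: "ip (c *\<^sub>R u) z = c * ip u z" if "u \<in> S" for u c
    using bilin assms that by (auto simp: symmetric_bilinear_on_def)
  show "ip (x + y) z = ip x z + ip y z" "ip (c *\<^sub>R x) z = c * ip x z" using a b assms by auto
  show "ip (x - y) z = ip x z - ip y z" using a[of x "(-1) *\<^sub>R y"] b[of y "-1"] assms by auto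
  show "ip (- x) z = - ip x z" using b[of x "-1"] assms by auto
  show "ip 0 z = 0" using b[of 0 0] by auto
qed

lemma ip_right:
  assumes "x \<in> S" "y \<in> S" "z \<in> S"
  shows ip_add_right: "ip z (x + y) = ip z x + ip z y" and ip_scale_right: "ip z (c *\<^sub>R x) = c * ip z x"
    and ip_diff_right: "ip z (x - y) = ip z x - ip z y" and ip_minus_right: "ip z (- x) = - ip z x"
    and ip_zero_right: "ip z 0 = 0"
  using ip_left[OF assms] assms ip_commute[of z] by auto

lemma N_square: "x \<in> S \<Longrightarrow> (N x)\<^sup>2 = ip x x"
  by (simp add: N_eq nonneg)

lemma N_ge_0: "x \<in> S \<Longrightarrow> 0 \<le> N x"
  by (simp add: N_eq nonneg)

lemma ip_self_add: "x \<in> S \<Longrightarrow> y \<in> S \<Longrightarrow> ip (x + y) (x + y) = ip x x + 2 * ip x y + ip y y"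
  by (simp add: ip_add_left ip_add_right ip_commute[of y x])

lemma ip_self_diff: "x \<in> S \<Longrightarrow> y \<in> S \<Longrightarrow> ip (x - y) (x - y) = ip x x - 2 * ip x y + ip y y"
  by (simp add: ip_diff_left ip_diff_right ip_commute[of y x])

lemma Cauchy_Schwarz:
  assumes x: "x \<in> S" and y: "y \<in> S" shows "\<bar>ip x y\<bar> \<le> N x * N y"
proof -
  have q: "0 \<le> ip x x + 2 * t * ip x y + t\<^sup>2 * ip y y" for t
    using nonneg[of "x + t *\<^sub>R y"] x y
    by (simp add: ip_self_add ip_scale_left ip_scale_right power2_eq_square algebra_simps)
  have "(ip x y)\<^sup>2 \<le> ip x x * ip y y"
  proof (cases "ip y y = 0")
    case True
    have "ip x y = 0"
    proof (rule ccontr)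
      assume "ip x y \<noteq> 0"
      then show False using q[of "- (ip x x + 1) / (2 * ip x y)"] True by (simp add: field_simps)
    qed
    then show ?thesis using True by simp
  next
    case False
    then have "ip y y > 0" using nonneg[OF y] by simp
    then show ?thesis using q[of "- ip x y / ip y y"] by (simp add: field_simps power2_eq_square)
  qed
  also have "\<dots> = (N x * N y)\<^sup>2" using x y by (simp add: power_mult_distrib N_square)
  finally show ?thesis using x y N_ge_0 by (metis abs_le_square_iff abs_of_nonneg mult_nonneg_nonneg)
qed

lemma seminormed: "seminormed_space S N"
proof
  show "subspace S" by (rule subspace_S)
  fix x y assume xy: "x \<in> S" "y \<in> S"
  have "(N (x + y))\<^sup>2 \<le> (N x + N y)\<^sup>2"
    using Cauchy_Schwarz[OF xy] xy by (simp add: N_square ip_self_add power2_sum)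
  then show "N (x + y) \<le> N x + N y" by (rule power2_le_imp_le) (use xy N_ge_0 in auto)
next
  fix c x assume x: "x \<in> S"
  have "N (c *\<^sub>R x) = sqrt (c\<^sup>2 * ip x x)"
    using x by (simp add: N_eq ip_scale_left ip_scale_right power2_eq_square algebra_simps)
  then show "N (c *\<^sub>R x) = \<bar>c\<bar> * N x" using x by (simp add: N_eq real_sqrt_mult)
qed

sublocale seminormed_space S N by (rule seminormed)

lemma ip_bounded_functional: "w \<in> S \<Longrightarrow> bounded_functional (\<lambda>x. ip x w)"
  unfolding bounded_functional_def using Cauchy_Schwarz
  by (auto simp: ip_add_left ip_scale_left mult.commute intro!: exI[of _ "N w"])

text \<open>Norms of integrals are bounded by pairing with all \<open>w\<close>, because the pairings are real integrals.\<close>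

lemma norm_le_of_pairing:
  assumes x: "x \<in> S" and bd: "\<And>w. w \<in> S \<Longrightarrow> ip x w \<le> c * N w" and c: "0 \<le> c" shows "N x \<le> c"
proof (cases "N x = 0")
  case False
  then have "0 < N x" using N_ge_0[OF x] by simp
  moreover have "N x * N x \<le> c * N x" using bd[OF x] x by (simp add: N_square[symmetric] power2_eq_square)
  ultimately show ?thesis by simp
qed (use c in simp)

lemma ip_null_right: "x \<in> S \<Longrightarrow> y \<in> S \<Longrightarrow> N y = 0 \<Longrightarrow> ip x y = 0"
  using Cauchy_Schwarz[of x y] by simp

lemma ip_cong_right: "x \<in> S \<Longrightarrow> y \<in> S \<Longrightarrow> z \<in> S \<Longrightarrow> N (y - z) = 0 \<Longrightarrow> ip x y = ip x z"
  using ip_null_right[of x "y - z"] by (simp add: ip_diff_right)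

lemma ip_tendsto:
  assumes "\<forall>i. y i \<in> S" "x \<in> S" "((\<lambda>i. N (x - y i)) \<longlongrightarrow> 0) F"
  shows "((\<lambda>i. ip (y i) (y i)) \<longlongrightarrow> ip x x) F"
proof -
  have "((\<lambda>i. N (y i) - N x) \<longlongrightarrow> 0) F"
  proof (rule tendsto_zero_dominated[OF assms(3)])
    show "\<bar>N (y i) - N x\<bar> \<le> N (x - y i)" for i
      using reverse_triangle[of "y i" x] N_commute[of x "y i"] assms(1,2) by simp
  qed
  then have "((\<lambda>i. (N (y i))\<^sup>2) \<longlongrightarrow> (N x)\<^sup>2) F" by (intro tendsto_power) (rule LIM_zero_cancel)
  then show ?thesis using assms(1,2) by (simp add: N_square)
qed

end

locale semi_hilbert = semi_inner S ip N for S :: "'b::real_vector set" and ip N +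
  assumes complete_S: "\<And>x. (\<And>n::nat. x n \<in> S) \<Longrightarrow> (\<And>e. e > 0 \<Longrightarrow> \<exists>k. \<forall>m\<ge>k. \<forall>n\<ge>k. N (x m - x n) < e)
     \<Longrightarrow> \<exists>l\<in>S. (\<lambda>n. N (x n - l)) \<longlonglongrightarrow> 0"

sublocale semi_hilbert \<subseteq> complete_seminormed_space S N
  by unfold_locales (rule complete_S)

lemma complete_equivalent_norm:
  assumes c: "complete_seminormed_space S N" and s: "seminormed_space S N'"
    and le: "\<And>x. x \<in> S \<Longrightarrow> N x \<le> C * N' x" "\<And>x. x \<in> S \<Longrightarrow> N' x \<le> D * N x" and CD: "0 < C" "0 < D"
  shows "complete_seminormed_space S N'"
proof -
  interpret N: complete_seminormed_space S N by (rule c)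
  interpret N': seminormed_space S N' by (rule s)
  show ?thesis
  proof
    fix x :: "nat \<Rightarrow> 'a"
    assume x: "\<And>n. x n \<in> S" and cauchy: "\<And>e. e > 0 \<Longrightarrow> \<exists>k. \<forall>m\<ge>k. \<forall>n\<ge>k. N' (x m - x n) < e"
    have "\<exists>l\<in>S. (\<lambda>n. N (x n - l)) \<longlonglongrightarrow> 0"
    proof (rule N.complete[OF x])
      fix e :: real assume "e > 0"
      then have "e / C > 0" using CD by simp
      then obtain k where k: "\<forall>m\<ge>k. \<forall>n\<ge>k. N' (x m - x n) < e / C" using cauchy by blast
      have "N (x m - x n) < e" if "m \<ge> k" "n \<ge> k" for m n
      proof -
        have "N' (x m - x n) < e / C" using k that by blast
        then have "C * N' (x m - x n) < e" using CD by (simp add: field_simps)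
        then show ?thesis using le(1)[of "x m - x n"] x by fastforce
      qed
      then show "\<exists>k. \<forall>m\<ge>k. \<forall>n\<ge>k. N (x m - x n) < e" by blast
    qed
    then obtain l where l: "l \<in> S" "(\<lambda>n. N (x n - l)) \<longlonglongrightarrow> 0" by blast
    have "(\<lambda>n. D * N (x n - l)) \<longlonglongrightarrow> 0" using tendsto_mult_left[OF l(2), of D] by simp
    then have "(\<lambda>n. N' (x n - l)) \<longlonglongrightarrow> 0"
    proof (rule tendsto_zero_dominated)
      show "\<bar>N' (x i - l)\<bar> \<le> D * N (x i - l)" for i
        using le(2)[of "x i - l"] N'.N_nonneg[of "x i - l"] x l(1) by auto
    qed
    then show "\<exists>l\<in>S. (\<lambda>n. N' (x n - l)) \<longlonglongrightarrow> 0" using l(1) by blast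
  qed
qed

lemma strongly_measurable_equivalent_norm:
  assumes s: "seminormed_space S N" "seminormed_space S N'"
    and le: "\<And>x. x \<in> S \<Longrightarrow> N' x \<le> D * N x" and f: "strongly_measurable_in M S N f"
  shows "strongly_measurable_in M S N' f"
proof -
  interpret N: seminormed_space S N by (rule s)
  interpret N': seminormed_space S N' by (rule s)
  obtain t where t: "\<forall>i::nat. simple_function M (t i)" "\<forall>i. t i ` space M \<subseteq> S"
      "AE x in M. (\<lambda>i. N (f x - t i x)) \<longlonglongrightarrow> 0" and fS: "AE x in M. f x \<in> S"
    by (rule N.strongly_measurableE[OF f])
  show ?thesis
  proof (rule N'.strongly_measurableI)
    show "AE x in M. (\<lambda>i. N' (f x - t i x)) \<longlonglongrightarrow> 0"
      using t(3) fS AE_space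
    proof eventually_elim
      case (elim x)
      have tS: "t i x \<in> S" for i by (rule subsetD[OF t(2)[rule_format] imageI[OF elim(3)]])
      have "(\<lambda>i. D * N (f x - t i x)) \<longlonglongrightarrow> 0" using tendsto_mult_left[OF elim(1), of D] by simp
      then show ?case
      proof (rule tendsto_zero_dominated)
        show "\<bar>N' (f x - t i x)\<bar> \<le> D * N (f x - t i x)" for i
          using le[of "f x - t i x"] N'.N_nonneg[of "f x - t i x"] tS elim(2) by auto
      qed
    qed
  qed (use t fS in auto)
qed

section \<open>Completeness of $L^2$ and of $H^1_0$\<close>

lemma completion_lebesgue_on:
  assumes "S \<in> sets lebesgue" shows "completion (lebesgue_on S) = lebesgue_on S"
proof -
  have sub: "A \<in> sets (lebesgue_on S)" if "N \<in> null_sets (lebesgue_on S)" "A \<subseteq> N" for A N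
  proof -
    have "N \<subseteq> S" "N \<in> null_sets lebesgue"
      using that(1) null_sets_restrict_space[of S lebesgue N] assms by auto
    then have "A \<in> null_sets lebesgue" using that(2) completion.complete2 by blast
    then show ?thesis using \<open>N \<subseteq> S\<close> that(2) assms by (auto simp: sets_restrict_space_iff)
  qed
  have sets: "sets (completion (lebesgue_on S)) = sets (lebesgue_on S)"
    unfolding sets_completion using sub by (auto intro!: sets.Un)
  show ?thesis
  proof (rule measure_eqI[OF sets])
    fix A assume "A \<in> sets (completion (lebesgue_on S))"
    then have "A \<in> sets (lebesgue_on S)" by (simp only: sets)
    then show "emeasure (completion (lebesgue_on S)) A = emeasure (lebesgue_on S) A" by simp
  qed
qed

lemma semi_inner_L2:
  fixes \<Omega> :: "(real^'d) set"
  shows "semi_inner (L2 \<Omega> :: (real^'d \<Rightarrow> 'b::euclidean_space) set) (L2_inner \<Omega>) (L2_norm \<Omega>)"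
proof
  show "subspace (L2 \<Omega> :: (real^'d \<Rightarrow> 'b) set)"
    by (rule subspaceI) (auto simp: zero_fun_def plus_fun_def scaleR_fun_def L2_zero intro: L2_add L2_scale)
  show "symmetric_bilinear_on (L2 \<Omega> :: (real^'d \<Rightarrow> 'b) set) (L2_inner \<Omega>)"
    unfolding symmetric_bilinear_on_def
  proof (intro conjI ballI allI)
    show "L2_inner \<Omega> u v = L2_inner \<Omega> v u" for u v :: "real^'d \<Rightarrow> 'b"
      by (simp add: L2_inner_def inner_commute)
    show "L2_inner \<Omega> (u + v) w = L2_inner \<Omega> u w + L2_inner \<Omega> v w"
      if "u \<in> L2 \<Omega>" "v \<in> L2 \<Omega>" "w \<in> L2 \<Omega>" for u v w :: "real^'d \<Rightarrow> 'b"
      using that by (simp add: L2_inner_def plus_fun_def inner_add_left L2_inner_integrable)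
    show "L2_inner \<Omega> (c *\<^sub>R u) w = c * L2_inner \<Omega> u w" for c and u w :: "real^'d \<Rightarrow> 'b"
      by (simp add: L2_inner_def scaleR_fun_def)
  qed
  show "0 \<le> L2_inner \<Omega> x x" for x :: "real^'d \<Rightarrow> 'b"
    by (auto simp: L2_inner_def intro: Bochner_Integration.integral_nonneg)
  show "L2_norm \<Omega> x = sqrt (L2_inner \<Omega> x x)" for x :: "real^'d \<Rightarrow> 'b" by (simp add: L2_norm_def)
qed

lemma nn_integral_L2_norm:
  "u \<in> L2 \<Omega> \<Longrightarrow> (\<integral>\<^sup>+x. ennreal ((norm (u x))\<^sup>2) \<partial>lebesgue_on \<Omega>) = ennreal ((L2_norm \<Omega> u)\<^sup>2)"
  unfolding L2_norm_square by (intro nn_integral_eq_integral L2_square_integrable) auto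

text \<open>Completeness is \<open>Bochner_L2_complete\<close> for functions with values in a Euclidean space.\<close>

lemma semi_hilbert_L2:
  fixes \<Omega> :: "(real^'d) set"
  assumes O: "open \<Omega>" "bounded \<Omega>"
  shows "semi_hilbert (L2 \<Omega> :: (real^'d \<Rightarrow> 'b::euclidean_space) set) (L2_inner \<Omega>) (L2_norm \<Omega>)"
proof -
  interpret L: semi_inner "L2 \<Omega> :: (real^'d \<Rightarrow> 'b) set" "L2_inner \<Omega>" "L2_norm \<Omega>" by (rule semi_inner_L2)
  interpret U: complete_seminormed_space "UNIV :: 'b set" norm
  proof unfold_locales
    fix x :: "nat \<Rightarrow> 'b" assume c: "\<And>e. e > 0 \<Longrightarrow> \<exists>k. \<forall>m\<ge>k. \<forall>n\<ge>k. norm (x m - x n) < e"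
    have "Cauchy x" by (rule metric_CauchyI) (use c in \<open>simp add: dist_norm\<close>)
    then obtain l where "x \<longlonglongrightarrow> l" by (auto simp: Cauchy_convergent_iff convergent_def)
    then show "\<exists>l\<in>UNIV. (\<lambda>n. norm (x n - l)) \<longlonglongrightarrow> 0"
      by (intro bexI[of _ l]) (auto simp: tendsto_norm_zero_iff LIM_zero_iff)
  qed (auto intro: norm_triangle_ineq)
  have sm: "strongly_measurable_in (lebesgue_on \<Omega>) UNIV norm u" if u: "u \<in> L2 \<Omega>" for u :: "real^'d \<Rightarrow> 'b"
  proof -
    obtain F where F: "\<And>i::nat. simple_function (lebesgue_on \<Omega>) (F i)"
      "\<And>x. x \<in> space (lebesgue_on \<Omega>) \<Longrightarrow> (\<lambda>i. F i x) \<longlonglongrightarrow> u x"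
      using borel_measurable_implies_sequence_metric[OF L2_measurable[OF u], of 0] by metis
    show ?thesis
    proof (rule U.strongly_measurableI)
      show "AE x in lebesgue_on \<Omega>. (\<lambda>i. norm (u x - F i x)) \<longlonglongrightarrow> 0"
      proof (rule AE_I2)
        fix x assume "x \<in> space (lebesgue_on \<Omega>)"
        from tendsto_diff[OF tendsto_const F(2)[OF this], of "u x"]
        show "(\<lambda>i. norm (u x - F i x)) \<longlonglongrightarrow> 0" by (simp add: tendsto_norm_zero)
      qed
    qed (use F in auto)
  qed
  show ?thesis
  proof
    fix x :: "nat \<Rightarrow> real^'d \<Rightarrow> 'b"
    assume x: "\<And>n. x n \<in> L2 \<Omega>" and cauchy: "\<And>e. e > 0 \<Longrightarrow> \<exists>k. \<forall>m\<ge>k. \<forall>n\<ge>k. L2_norm \<Omega> (x m - x n) < e"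
    obtain g where g: "strongly_measurable_in (lebesgue_on \<Omega>) UNIV norm g"
      "(\<integral>\<^sup>+y. ennreal ((norm (g y))\<^sup>2) \<partial>lebesgue_on \<Omega>) < \<infinity>"
      "(\<lambda>n. \<integral>\<^sup>+y. ennreal ((norm (x n y - g y))\<^sup>2) \<partial>lebesgue_on \<Omega>) \<longlonglongrightarrow> 0"
    proof (rule U.Bochner_L2_complete[OF finite_measure_lebesgue_on[OF O] sm[OF x]])
      show "(\<integral>\<^sup>+y. ennreal ((norm (x n y))\<^sup>2) \<partial>lebesgue_on \<Omega>) < \<infinity>" for n
        by (simp add: nn_integral_L2_norm[OF x])
      fix e :: real assume e: "e > 0"
      then obtain k where k: "\<forall>m\<ge>k. \<forall>n\<ge>k. L2_norm \<Omega> (x m - x n) < sqrt e" using cauchy[of "sqrt e"] by auto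
      have "(\<integral>\<^sup>+y. ennreal ((norm (x m y - x n y))\<^sup>2) \<partial>lebesgue_on \<Omega>) < ennreal e" if "m \<ge> k" "n \<ge> k" for m n
      proof -
        have "(L2_norm \<Omega> (x m - x n))\<^sup>2 < (sqrt e)\<^sup>2" using k that by (intro power_strict_mono) auto
        then show ?thesis
          using nn_integral_L2_norm[OF L2_diff[OF x x], of m n] e by (simp add: fun_diff_def ennreal_less_iff)
      qed
      then show "\<exists>k. \<forall>m\<ge>k. \<forall>n\<ge>k. (\<integral>\<^sup>+y. ennreal ((norm (x m y - x n y))\<^sup>2) \<partial>lebesgue_on \<Omega>) < ennreal e" by blast
    qed
    have "(\<lambda>y. g y \<bullet> b) \<in> borel_measurable (lebesgue_on \<Omega>)" for b
    proof -
      have "(\<lambda>y. g y \<bullet> b) \<in> borel_measurable (completion (lebesgue_on \<Omega>))"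
      proof (rule U.strongly_measurable_compose[OF g(1)])
        fix y and z :: 'b assume "(\<lambda>i. norm (z - y i)) \<longlonglongrightarrow> 0"
        then have "(\<lambda>i. z - y i) \<longlonglongrightarrow> 0" by (rule tendsto_norm_zero_cancel)
        from tendsto_diff[OF tendsto_const this, of z] have "y \<longlonglongrightarrow> z" by simp
        then show "(\<lambda>i. y i \<bullet> b) \<longlonglongrightarrow> z \<bullet> b" by (intro tendsto_inner tendsto_const)
      qed
      then show ?thesis using O by (simp add: completion_lebesgue_on)
    qed
    then have gm: "g \<in> borel_measurable (lebesgue_on \<Omega>)" by (subst borel_measurable_euclidean_space) auto
    have gL: "g \<in> L2 \<Omega>"
      by (rule L2_I[OF gm]) (use gm g(2) in \<open>auto intro!: integrableI_bounded\<close>)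
    have "(\<lambda>n. ennreal ((L2_norm \<Omega> (x n - g))\<^sup>2)) \<longlonglongrightarrow> ennreal 0"
      using g(3) nn_integral_L2_norm[OF L2_diff[OF x gL]] by (simp add: fun_diff_def)
    then have "(\<lambda>n. (L2_norm \<Omega> (x n - g))\<^sup>2) \<longlonglongrightarrow> 0"
      by (subst (asm) tendsto_ennreal_iff) auto
    from tendsto_real_sqrt[OF this] have "(\<lambda>n. L2_norm \<Omega> (x n - g)) \<longlonglongrightarrow> 0" by simp
    then show "\<exists>l\<in>L2 \<Omega>. (\<lambda>n. L2_norm \<Omega> (x n - l)) \<longlonglongrightarrow> 0" using gL by blast
  qed
qed

locale domain =
  fixes \<Omega> :: "(real^'d) set"
  assumes O: "open \<Omega>" "bounded \<Omega>"
begin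

sublocale H: semi_hilbert "L2 \<Omega> :: (real^'d \<Rightarrow> real) set" "L2_inner \<Omega>" "L2_norm \<Omega>"
  by (rule semi_hilbert_L2[OF O])

sublocale G: semi_hilbert "L2 \<Omega> :: (real^'d \<Rightarrow> real^'d) set" "L2_inner \<Omega>" "L2_norm \<Omega>"
  by (rule semi_hilbert_L2[OF O])

lemma H1_D: "v \<in> H1 \<Omega> \<Longrightarrow> v \<in> L2 \<Omega>" "v \<in> H1 \<Omega> \<Longrightarrow> is_weak_gradient \<Omega> v (grad \<Omega> v)"
    "v \<in> H1 \<Omega> \<Longrightarrow> grad \<Omega> v \<in> L2 \<Omega>"
  using weak_gradient_grad[of \<Omega> v] by (auto simp: H1_def is_weak_gradient_def)

lemma H1_I: "v \<in> L2 \<Omega> \<Longrightarrow> is_weak_gradient \<Omega> v g \<Longrightarrow> v \<in> H1 \<Omega>"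
  by (auto simp: H1_def)

lemma L2_inner_cong_AE:
  assumes "AE x in lebesgue_on \<Omega>. u x = u' x" "AE x in lebesgue_on \<Omega>. v x = v' x"
    "u \<in> L2 \<Omega>" "u' \<in> L2 \<Omega>" "v \<in> L2 \<Omega>" "v' \<in> L2 \<Omega>"
  shows "L2_inner \<Omega> u v = L2_inner \<Omega> u' v'"
  unfolding L2_inner_def
proof (rule integral_cong_AE)
  show "AE x in lebesgue_on \<Omega>. u x \<bullet> v x = u' x \<bullet> v' x" using assms(1,2) by eventually_elim simp
qed (use assms L2_inner_integrable borel_measurable_integrable in blast)+

lemma grad_lincomb_AE:
  assumes u: "u \<in> H1 \<Omega>" and v: "v \<in> H1 \<Omega>"
  shows "a *\<^sub>R u + b *\<^sub>R v \<in> H1 \<Omega>"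
    "AE x in lebesgue_on \<Omega>. grad \<Omega> (a *\<^sub>R u + b *\<^sub>R v) x = a *\<^sub>R grad \<Omega> u x + b *\<^sub>R grad \<Omega> v x"
proof -
  have eq: "a *\<^sub>R u + b *\<^sub>R v = (\<lambda>x. a * u x + b * v x)" by (auto simp: plus_fun_def scaleR_fun_def)
  have w: "is_weak_gradient \<Omega> (a *\<^sub>R u + b *\<^sub>R v) (\<lambda>x. a *\<^sub>R grad \<Omega> u x + b *\<^sub>R grad \<Omega> v x)"
    unfolding eq by (rule weak_gradient_lincomb[OF O(1) H1_D(1,2)[OF u] H1_D(1,2)[OF v]])
  then show "a *\<^sub>R u + b *\<^sub>R v \<in> H1 \<Omega>"
    using H1_D(1)[OF u] H1_D(1)[OF v] by (intro H1_I) auto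
  show "AE x in lebesgue_on \<Omega>. grad \<Omega> (a *\<^sub>R u + b *\<^sub>R v) x = a *\<^sub>R grad \<Omega> u x + b *\<^sub>R grad \<Omega> v x"
    by (rule grad_AE_eq[OF O w])
qed

lemma subspace_H1: "subspace (H1 \<Omega>)"
proof (rule subspaceI)
  have "is_weak_gradient \<Omega> 0 (\<lambda>x. 0)"
    by (auto simp: is_weak_gradient_def L2_zero zero_fun_def)
  then show "0 \<in> H1 \<Omega>" by (intro H1_I) auto
  show "x + y \<in> H1 \<Omega>" if "x \<in> H1 \<Omega>" "y \<in> H1 \<Omega>" for x y
    using grad_lincomb_AE(1)[OF that, of 1 1] by simp
  show "c *\<^sub>R x \<in> H1 \<Omega>" if "x \<in> H1 \<Omega>" for c x
    using grad_lincomb_AE(1)[OF that that, of c 0] by simp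
qed

lemma coeff_form_integrable:
  assumes A: "symmetric_Linfty_field \<Omega> A" and G: "G \<in> L2 \<Omega>" "G' \<in> L2 \<Omega>"
  shows "integrable (lebesgue_on \<Omega>) (\<lambda>x. (A x *v G x) \<bullet> G' x)"
proof -
  obtain C where C: "AE x in lebesgue_on \<Omega>. norm (A x) \<le> C" and Am: "A \<in> borel_measurable (lebesgue_on \<Omega>)"
    using A by (auto simp: symmetric_Linfty_field_def)
  have m: "(\<lambda>x. A x *v G x) \<in> borel_measurable (lebesgue_on \<Omega>)"
  proof -
    have "(\<lambda>x. (A x *v G x) \<bullet> b) \<in> borel_measurable (lebesgue_on \<Omega>)" if bB: "b \<in> Basis" for b
    proof -
      obtain i where "b = axis i 1" using bB by (auto simp: Basis_vec_def)
      then have "(\<lambda>x. (A x *v G x) \<bullet> b) = (\<lambda>x. \<Sum>j\<in>UNIV. A x $ i $ j * G x $ j)"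
        by (simp add: inner_axis matrix_vector_mult_def)
      moreover have "(\<lambda>x. A x $ i $ j) \<in> borel_measurable (lebesgue_on \<Omega>)" for j
        using measurable_compose[OF Am borel_measurable_continuous_onI[of "\<lambda>v. v $ i $ j"]]
        by (simp add: continuous_on_component)
      moreover have "(\<lambda>x. G x $ j) \<in> borel_measurable (lebesgue_on \<Omega>)" for j
        using L2_measurable[OF L2_nth[OF G(1)]] .
      ultimately show ?thesis by simp
    qed
    then show ?thesis by (subst borel_measurable_euclidean_space) auto
  qed
  have "integrable (lebesgue_on \<Omega>) (\<lambda>x. (norm (A x *v G x))\<^sup>2)"
  proof (rule Bochner_Integration.integrable_bound)
    show "integrable (lebesgue_on \<Omega>) (\<lambda>x. real CARD('d) * C\<^sup>2 * (norm (G x))\<^sup>2)"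
      by (intro integrable_mult_right L2_square_integrable G)
    show "AE x in lebesgue_on \<Omega>. norm ((norm (A x *v G x))\<^sup>2) \<le> norm (real CARD('d) * C\<^sup>2 * (norm (G x))\<^sup>2)"
      using C
    proof eventually_elim
      case (elim x)
      have comp: "((A x *v G x) $ i)\<^sup>2 \<le> C\<^sup>2 * (norm (G x))\<^sup>2" for i
      proof -
        have "\<bar>(A x *v G x) $ i\<bar> \<le> norm (A x $ i) * norm (G x)"
          unfolding matrix_vector_mul_component by (rule Cauchy_Schwarz_ineq2)
        also have "\<dots> \<le> C * norm (G x)"
          using Finite_Cartesian_Product.norm_nth_le[of "A x" i] elim by (intro mult_right_mono) auto
        finally have "\<bar>(A x *v G x) $ i\<bar>\<^sup>2 \<le> (C * norm (G x))\<^sup>2" by (intro power_mono) auto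
        then show ?thesis by (simp add: power_mult_distrib)
      qed
      have "(norm (A x *v G x))\<^sup>2 = (\<Sum>i\<in>UNIV. ((A x *v G x) $ i)\<^sup>2)"
        unfolding power2_norm_eq_inner by (simp add: inner_vec_def power2_eq_square)
      also have "\<dots> \<le> (\<Sum>i\<in>(UNIV::'d set). C\<^sup>2 * (norm (G x))\<^sup>2)" by (intro sum_mono comp)
      also have "\<dots> = real CARD('d) * C\<^sup>2 * (norm (G x))\<^sup>2" by simp
      finally show ?case by simp
    qed
  qed (use m in measurable)
  then have "(\<lambda>x. A x *v G x) \<in> L2 \<Omega>" by (intro L2_I m)
  then show ?thesis by (rule L2_inner_integrable[OF _ G(2)])
qed

lemma grad_inner_lincomb:
  assumes u: "u \<in> H1 \<Omega>" and v: "v \<in> H1 \<Omega>" and w: "w \<in> L2 \<Omega>"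
  shows "L2_inner \<Omega> (grad \<Omega> (a *\<^sub>R u + b *\<^sub>R v)) w = a * L2_inner \<Omega> (grad \<Omega> u) w + b * L2_inner \<Omega> (grad \<Omega> v) w"
proof -
  have gu: "grad \<Omega> u \<in> L2 \<Omega>" "grad \<Omega> v \<in> L2 \<Omega>" using H1_D(3) u v by auto
  have eq: "a *\<^sub>R grad \<Omega> u + b *\<^sub>R grad \<Omega> v = (\<lambda>x. a *\<^sub>R grad \<Omega> u x + b *\<^sub>R grad \<Omega> v x)"
    by (auto simp: plus_fun_def scaleR_fun_def)
  have "L2_inner \<Omega> (grad \<Omega> (a *\<^sub>R u + b *\<^sub>R v)) w = L2_inner \<Omega> (a *\<^sub>R grad \<Omega> u + b *\<^sub>R grad \<Omega> v) w"
    unfolding eq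
    by (rule L2_inner_cong_AE[OF grad_lincomb_AE(2)[OF u v] _ H1_D(3)[OF grad_lincomb_AE(1)[OF u v]] L2_add[OF L2_scale[OF gu(1)] L2_scale[OF gu(2)]] w w])
       simp
  then show ?thesis using gu w by (simp add: G.ip_add_left G.ip_scale_left)
qed

definition V_inner :: "(real^'d \<Rightarrow> real) \<Rightarrow> (real^'d \<Rightarrow> real) \<Rightarrow> real" where
  "V_inner u v = L2_inner \<Omega> u v + L2_inner \<Omega> (grad \<Omega> u) (grad \<Omega> v)"

lemma semi_inner_H1: "semi_inner (H1 \<Omega>) V_inner (V_norm \<Omega>)"
proof
  show "subspace (H1 \<Omega>)" by (rule subspace_H1)
  show "symmetric_bilinear_on (H1 \<Omega>) V_inner"
    unfolding symmetric_bilinear_on_def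
  proof (intro conjI ballI allI)
    fix u v w assume u: "u \<in> H1 \<Omega>" and v: "v \<in> H1 \<Omega>"
    show "V_inner u v = V_inner v u"
      using u v by (simp add: V_inner_def H.ip_commute[of u v] G.ip_commute[of "grad \<Omega> u" "grad \<Omega> v"] H1_D)
    assume w: "w \<in> H1 \<Omega>"
    show "V_inner (u + v) w = V_inner u w + V_inner v w"
      using grad_inner_lincomb[OF u v H1_D(3)[OF w], of 1 1] u v w by (simp add: V_inner_def H.ip_add_left H1_D)
  next
    fix c u w assume u: "u \<in> H1 \<Omega>" and w: "w \<in> H1 \<Omega>"
    show "V_inner (c *\<^sub>R u) w = c * V_inner u w"
      using grad_inner_lincomb[OF u u H1_D(3)[OF w], of c 0] u w
      by (simp add: V_inner_def H.ip_scale_left[of u w] H1_D algebra_simps)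
  qed
  fix u assume u: "u \<in> H1 \<Omega>"
  show "0 \<le> V_inner u u" using u by (simp add: V_inner_def H.nonneg G.nonneg H1_D)
  show "V_norm \<Omega> u = sqrt (V_inner u u)"
    using u by (simp add: V_norm_def V_inner_def V_seminorm_def H.N_square G.N_square H1_D)
qed

sublocale H1: semi_inner "H1 \<Omega>" V_inner "V_norm \<Omega>" by (rule semi_inner_H1)

lemma L2_le_V_norm: "L2_norm \<Omega> v \<le> V_norm \<Omega> v"
  by (simp add: V_norm_def)

lemma V_seminorm_nonneg [simp]: "0 \<le> V_seminorm \<Omega> v"
  by (simp add: V_seminorm_def)

lemma V_seminorm_le_V_norm: "V_seminorm \<Omega> v \<le> V_norm \<Omega> v"
  by (simp add: V_norm_def)

lemma V_norm_le_sum: "V_norm \<Omega> v \<le> L2_norm \<Omega> v + V_seminorm \<Omega> v"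
  by (simp add: V_norm_def sqrt_sum_squares_le_sum)

lemma L2_norm_cong_AE:
  assumes "AE x in lebesgue_on \<Omega>. u x = v x" "u \<in> L2 \<Omega>" "v \<in> L2 \<Omega>"
  shows "L2_norm \<Omega> u = L2_norm \<Omega> v"
  unfolding L2_norm_def using L2_inner_cong_AE[OF assms(1) assms(1)] assms(2,3) by simp

lemma seminormed_H1_grad: "seminormed_space (H1 \<Omega>) (V_seminorm \<Omega>)"
proof
  have lin: "V_seminorm \<Omega> (a *\<^sub>R u + b *\<^sub>R v) = L2_norm \<Omega> (a *\<^sub>R grad \<Omega> u + b *\<^sub>R grad \<Omega> v)"
    if "u \<in> H1 \<Omega>" "v \<in> H1 \<Omega>" for a b u v
    unfolding V_seminorm_def
  proof (rule L2_norm_cong_AE)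
    show "AE x in lebesgue_on \<Omega>. grad \<Omega> (a *\<^sub>R u + b *\<^sub>R v) x = (a *\<^sub>R grad \<Omega> u + b *\<^sub>R grad \<Omega> v) x"
      using grad_lincomb_AE(2)[OF that, of a b] by eventually_elim (simp add: plus_fun_def scaleR_fun_def)
  qed (use that grad_lincomb_AE(1)[OF that, of a b] in \<open>auto intro: H1_D(3)\<close>)
  show "V_seminorm \<Omega> (x + y) \<le> V_seminorm \<Omega> x + V_seminorm \<Omega> y" if "x \<in> H1 \<Omega>" "y \<in> H1 \<Omega>" for x y
    using lin[OF that, of 1 1] G.triangle[of "grad \<Omega> x" "grad \<Omega> y"] that by (simp add: V_seminorm_def H1_D)
  show "V_seminorm \<Omega> (c *\<^sub>R x) = \<bar>c\<bar> * V_seminorm \<Omega> x" if "x \<in> H1 \<Omega>" for c x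
    using lin[OF that that, of c 0] G.scale[of "grad \<Omega> x" c] that by (simp add: V_seminorm_def H1_D)
qed (rule subspace_H1)

sublocale H1g: seminormed_space "H1 \<Omega>" "V_seminorm \<Omega>" by (rule seminormed_H1_grad)

lemma test_in_H1: "\<phi> \<in> test_functions \<Omega> \<Longrightarrow> \<phi> \<in> H1 \<Omega>"
  using test_function_weak_gradient[OF O(1)] test_function_L2[OF O(1)] by (auto intro: H1_I)

lemma H10_in_H1: "v \<in> H10 \<Omega> \<Longrightarrow> v \<in> H1 \<Omega>"
  by (simp add: H10_def)

lemma H10_approx: "v \<in> H10 \<Omega> \<Longrightarrow> 0 < e \<Longrightarrow> \<exists>\<phi>\<in>test_functions \<Omega>. V_norm \<Omega> (\<phi> - v) < e"
proof -
  assume v: "v \<in> H10 \<Omega>" and e: "0 < e"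
  obtain \<phi> where \<phi>: "\<forall>i::nat. \<phi> i \<in> test_functions \<Omega>" "(\<lambda>i. V_norm \<Omega> (\<phi> i - v)) \<longlonglongrightarrow> 0"
    using v by (auto simp: H10_def)
  have "\<forall>\<^sub>F i in sequentially. V_norm \<Omega> (\<phi> i - v) < e" using order_tendstoD(2)[OF \<phi>(2) e] .
  then obtain i where "V_norm \<Omega> (\<phi> i - v) < e" by (auto simp: eventually_sequentially)
  then show ?thesis using \<phi>(1) by blast
qed

lemma H10_I:
  assumes v: "v \<in> H1 \<Omega>" and ap: "\<And>e. 0 < e \<Longrightarrow> \<exists>\<phi>\<in>test_functions \<Omega>. V_norm \<Omega> (\<phi> - v) < e"
  shows "v \<in> H10 \<Omega>"
proof -
  have "\<forall>i::nat. \<exists>\<phi>\<in>test_functions \<Omega>. V_norm \<Omega> (\<phi> - v) < inverse (real (Suc i))"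
    by (intro allI ap) simp
  then obtain \<phi> where \<phi>: "\<forall>i. \<phi> i \<in> test_functions \<Omega>" "\<And>i. V_norm \<Omega> (\<phi> i - v) < inverse (real (Suc i))" by metis
  have "(\<lambda>i. V_norm \<Omega> (\<phi> i - v)) \<longlonglongrightarrow> 0"
  proof (rule tendsto_zero_dominated[OF LIMSEQ_inverse_real_of_nat])
    show "\<bar>V_norm \<Omega> (\<phi> i - v)\<bar> \<le> inverse (real (Suc i))" for i
      using \<phi>(2)[of i] H1.N_nonneg[of "\<phi> i - v"] test_in_H1 \<phi>(1) v by simp
  qed
  then show ?thesis using v \<phi>(1) by (auto simp: H10_def)
qed

text \<open>Elements of \<open>H10\<close> are themselves approximated by test functions, by the triangle inequality within any
  given error.\<close>

lemma H10_closed: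
  assumes v: "v \<in> H1 \<Omega>" and ap: "\<And>e. 0 < e \<Longrightarrow> \<exists>w\<in>H10 \<Omega>. V_norm \<Omega> (w - v) < e"
  shows "v \<in> H10 \<Omega>"
proof (rule H10_I[OF v])
  fix e :: real assume e: "0 < e"
  obtain w where w: "w \<in> H10 \<Omega>" "V_norm \<Omega> (w - v) < e/2" using ap[of "e/2"] e by auto
  obtain \<phi> where \<phi>: "\<phi> \<in> test_functions \<Omega>" "V_norm \<Omega> (\<phi> - w) < e/2" using H10_approx[OF w(1), of "e/2"] e by auto
  have "V_norm \<Omega> (\<phi> - v) < e"
    using H1.triangle_diff[OF test_in_H1[OF \<phi>(1)] H10_in_H1[OF w(1)] v] w(2) \<phi>(2) by simp
  then show "\<exists>\<phi>\<in>test_functions \<Omega>. V_norm \<Omega> (\<phi> - v) < e" using \<phi>(1) by blast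
qed

lemma subspace_H10: "subspace (H10 \<Omega>)"
proof -
  have lin: "a *\<^sub>R u + b *\<^sub>R v \<in> H10 \<Omega>" if u: "u \<in> H10 \<Omega>" and v: "v \<in> H10 \<Omega>" for a b u v
  proof (rule H10_I)
    show "a *\<^sub>R u + b *\<^sub>R v \<in> H1 \<Omega>" using u v H10_in_H1 by auto
    fix e :: real assume e: "0 < e"
    define c where "c = 1 + \<bar>a\<bar> + \<bar>b\<bar>"
    have c: "c > 0" by (simp add: c_def)
    obtain \<phi> where \<phi>: "\<phi> \<in> test_functions \<Omega>" "V_norm \<Omega> (\<phi> - u) < e / c"
      using H10_approx[OF u, of "e / c"] e c by auto
    obtain \<psi> where \<psi>: "\<psi> \<in> test_functions \<Omega>" "V_norm \<Omega> (\<psi> - v) < e / c"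
      using H10_approx[OF v, of "e / c"] e c by auto
    have mem: "\<phi> - u \<in> H1 \<Omega>" "\<psi> - v \<in> H1 \<Omega>" using \<phi>(1) \<psi>(1) u v test_in_H1 H10_in_H1 by auto
    have "(a *\<^sub>R \<phi> + b *\<^sub>R \<psi>) - (a *\<^sub>R u + b *\<^sub>R v) = a *\<^sub>R (\<phi> - u) + b *\<^sub>R (\<psi> - v)"
      by (simp add: scaleR_diff_right)
    moreover have "V_norm \<Omega> (a *\<^sub>R (\<phi> - u) + b *\<^sub>R (\<psi> - v)) \<le> \<bar>a\<bar> * V_norm \<Omega> (\<phi> - u) + \<bar>b\<bar> * V_norm \<Omega> (\<psi> - v)"
      using H1.triangle[of "a *\<^sub>R (\<phi> - u)" "b *\<^sub>R (\<psi> - v)"] mem by (simp add: H1.scale)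
    moreover have "\<bar>a\<bar> * V_norm \<Omega> (\<phi> - u) + \<bar>b\<bar> * V_norm \<Omega> (\<psi> - v) \<le> \<bar>a\<bar> * (e / c) + \<bar>b\<bar> * (e / c)"
      using \<phi>(2) \<psi>(2) by (intro add_mono mult_left_mono) auto
    moreover have "\<bar>a\<bar> * (e / c) + \<bar>b\<bar> * (e / c) = (c - 1) * (e / c)" unfolding distrib_right[symmetric] by (simp add: c_def)
    moreover have "(c - 1) * (e / c) < e" using c e by (simp add: field_simps)
    moreover have "a *\<^sub>R \<phi> + b *\<^sub>R \<psi> \<in> test_functions \<Omega>"
      using subspace_test_functions[of \<Omega>] \<phi>(1) \<psi>(1) by (intro subspace_add subspace_scale)
    ultimately show "\<exists>\<theta>\<in>test_functions \<Omega>. V_norm \<Omega> (\<theta> - (a *\<^sub>R u + b *\<^sub>R v)) < e"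
      by (intro bexI[of _ "a *\<^sub>R \<phi> + b *\<^sub>R \<psi>"]) auto
  qed
  have "0 \<in> H10 \<Omega>"
    using subspace_0[OF subspace_test_functions[of \<Omega>]] by (intro H10_I) (auto intro!: bexI[of _ 0])
  then show ?thesis
  proof (rule subspaceI)
    show "u + v \<in> H10 \<Omega>" if "u \<in> H10 \<Omega>" "v \<in> H10 \<Omega>" for u v
      using lin[OF that, of 1 1] by simp
    show "c *\<^sub>R u \<in> H10 \<Omega>" if "u \<in> H10 \<Omega>" for c u
      using lin[OF that that, of c 0] by simp
  qed
qed

lemma weak_gradient_cong_AE:
  assumes "is_weak_gradient \<Omega> v g" "AE x in lebesgue_on \<Omega>. v x = w x" "v \<in> L2 \<Omega>" "w \<in> L2 \<Omega>"
  shows "is_weak_gradient \<Omega> w g"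
proof -
  have "L2_inner \<Omega> w (partial_deriv i \<phi>) = L2_inner \<Omega> v (partial_deriv i \<phi>)" if "\<phi> \<in> test_functions \<Omega>" for \<phi> i
    using assms test_function_L2[OF O(1) that] by (intro L2_inner_cong_AE) auto
  then show ?thesis using assms(1) by (simp add: is_weak_gradient_def L2_inner_def)
qed

text \<open>The zero field is a weak gradient of a null function, and by uniqueness every other one vanishes
  almost everywhere.\<close>

lemma V_norm_eq_0:
  assumes v: "v \<in> L2 \<Omega>" "L2_norm \<Omega> v = 0" shows "v \<in> H1 \<Omega>" "V_norm \<Omega> v = 0"
proof -
  have ae: "AE x in lebesgue_on \<Omega>. 0 = v x"
  proof -
    have "AE x in lebesgue_on \<Omega>. v x = 0" using v L2_norm_eq_0_AE[OF v(1)] by blast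
    then show ?thesis by eventually_elim simp
  qed
  have "is_weak_gradient \<Omega> (\<lambda>x. 0) (\<lambda>x. 0)" by (auto simp: is_weak_gradient_def L2_zero)
  then have w: "is_weak_gradient \<Omega> v (\<lambda>x. 0)"
    by (rule weak_gradient_cong_AE[OF _ ae L2_zero v(1)])
  then show H1: "v \<in> H1 \<Omega>" by (rule H1_I[OF v(1)])
  have "L2_norm \<Omega> (grad \<Omega> v) = 0"
    using grad_AE_eq[OF O w] L2_norm_eq_0_AE[OF H1_D(3)[OF H1]] by simp
  then show "V_norm \<Omega> v = 0" using v(2) by (simp add: V_norm_def V_seminorm_def)
qed

text \<open>Membership in \<open>H10\<close> can be concluded from an identity in \<open>L2\<close>, even though \<open>H10\<close> consists of
  representatives.\<close>

lemma H10_cong: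
  assumes w: "w \<in> H10 \<Omega>" and v: "v \<in> L2 \<Omega>" and eq: "L2_norm \<Omega> (w - v) = 0"
  shows "v \<in> H10 \<Omega>" "V_norm \<Omega> (w - v) = 0"
proof -
  have wL: "w \<in> L2 \<Omega>" using H1_D(1)[OF H10_in_H1[OF w]] .
  have d: "w - v \<in> H1 \<Omega>" "V_norm \<Omega> (w - v) = 0" using V_norm_eq_0[OF _ eq] wL v by auto
  then show "V_norm \<Omega> (w - v) = 0" by simp
  have "w - (w - v) \<in> H1 \<Omega>" using d(1) H10_in_H1[OF w] by blast
  then have "v \<in> H1 \<Omega>" by simp
  then show "v \<in> H10 \<Omega>"
  proof (rule H10_closed)
    show "\<exists>w\<in>H10 \<Omega>. V_norm \<Omega> (w - v) < e" if "0 < e" for e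
      using w d(2) that by (intro bexI[of _ w]) auto
  qed
qed

lemma semi_inner_H10: "semi_inner (H10 \<Omega>) V_inner (V_norm \<Omega>)"
proof
  show "symmetric_bilinear_on (H10 \<Omega>) V_inner"
    using H1.bilin H10_in_H1 by (auto simp: symmetric_bilinear_on_def)
qed (use subspace_H10 H1.nonneg H1.N_eq H10_in_H1 in auto)

text \<open>The weak gradient is a closed operator: its defining identity passes to limits in \<open>L2\<close> of the
  functions and of their gradients.\<close>

lemma semi_hilbert_H10: "semi_hilbert (H10 \<Omega>) V_inner (V_norm \<Omega>)"
proof -
  interpret V: semi_inner "H10 \<Omega>" V_inner "V_norm \<Omega>" by (rule semi_inner_H10)
  show ?thesis
  proof
    fix x :: "nat \<Rightarrow> real^'d \<Rightarrow> real"
    assume x: "\<And>n. x n \<in> H10 \<Omega>" and cauchy: "\<And>e. e > 0 \<Longrightarrow> \<exists>k. \<forall>m\<ge>k. \<forall>n\<ge>k. V_norm \<Omega> (x m - x n) < e"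
    have xH: "x n \<in> H1 \<Omega>" "x n \<in> L2 \<Omega>" "grad \<Omega> (x n) \<in> L2 \<Omega>" for n
      using H10_in_H1[OF x] H1_D by auto
    have gd: "L2_norm \<Omega> (grad \<Omega> u - grad \<Omega> v) = V_seminorm \<Omega> (u - v)" if "u \<in> H1 \<Omega>" "v \<in> H1 \<Omega>" for u v
      unfolding V_seminorm_def
    proof (rule L2_norm_cong_AE)
      show "AE y in lebesgue_on \<Omega>. (grad \<Omega> u - grad \<Omega> v) y = grad \<Omega> (u - v) y"
        using grad_lincomb_AE(2)[OF that, of 1 "-1"] by eventually_elim simp
    qed (use that in \<open>auto intro: H1_D(3)\<close>)
    have "\<exists>l\<in>L2 \<Omega>. (\<lambda>n. L2_norm \<Omega> (x n - l)) \<longlonglongrightarrow> 0"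
      using cauchy L2_le_V_norm by (intro H.complete xH) (meson le_less_trans)
    then obtain u where u: "u \<in> L2 \<Omega>" "(\<lambda>n. L2_norm \<Omega> (x n - u)) \<longlonglongrightarrow> 0" by blast
    have "\<exists>l\<in>L2 \<Omega>. (\<lambda>n. L2_norm \<Omega> (grad \<Omega> (x n) - l)) \<longlonglongrightarrow> 0"
      using cauchy V_seminorm_le_V_norm gd[OF xH(1) xH(1)]
      by (intro G.complete xH) (metis le_less_trans)
    then obtain g where g: "g \<in> L2 \<Omega>" "(\<lambda>n. L2_norm \<Omega> (grad \<Omega> (x n) - g)) \<longlonglongrightarrow> 0" by blast
    have w: "is_weak_gradient \<Omega> u g"
      unfolding is_weak_gradient_def
    proof (intro conjI ballI allI)
      fix \<phi> i assume \<phi>: "\<phi> \<in> test_functions \<Omega>"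
      have t: "\<phi> \<in> L2 \<Omega>" "partial_deriv i \<phi> \<in> L2 \<Omega>" using test_function_L2[OF O(1) \<phi>] by auto
      have ut: "(\<lambda>n. L2_norm \<Omega> (u - x n)) \<longlonglongrightarrow> 0" using u(2) H.N_commute[OF u(1) xH(2)] by simp
      have gt: "(\<lambda>n. L2_norm \<Omega> (g - grad \<Omega> (x n))) \<longlonglongrightarrow> 0" using g(2) G.N_commute[OF g(1) xH(3)] by simp
      have 1: "(\<lambda>n. L2_inner \<Omega> (x n) (partial_deriv i \<phi>)) \<longlonglongrightarrow> L2_inner \<Omega> u (partial_deriv i \<phi>)"
        by (rule H.bounded_functional_tendsto[OF H.ip_bounded_functional[OF t(2)] _ u(1) ut]) (use xH in auto)
      have e: "(\<lambda>y. axis i (\<phi> y)) = (\<lambda>y. \<phi> y *\<^sub>R (axis i 1 :: real^'d))"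
        by (auto simp: fun_eq_iff axis_def vec_eq_iff)
      have ax: "(\<lambda>y. axis i (\<phi> y) :: real^'d) \<in> L2 \<Omega>"
        unfolding e
      proof (rule L2_I)
        show "(\<lambda>y. \<phi> y *\<^sub>R (axis i 1 :: real^'d)) \<in> borel_measurable (lebesgue_on \<Omega>)"
          using L2_measurable[OF t(1)] by measurable
        show "integrable (lebesgue_on \<Omega>) (\<lambda>y. (norm (\<phi> y *\<^sub>R (axis i 1 :: real^'d)))\<^sup>2)"
          using L2_square_integrable[OF t(1)] by simp
      qed
      have 2: "(\<lambda>n. L2_inner \<Omega> (grad \<Omega> (x n)) (\<lambda>y. axis i (\<phi> y))) \<longlonglongrightarrow> L2_inner \<Omega> g (\<lambda>y. axis i (\<phi> y))"
        by (rule G.bounded_functional_tendsto[OF G.ip_bounded_functional[OF ax] _ g(1) gt]) (use xH in auto)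
      have "L2_inner \<Omega> (x n) (partial_deriv i \<phi>) = - L2_inner \<Omega> (grad \<Omega> (x n)) (\<lambda>y. axis i (\<phi> y))" for n
        using H1_D(2)[OF xH(1)[of n]] \<phi> by (simp add: is_weak_gradient_def L2_inner_def inner_axis)
      with 1 have "(\<lambda>n. - L2_inner \<Omega> (grad \<Omega> (x n)) (\<lambda>y. axis i (\<phi> y))) \<longlonglongrightarrow> L2_inner \<Omega> u (partial_deriv i \<phi>)" by simp
      from LIMSEQ_unique[OF this tendsto_minus[OF 2]]
      show "(LINT y|lebesgue_on \<Omega>. u y * partial_deriv i \<phi> y) = - (LINT y|lebesgue_on \<Omega>. (g y $ i) * \<phi> y)"
        by (simp add: L2_inner_def inner_axis)
    qed (rule g(1))
    have uH: "u \<in> H1 \<Omega>" by (rule H1_I[OF u(1) w])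
    have "V_seminorm \<Omega> (x n - u) = L2_norm \<Omega> (grad \<Omega> (x n) - g)" for n
    proof -
      have "L2_norm \<Omega> (grad \<Omega> (x n) - grad \<Omega> u) = L2_norm \<Omega> (grad \<Omega> (x n) - g)"
      proof (rule L2_norm_cong_AE)
        show "AE y in lebesgue_on \<Omega>. (grad \<Omega> (x n) - grad \<Omega> u) y = (grad \<Omega> (x n) - g) y"
          using grad_AE_eq[OF O w] by eventually_elim simp
      qed (use xH uH g(1) H1_D(3) in auto)
      then show ?thesis using gd[OF xH(1) uH] by simp
    qed
    then have "(\<lambda>n. L2_norm \<Omega> (x n - u) + V_seminorm \<Omega> (x n - u)) \<longlonglongrightarrow> 0"
      using tendsto_add[OF u(2) g(2)] by simp
    then have lim: "(\<lambda>n. V_norm \<Omega> (x n - u)) \<longlonglongrightarrow> 0"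
    proof (rule tendsto_zero_dominated)
      show "\<bar>V_norm \<Omega> (x n - u)\<bar> \<le> L2_norm \<Omega> (x n - u) + V_seminorm \<Omega> (x n - u)" for n
        using V_norm_le_sum[of "x n - u"] H1.N_nonneg[of "x n - u"] xH uH by simp
    qed
    have "u \<in> H10 \<Omega>"
    proof (rule H10_closed[OF uH])
      fix e :: real assume "0 < e"
      then have "\<forall>\<^sub>F n in sequentially. V_norm \<Omega> (x n - u) < e" using order_tendstoD(2)[OF lim] by simp
      then obtain n where "V_norm \<Omega> (x n - u) < e" by (auto simp: eventually_sequentially)
      then show "\<exists>w\<in>H10 \<Omega>. V_norm \<Omega> (w - u) < e" using x by blast
    qed
    then show "\<exists>l\<in>H10 \<Omega>. (\<lambda>n. V_norm \<Omega> (x n - l)) \<longlonglongrightarrow> 0" using lim by blast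
  qed
qed

sublocale V: semi_hilbert "H10 \<Omega>" V_inner "V_norm \<Omega>" by (rule semi_hilbert_H10)

text \<open>The inequality passes from test functions to their closure \<open>H10\<close>.\<close>

lemma Poincare: obtains C where "0 < C" "\<And>v. v \<in> H10 \<Omega> \<Longrightarrow> L2_norm \<Omega> v \<le> C * V_seminorm \<Omega> v"
proof -
  obtain R where R: "R > 0" "\<And>x. x \<in> \<Omega> \<Longrightarrow> norm x \<le> R"
    using O(2) by (auto simp: bounded_pos)
  have test: "L2_norm \<Omega> \<phi> \<le> 2 * R * V_seminorm \<Omega> \<phi>" if \<phi>: "\<phi> \<in> test_functions \<Omega>" for \<phi>
  proof (rule power2_le_imp_le)
    fix i :: 'd
    have w: "is_weak_gradient \<Omega> \<phi> (\<lambda>x. \<chi> i. partial_deriv i \<phi> x)" by (rule test_function_weak_gradient[OF O(1) \<phi>])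
    then have wL: "(\<lambda>x. \<chi> i. partial_deriv i \<phi> x) \<in> L2 \<Omega>" by (simp add: is_weak_gradient_def)
    have "(L2_norm \<Omega> \<phi>)\<^sup>2 = (LINT x|lebesgue_on \<Omega>. (\<phi> x)\<^sup>2)" by (simp add: L2_norm_square)
    also have "\<dots> \<le> 4 * R\<^sup>2 * (LINT x|lebesgue_on \<Omega>. (partial_deriv i \<phi> x)\<^sup>2)"
      by (rule Poincare_test[OF O(1) R(2) \<phi>])
    also have "(LINT x|lebesgue_on \<Omega>. (partial_deriv i \<phi> x)\<^sup>2) \<le> (LINT x|lebesgue_on \<Omega>. (norm (\<chi> i. partial_deriv i \<phi> x))\<^sup>2)"
    proof (rule Bochner_Integration.integral_mono)
      show "integrable (lebesgue_on \<Omega>) (\<lambda>x. (partial_deriv i \<phi> x)\<^sup>2)"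
        using L2_square_integrable[OF test_function_L2(2)[OF O(1) \<phi>, of i]] by simp
      show "integrable (lebesgue_on \<Omega>) (\<lambda>x. (norm (\<chi> i. partial_deriv i \<phi> x))\<^sup>2)" by (rule L2_square_integrable[OF wL])
      fix x
      have "\<bar>(\<chi> i. partial_deriv i \<phi> x) $ i\<bar> \<le> norm (\<chi> i. partial_deriv i \<phi> x)" by (rule component_le_norm_cart)
      then have "\<bar>partial_deriv i \<phi> x\<bar>\<^sup>2 \<le> (norm (\<chi> i. partial_deriv i \<phi> x))\<^sup>2" by (intro power_mono) auto
      then show "(partial_deriv i \<phi> x)\<^sup>2 \<le> (norm (\<chi> i. partial_deriv i \<phi> x))\<^sup>2" by simp
    qed
    also have "\<dots> = (V_seminorm \<Omega> \<phi>)\<^sup>2"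
      unfolding L2_norm_square[symmetric] V_seminorm_def
      using L2_norm_cong_AE[OF grad_AE_eq[OF O w] H1_D(3)[OF test_in_H1[OF \<phi>]] wL] by simp
    finally show "(L2_norm \<Omega> \<phi>)\<^sup>2 \<le> (2 * R * V_seminorm \<Omega> \<phi>)\<^sup>2"
      using R(1) by (simp add: power_mult_distrib mult_left_mono)
  qed (use R in auto)
  have "L2_norm \<Omega> v \<le> 2 * R * V_seminorm \<Omega> v" if v: "v \<in> H10 \<Omega>" for v
  proof (rule field_le_epsilon)
    fix e :: real assume e: "0 < e"
    define d where "d = e / (1 + 2 * R)"
    have "0 < d" using e R by (simp add: d_def)
    then obtain \<phi> where \<phi>: "\<phi> \<in> test_functions \<Omega>" "V_norm \<Omega> (\<phi> - v) < d" using H10_approx[OF v] by blast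
    have mem: "\<phi> \<in> H1 \<Omega>" "v \<in> H1 \<Omega>" "\<phi> \<in> L2 \<Omega>" "v \<in> L2 \<Omega>"
      using test_in_H1[OF \<phi>(1)] H10_in_H1[OF v] H1_D by auto
    have "L2_norm \<Omega> v \<le> L2_norm \<Omega> \<phi> + L2_norm \<Omega> (\<phi> - v)"
      using H.reverse_triangle[OF mem(3,4)] by simp
    moreover have "V_seminorm \<Omega> \<phi> \<le> V_seminorm \<Omega> v + V_seminorm \<Omega> (\<phi> - v)"
      using H1g.reverse_triangle[OF mem(1,2)] by simp
    moreover have "2 * R * V_seminorm \<Omega> \<phi> \<le> 2 * R * (V_seminorm \<Omega> v + V_norm \<Omega> (\<phi> - v))"
      using calculation(2) V_seminorm_le_V_norm[of "\<phi> - v"] R(1) by (intro mult_left_mono) auto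
    ultimately have "L2_norm \<Omega> v \<le> 2 * R * V_seminorm \<Omega> v + (1 + 2 * R) * V_norm \<Omega> (\<phi> - v)"
      using test[OF \<phi>(1)] L2_le_V_norm[of "\<phi> - v"] by (simp add: algebra_simps)
    also have "(1 + 2 * R) * V_norm \<Omega> (\<phi> - v) \<le> (1 + 2 * R) * d" using \<phi>(2) R(1) by (intro mult_left_mono) auto
    also have "(1 + 2 * R) * d = e" using R(1) by (simp add: d_def)
    finally show "L2_norm \<Omega> v \<le> 2 * R * V_seminorm \<Omega> v + e" by simp
  qed
  then show ?thesis using R(1) by (intro that[of "2 * R"]) auto
qed

text \<open>A form in the gradients with a bounded symmetric coefficient is bilinear, because gradients are
  unique up to null sets.\<close>

lemma coeff_form_bilinear:
  assumes A: "symmetric_Linfty_field \<Omega> A"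
  shows "symmetric_bilinear_on (H10 \<Omega>) (coeff_form \<Omega> A)"
  unfolding symmetric_bilinear_on_def
proof (intro conjI ballI allI)
  have H: "w \<in> H1 \<Omega>" "grad \<Omega> w \<in> L2 \<Omega>" if "w \<in> H10 \<Omega>" for w using H10_in_H1[OF that] H1_D(3) by auto
  have lin: "coeff_form \<Omega> A (a *\<^sub>R u + b *\<^sub>R v) w = a * coeff_form \<Omega> A u w + b * coeff_form \<Omega> A v w"
    if u: "u \<in> H10 \<Omega>" and v: "v \<in> H10 \<Omega>" and w: "w \<in> H10 \<Omega>" for a b u v w
  proof -
    have i: "integrable (lebesgue_on \<Omega>) (\<lambda>x. (A x *v grad \<Omega> u x) \<bullet> grad \<Omega> w x)"
       "integrable (lebesgue_on \<Omega>) (\<lambda>x. (A x *v grad \<Omega> v x) \<bullet> grad \<Omega> w x)"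
      "integrable (lebesgue_on \<Omega>) (\<lambda>x. (A x *v grad \<Omega> (a *\<^sub>R u + b *\<^sub>R v) x) \<bullet> grad \<Omega> w x)"
      using coeff_form_integrable[OF A] H u v w V.mem_simps by auto
    have "coeff_form \<Omega> A (a *\<^sub>R u + b *\<^sub>R v) w = (LINT x|lebesgue_on \<Omega>. a * ((A x *v grad \<Omega> u x) \<bullet> grad \<Omega> w x) + b * ((A x *v grad \<Omega> v x) \<bullet> grad \<Omega> w x))"
      unfolding coeff_form_def
    proof (rule integral_cong_AE)
      show "AE x in lebesgue_on \<Omega>. (A x *v grad \<Omega> (a *\<^sub>R u + b *\<^sub>R v) x) \<bullet> grad \<Omega> w x =
          a * ((A x *v grad \<Omega> u x) \<bullet> grad \<Omega> w x) + b * ((A x *v grad \<Omega> v x) \<bullet> grad \<Omega> w x)"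
        using grad_lincomb_AE(2)[OF H(1)[OF u] H(1)[OF v], of a b]
        by eventually_elim (simp add: matrix_vector_right_distrib matrix_vector_mult_scaleR inner_add_left)
    qed (use i in auto)
    also have "\<dots> = a * coeff_form \<Omega> A u w + b * coeff_form \<Omega> A v w"
      unfolding coeff_form_def using i by simp
    finally show ?thesis .
  qed
  show "coeff_form \<Omega> A (u + v) w = coeff_form \<Omega> A u w + coeff_form \<Omega> A v w"
    if "u \<in> H10 \<Omega>" "v \<in> H10 \<Omega>" "w \<in> H10 \<Omega>" for u v w using lin[OF that, of 1 1] by simp
  show "coeff_form \<Omega> A (c *\<^sub>R u) w = c * coeff_form \<Omega> A u w"
    if "u \<in> H10 \<Omega>" "w \<in> H10 \<Omega>" for u w c using lin[OF that(1) that(1,2), of c 0] by simp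
  show "coeff_form \<Omega> A u w = coeff_form \<Omega> A w u" if u: "u \<in> H10 \<Omega>" and w: "w \<in> H10 \<Omega>" for u w
    unfolding coeff_form_def
  proof (rule integral_cong_AE)
    have "AE x in lebesgue_on \<Omega>. transpose (A x) = A x" using A by (simp add: symmetric_Linfty_field_def)
    then show "AE x in lebesgue_on \<Omega>. (A x *v grad \<Omega> u x) \<bullet> grad \<Omega> w x = (A x *v grad \<Omega> w x) \<bullet> grad \<Omega> u x"
      by eventually_elim (metis dot_lmul_matrix inner_commute vector_transpose_matrix)
  qed (use coeff_form_integrable[OF A H(2)[OF u] H(2)[OF w]] coeff_form_integrable[OF A H(2)[OF w] H(2)[OF u]] in auto)
qed

end

section \<open>The memory space and the product space\<close>

lemma tendsto_zero_of_square:
  fixes f :: "nat \<Rightarrow> real"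
  assumes "(\<lambda>n. (f n)\<^sup>2) \<longlonglongrightarrow> 0" shows "f \<longlonglongrightarrow> 0"
proof -
  have "(\<lambda>n. sqrt ((f n)\<^sup>2)) \<longlonglongrightarrow> sqrt 0" by (rule tendsto_real_sqrt[OF assms])
  then have "(\<lambda>n. \<bar>f n\<bar>) \<longlonglongrightarrow> 0" by simp
  then show ?thesis by (rule tendsto_rabs_zero_cancel)
qed

context semi_hilbert
begin

definition BL2 :: "'c measure \<Rightarrow> ('c \<Rightarrow> 'b) set" where
  "BL2 M = {\<zeta>. strongly_measurable_in M S N \<zeta> \<and> (\<integral>\<^sup>+l. ennreal (ip (\<zeta> l) (\<zeta> l)) \<partial>M) < \<infinity>}"

text \<open>A pointwise inner product need only be measurable for the completed measure.\<close>

definition BL2_inner :: "'c measure \<Rightarrow> ('c \<Rightarrow> 'b) \<Rightarrow> ('c \<Rightarrow> 'b) \<Rightarrow> real" where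
  "BL2_inner M \<zeta> \<eta> = (LINT l|completion M. ip (\<zeta> l) (\<eta> l))"

lemma BL2_strongly: "\<zeta> \<in> BL2 M \<Longrightarrow> strongly_measurable_in M S N \<zeta>"
  by (simp add: BL2_def)

lemma BL2_AE: "\<zeta> \<in> BL2 M \<Longrightarrow> AE l in completion M. \<zeta> l \<in> S"
  unfolding BL2_def strongly_measurable_in_def by (intro AE_completion) simp

lemma nn_integral_ip_eq:
  assumes "strongly_measurable_in M S N \<zeta>"
  shows "(\<integral>\<^sup>+l. ennreal (ip (\<zeta> l) (\<zeta> l)) \<partial>M) = (\<integral>\<^sup>+l. ennreal ((N (\<zeta> l))\<^sup>2) \<partial>M)"
proof (rule nn_integral_cong_AE)
  have "AE l in M. \<zeta> l \<in> S" using assms by (simp add: strongly_measurable_in_def)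
  then show "AE l in M. ennreal (ip (\<zeta> l) (\<zeta> l)) = ennreal ((N (\<zeta> l))\<^sup>2)"
    by eventually_elim (simp add: N_square)
qed

lemma strongly_measurable_ip:
  assumes f: "strongly_measurable_in M S N f" and g: "strongly_measurable_in M S N g"
  shows "(\<lambda>l. ip (f l) (g l)) \<in> borel_measurable (completion M)"
proof (rule measurable_completion_AE)
  have [measurable]: "(\<lambda>l. N (f l + g l)) \<in> borel_measurable (completion M)" "(\<lambda>l. N (f l - g l)) \<in> borel_measurable (completion M)"
    by (intro strongly_measurable_norm strongly_measurable_add strongly_measurable_diff f g)+
  show "(\<lambda>l. ((N (f l + g l))\<^sup>2 - (N (f l - g l))\<^sup>2) / 4) \<in> borel_measurable (completion M)"
    by measurable
  have "AE l in M. f l \<in> S" "AE l in M. g l \<in> S" using f g by (auto simp: strongly_measurable_in_def)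
  then show "AE l in M. ip (f l) (g l) = ((N (f l + g l))\<^sup>2 - (N (f l - g l))\<^sup>2) / 4"
    by eventually_elim (simp add: N_square ip_self_add ip_self_diff)
qed

lemma BL2_integrable:
  assumes f: "f \<in> BL2 M" and g: "g \<in> BL2 M"
  shows "integrable (completion M) (\<lambda>l. ip (f l) (g l))"
proof -
  have sq: "integrable (completion M) (\<lambda>l. (N (h l))\<^sup>2)" if h: "h \<in> BL2 M" for h
  proof (rule integrableI_bounded)
    show "(\<lambda>l. (N (h l))\<^sup>2) \<in> borel_measurable (completion M)"
      using strongly_measurable_norm[OF BL2_strongly[OF h]] by measurable
    show "(\<integral>\<^sup>+l. ennreal (norm ((N (h l))\<^sup>2)) \<partial>completion M) < \<infinity>"
      using h nn_integral_ip_eq[OF BL2_strongly[OF h]] by (simp add: BL2_def nn_integral_completion)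
  qed
  show ?thesis
  proof (rule Bochner_Integration.integrable_bound)
    show "integrable (completion M) (\<lambda>l. (N (f l))\<^sup>2 + (N (g l))\<^sup>2)"
      by (intro Bochner_Integration.integrable_add sq f g)
    show "(\<lambda>l. ip (f l) (g l)) \<in> borel_measurable (completion M)"
      by (intro strongly_measurable_ip BL2_strongly f g)
    show "AE l in completion M. norm (ip (f l) (g l)) \<le> norm ((N (f l))\<^sup>2 + (N (g l))\<^sup>2)"
      using BL2_AE[OF f] BL2_AE[OF g]
    proof eventually_elim
      case (elim l)
      have "\<bar>ip (f l) (g l)\<bar> \<le> N (f l) * N (g l)" by (rule Cauchy_Schwarz[OF elim])
      also have "\<dots> \<le> (N (f l))\<^sup>2 + (N (g l))\<^sup>2"
      proof -
        have "2 * (N (f l) * N (g l)) \<le> (N (f l))\<^sup>2 + (N (g l))\<^sup>2"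
          using sum_squares_bound[of "N (f l)" "N (g l)"] by simp
        moreover have "0 \<le> N (f l) * N (g l)" using elim by simp
        ultimately show ?thesis by linarith
      qed
      finally show ?case by simp
    qed
  qed
qed

lemma BL2_nn_integral:
  assumes f: "f \<in> BL2 M"
  shows "(\<integral>\<^sup>+l. ennreal (ip (f l) (f l)) \<partial>M) = ennreal (BL2_inner M f f)" "0 \<le> BL2_inner M f f"
proof -
  have ae: "AE l in completion M. 0 \<le> ip (f l) (f l)" using BL2_AE[OF f] by eventually_elim (simp add: nonneg)
  show "(\<integral>\<^sup>+l. ennreal (ip (f l) (f l)) \<partial>M) = ennreal (BL2_inner M f f)"
    unfolding BL2_inner_def using nn_integral_eq_integral[OF BL2_integrable[OF f f] ae]
    by (simp add: nn_integral_completion)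
  show "0 \<le> BL2_inner M f f"
    unfolding BL2_inner_def using ae by (rule integral_nonneg_AE)
qed

lemma BL2_K_norm:
  fixes M :: "real measure"
  assumes "f \<in> BL2 M" shows "K_norm ip M f = sqrt (BL2_inner M f f)"
  unfolding K_norm_def using BL2_nn_integral[OF assms] by simp

lemma BL2_lincomb:
  assumes f: "f \<in> BL2 M" and g: "g \<in> BL2 M"
  shows "a *\<^sub>R f + b *\<^sub>R g \<in> BL2 M"
proof -
  have e: "a *\<^sub>R f + b *\<^sub>R g = (\<lambda>l. a *\<^sub>R f l + b *\<^sub>R g l)" by (auto simp: plus_fun_def scaleR_fun_def)
  have sm: "strongly_measurable_in M S N (\<lambda>l. a *\<^sub>R f l + b *\<^sub>R g l)"
    by (rule strongly_measurable_lincomb[OF BL2_strongly[OF f] BL2_strongly[OF g]])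
  have i: "integrable (completion M) (\<lambda>l. a\<^sup>2 * ip (f l) (f l) + 2 * a * b * ip (f l) (g l) + b\<^sup>2 * ip (g l) (g l))"
    using BL2_integrable f g by (intro Bochner_Integration.integrable_add integrable_mult_right) auto
  have "(\<integral>\<^sup>+l. ennreal (ip (a *\<^sub>R f l + b *\<^sub>R g l) (a *\<^sub>R f l + b *\<^sub>R g l)) \<partial>completion M)
     \<le> (\<integral>\<^sup>+l. ennreal (norm (a\<^sup>2 * ip (f l) (f l) + 2 * a * b * ip (f l) (g l) + b\<^sup>2 * ip (g l) (g l))) \<partial>completion M)"
    using BL2_AE[OF f] BL2_AE[OF g]
  proof (intro nn_integral_mono_AE, eventually_elim)
    case (elim l)
    have "ip (a *\<^sub>R f l + b *\<^sub>R g l) (a *\<^sub>R f l + b *\<^sub>R g l)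
        = a\<^sup>2 * ip (f l) (f l) + 2 * a * b * ip (f l) (g l) + b\<^sup>2 * ip (g l) (g l)"
      using elim by (simp add: ip_self_add ip_scale_left ip_scale_right power2_eq_square)
    then show ?case by (simp add: ennreal_leI)
  qed
  also have "\<dots> < \<infinity>" using i by (simp add: integrable_iff_bounded)
  finally show ?thesis unfolding BL2_def using sm by (simp add: nn_integral_completion e)
qed

text \<open>For the form \<open>a1\<close> on \<open>H10\<close> and the measure \<open>\<nu>\<close> this is the memory space.\<close>

lemma semi_hilbert_BL2:
  fixes M :: "real measure"
  assumes fin: "finite_measure M"
  shows "semi_hilbert (BL2 M) (BL2_inner M) (K_norm ip M)"
proof -
  interpret K: semi_inner "BL2 M" "BL2_inner M" "K_norm ip M"
  proof
    have "0 \<in> BL2 M"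
      unfolding BL2_def using strongly_measurable_const[of 0 M] ip_zero_left[of 0 0 0] by (simp add: zero_fun_def)
    then show "subspace (BL2 M)"
    proof (rule subspaceI)
      show "f + g \<in> BL2 M" if "f \<in> BL2 M" "g \<in> BL2 M" for f g
        using BL2_lincomb[OF that, of 1 1] by simp
      show "c *\<^sub>R f \<in> BL2 M" if "f \<in> BL2 M" for c f
        using BL2_lincomb[OF that that, of c 0] by simp
    qed
    show "symmetric_bilinear_on (BL2 M) (BL2_inner M)"
      unfolding symmetric_bilinear_on_def
    proof (intro conjI ballI allI)
      fix f g assume f: "f \<in> BL2 M" and g: "g \<in> BL2 M"
      note i = BL2_integrable
      show "BL2_inner M f g = BL2_inner M g f"
        unfolding BL2_inner_def
      proof (rule integral_cong_AE)
        show "AE l in completion M. ip (f l) (g l) = ip (g l) (f l)"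
          using BL2_AE[OF f] BL2_AE[OF g] by eventually_elim (use ip_commute in blast)
      qed (use i f g in auto)
      fix h assume h: "h \<in> BL2 M"
      have fg: "f + g \<in> BL2 M" using BL2_lincomb[OF f g, of 1 1] by simp
      have "BL2_inner M (f + g) h = (LINT l|completion M. ip (f l) (h l) + ip (g l) (h l))"
        unfolding BL2_inner_def
      proof (rule integral_cong_AE)
        show "AE l in completion M. ip ((f + g) l) (h l) = ip (f l) (h l) + ip (g l) (h l)"
          using BL2_AE[OF f] BL2_AE[OF g] BL2_AE[OF h] by eventually_elim (simp add: ip_add_left)
      qed (use i[OF fg h] i[OF f h] i[OF g h] in auto)
      then show "BL2_inner M (f + g) h = BL2_inner M f h + BL2_inner M g h"
        unfolding BL2_inner_def using i[OF f h] i[OF g h] by simp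
    next
      fix c f h assume f: "f \<in> BL2 M" and h: "h \<in> BL2 M"
      have cf: "c *\<^sub>R f \<in> BL2 M" using BL2_lincomb[OF f f, of c 0] by simp
      have "BL2_inner M (c *\<^sub>R f) h = (LINT l|completion M. c * ip (f l) (h l))"
        unfolding BL2_inner_def
      proof (rule integral_cong_AE)
        show "AE l in completion M. ip ((c *\<^sub>R f) l) (h l) = c * ip (f l) (h l)"
          using BL2_AE[OF f] BL2_AE[OF h] by eventually_elim (simp add: ip_scale_left scaleR_fun_def)
      qed (use BL2_integrable[OF cf h] BL2_integrable[OF f h] in auto)
      then show "BL2_inner M (c *\<^sub>R f) h = c * BL2_inner M f h" unfolding BL2_inner_def by simp
    qed
  qed (auto intro: BL2_nn_integral BL2_K_norm)
  have sq: "(\<integral>\<^sup>+l. ennreal ((N (f l))\<^sup>2) \<partial>M) = ennreal ((K_norm ip M f)\<^sup>2)" if f: "f \<in> BL2 M" for f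
    using nn_integral_ip_eq[OF BL2_strongly[OF f]] BL2_nn_integral[OF f] K.N_square[OF f] by simp
  show ?thesis
  proof
    fix x :: "nat \<Rightarrow> real \<Rightarrow> 'b"
    assume x: "\<And>n. x n \<in> BL2 M" and cauchy: "\<And>e. e > 0 \<Longrightarrow> \<exists>k. \<forall>m\<ge>k. \<forall>n\<ge>k. K_norm ip M (x m - x n) < e"
    obtain g where g: "strongly_measurable_in M S N g"
      "(\<integral>\<^sup>+l. ennreal ((N (g l))\<^sup>2) \<partial>M) < \<infinity>"
      "(\<lambda>n. \<integral>\<^sup>+l. ennreal ((N (x n l - g l))\<^sup>2) \<partial>M) \<longlonglongrightarrow> 0"
    proof (rule Bochner_L2_complete[OF fin BL2_strongly[OF x]])
      show "(\<integral>\<^sup>+l. ennreal ((N (x n l))\<^sup>2) \<partial>M) < \<infinity>" for n by (simp add: sq[OF x])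
      fix e :: real assume e: "e > 0"
      then obtain k where k: "\<forall>m\<ge>k. \<forall>n\<ge>k. K_norm ip M (x m - x n) < sqrt e" using cauchy[of "sqrt e"] by auto
      have "(\<integral>\<^sup>+l. ennreal ((N (x m l - x n l))\<^sup>2) \<partial>M) < ennreal e" if "m \<ge> k" "n \<ge> k" for m n
      proof -
        have d: "x m - x n \<in> BL2 M" using x by auto
        have "(K_norm ip M (x m - x n))\<^sup>2 < (sqrt e)\<^sup>2" using k that K.N_nonneg[OF d] by (intro power_strict_mono) auto
        then show ?thesis using sq[OF d] e by (simp add: ennreal_less_iff)
      qed
      then show "\<exists>k. \<forall>m\<ge>k. \<forall>n\<ge>k. (\<integral>\<^sup>+l. ennreal ((N (x m l - x n l))\<^sup>2) \<partial>M) < ennreal e" by blast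
    qed
    have gB: "g \<in> BL2 M" using g(1,2) nn_integral_ip_eq[OF g(1)] by (simp add: BL2_def)
    have "(\<lambda>n. ennreal ((K_norm ip M (x n - g))\<^sup>2)) \<longlonglongrightarrow> ennreal 0"
      using g(3) sq[OF K.memS(3)[OF x gB]] by simp
    then have "(\<lambda>n. (K_norm ip M (x n - g))\<^sup>2) \<longlonglongrightarrow> 0"
      by (subst (asm) tendsto_ennreal_iff) auto
    from tendsto_zero_of_square[OF this] gB
    show "\<exists>l\<in>BL2 M. (\<lambda>n. K_norm ip M (x n - l)) \<longlonglongrightarrow> 0" by blast
  qed
qed

end

lemma semi_hilbert_product:
  assumes A: "semi_hilbert A ipA NA" and B: "semi_hilbert B ipB NB"
  shows "semi_hilbert (A \<times> B) (\<lambda>x y. ipA (fst x) (fst y) + ipB (snd x) (snd y)) (\<lambda>x. sqrt ((NA (fst x))\<^sup>2 + (NB (snd x))\<^sup>2))"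
proof -
  interpret A: semi_hilbert A ipA NA by (rule A)
  interpret B: semi_hilbert B ipB NB by (rule B)
  let ?N = "\<lambda>x. sqrt ((NA (fst x))\<^sup>2 + (NB (snd x))\<^sup>2)"
  show ?thesis
  proof
    show "subspace (A \<times> B)" by (rule subspaceI) (auto simp: zero_prod_def)
    show "symmetric_bilinear_on (A \<times> B) (\<lambda>x y. ipA (fst x) (fst y) + ipB (snd x) (snd y))"
      unfolding symmetric_bilinear_on_def
    proof (intro conjI ballI allI)
      fix x y assume "x \<in> A \<times> B" "y \<in> A \<times> B"
      then show "ipA (fst x) (fst y) + ipB (snd x) (snd y) = ipA (fst y) (fst x) + ipB (snd y) (snd x)"
        using A.ip_commute[of "fst x" "fst y"] B.ip_commute[of "snd x" "snd y"] by auto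
    next
      fix x y z assume "x \<in> A \<times> B" "y \<in> A \<times> B" "z \<in> A \<times> B"
      then show "ipA (fst (x + y)) (fst z) + ipB (snd (x + y)) (snd z) =
          ipA (fst x) (fst z) + ipB (snd x) (snd z) + (ipA (fst y) (fst z) + ipB (snd y) (snd z))"
        by (auto simp: A.ip_add_left B.ip_add_left)
    next
      fix c x z assume "x \<in> A \<times> B" "z \<in> A \<times> B"
      then show "ipA (fst (c *\<^sub>R x)) (fst z) + ipB (snd (c *\<^sub>R x)) (snd z) = c * (ipA (fst x) (fst z) + ipB (snd x) (snd z))"
        by (auto simp: A.ip_scale_left B.ip_scale_left algebra_simps)
    qed
    show "0 \<le> ipA (fst x) (fst x) + ipB (snd x) (snd x)" if "x \<in> A \<times> B" for x
      using that A.nonneg B.nonneg by auto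
    show "?N x = sqrt (ipA (fst x) (fst x) + ipB (snd x) (snd x))" if "x \<in> A \<times> B" for x
      using that by (auto simp: A.N_square B.N_square)
    fix x :: "nat \<Rightarrow> 'a \<times> 'b"
    assume x: "\<And>n. x n \<in> A \<times> B" and c: "\<And>e. e > 0 \<Longrightarrow> \<exists>k. \<forall>m\<ge>k. \<forall>n\<ge>k. ?N (x m - x n) < e"
    have mem: "fst (x n) \<in> A" "snd (x n) \<in> B" for n using x[of n] by auto
    have le: "NA (fst y) \<le> ?N y" "NB (snd y) \<le> ?N y" for y by auto
    have "\<exists>l\<in>A. (\<lambda>n. NA (fst (x n) - l)) \<longlonglongrightarrow> 0"
    proof (rule A.complete[OF mem(1)])
      fix e :: real assume "e > 0"
      then obtain k where k: "\<forall>m\<ge>k. \<forall>n\<ge>k. ?N (x m - x n) < e" using c by blast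
      have "NA (fst (x m) - fst (x n)) < e" if "m \<ge> k" "n \<ge> k" for m n
        using le_less_trans[OF le(1)[of "x m - x n"] k[rule_format, OF that]] by simp
      then show "\<exists>k. \<forall>m\<ge>k. \<forall>n\<ge>k. NA (fst (x m) - fst (x n)) < e" by blast
    qed
    then obtain a where a: "a \<in> A" "(\<lambda>n. NA (fst (x n) - a)) \<longlonglongrightarrow> 0" by blast
    have "\<exists>l\<in>B. (\<lambda>n. NB (snd (x n) - l)) \<longlonglongrightarrow> 0"
    proof (rule B.complete[OF mem(2)])
      fix e :: real assume "e > 0"
      then obtain k where k: "\<forall>m\<ge>k. \<forall>n\<ge>k. ?N (x m - x n) < e" using c by blast
      have "NB (snd (x m) - snd (x n)) < e" if "m \<ge> k" "n \<ge> k" for m n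
        using le_less_trans[OF le(2)[of "x m - x n"] k[rule_format, OF that]] by simp
      then show "\<exists>k. \<forall>m\<ge>k. \<forall>n\<ge>k. NB (snd (x m) - snd (x n)) < e" by blast
    qed
    then obtain b where b: "b \<in> B" "(\<lambda>n. NB (snd (x n) - b)) \<longlonglongrightarrow> 0" by blast
    have "(\<lambda>n. sqrt ((NA (fst (x n) - a))\<^sup>2 + (NB (snd (x n) - b))\<^sup>2)) \<longlonglongrightarrow> sqrt (0\<^sup>2 + 0\<^sup>2)"
      by (intro tendsto_real_sqrt tendsto_add tendsto_power a b)
    then show "\<exists>l\<in>A \<times> B. (\<lambda>n. ?N (x n - l)) \<longlonglongrightarrow> 0"
      using a(1) b(1) by (intro bexI[of _ "(a, b)"]) auto
  qed
qed

section \<open>Integrals over intervals\<close>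

lemma AE_lebesgue_on_iff:
  "S \<in> sets lebesgue \<Longrightarrow> (AE x in lebesgue_on S. P x) \<longleftrightarrow> (AE x in lebesgue. x \<in> S \<longrightarrow> P x)"
  by (subst AE_restrict_space_iff) auto

lemma AE_lebesgue_on_neq: "S \<in> sets lebesgue \<Longrightarrow> AE s in lebesgue_on S. s \<noteq> (c::real)"
proof -
  assume S: "S \<in> sets lebesgue"
  have "AE s in lebesgue. s \<noteq> c" by (rule AE_completion[OF AE_lborel_singleton])
  then show ?thesis unfolding AE_lebesgue_on_iff[OF S] by eventually_elim simp
qed

lemma AE_lebesgue_on_subset:
  assumes "AE x in lebesgue_on A. P x" "B \<subseteq> A" "A \<in> sets lebesgue" "B \<in> sets lebesgue"
  shows "AE x in lebesgue_on B. P x"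
proof -
  have "AE x in lebesgue. x \<in> A \<longrightarrow> P x" using assms by (simp add: AE_lebesgue_on_iff)
  then have "AE x in lebesgue. x \<in> B \<longrightarrow> P x" by eventually_elim (use assms(2) in blast)
  then show ?thesis using assms by (simp add: AE_lebesgue_on_iff)
qed

lemma nn_integral_lebesgue_on_subset:
  assumes "B \<subseteq> A" "A \<in> sets lebesgue" "B \<in> sets lebesgue"
  shows "(\<integral>\<^sup>+x. f x \<partial>lebesgue_on B) \<le> (\<integral>\<^sup>+x. f x \<partial>lebesgue_on A)"
  using assms by (simp add: nn_integral_restrict_space indicator_def) (intro nn_integral_mono, auto)

lemma integrable_lebesgue_on_subset:
  fixes f :: "real \<Rightarrow> real"
  assumes f: "integrable (lebesgue_on A) f" and s: "B \<subseteq> A" "A \<in> sets lebesgue" "B \<in> sets lebesgue"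
  shows "integrable (lebesgue_on B) f"
proof -
  have "set_integrable lebesgue A f" using f s(2) by (simp add: integrable_restrict_space set_integrable_def)
  then have "set_integrable lebesgue B f" by (rule set_integrable_subset[OF _ s(3) s(1)])
  then show ?thesis using s(3) by (simp add: integrable_restrict_space set_integrable_def)
qed

lemma LINT_interval_combine:
  fixes f :: "real \<Rightarrow> real"
  assumes f: "integrable (lebesgue_on {a..c}) f" and ab: "a \<le> b" "b \<le> c"
  shows "(LINT x|lebesgue_on {a..c}. f x) = (LINT x|lebesgue_on {a..b}. f x) + (LINT x|lebesgue_on {b..c}. f x)"
proof -
  have i: "integrable (lebesgue_on {a..b}) f" "integrable (lebesgue_on {b..c}) f"
    using ab by (auto intro!: integrable_lebesgue_on_subset[OF f])
  have "f integrable_on {a..c}" using f by (auto intro: integrable_on_lebesgue_on)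
  from Henstock_Kurzweil_Integration.integral_combine[OF ab this]
  show ?thesis using f i by (simp add: lebesgue_integral_eq_integral)
qed

lemma LINT_continuous:
  fixes g :: "real \<Rightarrow> real"
  assumes "continuous_on {a..b} g"
  shows "integrable (lebesgue_on {a..b}) g" "(LINT x|lebesgue_on {a..b}. g x) = integral {a..b} g"
proof -
  show "integrable (lebesgue_on {a..b}) g"
    using absolutely_integrable_continuous_real[OF assms] by (simp add: integrable_restrict_space set_integrable_def)
  then show "(LINT x|lebesgue_on {a..b}. g x) = integral {a..b} g" by (simp add: lebesgue_integral_eq_integral)
qed

lemma integral_translate:
  fixes g :: "real \<Rightarrow> real"
  assumes "continuous_on {a+h..b+h} g"
  shows "integral {a+h..b+h} g = integral {a..b} (\<lambda>s. g (s + h))"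
proof -
  have "(g has_integral integral {a+h..b+h} g) (cbox (a + h) (b + h))"
    using assms by (auto intro!: integrable_integral integrable_continuous_real)
  from has_integral_affinity'[OF this, of 1 h]
  have "((\<lambda>x. g (x + h)) has_integral integral {a+h..b+h} g) {a..b}" by simp
  from integral_unique[OF this] show ?thesis by simp
qed

lemma integral_shift_diff:
  fixes g :: "real \<Rightarrow> real"
  assumes g: "continuous_on {0..t+k} g" and tk: "0 \<le> t" "0 \<le> k"
  shows "integral {0..t} (\<lambda>s. g (s + k) - g s) = integral {t..t+k} g - integral {0..k} g"
proof -
  have c1: "continuous_on {0..t} (\<lambda>s. g (s + k))"
    by (rule continuous_on_compose2[OF g]) (use tk in \<open>auto intro!: continuous_intros\<close>)
  have c2: "continuous_on {0..t} g" using g tk by (auto intro: continuous_on_subset)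
  have i: "g integrable_on {0..t+k}" using g by (rule integrable_continuous_real)
  have "integral {0..t} (\<lambda>s. g (s + k)) = integral {k..t+k} g"
  proof -
    have "((\<lambda>x. g x) has_integral integral {k..t+k} g) (cbox (0 + k) (t + k))"
      using g tk by (auto intro!: integrable_integral integrable_continuous_real intro: continuous_on_subset)
    from has_integral_affinity'[OF this, of 1 k]
    have "((\<lambda>x. g (x + k)) has_integral integral {k..t+k} g) {0..t}" by simp
    then show ?thesis by (rule integral_unique)
  qed
  moreover have "integral {0..t} (\<lambda>s. g (s + k) - g s) = integral {0..t} (\<lambda>s. g (s + k)) - integral {0..t} g"
    using c1 c2 by (intro Henstock_Kurzweil_Integration.integral_diff integrable_continuous_real)
  moreover have "integral {0..k} g + integral {k..t+k} g = integral {0..t+k} g"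
    using i tk by (intro Henstock_Kurzweil_Integration.integral_combine) auto
  moreover have "integral {0..t} g + integral {t..t+k} g = integral {0..t+k} g"
    using i tk by (intro Henstock_Kurzweil_Integration.integral_combine) auto
  ultimately show ?thesis by simp
qed

lemma integral_near_const:
  fixes g :: "real \<Rightarrow> real"
  assumes g: "continuous_on {a..a+k} g" and k: "0 \<le> k" and bd: "\<And>s. s \<in> {a..a+k} \<Longrightarrow> \<bar>g s - c\<bar> \<le> B"
  shows "\<bar>integral {a..a+k} g - k * c\<bar> \<le> k * B"
proof -
  have "integral {a..a+k} g - k * c = integral {a..a+k} (\<lambda>s. g s - c)"
    using g k by (subst Henstock_Kurzweil_Integration.integral_diff) (auto intro: integrable_continuous_real)
  moreover have "norm (integral {a..a+k} (\<lambda>s. g s - c)) \<le> B * (a + k - a)"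
    by (rule integral_bound) (use g k bd in \<open>auto intro!: continuous_intros\<close>)
  ultimately show ?thesis by (simp add: mult.commute)
qed

lemma absolutely_continuous_primitive:
  fixes f :: "real \<Rightarrow> real"
  assumes f: "integrable (lebesgue_on {0..T}) f"
  shows "continuous_on {0..T} (\<lambda>t. LINT x|lebesgue_on {0..t}. f x)"
proof -
  have "continuous_on {0..T} (\<lambda>t. integral {0..t} f)"
    using f by (intro indefinite_integral_continuous_1 integrable_on_lebesgue_on) auto
  then show ?thesis
  proof (rule continuous_on_eq)
    show "integral {0..t} f = (LINT x|lebesgue_on {0..t}. f x)" if "t \<in> {0..T}" for t
      using that integrable_lebesgue_on_subset[OF f, of "{0..t}"] by (intro lebesgue_integral_eq_integral[symmetric]) auto
  qed
qed

section \<open>Mild solutions\<close>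

lemma (in seminormed_space) strongly_measurable_lebesgue_on_subset:
  fixes f :: "'a::euclidean_space \<Rightarrow> 'b"
  assumes f: "strongly_measurable_in (lebesgue_on A) S N f" and s: "B \<subseteq> A" "A \<in> sets lebesgue" "B \<in> sets lebesgue"
  shows "strongly_measurable_in (lebesgue_on B) S N f"
proof -
  obtain t where t: "\<forall>i::nat. simple_function (lebesgue_on A) (t i)" "\<forall>i. t i ` space (lebesgue_on A) \<subseteq> S"
    "AE x in lebesgue_on A. (\<lambda>i. N (f x - t i x)) \<longlonglongrightarrow> 0" "AE x in lebesgue_on A. f x \<in> S"
    by (rule strongly_measurableE[OF f])
  show ?thesis
  proof (rule strongly_measurableI[where s=t])
    fix i
    have fin: "finite (t i ` A)" and ms: "\<And>y. y \<in> t i ` A \<Longrightarrow> t i -` {y} \<inter> A \<in> sets (lebesgue_on A)"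
      using t(1)[rule_format, of i] by (auto simp: simple_function_def)
    have "t i -` {y} \<inter> B \<in> sets (lebesgue_on B)" if "y \<in> t i ` B" for y
    proof -
      have "t i -` {y} \<inter> A \<in> sets lebesgue"
        using ms[of y] that s by (auto simp: sets_restrict_space_iff)
      then have "(t i -` {y} \<inter> A) \<inter> B \<in> sets lebesgue" using s(3) by (rule sets.Int)
      moreover have "(t i -` {y} \<inter> A) \<inter> B = t i -` {y} \<inter> B" using s(1) by blast
      ultimately show ?thesis using s(3) by (simp add: sets_restrict_space_iff)
    qed
    moreover have "finite (t i ` B)" using fin s(1) by (meson finite_subset image_mono)
    ultimately show "simple_function (lebesgue_on B) (t i)" by (simp add: simple_function_def)
    show "t i ` space (lebesgue_on B) \<subseteq> S" using t(2) s(1) by fastforce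
  qed (use t(3,4) s AE_lebesgue_on_subset in blast)+
qed

lemma (in seminormed_space) simple_norm_integrable:
  assumes fin: "finite_measure M" and s: "simple_function M s" "s ` space M \<subseteq> S"
  shows "(\<integral>\<^sup>+x. ennreal (N (s x)) \<partial>M) < \<infinity>"
proof -
  interpret finite_measure M by (rule fin)
  have "Bochner_Integration.simple_bochner_integrable M (\<lambda>x. N (s x))"
    using simple_function_compose1[OF s(1), of N] by (intro Bochner_Integration.simple_bochner_integrable.intros) auto
  then have "integrable M (\<lambda>x. N (s x))" by (rule integrableI_simple_bochner_integrable)
  then have "(\<integral>\<^sup>+x. ennreal (norm (N (s x))) \<partial>M) < \<infinity>" by (simp add: integrable_iff_bounded)
  moreover have "(\<integral>\<^sup>+x. ennreal (N (s x)) \<partial>M) \<le> (\<integral>\<^sup>+x. ennreal (norm (N (s x))) \<partial>M)"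
    by (intro nn_integral_mono ennreal_leI) simp
  ultimately show ?thesis by (rule le_less_trans[rotated])
qed

text \<open>The largest multiple of \<open>1 / Suc n\<close> that does not exceed \<open>s\<close>.\<close>

definition grid :: "nat \<Rightarrow> real \<Rightarrow> real" where
  "grid n s = real_of_int \<lfloor>s * real (Suc n)\<rfloor> / real (Suc n)"

lemma grid_bounds: "grid n s \<le> s" "s - 1 / real (Suc n) < grid n s" "0 \<le> s \<Longrightarrow> 0 \<le> grid n s"
proof -
  have c: "0 < real (Suc n)" by simp
  have f: "real_of_int \<lfloor>s * real (Suc n)\<rfloor> \<le> s * real (Suc n)" "s * real (Suc n) < real_of_int \<lfloor>s * real (Suc n)\<rfloor> + 1"
    by linarith+
  show "grid n s \<le> s" unfolding grid_def using f(1) by (simp add: pos_divide_le_eq[OF c] del: of_nat_Suc)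
  have "s < (real_of_int \<lfloor>s * real (Suc n)\<rfloor> + 1) / real (Suc n)"
    using f(2) by (simp add: pos_less_divide_eq[OF c] del: of_nat_Suc)
  then show "s - 1 / real (Suc n) < grid n s" unfolding grid_def add_divide_distrib by linarith
  assume "0 \<le> s"
  then have "0 \<le> s * real (Suc n)" by simp
  then have "0 \<le> \<lfloor>s * real (Suc n)\<rfloor>" by (simp del: of_nat_Suc)
  then show "0 \<le> grid n s" unfolding grid_def by (simp del: of_nat_Suc)
qed

lemma grid_tendsto: "(\<lambda>n. grid n s) \<longlonglongrightarrow> s"
proof (rule LIM_zero_cancel, rule tendsto_zero_dominated[OF LIMSEQ_inverse_real_of_nat])
  show "\<bar>grid n s - s\<bar> \<le> inverse (real (Suc n))" for n
    using grid_bounds(1,2)[where n=n and s=s] by (simp add: inverse_eq_divide)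
qed

lemma simple_function_grid:
  fixes g :: "real \<Rightarrow> real"
  assumes g: "continuous_on {a..b} g" and bd: "\<And>s. s \<in> {a..b} \<Longrightarrow> \<bar>g s\<bar> \<le> C"
  shows "simple_function (lebesgue_on {a..b}) (\<lambda>s. grid n (g s))"
proof (rule simple_function_borel_measurable)
  have gm: "g \<in> borel_measurable (lebesgue_on {a..b})"
    by (rule borel_measurable_integrable[OF LINT_continuous(1)[OF g]])
  then show "(\<lambda>s. grid n (g s)) \<in> borel_measurable (lebesgue_on {a..b})"
    unfolding grid_def by measurable
  have "(\<lambda>s. grid n (g s)) ` {a..b} \<subseteq> (\<lambda>j. real_of_int j / real (Suc n)) ` {\<lfloor>- C * real (Suc n)\<rfloor>..\<lfloor>C * real (Suc n)\<rfloor>}"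
  proof (rule image_subsetI)
    fix s assume "s \<in> {a..b}"
    then have "- C \<le> g s" "g s \<le> C" using bd[of s] by auto
    then have "- C * real (Suc n) \<le> g s * real (Suc n)" "g s * real (Suc n) \<le> C * real (Suc n)"
      by (intro mult_right_mono; simp)+
    then have "\<lfloor>g s * real (Suc n)\<rfloor> \<in> {\<lfloor>- C * real (Suc n)\<rfloor>..\<lfloor>C * real (Suc n)\<rfloor>}"
      by (auto intro: floor_mono)
    then show "grid n (g s) \<in> (\<lambda>j. real_of_int j / real (Suc n)) ` {\<lfloor>- C * real (Suc n)\<rfloor>..\<lfloor>C * real (Suc n)\<rfloor>}"
      unfolding grid_def by (rule imageI)
  qed
  then show "finite ((\<lambda>s. grid n (g s)) ` space (lebesgue_on {a..b}))"
    by (simp add: finite_subset)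
qed

lemma finite_measure_interval: "finite_measure (lebesgue_on {a..b::real})"
  by (intro finite_measureI) (simp add: emeasure_restrict_space emeasure_lborel_Icc_eq)

locale contraction_semigroup_space = semi_hilbert S ip N for S :: "'b::real_vector set" and ip N +
  fixes Sg :: "real \<Rightarrow> 'b \<Rightarrow> 'b"
  assumes csg: "contraction_semigroup S N Sg"
begin

lemma Sg_mem [simp, intro]: "0 \<le> t \<Longrightarrow> x \<in> S \<Longrightarrow> Sg t x \<in> S"
  using csg by (simp add: contraction_semigroup_def)

lemma Sg_contr: "0 \<le> t \<Longrightarrow> x \<in> S \<Longrightarrow> N (Sg t x) \<le> N x"
  using csg by (simp add: contraction_semigroup_def)

lemma ip_eq_of_null: "x \<in> S \<Longrightarrow> y \<in> S \<Longrightarrow> w \<in> S \<Longrightarrow> N (x - y) = 0 \<Longrightarrow> ip x w = ip y w"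
  using ip_cong_right[of w x y] ip_commute by metis

lemma Sg_ip:
  assumes "0 \<le> t" "x \<in> S" "y \<in> S" "w \<in> S"
  shows "ip (Sg t (x + y)) w = ip (Sg t x) w + ip (Sg t y) w" "ip (Sg t (c *\<^sub>R x)) w = c * ip (Sg t x) w"
    "0 \<le> s \<Longrightarrow> ip (Sg (t + s) x) w = ip (Sg t (Sg s x)) w"
proof -
  have "N (Sg t (x + y) - (Sg t x + Sg t y)) = 0" using assms csg by (simp add: contraction_semigroup_def)
  from ip_eq_of_null[OF _ _ assms(4) this] show "ip (Sg t (x + y)) w = ip (Sg t x) w + ip (Sg t y) w"
    using assms by (simp add: ip_add_left)
  have "N (Sg t (c *\<^sub>R x) - c *\<^sub>R Sg t x) = 0" using assms csg by (simp add: contraction_semigroup_def)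
  from ip_eq_of_null[OF _ _ assms(4) this] show "ip (Sg t (c *\<^sub>R x)) w = c * ip (Sg t x) w"
    using assms ip_scale_left[of "Sg t x" "Sg t x" w c] by simp
  assume s: "0 \<le> s"
  have "N (Sg (t + s) x - Sg t (Sg s x)) = 0" using assms s csg by (simp add: contraction_semigroup_def)
  from ip_eq_of_null[OF _ _ assms(4) this] show "ip (Sg (t + s) x) w = ip (Sg t (Sg s x)) w"
    using assms s by simp
qed

lemma Sg_functional: "0 \<le> t \<Longrightarrow> w \<in> S \<Longrightarrow> bounded_functional (\<lambda>x. ip (Sg t x) w)"
  unfolding bounded_functional_def
proof (intro conjI ballI allI exI[of _ "N w"])
  fix x assume t: "0 \<le> t" and w: "w \<in> S" and x: "x \<in> S"
  have "\<bar>ip (Sg t x) w\<bar> \<le> N (Sg t x) * N w" using t w x by (intro Cauchy_Schwarz) auto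
  also have "\<dots> \<le> N x * N w" using Sg_contr[OF t x] w by (intro mult_right_mono) auto
  finally show "\<bar>ip (Sg t x) w\<bar> \<le> N w * N x" by (simp add: mult.commute)
qed (auto simp: Sg_ip(1) Sg_ip(2)[where y=0])

lemma Sg_diff_le:
  assumes t: "0 \<le> t" and x: "x \<in> S" and y: "y \<in> S"
  shows "N (Sg t x - Sg t y) \<le> N (x - y)"
proof (rule norm_le_of_pairing)
  fix w assume w: "w \<in> S"
  have "ip (Sg t x - Sg t y) w = ip (Sg t (x - y)) w"
    using bounded_functional_simps(3)[OF Sg_functional[OF t w] x y] t w x y by (simp add: ip_diff_left)
  also have "\<dots> \<le> N (Sg t (x - y)) * N w" using Cauchy_Schwarz[of "Sg t (x - y)" w] t w x y by auto
  also have "\<dots> \<le> N (x - y) * N w" using Sg_contr[OF t, of "x - y"] w x y by (intro mult_right_mono) auto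
  finally show "ip (Sg t x - Sg t y) w \<le> N (x - y) * N w" .
qed (use assms in auto)

lemma Sg_time_diff_le:
  assumes s: "0 \<le> s" "s \<le> t" and x: "x \<in> S"
  shows "N (Sg t x - Sg s x) \<le> N (Sg (t - s) x - x)"
proof -
  have null: "N (Sg t x - Sg s (Sg (t - s) x)) = 0"
  proof -
    have "N (Sg (s + r) x - Sg s (Sg r x)) = 0" if "0 \<le> r" for r
      using csg s(1) x that by (simp add: contraction_semigroup_def)
    from this[of "t - s"] show ?thesis using s by simp
  qed
  have "N (Sg t x - Sg s x) \<le> N (Sg t x - Sg s (Sg (t - s) x)) + N (Sg s (Sg (t - s) x) - Sg s x)"
    using s x by (intro triangle_diff) auto
  also have "\<dots> \<le> N (Sg (t - s) x - x)" using Sg_diff_le[OF s(1), of "Sg (t - s) x" x] s x null by simp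
  finally show ?thesis .
qed

lemma Sg_small:
  assumes x: "x \<in> S" and e: "0 < e"
  obtains d where "0 < d" "\<And>k. 0 \<le> k \<Longrightarrow> k < d \<Longrightarrow> N (Sg k x - x) < e"
proof -
  have "((\<lambda>t. N (Sg t x - x)) \<longlongrightarrow> 0) (at_right 0)" using csg x by (simp add: contraction_semigroup_def)
  then have "\<forall>\<^sub>F t in at_right 0. N (Sg t x - x) < e" using e by (rule order_tendstoD(2))
  then obtain d where d: "0 < d" "\<And>k. 0 < k \<Longrightarrow> k < d \<Longrightarrow> N (Sg k x - x) < e"
    unfolding eventually_at_right_field by auto
  have "N (Sg 0 x - x) = 0" using csg x by (simp add: contraction_semigroup_def)
  then have "N (Sg k x - x) < e" if "0 \<le> k" "k < d" for k using d(2)[of k] that e by (cases "k = 0") auto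
  with d(1) show ?thesis by (rule that)
qed

lemma Sg_small_finite:
  assumes D: "finite D" "D \<subseteq> S" and e: "0 < e"
  obtains d where "0 < d" "\<And>k y. 0 \<le> k \<Longrightarrow> k < d \<Longrightarrow> y \<in> D \<Longrightarrow> N (Sg k y - y) < e"
proof -
  have "\<exists>d>0. \<forall>k. 0 \<le> k \<longrightarrow> k < d \<longrightarrow> (\<forall>y\<in>D. N (Sg k y - y) < e)"
    using D
  proof (induction D rule: finite_induct)
    case empty
    then show ?case by (intro exI[of _ 1]) auto
  next
    case (insert y D)
    then obtain d where d: "d > 0" "\<forall>k. 0 \<le> k \<longrightarrow> k < d \<longrightarrow> (\<forall>y\<in>D. N (Sg k y - y) < e)" by auto
    have yS: "y \<in> S" using insert by simp
    obtain d' where d': "0 < d'" "\<And>k. 0 \<le> k \<Longrightarrow> k < d' \<Longrightarrow> N (Sg k y - y) < e"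
      using Sg_small[OF yS e] by metis
    show ?case using d d' by (intro exI[of _ "min d d'"]) auto
  qed
  then show ?thesis using that by blast
qed

text \<open>For a simple forcing the time \<open>t - s\<close> is rounded down to a grid, which makes the convolution integrand
  simple and converges by strong continuity. Contractivity reduces the general forcing to this case.\<close>

lemma Sg_strongly_measurable:
  assumes F: "strongly_measurable_in (lebesgue_on {0..t}) S N F"
  shows "strongly_measurable_in (lebesgue_on {0..t}) S N (\<lambda>s. Sg (t - s) (F s))"
proof -
  let ?M = "lebesgue_on {0..t}"
  obtain f where f: "\<forall>i::nat. simple_function ?M (f i)" "\<forall>i. f i ` space ?M \<subseteq> S"
    "AE x in ?M. (\<lambda>i. N (F x - f i x)) \<longlonglongrightarrow> 0" and FS: "AE x in ?M. F x \<in> S"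
    by (rule strongly_measurableE[OF F])
  note fin = finite_measure_interval[of 0 t]
  have fS: "f i s \<in> S" if "s \<in> {0..t}" for i s
    using subsetD[OF f(2)[rule_format] imageI, of s i] that by simp
  have inner: "strongly_measurable_in ?M S N (\<lambda>s. Sg (t - s) (f i s))" for i
  proof (rule strongly_measurable_AE_limit[OF fin])
    have sf: "simple_function ?M (\<lambda>s. Sg (grid n (t - s)) (f i s))" for n
      by (rule simple_function_compose2[OF simple_function_grid[where C=t] f(1)[rule_format]])
         (auto intro!: continuous_intros)
    have sS: "(\<lambda>s. Sg (grid n (t - s)) (f i s)) ` space ?M \<subseteq> S" for n
      using fS grid_bounds(3) by auto
    show "strongly_measurable_in ?M S N (\<lambda>s. Sg (grid n (t - s)) (f i s))" for n
      by (rule strongly_measurable_simple[OF sf sS])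
    show "(\<integral>\<^sup>+s. ennreal (N (Sg (grid n (t - s)) (f i s))) \<partial>?M) < \<infinity>" for n
      by (rule simple_norm_integrable[OF fin sf sS])
    show "AE s in ?M. Sg (t - s) (f i s) \<in> S" using fS by (intro AE_I2) auto
    show "AE s in ?M. (\<lambda>n. N (Sg (t - s) (f i s) - Sg (grid n (t - s)) (f i s))) \<longlonglongrightarrow> 0"
    proof (rule AE_I2, rule tendstoI)
      fix s e assume "s \<in> space ?M" and e: "0 < (e::real)"
      then have s: "0 \<le> s" "s \<le> t" by auto
      have y: "f i s \<in> S" using fS s by auto
      obtain d where d: "0 < d" "\<And>k. 0 \<le> k \<Longrightarrow> k < d \<Longrightarrow> N (Sg k (f i s) - f i s) < e"
        using Sg_small[OF y e] by metis
      have "\<forall>\<^sub>F n in sequentially. t - s - d < grid n (t - s)"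
        using d(1) by (intro order_tendstoD(1)[OF grid_tendsto]) auto
      then show "\<forall>\<^sub>F n in sequentially. dist (N (Sg (t - s) (f i s) - Sg (grid n (t - s)) (f i s))) 0 < e"
      proof eventually_elim
        case (elim n)
        have g: "0 \<le> grid n (t - s)" "grid n (t - s) \<le> t - s" using grid_bounds s by auto
        have "N (Sg (t - s) (f i s) - Sg (grid n (t - s)) (f i s)) \<le> N (Sg (t - s - grid n (t - s)) (f i s) - f i s)"
          by (rule Sg_time_diff_le[OF g y])
        also have "\<dots> < e" using d(2) elim g by simp
        finally show ?case using y g s N_nonneg[of "Sg (t - s) (f i s) - Sg (grid n (t - s)) (f i s)"] by simp
      qed
    qed
  qed
  show ?thesis
  proof (rule strongly_measurable_AE_limit[OF fin inner])
    show "(\<integral>\<^sup>+s. ennreal (N (Sg (t - s) (f i s))) \<partial>?M) < \<infinity>" for i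
    proof (rule le_less_trans[OF _ simple_norm_integrable[OF fin f(1,2)[rule_format], of i]])
      show "(\<integral>\<^sup>+s. ennreal (N (Sg (t - s) (f i s))) \<partial>?M) \<le> (\<integral>\<^sup>+s. ennreal (N (f i s)) \<partial>?M)"
        using fS by (intro nn_integral_mono ennreal_leI Sg_contr) auto
    qed
    show "AE s in ?M. Sg (t - s) (F s) \<in> S"
      using FS AE_space by eventually_elim auto
    show "AE s in ?M. (\<lambda>i. N (Sg (t - s) (F s) - Sg (t - s) (f i s))) \<longlonglongrightarrow> 0"
      using f(3) FS AE_space
    proof eventually_elim
      case (elim s)
      then have s: "s \<in> {0..t}" by simp
      show ?case
      proof (rule tendsto_zero_dominated[OF elim(1)])
        show "\<bar>N (Sg (t - s) (F s) - Sg (t - s) (f i s))\<bar> \<le> N (F s - f i s)" for i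
          using Sg_diff_le[of "t - s" "F s" "f i s"] elim(2) fS[OF s, of i] s
            N_nonneg[of "Sg (t - s) (F s) - Sg (t - s) (f i s)"] by auto
      qed
    qed
  qed
qed

end

context semi_inner
begin

text \<open>Continuity on a compact interval in its uniform form, so that one bound serves all times.\<close>

definition uniform_path :: "real \<Rightarrow> (real \<Rightarrow> 'b) \<Rightarrow> bool" where
  "uniform_path \<tau> Y \<longleftrightarrow> (\<forall>t\<in>{0..\<tau>}. Y t \<in> S) \<and>
     (\<forall>e>0. \<exists>d>0. \<forall>s\<in>{0..\<tau>}. \<forall>t\<in>{0..\<tau>}. \<bar>s - t\<bar> < d \<longrightarrow> N (Y s - Y t) < e)"

lemma uniform_path_mem: "uniform_path \<tau> Y \<Longrightarrow> t \<in> {0..\<tau>} \<Longrightarrow> Y t \<in> S"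
  by (simp add: uniform_path_def)

lemma uniform_pathE:
  assumes "uniform_path \<tau> Y" "0 < e"
  obtains d where "0 < d" "\<forall>s\<in>{0..\<tau>}. \<forall>t\<in>{0..\<tau>}. \<bar>s - t\<bar> < d \<longrightarrow> N (Y s - Y t) < e"
  using assms unfolding uniform_path_def by blast

lemma uniform_pathI:
  assumes mem: "\<And>t. t \<in> {0..\<tau>} \<Longrightarrow> Y t \<in> S"
    and "\<And>e. 0 < e \<Longrightarrow> \<exists>d>0. \<forall>s t. 0 \<le> s \<longrightarrow> s \<le> t \<longrightarrow> t \<le> \<tau> \<longrightarrow> t - s < d \<longrightarrow> N (Y t - Y s) < e"
  shows "uniform_path \<tau> Y"
  unfolding uniform_path_def
proof (intro conjI ballI allI impI)
  fix e :: real assume "0 < e"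
  then obtain d where d: "d > 0" "\<And>s t. 0 \<le> s \<Longrightarrow> s \<le> t \<Longrightarrow> t \<le> \<tau> \<Longrightarrow> t - s < d \<Longrightarrow> N (Y t - Y s) < e"
    using assms(2) by metis
  have "N (Y s - Y t) < e" if "s \<in> {0..\<tau>}" "t \<in> {0..\<tau>}" "\<bar>s - t\<bar> < d" for s t
  proof (cases "s \<le> t")
    case True
    then show ?thesis using d(2)[of s t] that N_commute[OF mem mem, of s t] by simp
  next
    case False
    then show ?thesis using d(2)[of t s] that by simp
  qed
  then show "\<exists>d>0. \<forall>s\<in>{0..\<tau>}. \<forall>t\<in>{0..\<tau>}. \<bar>s - t\<bar> < d \<longrightarrow> N (Y s - Y t) < e" using d(1) by blast
qed (rule mem)

lemma uniform_path_subset: "uniform_path \<tau> Y \<Longrightarrow> \<sigma> \<le> \<tau> \<Longrightarrow> uniform_path \<sigma> Y"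
  unfolding uniform_path_def by (meson atLeastAtMost_iff order_trans)

lemma uniform_path_tendsto:
  assumes Y: "uniform_path \<tau> Y" and t: "t \<in> {0..\<tau>}"
  shows "((\<lambda>s. N (Y s - Y t)) \<longlongrightarrow> 0) (at t within {0..\<tau>})"
proof (rule tendstoI)
  fix e :: real assume "0 < e"
  then obtain d where d: "0 < d" "\<forall>s\<in>{0..\<tau>}. \<forall>t\<in>{0..\<tau>}. \<bar>s - t\<bar> < d \<longrightarrow> N (Y s - Y t) < e"
    by (rule uniform_pathE[OF Y])
  have "dist (N (Y s - Y t)) 0 < e" if "s \<in> {0..\<tau>}" "dist s t < d" for s
    using d(2) that t N_nonneg[of "Y s - Y t"] uniform_path_mem[OF Y that(1)] uniform_path_mem[OF Y t]
    by (auto simp: dist_real_def)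
  then show "\<forall>\<^sub>F s in at t within {0..\<tau>}. dist (N (Y s - Y t)) 0 < e"
    unfolding eventually_at using d(1) by (intro exI[of _ d]) auto
qed

lemma ip_tendsto_both:
  assumes y: "((\<lambda>s. N (Y s - a)) \<longlongrightarrow> 0) F" and z: "((\<lambda>s. N (Z s - b)) \<longlongrightarrow> 0) F"
    and mem: "\<forall>\<^sub>F s in F. Y s \<in> S \<and> Z s \<in> S" and ab: "a \<in> S" "b \<in> S"
  shows "((\<lambda>s. ip (Y s) (Z s)) \<longlongrightarrow> ip a b) F"
proof -
  have lim: "((\<lambda>s. N (Y s - a) * N (Z s - b) + N (Y s - a) * N b + N a * N (Z s - b)) \<longlongrightarrow> 0) F"
    using y z by (auto intro!: tendsto_eq_intros)
  have "((\<lambda>s. ip (Y s) (Z s) - ip a b) \<longlongrightarrow> 0) F"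
  proof (rule Lim_null_comparison[OF _ lim])
    show "\<forall>\<^sub>F s in F. norm (ip (Y s) (Z s) - ip a b) \<le> N (Y s - a) * N (Z s - b) + N (Y s - a) * N b + N a * N (Z s - b)"
      using mem
    proof eventually_elim
      case (elim s)
      then have m: "Y s \<in> S" "Z s \<in> S" by auto
      have "ip (Y s) (Z s) - ip a b = ip (Y s - a) (Z s - b) + ip (Y s - a) b + ip a (Z s - b)"
        using m ab by (simp add: ip_diff_left ip_diff_right)
      then show ?case
        using Cauchy_Schwarz[of "Y s - a" "Z s - b"] Cauchy_Schwarz[of "Y s - a" b] Cauchy_Schwarz[of a "Z s - b"] m ab
        by auto
    qed
  qed
  then show ?thesis by (rule LIM_zero_cancel)
qed

lemma uniform_path_ip_continuous:
  assumes Y: "uniform_path \<tau> Y" and Z: "uniform_path \<tau> Z"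
  shows "continuous_on {0..\<tau>} (\<lambda>t. ip (Y t) (Z t))"
  unfolding continuous_on_def
proof
  fix t assume t: "t \<in> {0..\<tau>}"
  have "\<forall>\<^sub>F s in at t within {0..\<tau>}. Y s \<in> S \<and> Z s \<in> S"
    unfolding eventually_at_filter using uniform_path_mem[OF Y] uniform_path_mem[OF Z] by (auto intro!: always_eventually)
  then show "((\<lambda>s. ip (Y s) (Z s)) \<longlongrightarrow> ip (Y t) (Z t)) (at t within {0..\<tau>})"
    by (rule ip_tendsto_both[OF uniform_path_tendsto[OF Y t] uniform_path_tendsto[OF Z t]])
       (use t uniform_path_mem[OF Y] uniform_path_mem[OF Z] in auto)
qed

lemma uniform_path_const: "x \<in> S \<Longrightarrow> uniform_path \<tau> (\<lambda>_. x)"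
  by (rule uniform_pathI) (auto intro: exI[of _ 1])

lemma uniform_path_norm_continuous:
  assumes Y: "uniform_path \<tau> Y" shows "continuous_on {0..\<tau>} (\<lambda>t. N (Y t))"
proof -
  have "continuous_on {0..\<tau>} (\<lambda>t. sqrt (ip (Y t) (Y t)))"
    by (intro continuous_intros uniform_path_ip_continuous Y)
  then show ?thesis by (rule continuous_on_eq) (simp add: N_eq uniform_path_mem[OF Y])
qed

lemma uniform_path_diff:
  assumes Y: "uniform_path \<tau> Y" and Z: "uniform_path \<tau> Z"
  shows "uniform_path \<tau> (\<lambda>t. Y t - Z t)"
proof (rule uniform_pathI)
  show "Y t - Z t \<in> S" if "t \<in> {0..\<tau>}" for t using that uniform_path_mem Y Z by blast
  fix e :: real assume "0 < e"
  then have e: "0 < e/2" by simp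
  obtain d where d: "0 < d" "\<forall>s\<in>{0..\<tau>}. \<forall>t\<in>{0..\<tau>}. \<bar>s - t\<bar> < d \<longrightarrow> N (Y s - Y t) < e/2"
    by (rule uniform_pathE[OF Y e])
  obtain d' where d': "0 < d'" "\<forall>s\<in>{0..\<tau>}. \<forall>t\<in>{0..\<tau>}. \<bar>s - t\<bar> < d' \<longrightarrow> N (Z s - Z t) < e/2"
    by (rule uniform_pathE[OF Z e])
  have "N ((Y t - Z t) - (Y s - Z s)) < e" if "0 \<le> s" "s \<le> t" "t \<le> \<tau>" "t - s < min d d'" for s t
  proof -
    have st: "s \<in> {0..\<tau>}" "t \<in> {0..\<tau>}" using that by auto
    have m: "Y t - Y s \<in> S" "Z t - Z s \<in> S" using st uniform_path_mem Y Z by blast+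
    have eq: "(Y t - Z t) - (Y s - Z s) = (Y t - Y s) - (Z t - Z s)" by simp
    have "\<bar>t - s\<bar> < d" "\<bar>t - s\<bar> < d'" using that by auto
    then have "N (Y t - Y s) < e/2" "N (Z t - Z s) < e/2" using d(2) d'(2) st by blast+
    then show ?thesis unfolding eq using triangle_minus[OF m] by linarith
  qed
  then show "\<exists>d>0. \<forall>s t. 0 \<le> s \<longrightarrow> s \<le> t \<longrightarrow> t \<le> \<tau> \<longrightarrow> t - s < d \<longrightarrow> N ((Y t - Z t) - (Y s - Z s)) < e"
    using d(1) d'(1) by (intro exI[of _ "min d d'"]) auto
qed

lemma uniform_path_scale:
  assumes Y: "uniform_path \<tau> Y" shows "uniform_path \<tau> (\<lambda>t. c *\<^sub>R Y t)"
proof (rule uniform_pathI)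
  show "c *\<^sub>R Y t \<in> S" if "t \<in> {0..\<tau>}" for t using uniform_path_mem[OF Y that] by simp
  fix e :: real assume "0 < e"
  then have e: "0 < e / (\<bar>c\<bar> + 1)" by simp
  obtain d where d: "0 < d" "\<forall>s\<in>{0..\<tau>}. \<forall>t\<in>{0..\<tau>}. \<bar>s - t\<bar> < d \<longrightarrow> N (Y s - Y t) < e / (\<bar>c\<bar> + 1)"
    by (rule uniform_pathE[OF Y e])
  have "N (c *\<^sub>R Y t - c *\<^sub>R Y s) < e" if st: "0 \<le> s" "s \<le> t" "t \<le> \<tau>" "t - s < d" for s t
  proof -
    have m: "Y t - Y s \<in> S" using st uniform_path_mem[OF Y, of s] uniform_path_mem[OF Y, of t] by auto
    have "N (Y t - Y s) < e / (\<bar>c\<bar> + 1)" using d(2) st by auto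
    then have "(\<bar>c\<bar> + 1) * N (Y t - Y s) < e" by (simp add: pos_less_divide_eq mult.commute)
    moreover have "\<bar>c\<bar> * N (Y t - Y s) \<le> (\<bar>c\<bar> + 1) * N (Y t - Y s)" using m by (intro mult_right_mono) auto
    moreover have "N (c *\<^sub>R Y t - c *\<^sub>R Y s) = \<bar>c\<bar> * N (Y t - Y s)" using scale[OF m, of c] by (simp add: scaleR_diff_right)
    ultimately show ?thesis by linarith
  qed
  then show "\<exists>d>0. \<forall>s t. 0 \<le> s \<longrightarrow> s \<le> t \<longrightarrow> t \<le> \<tau> \<longrightarrow> t - s < d \<longrightarrow> N (c *\<^sub>R Y t - c *\<^sub>R Y s) < e"
    using d(1) by blast
qed

lemma uniform_path_shift:
  assumes Y: "uniform_path \<tau> Y" and h: "0 \<le> h" "\<sigma> + h \<le> \<tau>" shows "uniform_path \<sigma> (\<lambda>t. Y (t + h))"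
proof (rule uniform_pathI)
  show "Y (t + h) \<in> S" if "t \<in> {0..\<sigma>}" for t using uniform_path_mem[OF Y, of "t + h"] that h by auto
  fix e :: real assume e: "0 < e"
  obtain d where d: "0 < d" "\<forall>s\<in>{0..\<tau>}. \<forall>t\<in>{0..\<tau>}. \<bar>s - t\<bar> < d \<longrightarrow> N (Y s - Y t) < e"
    by (rule uniform_pathE[OF Y e])
  have "N (Y (t + h) - Y (s + h)) < e" if "0 \<le> s" "s \<le> t" "t \<le> \<sigma>" "t - s < d" for s t
    using d(2)[rule_format, of "t + h" "s + h"] that h by auto
  then show "\<exists>d>0. \<forall>s t. 0 \<le> s \<longrightarrow> s \<le> t \<longrightarrow> t \<le> \<sigma> \<longrightarrow> t - s < d \<longrightarrow> N (Y (t + h) - Y (s + h)) < e"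
    using d(1) by blast
qed

lemma uniform_path_strongly_measurable:
  assumes Y: "uniform_path \<tau> Y"
  shows "strongly_measurable_in (lebesgue_on {0..\<tau>}) S N Y" "(\<integral>\<^sup>+s. ennreal (N (Y s)) \<partial>lebesgue_on {0..\<tau>}) < \<infinity>"
proof -
  have g: "grid n s \<in> {0..\<tau>}" if "s \<in> {0..\<tau>}" for n s
    using grid_bounds(1,3)[where n=n and s=s] that by auto
  show "strongly_measurable_in (lebesgue_on {0..\<tau>}) S N Y"
  proof (rule strongly_measurableI[where s="\<lambda>n s. Y (grid n s)"])
    show "simple_function (lebesgue_on {0..\<tau>}) (\<lambda>s. Y (grid n s))" for n
      by (rule simple_function_compose1[OF simple_function_grid[where C=\<tau>]]) (auto intro!: continuous_intros)
    show "(\<lambda>s. Y (grid n s)) ` space (lebesgue_on {0..\<tau>}) \<subseteq> S" for n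
    proof (rule image_subsetI)
      fix s assume "s \<in> space (lebesgue_on {0..\<tau>})"
      then show "Y (grid n s) \<in> S" using g[of s n] uniform_path_mem[OF Y] by simp
    qed
    show "AE s in lebesgue_on {0..\<tau>}. Y s \<in> S" using uniform_path_mem[OF Y] by (intro AE_I2) auto
    show "AE s in lebesgue_on {0..\<tau>}. (\<lambda>n. N (Y s - Y (grid n s))) \<longlonglongrightarrow> 0"
    proof (rule AE_I2, rule tendstoI)
      fix s and e :: real assume "s \<in> space (lebesgue_on {0..\<tau>})" and e: "0 < e"
      then have s: "s \<in> {0..\<tau>}" by simp
      obtain d where d: "0 < d" "\<forall>s\<in>{0..\<tau>}. \<forall>t\<in>{0..\<tau>}. \<bar>s - t\<bar> < d \<longrightarrow> N (Y s - Y t) < e"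
        by (rule uniform_pathE[OF Y e])
      have "\<forall>\<^sub>F n in sequentially. dist (grid n s) s < d" by (rule tendstoD[OF grid_tendsto d(1)])
      then show "\<forall>\<^sub>F n in sequentially. dist (N (Y s - Y (grid n s))) 0 < e"
      proof eventually_elim
        case (elim n)
        then have "N (Y s - Y (grid n s)) < e" using d(2) s g[OF s, of n] by (simp add: dist_real_def abs_minus_commute)
        moreover have "0 \<le> N (Y s - Y (grid n s))" using uniform_path_mem[OF Y s] uniform_path_mem[OF Y g[OF s, of n]] by simp
        ultimately show ?case by simp
      qed
    qed
  qed
  have "integrable (lebesgue_on {0..\<tau>}) (\<lambda>s. N (Y s))"
    by (rule LINT_continuous(1)[OF uniform_path_norm_continuous[OF Y]])
  then have "(\<integral>\<^sup>+s. ennreal (norm (N (Y s))) \<partial>lebesgue_on {0..\<tau>}) < \<infinity>" by (simp add: integrable_iff_bounded)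
  moreover have "(\<integral>\<^sup>+s. ennreal (N (Y s)) \<partial>lebesgue_on {0..\<tau>}) \<le> (\<integral>\<^sup>+s. ennreal (norm (N (Y s))) \<partial>lebesgue_on {0..\<tau>})"
    by (intro nn_integral_mono ennreal_leI) simp
  ultimately show "(\<integral>\<^sup>+s. ennreal (N (Y s)) \<partial>lebesgue_on {0..\<tau>}) < \<infinity>" by (rule le_less_trans[rotated])
qed

end

locale mild_problem = contraction_semigroup_space S ip N Sg for S :: "'b::real_vector set" and ip N Sg +
  fixes F :: "real \<Rightarrow> 'b" and x0 :: 'b and \<tau> :: real
  assumes tau: "0 \<le> \<tau>" and x0: "x0 \<in> S"
    and F_meas: "strongly_measurable_in (lebesgue_on {0..\<tau>}) S N F"
    and F_int: "(\<integral>\<^sup>+s. ennreal (N (F s)) \<partial>lebesgue_on {0..\<tau>}) < \<infinity>"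
begin

definition X :: "real \<Rightarrow> 'b" where "X t = mild_solution S N Sg x0 F t"

lemma F_meas_sub: "t \<le> \<tau> \<Longrightarrow> strongly_measurable_in (lebesgue_on {0..t}) S N F"
  by (rule strongly_measurable_lebesgue_on_subset[OF F_meas]) auto

lemma convolution_exists:
  assumes t: "0 \<le> t" "t \<le> \<tau>"
  shows "has_bochner_integral_in (lebesgue_on {0..t}) S N (\<lambda>s. Sg (t - s) (F s))
     (bochner_integral_in (lebesgue_on {0..t}) S N (\<lambda>s. Sg (t - s) (F s)))"
proof (rule bochner_integral_exists[OF finite_measure_interval])
  show "strongly_measurable_in (lebesgue_on {0..t}) S N (\<lambda>s. Sg (t - s) (F s))"
    by (rule Sg_strongly_measurable[OF F_meas_sub[OF t(2)]])
  have FS: "AE s in lebesgue_on {0..t}. F s \<in> S" using F_meas_sub[OF t(2)] by (simp add: strongly_measurable_in_def)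
  have "(\<integral>\<^sup>+s. ennreal (N (Sg (t - s) (F s))) \<partial>lebesgue_on {0..t}) \<le> (\<integral>\<^sup>+s. ennreal (N (F s)) \<partial>lebesgue_on {0..t})"
    using FS AE_space by (intro nn_integral_mono_AE, eventually_elim) (auto intro!: ennreal_leI Sg_contr)
  also have "\<dots> \<le> (\<integral>\<^sup>+s. ennreal (N (F s)) \<partial>lebesgue_on {0..\<tau>})"
    using t by (intro nn_integral_lebesgue_on_subset) auto
  also note F_int
  finally show "(\<integral>\<^sup>+s. ennreal (N (Sg (t - s) (F s))) \<partial>lebesgue_on {0..t}) < \<infinity>" .
qed

lemma X_mem: "0 \<le> t \<Longrightarrow> t \<le> \<tau> \<Longrightarrow> X t \<in> S"
  using convolution_exists[of t] x0 by (auto simp: X_def mild_solution_def has_bochner_integral_in_def)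

lemma X_pairing:
  assumes l: "bounded_functional \<l>" and t: "0 \<le> t" "t \<le> \<tau>"
  shows "integrable (lebesgue_on {0..t}) (\<lambda>s. \<l> (Sg (t - s) (F s)))"
    "\<l> (X t) = \<l> (Sg t x0) + (LINT s|lebesgue_on {0..t}. \<l> (Sg (t - s) (F s)))"
proof -
  note b = has_bochner_integral_in_functional[OF l convolution_exists[OF t]]
  show "integrable (lebesgue_on {0..t}) (\<lambda>s. \<l> (Sg (t - s) (F s)))"
    using b(1) by (simp add: completion_lebesgue_on)
  have "bochner_integral_in (lebesgue_on {0..t}) S N (\<lambda>s. Sg (t - s) (F s)) \<in> S"
    using convolution_exists[OF t] by (simp add: has_bochner_integral_in_def)
  then show "\<l> (X t) = \<l> (Sg t x0) + (LINT s|lebesgue_on {0..t}. \<l> (Sg (t - s) (F s)))"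
    using b(2) x0 t by (simp add: X_def mild_solution_def bounded_functional_simps[OF l] completion_lebesgue_on)
qed

text \<open>Up to a small error in \<open>L^1\<close> the forcing has finitely many values, on which the semigroup is
  uniformly continuous at time zero.\<close>

lemma forcing_approx:
  assumes eta: "0 < \<eta>" and e: "0 < e"
  obtains \<rho> \<delta> C where "integrable (lebesgue_on {0..\<tau>}) \<rho>" "\<forall>r. 0 \<le> \<rho> r" "(LINT r|lebesgue_on {0..\<tau>}. \<rho> r) < \<eta>"
    "0 < \<delta>" "0 \<le> C" "AE r in lebesgue_on {0..\<tau>}. F r \<in> S \<and> N (F r) \<le> \<rho> r + C \<and>
       (\<forall>k. 0 \<le> k \<longrightarrow> k < \<delta> \<longrightarrow> N (Sg k (F r) - F r) \<le> 2 * \<rho> r + e)"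
proof -
  let ?M = "lebesgue_on {0..\<tau>}"
  obtain s where s: "\<forall>i::nat. Bochner_Integration.simple_bochner_integrable ?M (s i)" "\<forall>i. s i ` space ?M \<subseteq> S"
    and lim: "(\<lambda>i. \<integral>\<^sup>+x. ennreal (N (F x - s i x)) \<partial>?M) \<longlonglongrightarrow> 0"
    by (rule simple_L1_approx[OF finite_measure_interval F_meas F_int])
  have "\<forall>\<^sub>F i in sequentially. (\<integral>\<^sup>+x. ennreal (N (F x - s i x)) \<partial>?M) < ennreal \<eta>"
    by (rule order_tendstoD(2)[OF lim]) (use eta in simp)
  then obtain i where i: "(\<integral>\<^sup>+x. ennreal (N (F x - s i x)) \<partial>?M) < ennreal \<eta>"
    by (auto simp: eventually_sequentially)
  have sf: "simple_function ?M (s i)"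
    using s(1)[rule_format, of i] by (auto elim: Bochner_Integration.simple_bochner_integrable.cases)
  define \<rho> where "\<rho> r = max 0 (N (F r - s i r))" for r
  have "(\<lambda>r. N (F r - s i r)) \<in> borel_measurable (completion ?M)"
    by (intro strongly_measurable_norm strongly_measurable_diff F_meas strongly_measurable_simple[OF sf s(2)[rule_format]])
  then have rm: "\<rho> \<in> borel_measurable ?M" unfolding \<rho>_def by (simp add: completion_lebesgue_on)
  have rnn: "(\<integral>\<^sup>+r. ennreal (\<rho> r) \<partial>?M) = (\<integral>\<^sup>+x. ennreal (N (F x - s i x)) \<partial>?M)"
    unfolding \<rho>_def by (intro nn_integral_cong) (simp add: max_def ennreal_neg)
  have r1: "integrable ?M \<rho>"
  proof (rule integrableI_bounded[OF rm])
    have "(\<integral>\<^sup>+r. ennreal (norm (\<rho> r)) \<partial>?M) = (\<integral>\<^sup>+r. ennreal (\<rho> r) \<partial>?M)" by (simp add: \<rho>_def)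
    also have "\<dots> < \<infinity>" using i rnn by (metis ennreal_less_top less_trans infinity_ennreal_def)
    finally show "(\<integral>\<^sup>+r. ennreal (norm (\<rho> r)) \<partial>?M) < \<infinity>" .
  qed
  have r0: "0 \<le> \<rho> r" for r by (simp add: \<rho>_def)
  have "ennreal (LINT r|?M. \<rho> r) < ennreal \<eta>"
    using nn_integral_eq_integral[OF r1] r0 i rnn by simp
  then have r2: "(LINT r|?M. \<rho> r) < \<eta>" using r0 by (simp add: ennreal_less_iff Bochner_Integration.integral_nonneg)
  define D where "D = s i ` {0..\<tau>}"
  have D: "finite D" "D \<subseteq> S" using sf s(2)[rule_format, of i] by (auto simp: D_def simple_function_def)
  obtain \<delta> where \<delta>: "0 < \<delta>" "\<And>k y. 0 \<le> k \<Longrightarrow> k < \<delta> \<Longrightarrow> y \<in> D \<Longrightarrow> N (Sg k y - y) < e"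
    using Sg_small_finite[OF D e] by metis
  define C where "C = (\<Sum>y\<in>D. N y)"
  have C: "N y \<le> C" if "y \<in> D" for y
    unfolding C_def using that D by (intro member_le_sum) (auto intro!: N_nonneg)
  have C0: "0 \<le> C" unfolding C_def using D by (intro sum_nonneg) (auto intro!: N_nonneg)
  have FS: "AE r in ?M. F r \<in> S" using F_meas by (simp add: strongly_measurable_in_def)
  have "AE r in ?M. F r \<in> S \<and> N (F r) \<le> \<rho> r + C \<and> (\<forall>k. 0 \<le> k \<longrightarrow> k < \<delta> \<longrightarrow> N (Sg k (F r) - F r) \<le> 2 * \<rho> r + e)"
    using FS AE_space
  proof eventually_elim
    case (elim r)
    let ?y = "s i r"
    have y: "?y \<in> D" "?y \<in> S" using elim(2) D(2) by (auto simp: D_def)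
    have d: "N (F r - ?y) \<le> \<rho> r" by (simp add: \<rho>_def)
    have "N (F r) \<le> \<rho> r + C"
      using reverse_triangle[OF elim(1) y(2)] d C[OF y(1)] by linarith
    moreover have "N (Sg k (F r) - F r) \<le> 2 * \<rho> r + e" if k: "0 \<le> k" "k < \<delta>" for k
    proof -
      have m: "Sg k (F r) \<in> S" "Sg k ?y \<in> S" using k elim(1) y by auto
      have "N (Sg k (F r) - F r) \<le> N (Sg k (F r) - Sg k ?y) + N (Sg k ?y - F r)"
        using m elim(1) by (intro triangle_diff) auto
      moreover have "N (Sg k ?y - F r) \<le> N (Sg k ?y - ?y) + N (?y - F r)"
        using m elim(1) y by (intro triangle_diff) auto
      moreover have "N (Sg k (F r) - Sg k ?y) \<le> N (F r - ?y)" by (rule Sg_diff_le[OF k(1) elim(1) y(2)])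
      moreover have "N (?y - F r) = N (F r - ?y)" by (rule N_commute[OF y(2) elim(1)])
      moreover have "N (Sg k ?y - ?y) < e" by (rule \<delta>(2)[OF k y(1)])
      ultimately show ?thesis using d by linarith
    qed
    ultimately show ?case using elim(1) by blast
  qed
  from that[OF r1 allI[OF r0] r2 \<delta>(1) C0 this] show ?thesis .
qed

lemma integrable_forcing_bound:
  fixes \<rho> :: "real \<Rightarrow> real"
  assumes r: "integrable (lebesgue_on {0..\<tau>}) \<rho>" "\<And>r. 0 \<le> \<rho> r" and ab: "0 \<le> a" "a \<le> b" "b \<le> \<tau>"
  shows "integrable (lebesgue_on {a..b}) (\<lambda>r. c * \<rho> r + d)"
    "(LINT r|lebesgue_on {a..b}. c * \<rho> r + d) = c * (LINT r|lebesgue_on {a..b}. \<rho> r) + d * (b - a)"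
    "(LINT r|lebesgue_on {a..b}. \<rho> r) \<le> (LINT r|lebesgue_on {0..\<tau>}. \<rho> r)"
proof -
  interpret finite_measure "lebesgue_on {a..b}" by (rule finite_measure_interval)
  have i: "integrable (lebesgue_on {a..b}) \<rho>" using ab by (intro integrable_lebesgue_on_subset[OF r(1)]) auto
  then show "integrable (lebesgue_on {a..b}) (\<lambda>r. c * \<rho> r + d)" by simp
  have "measure (lebesgue_on {a..b}) (space (lebesgue_on {a..b})) = b - a"
    using ab by (simp add: measure_restrict_space)
  then show "(LINT r|lebesgue_on {a..b}. c * \<rho> r + d) = c * (LINT r|lebesgue_on {a..b}. \<rho> r) + d * (b - a)"
    using i by simp
  have i2: "integrable (lebesgue_on {0..b}) \<rho>" using ab by (intro integrable_lebesgue_on_subset[OF r(1)]) auto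
  have "(LINT r|lebesgue_on {0..\<tau>}. \<rho> r) = (LINT r|lebesgue_on {0..a}. \<rho> r) + (LINT r|lebesgue_on {a..b}. \<rho> r) + (LINT r|lebesgue_on {b..\<tau>}. \<rho> r)"
    using LINT_interval_combine[OF r(1), of b] LINT_interval_combine[OF i2, of a] ab by simp
  moreover have "0 \<le> (LINT r|lebesgue_on {0..a}. \<rho> r)" "0 \<le> (LINT r|lebesgue_on {b..\<tau>}. \<rho> r)"
    using r(2) by (auto intro: Bochner_Integration.integral_nonneg)
  ultimately show "(LINT r|lebesgue_on {a..b}. \<rho> r) \<le> (LINT r|lebesgue_on {0..\<tau>}. \<rho> r)" by simp
qed

lemma abs_LINT_le:
  fixes g h :: "real \<Rightarrow> real"
  assumes g: "integrable (lebesgue_on A) g" and h: "integrable (lebesgue_on A) h" and le: "AE r in lebesgue_on A. \<bar>g r\<bar> \<le> h r"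
  shows "\<bar>LINT r|lebesgue_on A. g r\<bar> \<le> (LINT r|lebesgue_on A. h r)"
proof -
  have "\<bar>LINT r|lebesgue_on A. g r\<bar> \<le> (LINT r|lebesgue_on A. \<bar>g r\<bar>)"
    using integral_norm_bound[of "lebesgue_on A" g] by simp
  also have "\<dots> \<le> (LINT r|lebesgue_on A. h r)"
    using g h le by (intro integral_mono_AE) auto
  finally show ?thesis .
qed

lemma X_increment:
  assumes st: "0 \<le> s" "s \<le> t" "t \<le> \<tau>" and w: "w \<in> S"
  shows "integrable (lebesgue_on {s..t}) (\<lambda>r. ip (Sg (t - r) (F r)) w)"
    "integrable (lebesgue_on {0..s}) (\<lambda>r. ip (Sg (t - r) (F r)) w)"
    "ip (X t) w = ip (Sg t x0) w + (LINT r|lebesgue_on {0..s}. ip (Sg (t - r) (F r)) w)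
       + (LINT r|lebesgue_on {s..t}. ip (Sg (t - r) (F r)) w)"
proof -
  note p = X_pairing[OF ip_bounded_functional[OF w], of t]
  have i: "integrable (lebesgue_on {0..t}) (\<lambda>r. ip (Sg (t - r) (F r)) w)" using p(1) st by simp
  show "integrable (lebesgue_on {s..t}) (\<lambda>r. ip (Sg (t - r) (F r)) w)"
    "integrable (lebesgue_on {0..s}) (\<lambda>r. ip (Sg (t - r) (F r)) w)"
    using st by (auto intro!: integrable_lebesgue_on_subset[OF i])
  show "ip (X t) w = ip (Sg t x0) w + (LINT r|lebesgue_on {0..s}. ip (Sg (t - r) (F r)) w)
       + (LINT r|lebesgue_on {s..t}. ip (Sg (t - r) (F r)) w)"
    using p(2) LINT_interval_combine[OF i st(1,2)] st by simp
qed

text \<open>An increment, paired with \<open>w\<close>, consists of the increment of \<open>Sg\<close> on the initial state, the change of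
  the convolution over the earlier interval, and the convolution over the new one. In the middle part the
  increment of the semigroup falls on the forcing, where \<open>forcing_approx\<close> controls it.\<close>

lemma X_uniform_path: "uniform_path \<tau> X"
proof (rule uniform_pathI)
  show "X t \<in> S" if "t \<in> {0..\<tau>}" for t using that X_mem by simp
  fix e :: real assume e: "0 < e"
  define e1 where "e1 = e / (8 * (\<tau> + 1))"
  have e1: "0 < e1" "\<tau> * e1 \<le> e / 8" using e tau by (auto simp: e1_def field_simps)
  have e8: "0 < e / 8" using e by simp
  obtain \<rho> \<delta> C where r0: "integrable (lebesgue_on {0..\<tau>}) \<rho>" "\<forall>r. 0 \<le> \<rho> r" "(LINT r|lebesgue_on {0..\<tau>}. \<rho> r) < e / 8"
    and dC: "0 < \<delta>" "0 \<le> C" and ae: "AE r in lebesgue_on {0..\<tau>}. F r \<in> S \<and> N (F r) \<le> \<rho> r + C \<and>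
       (\<forall>k. 0 \<le> k \<longrightarrow> k < \<delta> \<longrightarrow> N (Sg k (F r) - F r) \<le> 2 * \<rho> r + e1)"
    by (rule forcing_approx[OF e8 e1(1)])
  note r = r0(1) r0(2)[rule_format] r0(3)
  obtain \<delta>0 where \<delta>0: "0 < \<delta>0" "\<And>k. 0 \<le> k \<Longrightarrow> k < \<delta>0 \<Longrightarrow> N (Sg k x0 - x0) < e / 8"
    using Sg_small[OF x0 e8] by metis
  define d where "d = min (min \<delta> \<delta>0) (e / (8 * (C + 1)))"
  have d: "0 < d" "d \<le> \<delta>" "d \<le> \<delta>0" "d \<le> e / (8 * (C + 1))" using dC \<delta>0 e by (auto simp: d_def)
  have "N (X t - X s) < e" if st: "0 \<le> s" "s \<le> t" "t \<le> \<tau>" and ts: "t - s < d" for s t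
  proof -
    have Xm: "X t \<in> S" "X s \<in> S" using st X_mem by auto
    have ae1: "AE r in lebesgue_on {0..s}. F r \<in> S \<and> N (F r) \<le> \<rho> r + C \<and>
       (\<forall>k. 0 \<le> k \<longrightarrow> k < \<delta> \<longrightarrow> N (Sg k (F r) - F r) \<le> 2 * \<rho> r + e1)"
      by (rule AE_lebesgue_on_subset[OF ae]) (use st in auto)
    have ae2: "AE r in lebesgue_on {s..t}. F r \<in> S \<and> N (F r) \<le> \<rho> r + C \<and>
       (\<forall>k. 0 \<le> k \<longrightarrow> k < \<delta> \<longrightarrow> N (Sg k (F r) - F r) \<le> 2 * \<rho> r + e1)"
      by (rule AE_lebesgue_on_subset[OF ae]) (use st in auto)
    have Cts: "C * (t - s) \<le> e / 8"
    proof -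
      have "t - s \<le> e / (8 * (C + 1))" using d(4) ts by linarith
      then have "C * (t - s) \<le> (C + 1) * (e / (8 * (C + 1)))" using dC st by (intro mult_mono) auto
      moreover have "(C + 1) * (e / (8 * (C + 1))) = e / 8"
      proof -
        have "c * (e / (8 * c)) = e / 8" if "c \<noteq> 0" for c using that by simp
        from this[of "C + 1"] show ?thesis using dC(2) by linarith
      qed
      ultimately show ?thesis by linarith
    qed
    have "N (X t - X s) \<le> e * (7/8)"
    proof (rule norm_le_of_pairing)
      fix w assume w: "w \<in> S"
      note it = X_increment[OF st w]
      note js = X_pairing[OF ip_bounded_functional[OF w] st(1)]
      have is1: "integrable (lebesgue_on {0..s}) (\<lambda>r. ip (Sg (s - r) (F r)) w)" using js(1) st by simp
      have Nw: "0 \<le> N w" using w by simp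
      have A: "\<bar>LINT r|lebesgue_on {0..s}. ip (Sg (t - r) (F r)) w - ip (Sg (s - r) (F r)) w\<bar>
          \<le> (LINT r|lebesgue_on {0..s}. N w * (2 * \<rho> r + e1))"
      proof (rule abs_LINT_le)
        show "integrable (lebesgue_on {0..s}) (\<lambda>r. N w * (2 * \<rho> r + e1))"
          using integrable_forcing_bound(1)[OF r(1,2), of 0 s 2 e1] st by (intro integrable_mult_right) auto
        show "AE r in lebesgue_on {0..s}. \<bar>ip (Sg (t - r) (F r)) w - ip (Sg (s - r) (F r)) w\<bar> \<le> N w * (2 * \<rho> r + e1)"
          using ae1 AE_space
        proof eventually_elim
          case (elim r)
          then have rr: "0 \<le> r" "r \<le> s" and FS: "F r \<in> S" by auto
          have m: "Sg (t - r) (F r) \<in> S" "Sg (s - r) (F r) \<in> S" using rr st FS by auto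
          have "\<bar>ip (Sg (t - r) (F r)) w - ip (Sg (s - r) (F r)) w\<bar> \<le> N (Sg (t - r) (F r) - Sg (s - r) (F r)) * N w"
            using Cauchy_Schwarz[OF memS(3)[OF m] w] m w by (simp add: ip_diff_left)
          also have "\<dots> \<le> N (Sg (t - s) (F r) - F r) * N w"
            using Sg_time_diff_le[of "s - r" "t - r" "F r"] rr st FS w by (intro mult_right_mono) auto
          also have "\<dots> \<le> (2 * \<rho> r + e1) * N w"
            using elim(1) st ts d Nw by (intro mult_right_mono) auto
          finally show ?case by (simp add: mult.commute)
        qed
      qed (use it(2) is1 in auto)
      have B: "\<bar>LINT r|lebesgue_on {s..t}. ip (Sg (t - r) (F r)) w\<bar> \<le> (LINT r|lebesgue_on {s..t}. N w * (1 * \<rho> r + C))"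
      proof (rule abs_LINT_le)
        show "integrable (lebesgue_on {s..t}) (\<lambda>r. N w * (1 * \<rho> r + C))"
          using integrable_forcing_bound(1)[OF r(1,2), of s t 1 C] st by (intro integrable_mult_right) auto
        show "AE r in lebesgue_on {s..t}. \<bar>ip (Sg (t - r) (F r)) w\<bar> \<le> N w * (1 * \<rho> r + C)"
          using ae2 AE_space
        proof eventually_elim
          case (elim r)
          then have rr: "s \<le> r" "r \<le> t" and FS: "F r \<in> S" by auto
          have "\<bar>ip (Sg (t - r) (F r)) w\<bar> \<le> N (Sg (t - r) (F r)) * N w" using rr FS w by (intro Cauchy_Schwarz) auto
          also have "\<dots> \<le> (\<rho> r + C) * N w" using Sg_contr[of "t - r" "F r"] rr FS elim(1) Nw by (intro mult_right_mono) auto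
          finally show ?case by (simp add: mult.commute)
        qed
      qed (use it(1) in auto)
      have "ip (X t - X s) w = ip (Sg t x0 - Sg s x0) w
          + (LINT r|lebesgue_on {0..s}. ip (Sg (t - r) (F r)) w - ip (Sg (s - r) (F r)) w)
          + (LINT r|lebesgue_on {s..t}. ip (Sg (t - r) (F r)) w)"
        using it(2,3) js(2) is1 st Xm w x0 by (simp add: ip_diff_left)
      also have "\<dots> \<le> N w * (e/8) + (LINT r|lebesgue_on {0..s}. N w * (2 * \<rho> r + e1)) + (LINT r|lebesgue_on {s..t}. N w * (1 * \<rho> r + C))"
      proof -
        have "ip (Sg t x0 - Sg s x0) w \<le> N (Sg t x0 - Sg s x0) * N w"
          using Cauchy_Schwarz[of "Sg t x0 - Sg s x0" w] st x0 w by auto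
        also have "\<dots> \<le> (e/8) * N w"
          using Sg_time_diff_le[OF st(1,2) x0] \<delta>0(2)[of "t - s"] st ts d Nw by (intro mult_right_mono) auto
        finally show ?thesis using A B by (simp add: mult.commute)
      qed
      also have "\<dots> = N w * (e/8 + (2 * (LINT r|lebesgue_on {0..s}. \<rho> r) + e1 * (s - 0)) + (1 * (LINT r|lebesgue_on {s..t}. \<rho> r) + C * (t - s)))"
      proof -
        have i1: "(LINT r|lebesgue_on {0..s}. 2 * \<rho> r + e1) = 2 * (LINT r|lebesgue_on {0..s}. \<rho> r) + e1 * (s - 0)"
          using st by (intro integrable_forcing_bound(2)[OF r(1,2)]) auto
        have i2: "(LINT r|lebesgue_on {s..t}. 1 * \<rho> r + C) = 1 * (LINT r|lebesgue_on {s..t}. \<rho> r) + C * (t - s)"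
          using st by (intro integrable_forcing_bound(2)[OF r(1,2)]) auto
        show ?thesis unfolding integral_mult_right_zero i1 i2 by (simp only: distrib_left)
      qed
      \<comment> \<open>The five terms are at most \<open>e/8\<close>, \<open>2 e/8\<close>, \<open>e/8\<close>, \<open>e/8\<close> and \<open>e/8\<close>.\<close>
      also have "\<dots> \<le> N w * (e * (7/8))"
      proof (rule mult_left_mono[OF _ Nw])
        have es: "e1 * s \<le> \<tau> * e1" using e1 st by (simp add: mult.commute mult_right_mono)
        show "e/8 + (2 * (LINT r|lebesgue_on {0..s}. \<rho> r) + e1 * (s - 0)) + (1 * (LINT r|lebesgue_on {s..t}. \<rho> r) + C * (t - s)) \<le> e * (7/8)"
        proof -
          have "(LINT r|lebesgue_on {0..s}. \<rho> r) \<le> (LINT r|lebesgue_on {0..\<tau>}. \<rho> r)"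
            "(LINT r|lebesgue_on {s..t}. \<rho> r) \<le> (LINT r|lebesgue_on {0..\<tau>}. \<rho> r)"
            using st by (auto intro!: integrable_forcing_bound(3)[OF r(1,2)])
          with r(3) e e1 Cts es show ?thesis unfolding diff_zero by linarith
        qed
      qed
      finally show "ip (X t - X s) w \<le> e * (7/8) * N w" by (simp add: mult.commute)
    qed (use Xm e in auto)
    then show ?thesis using e by simp
  qed
  then show "\<exists>d>0. \<forall>s t. 0 \<le> s \<longrightarrow> s \<le> t \<longrightarrow> t \<le> \<tau> \<longrightarrow> t - s < d \<longrightarrow> N (X t - X s) < e" using d(1) by blast
qed

lemma X_zero_null: "N (X 0 - x0) = 0"
proof -
  have "N (X 0 - x0) \<le> 0"
  proof (rule norm_le_of_pairing)
    fix w assume w: "w \<in> S"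
    have null: "N (Sg 0 x0 - x0) = 0" using csg x0 by (simp add: contraction_semigroup_def)
    have "ip (X 0) w = ip (Sg 0 x0) w + (LINT r|lebesgue_on {0..0}. ip (Sg (0 - r) (F r)) w)"
      using X_pairing(2)[OF ip_bounded_functional[OF w], of 0] tau by simp
    also have "(LINT r|lebesgue_on {0..0::real}. ip (Sg (0 - r) (F r)) w) = 0"
    proof -
      have "(LINT r|lebesgue_on {0..0::real}. ip (Sg (0 - r) (F r)) w) = integral {0..0} (\<lambda>r. ip (Sg (0 - r) (F r)) w)"
        using X_pairing(1)[OF ip_bounded_functional[OF w], of 0] tau by (intro lebesgue_integral_eq_integral) auto
      then show ?thesis by simp
    qed
    also have "ip (Sg 0 x0) w = ip x0 w" using ip_eq_of_null[OF _ x0 w null] x0 by simp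
    finally show "ip (X 0 - x0) w \<le> 0 * N w" using X_mem[of 0] tau x0 w by (simp add: ip_diff_left)
  qed (use X_mem[of 0] tau x0 in auto)
  moreover have "0 \<le> N (X 0 - x0)" by (intro N_nonneg memS(3)[OF X_mem[OF order_refl tau] x0])
  ultimately show ?thesis by simp
qed

end

section \<open>Primitives and the generator\<close>

context semi_hilbert
begin

lemma contraction_semigroup_id: "contraction_semigroup S N (\<lambda>_ x. x)"
  unfolding contraction_semigroup_def by simp

text \<open>The time integral of \<open>F\<close>, presented as a mild solution for the identity semigroup so that the
  results on mild solutions apply to it.\<close>

definition primitive :: "(real \<Rightarrow> 'b) \<Rightarrow> real \<Rightarrow> 'b" where
  "primitive F t = mild_solution S N (\<lambda>_ x. x) 0 F t"

lemma primitive_problem: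
  assumes "0 \<le> \<tau>" "strongly_measurable_in (lebesgue_on {0..\<tau>}) S N F"
    "(\<integral>\<^sup>+s. ennreal (N (F s)) \<partial>lebesgue_on {0..\<tau>}) < \<infinity>"
  shows "mild_problem S ip N (\<lambda>_ x. x) F 0 \<tau>"
  by unfold_locales (use contraction_semigroup_id assms in auto)

lemma primitive_facts:
  assumes F: "0 \<le> \<tau>" "strongly_measurable_in (lebesgue_on {0..\<tau>}) S N F"
    "(\<integral>\<^sup>+s. ennreal (N (F s)) \<partial>lebesgue_on {0..\<tau>}) < \<infinity>"
  shows primitive_path: "uniform_path \<tau> (primitive F)"
    and primitive_mem: "0 \<le> t \<Longrightarrow> t \<le> \<tau> \<Longrightarrow> primitive F t \<in> S"
    and primitive_integrable: "bounded_functional \<l> \<Longrightarrow> 0 \<le> t \<Longrightarrow> t \<le> \<tau> \<Longrightarrow> integrable (lebesgue_on {0..t}) (\<lambda>s. \<l> (F s))"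
    and primitive_pairing: "bounded_functional \<l> \<Longrightarrow> 0 \<le> t \<Longrightarrow> t \<le> \<tau> \<Longrightarrow> \<l> (primitive F t) = (LINT s|lebesgue_on {0..t}. \<l> (F s))"
    and primitive_0: "N (primitive F 0) = 0"
proof -
  interpret I: mild_problem S ip N "\<lambda>_ x. x" F 0 \<tau> by (rule primitive_problem[OF F])
  have eq: "I.X = primitive F" by (auto simp: fun_eq_iff I.X_def primitive_def)
  show "uniform_path \<tau> (primitive F)" using I.X_uniform_path by (simp add: eq)
  show "0 \<le> t \<Longrightarrow> t \<le> \<tau> \<Longrightarrow> primitive F t \<in> S" unfolding eq[symmetric] by (rule I.X_mem)
  show "bounded_functional \<l> \<Longrightarrow> 0 \<le> t \<Longrightarrow> t \<le> \<tau> \<Longrightarrow> integrable (lebesgue_on {0..t}) (\<lambda>s. \<l> (F s))"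
    using I.X_pairing(1) by blast
  show "bounded_functional \<l> \<Longrightarrow> 0 \<le> t \<Longrightarrow> t \<le> \<tau> \<Longrightarrow> \<l> (primitive F t) = (LINT s|lebesgue_on {0..t}. \<l> (F s))"
    using I.X_pairing(2)[of \<l> t] bounded_functional_simps(4)[of \<l>] unfolding eq by simp
  show "N (primitive F 0) = 0" using I.X_zero_null by (simp add: eq)
qed

lemma primitive_increment:
  assumes F: "0 \<le> \<tau>" "strongly_measurable_in (lebesgue_on {0..\<tau>}) S N F"
    "(\<integral>\<^sup>+s. ennreal (N (F s)) \<partial>lebesgue_on {0..\<tau>}) < \<infinity>"
    and l: "bounded_functional \<l>" and ab: "0 \<le> a" "a \<le> b" "b \<le> \<tau>"
  shows "integrable (lebesgue_on {a..b}) (\<lambda>s. \<l> (F s))"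
    "\<l> (primitive F b) - \<l> (primitive F a) = (LINT s|lebesgue_on {a..b}. \<l> (F s))"
proof -
  have i: "integrable (lebesgue_on {0..b}) (\<lambda>s. \<l> (F s))" using primitive_integrable[OF F l] ab by simp
  show "integrable (lebesgue_on {a..b}) (\<lambda>s. \<l> (F s))" by (rule integrable_lebesgue_on_subset[OF i]) (use ab in auto)
  show "\<l> (primitive F b) - \<l> (primitive F a) = (LINT s|lebesgue_on {a..b}. \<l> (F s))"
    using primitive_pairing[OF F l] LINT_interval_combine[OF i ab(1,2)] ab by simp
qed

text \<open>An antiderivative in the weak sense of a continuous path is one for the norm as well: testing with
  \<open>w\<close> gives bounds that are uniform in \<open>w\<close>.\<close>

lemma weak_primitive_average:
  assumes d: "\<And>t. t \<in> {0..\<sigma>} \<Longrightarrow> d t \<in> S" and r: "uniform_path \<sigma> r"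
    and dr: "\<And>a b w. 0 \<le> a \<Longrightarrow> a \<le> b \<Longrightarrow> b \<le> \<sigma> \<Longrightarrow> w \<in> S \<Longrightarrow> ip (d b - d a) w = integral {a..b} (\<lambda>s. ip (r s) w)"
    and e: "0 < e"
  obtains \<delta> where "0 < \<delta>" "\<forall>a b s. 0 \<le> a \<longrightarrow> a \<le> b \<longrightarrow> b \<le> \<sigma> \<longrightarrow> s \<in> {a..b} \<longrightarrow> b - a < \<delta> \<longrightarrow>
     N (d b - d a - (b - a) *\<^sub>R r s) \<le> (b - a) * e"
proof -
  obtain \<delta> where \<delta>: "0 < \<delta>" "\<forall>s\<in>{0..\<sigma>}. \<forall>t\<in>{0..\<sigma>}. \<bar>s - t\<bar> < \<delta> \<longrightarrow> N (r s - r t) < e"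
    by (rule uniform_pathE[OF r e])
  have key: "N (d b - d a - (b - a) *\<^sub>R r s) \<le> (b - a) * e"
    if ab: "0 \<le> a" "a \<le> b" "b \<le> \<sigma>" and sab: "s \<in> {a..b}" "b - a < \<delta>" for a b s
  proof (rule norm_le_of_pairing)
    have s: "s \<in> {0..\<sigma>}" using ab sab by auto
    have rs: "r s \<in> S" using uniform_path_mem[OF r s] .
    have m: "d a \<in> S" "d b \<in> S" using ab d by auto
    show "d b - d a - (b - a) *\<^sub>R r s \<in> S" using m rs by simp
    fix w assume w: "w \<in> S"
    have c: "continuous_on {a..b} (\<lambda>u. ip (r u) w)"
      by (rule continuous_on_subset[OF uniform_path_ip_continuous[OF r uniform_path_const[OF w]]]) (use ab in auto)
    have "\<bar>integral {a..a + (b - a)} (\<lambda>u. ip (r u) w) - (b - a) * ip (r s) w\<bar> \<le> (b - a) * (e * N w)"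
    proof (rule integral_near_const)
      fix u assume "u \<in> {a..a + (b - a)}"
      then have u: "u \<in> {0..\<sigma>}" "\<bar>u - s\<bar> < \<delta>" using ab sab by auto
      have ru: "r u \<in> S" using u r uniform_path_mem by blast
      have "\<bar>ip (r u) w - ip (r s) w\<bar> \<le> N (r u - r s) * N w"
        using Cauchy_Schwarz[OF memS(3)[OF ru rs] w] ru rs w by (simp add: ip_diff_left)
      also have "\<dots> \<le> e * N w"
      proof (rule mult_right_mono)
        show "N (r u - r s) \<le> e" using \<delta>(2) u s by (simp add: less_imp_le)
      qed (use w in simp)
      finally show "\<bar>ip (r u) w - ip (r s) w\<bar> \<le> e * N w" .
    qed (use c ab in auto)
    moreover have "ip (d b - d a - (b - a) *\<^sub>R r s) w = integral {a..b} (\<lambda>u. ip (r u) w) - (b - a) * ip (r s) w"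
      using dr[OF ab w] m rs w by (simp add: ip_diff_left ip_scale_left[of "r s" "r s"])
    ultimately show "ip (d b - d a - (b - a) *\<^sub>R r s) w \<le> (b - a) * e * N w"
      unfolding mult.assoc by (simp only: add_diff_cancel_left' abs_le_iff) simp
  qed (use ab e in auto)
  show ?thesis by (rule that[OF \<delta>(1)]) (use key in blast)
qed

lemma weak_primitive_derivative:
  assumes d: "uniform_path \<sigma> d" and r: "uniform_path \<sigma> r"
    and dr: "\<And>a b w. 0 \<le> a \<Longrightarrow> a \<le> b \<Longrightarrow> b \<le> \<sigma> \<Longrightarrow> w \<in> S \<Longrightarrow> ip (d b - d a) w = integral {a..b} (\<lambda>s. ip (r s) w)"
    and s: "s \<in> {0..\<sigma>}"
  shows "((\<lambda>y. N ((1 / (y - s)) *\<^sub>R (d y - d s) - r s)) \<longlongrightarrow> 0) (at s within {0..\<sigma>})"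
proof (rule tendstoI)
  fix e :: real assume e: "0 < e"
  then have e2: "0 < e/2" by simp
  obtain \<delta> where \<delta>: "0 < \<delta>" and key0: "\<forall>a b s. 0 \<le> a \<longrightarrow> a \<le> b \<longrightarrow> b \<le> \<sigma> \<longrightarrow> s \<in> {a..b} \<longrightarrow> b - a < \<delta> \<longrightarrow>
     N (d b - d a - (b - a) *\<^sub>R r s) \<le> (b - a) * (e/2)"
    by (rule weak_primitive_average[OF uniform_path_mem[OF d] r dr e2])
  note key = key0[rule_format]
  have rs: "r s \<in> S" and ds: "d s \<in> S" using s d r uniform_path_mem by auto
  have "N ((1 / (y - s)) *\<^sub>R (d y - d s) - r s) < e" if y: "y \<in> {0..\<sigma>}" "y \<noteq> s" "dist y s < \<delta>" for y
  proof -
    have dy: "d y \<in> S" using y d uniform_path_mem by blast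
    have m: "d y - d s - (y - s) *\<^sub>R r s \<in> S" using dy ds rs by simp
    have "N (d y - d s - (y - s) *\<^sub>R r s) \<le> \<bar>y - s\<bar> * (e/2)"
    proof (cases "s \<le> y")
      case True
      then show ?thesis using key[of s y] y s by (auto simp: dist_real_def)
    next
      case False
      have eq: "d y - d s - (y - s) *\<^sub>R r s = - (d s - d y - (s - y) *\<^sub>R r s)" by (simp add: algebra_simps)
      have "d s - d y - (s - y) *\<^sub>R r s \<in> S" using dy ds rs by simp
      then have "N (d y - d s - (y - s) *\<^sub>R r s) = N (d s - d y - (s - y) *\<^sub>R r s)" unfolding eq by (rule N_minus)
      then show ?thesis using key[of y s] y s False by (auto simp: dist_real_def)
    qed
    then have "\<bar>1 / (y - s)\<bar> * N (d y - d s - (y - s) *\<^sub>R r s) \<le> \<bar>1 / (y - s)\<bar> * (\<bar>y - s\<bar> * (e/2))"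
      by (rule mult_left_mono) simp
    moreover have eq: "(1 / (y - s)) *\<^sub>R (d y - d s) - r s = (1 / (y - s)) *\<^sub>R (d y - d s - (y - s) *\<^sub>R r s)"
      using y(2) by (simp add: scaleR_diff_right)
    ultimately have "N ((1 / (y - s)) *\<^sub>R (d y - d s) - r s) \<le> \<bar>1 / (y - s)\<bar> * (\<bar>y - s\<bar> * (e/2))"
      unfolding eq scale[OF m] by simp
    also have "\<dots> = e/2" using y(2) by (simp add: abs_divide)
    finally show ?thesis using e by simp
  qed
  moreover have "0 \<le> N ((1 / (y - s)) *\<^sub>R (d y - d s) - r s)" if "y \<in> {0..\<sigma>}" for y
    using uniform_path_mem[OF d that] ds rs by simp
  ultimately show "\<forall>\<^sub>F y in at s within {0..\<sigma>}. dist (N ((1 / (y - s)) *\<^sub>R (d y - d s) - r s)) 0 < e"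
    unfolding eventually_at using \<delta> by (intro exI[of _ \<delta>]) auto
qed

text \<open>The quotient \<open>(ip (d y) (d y) - ip (d s) (d s)) / (y - s)\<close> is the pairing of the difference quotient
  of \<open>d\<close> with \<open>d y + d s\<close>.\<close>

lemma energy_identity:
  assumes d: "uniform_path \<sigma> d" and r: "uniform_path \<sigma> r"
    and dr: "\<And>a b w. 0 \<le> a \<Longrightarrow> a \<le> b \<Longrightarrow> b \<le> \<sigma> \<Longrightarrow> w \<in> S \<Longrightarrow> ip (d b - d a) w = integral {a..b} (\<lambda>s. ip (r s) w)"
    and \<sigma>: "0 \<le> \<sigma>"
  shows "ip (d \<sigma>) (d \<sigma>) - ip (d 0) (d 0) = integral {0..\<sigma>} (\<lambda>s. 2 * ip (r s) (d s))"
proof -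
  have "((\<lambda>t. ip (d t) (d t)) has_real_derivative 2 * ip (r s) (d s)) (at s within {0..\<sigma>})" if s: "s \<in> {0..\<sigma>}" for s
    unfolding has_field_derivative_iff
  proof -
    let ?F = "at s within {0..\<sigma>}" and ?v = "\<lambda>y. (1 / (y - s)) *\<^sub>R (d y - d s)"
    have rs: "r s \<in> S" and ds: "d s \<in> S" using s d r uniform_path_mem by auto
    have dm: "d y \<in> S" if "y \<in> {0..\<sigma>}" for y using that d uniform_path_mem by blast
    have ev: "\<forall>\<^sub>F y in ?F. ?v y \<in> S \<and> d y + d s \<in> S"
      unfolding eventually_at_filter using dm ds by (auto intro!: always_eventually)
    have sum: "((\<lambda>y. N ((d y + d s) - (d s + d s))) \<longlongrightarrow> 0) ?F"
      using uniform_path_tendsto[OF d s] by simp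
    have "((\<lambda>y. ip (?v y) (d y + d s)) \<longlongrightarrow> ip (r s) (d s + d s)) ?F"
      by (rule ip_tendsto_both[OF weak_primitive_derivative[OF d r dr s] sum ev]) (use rs ds in auto)
    then have "((\<lambda>y. ip (?v y) (d y + d s)) \<longlongrightarrow> 2 * ip (r s) (d s)) ?F"
      using rs ds by (simp add: ip_add_right)
    then show "((\<lambda>y. (ip (d y) (d y) - ip (d s) (d s)) / (y - s)) \<longlongrightarrow> 2 * ip (r s) (d s)) ?F"
    proof (rule Lim_transform_eventually)
      have "ip (?v y) (d y + d s) = (ip (d y) (d y) - ip (d s) (d s)) / (y - s)" if "y \<in> {0..\<sigma>}" for y
      proof -
        have m: "d y - d s \<in> S" "d y + d s \<in> S" using dm[OF that] ds by auto
        have "ip (d y - d s) (d y + d s) = ip (d y) (d y) - ip (d s) (d s)"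
          using dm[OF that] ds by (simp add: ip_diff_left ip_add_right ip_commute[of "d s" "d y"])
        then show ?thesis using ip_scale_left[OF m(1) m(1) m(2)] by simp
      qed
      then show "\<forall>\<^sub>F y in ?F. ip (?v y) (d y + d s) = (ip (d y) (d y) - ip (d s) (d s)) / (y - s)"
        unfolding eventually_at_filter by (auto intro!: always_eventually)
    qed
  qed
  then have "((\<lambda>s. 2 * ip (r s) (d s)) has_integral ip (d \<sigma>) (d \<sigma>) - ip (d 0) (d 0)) {0..\<sigma>}"
    using \<sigma> by (intro fundamental_theorem_of_calculus) (auto simp: has_real_derivative_iff_has_vector_derivative)
  from integral_unique[OF this] show ?thesis by simp
qed

text \<open>A bounded sequence in a complete space that converges for a weaker norm has its limit, up to a null
  element, in the space, and the bound persists. The convex hulls of the tails contain elements of almost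
  minimal norm; by the parallelogram law these form a Cauchy sequence.\<close>

lemma bounded_weak_limit:
  assumes S': "seminormed_space S' N'" and sub: "S \<subseteq> S'" and C: "\<And>x. x \<in> S \<Longrightarrow> N' x \<le> C * N x"
    and v: "\<And>n::nat. v n \<in> S" "\<And>n. ip (v n) (v n) \<le> c" and u: "u \<in> S'" and lim: "(\<lambda>n. N' (v n - u)) \<longlonglongrightarrow> 0"
  shows "\<exists>w\<in>S. ip w w \<le> c \<and> N' (w - u) = 0"
proof -
  interpret S': seminormed_space S' N' by (rule S')
  define Cn where "Cn n = convex hull (v ` {n..})" for n
  \<comment> \<open>Balls of both norms are convex, so the bounds for the sequence hold on the hulls of its tails.\<close>
  have half: "ip (\<alpha> *\<^sub>R x + \<beta> *\<^sub>R y) (\<alpha> *\<^sub>R x + \<beta> *\<^sub>R y) \<le> c"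
    if xy: "x \<in> S" "y \<in> S" "ip x x \<le> c" "ip y y \<le> c" and ab: "0 \<le> \<alpha>" "0 \<le> \<beta>" "\<alpha> + \<beta> = 1" for \<alpha> \<beta> x y
  proof -
    have "ip (\<alpha> *\<^sub>R x + \<beta> *\<^sub>R y) (\<alpha> *\<^sub>R x + \<beta> *\<^sub>R y) = \<alpha>\<^sup>2 * ip x x + 2 * (\<alpha> * \<beta>) * ip x y + \<beta>\<^sup>2 * ip y y"
      using xy by (simp add: ip_self_add ip_scale_left ip_scale_right power2_eq_square)
    also have "2 * (\<alpha> * \<beta>) * ip x y \<le> (\<alpha> * \<beta>) * (ip x x + ip y y)"
      using nonneg[of "x - y"] xy ab mult_left_mono[of "2 * ip x y" "ip x x + ip y y" "\<alpha> * \<beta>"] by (simp add: ip_self_diff)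
    also have "\<alpha>\<^sup>2 * ip x x + (\<alpha> * \<beta>) * (ip x x + ip y y) + \<beta>\<^sup>2 * ip y y = (\<alpha> + \<beta>) * (\<alpha> * ip x x + \<beta> * ip y y)"
      by (simp add: algebra_simps power2_eq_square)
    also have "\<dots> \<le> \<alpha> * c + \<beta> * c" using ab xy by (auto intro!: add_mono mult_left_mono)
    also have "\<dots> = c" using ab by (simp flip: distrib_right)
    finally show ?thesis by simp
  qed
  have CnS: "Cn n \<subseteq> {x \<in> S. ip x x \<le> c}" for n
    unfolding Cn_def
  proof (rule hull_minimal)
    show "v ` {n..} \<subseteq> {x \<in> S. ip x x \<le> c}" using v by auto
    show "convex {x \<in> S. ip x x \<le> c}" unfolding convex_def using half by auto
  qed
  have Cnu: "N' (x - u) \<le> \<delta>" if x: "x \<in> Cn n" and \<delta>: "\<And>k. k \<ge> n \<Longrightarrow> N' (v k - u) \<le> \<delta>" for x n \<delta>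
  proof -
    have "Cn n \<subseteq> {x \<in> S'. N' (x - u) \<le> \<delta>}"
      unfolding Cn_def
    proof (rule hull_minimal)
      show "v ` {n..} \<subseteq> {x \<in> S'. N' (x - u) \<le> \<delta>}" using v sub \<delta> by auto
      show "convex {x \<in> S'. N' (x - u) \<le> \<delta>}"
        unfolding convex_def
      proof (intro ballI allI impI)
        fix x y \<alpha> \<beta> assume x: "x \<in> {x \<in> S'. N' (x - u) \<le> \<delta>}" and y: "y \<in> {x \<in> S'. N' (x - u) \<le> \<delta>}"
          and ab: "0 \<le> \<alpha>" "0 \<le> \<beta>" "\<alpha> + \<beta> = (1::real)"
        have m: "x - u \<in> S'" "y - u \<in> S'" using x y u by auto
        have "\<alpha> *\<^sub>R x + \<beta> *\<^sub>R y - u = \<alpha> *\<^sub>R x + \<beta> *\<^sub>R y - (\<alpha> + \<beta>) *\<^sub>R u" using ab by simp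
        also have "\<dots> = \<alpha> *\<^sub>R (x - u) + \<beta> *\<^sub>R (y - u)" by (simp add: algebra_simps)
        finally have "N' (\<alpha> *\<^sub>R x + \<beta> *\<^sub>R y - u) \<le> \<alpha> * N' (x - u) + \<beta> * N' (y - u)"
          using S'.triangle[of "\<alpha> *\<^sub>R (x - u)" "\<beta> *\<^sub>R (y - u)"] m ab by (simp add: S'.scale)
        also have "\<dots> \<le> \<alpha> * \<delta> + \<beta> * \<delta>" using x y ab by (intro add_mono mult_left_mono) auto
        also have "\<dots> = \<delta>" using ab by (simp flip: distrib_right)
        finally show "\<alpha> *\<^sub>R x + \<beta> *\<^sub>R y \<in> {x \<in> S'. N' (x - u) \<le> \<delta>}" using x y by auto
      qed
    qed
    with x show ?thesis by blast
  qed
  have Cmono: "Cn m \<subseteq> Cn n" if "n \<le> m" for n m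
    unfolding Cn_def using that by (intro hull_mono) auto
  have vC: "v n \<in> Cn n" for n unfolding Cn_def by (rule hull_inc) simp
  define Q where "Q n = (\<lambda>x. ip x x) ` Cn n" for n
  have Qne: "Q n \<noteq> {}" and Qbd: "bdd_below (Q n)" for n
  proof -
    show "Q n \<noteq> {}" using vC[of n] by (auto simp: Q_def)
    show "bdd_below (Q n)" unfolding Q_def using CnS[of n] nonneg by (intro bdd_belowI[of _ 0]) auto
  qed
  \<comment> \<open>The infima increase with \<open>n\<close> and stay below \<open>c\<close>; their convergence is what makes the parallelogram
    law give a Cauchy sequence.\<close>
  define dn where "dn n = Inf (Q n)" for n
  have "incseq dn"
    unfolding incseq_def dn_def using Cmono Qne Qbd by (auto intro!: cInf_superset_mono simp: Q_def)
  moreover have dn_le: "dn n \<le> c" for n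
  proof -
    have "dn n \<le> ip (v n) (v n)" unfolding dn_def by (rule cInf_lower[OF _ Qbd]) (use vC in \<open>auto simp: Q_def\<close>)
    with v(2)[of n] show ?thesis by simp
  qed
  ultimately obtain D where D: "dn \<longlonglongrightarrow> D" "\<And>i. dn i \<le> D" by (metis incseq_convergent)
  have "\<exists>w\<in>Cn n. ip w w < dn n + inverse (real (Suc n))" for n
  proof -
    have "Inf (Q n) < dn n + inverse (real (Suc n))" by (simp add: dn_def)
    then show ?thesis using cInf_less_iff[OF Qne Qbd, of n] by (auto simp: Q_def)
  qed
  then obtain w where w: "\<And>n. w n \<in> Cn n" "\<And>n. ip (w n) (w n) < dn n + inverse (real (Suc n))" by metis
  have wS: "w n \<in> S" and wc: "ip (w n) (w n) \<le> c" for n using w(1)[of n] CnS[of n] by auto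
  have par: "(N (w m - w n))\<^sup>2 \<le> 4 * (D - dn n) + 4 * inverse (real (Suc n))" if nm: "n \<le> m" for n m
  proof -
    let ?h = "(1/2) *\<^sub>R w m + (1/2) *\<^sub>R w n"
    have "w m \<in> Cn n" using w(1)[of m] Cmono[OF nm] by blast
    then have "?h \<in> Cn n" using w(1)[of n] convex_convex_hull[of "v ` {n..}"] unfolding Cn_def convex_def by simp
    then have "dn n \<le> ip ?h ?h" unfolding dn_def by (intro cInf_lower[OF _ Qbd]) (auto simp: Q_def)
    moreover have "4 * ip ?h ?h = ip (w m) (w m) + 2 * ip (w m) (w n) + ip (w n) (w n)"
      using wS by (simp add: ip_self_add ip_scale_left[OF wS wS] ip_scale_right[OF wS wS])
    moreover have "(N (w m - w n))\<^sup>2 = ip (w m) (w m) - 2 * ip (w m) (w n) + ip (w n) (w n)"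
      using wS by (simp add: N_square ip_self_diff)
    moreover have "inverse (real (Suc m)) \<le> inverse (real (Suc n))" using nm by (simp add: le_imp_inverse_le)
    moreover have "Q \<le> 4 * (D - b) + 4 * i"
      if "b \<le> h" "4 * h = A + 2 * B + E" "Q = A - 2 * B + E" "j \<le> i" "A < a + j" "E < b + i" "a \<le> D" "b \<le> D"
      for Q h A B E a b i j :: real
    proof -
      have "Q = 2 * A + 2 * E - 4 * h" using that by simp
      also have "\<dots> \<le> 2 * a + 2 * j + 2 * i - 2 * b" using that by simp
      also have "\<dots> \<le> 4 * (D - b) + 4 * i" using that by simp
      finally show ?thesis .
    qed
    ultimately show ?thesis using w(2)[of m] w(2)[of n] D(2)[of m] D(2)[of n] by blast
  qed
  have "\<exists>l\<in>S. (\<lambda>n. N (w n - l)) \<longlonglongrightarrow> 0"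
  proof (rule complete[OF wS])
    fix e :: real assume e: "0 < e"
    have "(\<lambda>n. 4 * (D - dn n) + 4 * inverse (real (Suc n))) \<longlonglongrightarrow> 4 * (D - D) + 4 * 0"
      by (intro tendsto_add tendsto_mult tendsto_diff tendsto_const D LIMSEQ_inverse_real_of_nat)
    then have "\<forall>\<^sub>F n in sequentially. 4 * (D - dn n) + 4 * inverse (real (Suc n)) < e\<^sup>2"
      by (rule order_tendstoD(2)) (use e in simp)
    then obtain k where k: "\<And>n. n \<ge> k \<Longrightarrow> 4 * (D - dn n) + 4 * inverse (real (Suc n)) < e\<^sup>2"
      by (auto simp: eventually_sequentially)
    have lt: "N (w m - w n) < e" if "n \<ge> k" "n \<le> m" for m n
      by (rule power2_less_imp_less) (use par[OF that(2)] k[OF that(1)] e in auto)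
    have "N (w m - w n) < e" if "m \<ge> k" "n \<ge> k" for m n
      using lt[of n m] lt[of m n] that N_commute[OF wS wS, of m n] by (cases "n \<le> m") auto
    then show "\<exists>k. \<forall>m\<ge>k. \<forall>n\<ge>k. N (w m - w n) < e" by blast
  qed
  then obtain l where l: "l \<in> S" "(\<lambda>n. N (w n - l)) \<longlonglongrightarrow> 0" by blast
  have "(\<lambda>n. N (l - w n)) \<longlonglongrightarrow> 0" using l N_commute[OF l(1) wS] by simp
  from ip_tendsto[OF _ l(1) this] have "(\<lambda>n. ip (w n) (w n)) \<longlonglongrightarrow> ip l l" using wS by simp
  then have "ip l l \<le> c" using wc by (intro LIMSEQ_le_const2) auto
  moreover have "N' (l - u) = 0"
  proof -
    have lu: "l - u \<in> S'" using l sub u by blast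
    have le: "N' (l - u) \<le> e" if e: "0 < e" for e
    proof -
      have "\<forall>\<^sub>F n in sequentially. N' (v n - u) < e/2" using order_tendstoD(2)[OF lim, of "e/2"] e by simp
      then obtain k where k: "\<forall>n\<ge>k. N' (v n - u) < e/2" by (auto simp: eventually_sequentially)
      have "(\<lambda>n. C * N (w n - l)) \<longlonglongrightarrow> 0" using tendsto_mult_left[OF l(2), of C] by simp
      then have "\<forall>\<^sub>F n in sequentially. C * N (w n - l) < e/2" by (rule order_tendstoD(2)) (use e in simp)
      then obtain k' where k': "\<And>n. n \<ge> k' \<Longrightarrow> C * N (w n - l) < e/2" by (auto simp: eventually_sequentially)
      let ?n = "max k k'"
      have m: "w ?n \<in> S'" "l \<in> S'" using wS l sub by auto
      have "N' (w ?n - u) \<le> e/2" by (rule Cnu[OF w(1)]) (use k in \<open>simp add: less_imp_le\<close>)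
      moreover have "N' (l - w ?n) \<le> e/2"
        using C[of "w ?n - l"] k'[of ?n] wS l S'.N_commute[OF m] by simp
      ultimately show ?thesis using S'.triangle_diff[OF m(2,1) u] by simp
    qed
    have "N' (l - u) \<le> 0" by (rule field_le_epsilon) (simp add: le)
    then show ?thesis using S'.N_nonneg[OF lu] by simp
  qed
  ultimately show ?thesis using l(1) by blast
qed

end

context mild_problem
begin

lemma X_regular: "strongly_measurable_in (lebesgue_on {0..\<tau>}) S N X" "(\<integral>\<^sup>+s. ennreal (N (X s)) \<partial>lebesgue_on {0..\<tau>}) < \<infinity>"
  using uniform_path_strongly_measurable[OF X_uniform_path] .

text \<open>The variation of constants formula restarted at time \<open>s\<close>.\<close>

lemma X_shift:
  assumes s: "0 \<le> s" and k: "0 \<le> k" and sk: "s + k \<le> \<tau>" and w: "w \<in> S"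
  shows "ip (Sg k (X s)) w = ip (X (s + k)) w - (LINT r|lebesgue_on {s..s+k}. ip (Sg (s + k - r) (F r)) w)"
proof -
  have s\<tau>: "s \<le> \<tau>" using k sk by simp
  note l = Sg_functional[OF k w]
  note pX = X_pairing[OF l s s\<tau>]
  note inc = X_increment[of s "s + k", OF s _ sk w]
  have inc1: "integrable (lebesgue_on {0..s}) (\<lambda>r. ip (Sg (s + k - r) (F r)) w)" using inc(2) k by simp
  have FS: "AE r in lebesgue_on {0..s}. F r \<in> S" using F_meas_sub[OF s\<tau>] by (simp add: strongly_measurable_in_def)
  have "(LINT r|lebesgue_on {0..s}. ip (Sg k (Sg (s - r) (F r))) w) = (LINT r|lebesgue_on {0..s}. ip (Sg (s + k - r) (F r)) w)"
  proof (rule integral_cong_AE)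
    show "AE r in lebesgue_on {0..s}. ip (Sg k (Sg (s - r) (F r))) w = ip (Sg (s + k - r) (F r)) w"
      using FS AE_space
    proof eventually_elim
      case (elim r)
      then have "0 \<le> s - r" by simp
      from Sg_ip(3)[OF k elim(1) elim(1) w this] show ?case by (simp add: algebra_simps)
    qed
  qed (use pX(1) inc1 in auto)
  moreover have "ip (Sg k (Sg s x0)) w = ip (Sg (s + k) x0) w"
    using Sg_ip(3)[OF k x0 x0 w s] by (simp add: add.commute)
  ultimately show ?thesis using pX(2) inc(3) k by simp
qed

lemma primitive_forcing:
  shows "uniform_path \<tau> (primitive F)" "uniform_path \<tau> (primitive X)"
  using primitive_path[OF tau F_meas F_int] primitive_path[OF tau X_regular] .

text \<open>The time integral of a mild solution lies in the domain of the generator. Shifting the variation of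
  constants formula by \<open>k\<close> produces the increment of \<open>X\<close>, and the remaining convolution over \<open>[s, s + k]\<close>
  differs from the increment of the primitive of the forcing by \<open>o(k)\<close> after integration in \<open>s\<close>.\<close>

lemma generator_of_primitive:
  assumes t: "0 \<le> t" "t < \<tau>"
  shows "((\<lambda>k. N ((1 / k) *\<^sub>R (Sg k (primitive X t) - primitive X t) - (X t - primitive F t - x0))) \<longlongrightarrow> 0) (at_right 0)"
proof (rule tendstoI)
  fix c :: real assume c: "0 < c"
  define e1 where "e1 = c / (8 * (\<tau> + 1))"
  have e1: "0 < e1" "\<tau> * e1 \<le> c / 8" using c tau by (auto simp: e1_def field_simps)
  have c16: "0 < c / 16" and c8: "0 < c / 8" using c by auto
  obtain \<rho> \<delta> C where r0: "integrable (lebesgue_on {0..\<tau>}) \<rho>" "\<forall>r. 0 \<le> \<rho> r" "(LINT r|lebesgue_on {0..\<tau>}. \<rho> r) < c / 16"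
    and dC: "0 < \<delta>" "0 \<le> C" and ae: "AE r in lebesgue_on {0..\<tau>}. F r \<in> S \<and> N (F r) \<le> \<rho> r + C \<and>
       (\<forall>k. 0 \<le> k \<longrightarrow> k < \<delta> \<longrightarrow> N (Sg k (F r) - F r) \<le> 2 * \<rho> r + e1)"
    by (rule forcing_approx[OF c16 e1(1)])
  note r = r0(1) r0(2)[rule_format] r0(3)
  let ?I = "primitive F" and ?P = "primitive X"
  let ?Y = "\<lambda>s. X s - ?I s"
  have Ypath: "uniform_path \<tau> ?Y" by (rule uniform_path_diff[OF X_uniform_path primitive_forcing(1)])
  obtain \<delta>' where \<delta>': "0 < \<delta>'" "\<forall>s\<in>{0..\<tau>}. \<forall>t\<in>{0..\<tau>}. \<bar>s - t\<bar> < \<delta>' \<longrightarrow> N (?Y s - ?Y t) < c / 8"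
    by (rule uniform_pathE[OF Ypath c8])
  \<comment> \<open>\<open>R\<close> measures the part of the forcing on which the semigroup is not uniformly close to the identity.\<close>
  define R where "R s = (LINT r|lebesgue_on {0..s}. \<rho> r)" for s
  have Rc: "continuous_on {0..\<tau>} R" unfolding R_def by (rule absolutely_continuous_primitive[OF r(1)])
  have Rinc: "(LINT r|lebesgue_on {a..b}. \<rho> r) = R b - R a" if "0 \<le> a" "a \<le> b" "b \<le> \<tau>" for a b
  proof -
    have "integrable (lebesgue_on {0..b}) \<rho>" by (rule integrable_lebesgue_on_subset[OF r(1)]) (use that in auto)
    from LINT_interval_combine[OF this that(1,2)] show ?thesis by (simp add: R_def)
  qed
  have Rb: "0 \<le> R s" "s \<in> {0..\<tau>} \<Longrightarrow> R s \<le> c / 16" for s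
  proof -
    show "0 \<le> R s" unfolding R_def using r(2) by (intro Bochner_Integration.integral_nonneg) auto
    assume "s \<in> {0..\<tau>}"
    then show "R s \<le> c / 16" using integrable_forcing_bound(3)[OF r(1,2), of 0 s] r(3) by (simp add: R_def)
  qed
  have mem: "X s \<in> S" "?I s \<in> S" "?P s \<in> S" if "s \<in> {0..\<tau>}" for s
    using that uniform_path_mem X_uniform_path primitive_forcing by auto
  have main: "N (Sg k (?P t) - ?P t - k *\<^sub>R (X t - ?I t - x0)) \<le> k * (c / 2)"
    if k: "0 < k" "k < \<delta>" "k < \<delta>'" "t + k \<le> \<tau>" for k
  proof (rule norm_le_of_pairing)
    have k0: "0 \<le> k" and tt: "t \<in> {0..\<tau>}" and t\<tau>: "t \<le> \<tau>" using k t by auto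
    show "Sg k (?P t) - ?P t - k *\<^sub>R (X t - ?I t - x0) \<in> S" using mem[OF tt] k0 x0 by auto
    fix w assume w: "w \<in> S"
    have Nw: "0 \<le> N w" using w by simp
    define g where "g s = ip (?Y s) w" for s
    have gc: "continuous_on {0..\<tau>} g"
      unfolding g_def by (rule uniform_path_ip_continuous[OF Ypath uniform_path_const[OF w]])
    note lw = ip_bounded_functional[OF w] and lk = Sg_functional[OF k0 w]
    \<comment> \<open>\<open>E s\<close> is the error of replacing \<open>Sg\<close> by the identity in the convolution over \<open>[s, s + k]\<close>. Its bound
      contains the increment of \<open>R\<close>, whose integral over \<open>s\<close> is \<open>O(k)\<close> with a small constant.\<close>
    define E where "E s = (LINT r|lebesgue_on {s..s+k}. ip (Sg (s + k - r) (F r)) w - ip (F r) w)" for s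
    have point: "ip (Sg k (X s)) w - ip (X s) w = (g (s + k) - g s) - E s" if s: "s \<in> {0..t}" for s
    proof -
      have sk: "0 \<le> s" "s + k \<le> \<tau>" using s k by auto
      have iF: "integrable (lebesgue_on {s..s+k}) (\<lambda>r. ip (F r) w)"
        "ip (?I (s + k)) w - ip (?I s) w = (LINT r|lebesgue_on {s..s+k}. ip (F r) w)"
        using primitive_increment[OF tau F_meas F_int lw, of s "s + k"] sk k by auto
      have iS: "integrable (lebesgue_on {s..s+k}) (\<lambda>r. ip (Sg (s + k - r) (F r)) w)"
        using X_increment(1)[of s "s + k" w] sk k w by simp
      have "E s = (LINT r|lebesgue_on {s..s+k}. ip (Sg (s + k - r) (F r)) w) - (ip (?I (s + k)) w - ip (?I s) w)"
        unfolding E_def using iF iS by simp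
      moreover have "g (s + k) - g s = ip (X (s + k)) w - ip (X s) w - (ip (?I (s + k)) w - ip (?I s) w)"
        unfolding g_def using mem[of s] mem[of "s + k"] sk k w by (simp add: ip_diff_left)
      ultimately show ?thesis using X_shift[OF sk(1) k0 sk(2) w] by simp
    qed
    have Ebound: "\<bar>E s\<bar> \<le> N w * (2 * (R (s + k) - R s) + e1 * k)" if s: "s \<in> {0..t}" for s
    proof -
      have sk: "0 \<le> s" "s \<le> s + k" "s + k \<le> \<tau>" using s k by auto
      have iF: "integrable (lebesgue_on {s..s+k}) (\<lambda>r. ip (F r) w)"
        using primitive_increment(1)[OF tau F_meas F_int lw sk] .
      have iS: "integrable (lebesgue_on {s..s+k}) (\<lambda>r. ip (Sg (s + k - r) (F r)) w)"
        using X_increment(1)[OF sk w] .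
      have ae1: "AE r in lebesgue_on {s..s+k}. F r \<in> S \<and> N (F r) \<le> \<rho> r + C \<and>
         (\<forall>k. 0 \<le> k \<longrightarrow> k < \<delta> \<longrightarrow> N (Sg k (F r) - F r) \<le> 2 * \<rho> r + e1)"
        by (rule AE_lebesgue_on_subset[OF ae]) (use sk in auto)
      have "\<bar>E s\<bar> \<le> (LINT r|lebesgue_on {s..s+k}. N w * (2 * \<rho> r + e1))"
        unfolding E_def
      proof (rule abs_LINT_le)
        show "integrable (lebesgue_on {s..s+k}) (\<lambda>r. N w * (2 * \<rho> r + e1))"
          using integrable_forcing_bound(1)[OF r(1,2) sk] by (rule integrable_mult_right)
        show "AE r in lebesgue_on {s..s+k}. \<bar>ip (Sg (s + k - r) (F r)) w - ip (F r) w\<bar> \<le> N w * (2 * \<rho> r + e1)"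
          using ae1 AE_space
        proof eventually_elim
          case (elim r)
          then have rr: "0 \<le> s + k - r" "s + k - r < \<delta>" and FS: "F r \<in> S" using k by auto
          have m: "Sg (s + k - r) (F r) \<in> S" using rr FS by auto
          have "\<bar>ip (Sg (s + k - r) (F r)) w - ip (F r) w\<bar> \<le> N (Sg (s + k - r) (F r) - F r) * N w"
            using Cauchy_Schwarz[OF memS(3)[OF m FS] w] m FS w by (simp add: ip_diff_left)
          also have "\<dots> \<le> (2 * \<rho> r + e1) * N w" using elim(1) rr Nw by (intro mult_right_mono) auto
          finally show ?case by (simp add: mult.commute)
        qed
      qed (use iF iS in auto)
      also have "\<dots> = N w * (2 * (LINT r|lebesgue_on {s..s+k}. \<rho> r) + e1 * (s + k - s))"
        unfolding integral_mult_right_zero integrable_forcing_bound(2)[OF r(1,2) sk] ..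
      finally show ?thesis unfolding Rinc[OF sk] by simp
    qed
    have iP: "integrable (lebesgue_on {0..t}) (\<lambda>s. ip (Sg k (X s)) w)" "ip (Sg k (?P t)) w = (LINT s|lebesgue_on {0..t}. ip (Sg k (X s)) w)"
      "integrable (lebesgue_on {0..t}) (\<lambda>s. ip (X s) w)" "ip (?P t) w = (LINT s|lebesgue_on {0..t}. ip (X s) w)"
      using primitive_integrable[OF tau X_regular lk t(1) t\<tau>] primitive_pairing[OF tau X_regular lk t(1) t\<tau>]
        primitive_integrable[OF tau X_regular lw t(1) t\<tau>] primitive_pairing[OF tau X_regular lw t(1) t\<tau>] by auto
    have shift_cont: "continuous_on {0..t} (\<lambda>s. h (s + k) - h s)" if h: "continuous_on {0..\<tau>} h" for h :: "real \<Rightarrow> real"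
    proof -
      have "continuous_on {0..t} (\<lambda>s. h (s + k))"
        by (rule continuous_on_compose2[OF h]) (use k in \<open>auto intro!: continuous_intros\<close>)
      moreover have "continuous_on {0..t} h" by (rule continuous_on_subset[OF h]) (use k in auto)
      ultimately show ?thesis by (intro continuous_on_diff)
    qed
    note gs = LINT_continuous[OF shift_cont[OF gc]] and Rs = LINT_continuous[OF shift_cont[OF Rc]]
    have sub: "{0..t+k} \<subseteq> {0..\<tau>}" "{t..t+k} \<subseteq> {0..\<tau>}" "{0..0+k} \<subseteq> {0..\<tau>}" using k t by auto
    have "\<bar>(ip (Sg k (?P t)) w - ip (?P t) w) - (LINT s|lebesgue_on {0..t}. g (s + k) - g s)\<bar>
       = \<bar>LINT s|lebesgue_on {0..t}. (ip (Sg k (X s)) w - ip (X s) w) - (g (s + k) - g s)\<bar>"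
      using iP gs(1) by simp
    also have "\<dots> \<le> (LINT s|lebesgue_on {0..t}. N w * (2 * (R (s + k) - R s) + e1 * k))"
    proof (rule abs_LINT_le)
      interpret finite_measure "lebesgue_on {0..t}" by (rule finite_measure_interval)
      show "integrable (lebesgue_on {0..t}) (\<lambda>s. N w * (2 * (R (s + k) - R s) + e1 * k))"
        using Rs(1) by (intro integrable_mult_right Bochner_Integration.integrable_add) auto
      show "AE s in lebesgue_on {0..t}. \<bar>ip (Sg k (X s)) w - ip (X s) w - (g (s + k) - g s)\<bar> \<le> N w * (2 * (R (s + k) - R s) + e1 * k)"
      proof (rule AE_I2)
        fix s assume "s \<in> space (lebesgue_on {0..t})"
        then have s: "s \<in> {0..t}" by simp
        show "\<bar>ip (Sg k (X s)) w - ip (X s) w - (g (s + k) - g s)\<bar> \<le> N w * (2 * (R (s + k) - R s) + e1 * k)"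
          using Ebound[OF s] point[OF s] by simp
      qed
    qed (use iP gs(1) in auto)
    also have "\<dots> \<le> N w * (k * (c / 4))"
    proof -
      have Rcont: "continuous_on {t..t+k} R" "continuous_on {0..0+k} R" "continuous_on {0..t+k} R"
        using sub by (auto intro: continuous_on_subset[OF Rc])
      have "(LINT s|lebesgue_on {0..t}. R (s + k) - R s) = integral {t..t+k} R - integral {0..k} R"
        unfolding Rs(2) by (rule integral_shift_diff[OF Rcont(3) t(1) k0])
      also have "\<dots> \<le> integral {t..t+k} R"
        using Rcont(2) Rb(1) by (simp add: Henstock_Kurzweil_Integration.integral_nonneg integrable_continuous_real)
      also have "\<dots> \<le> integral {t..t+k} (\<lambda>_. c / 16)"
        using Rcont(1) sub Rb(2) by (intro integral_le integrable_continuous_real) auto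
      also have "\<dots> = k * (c / 16)" using k by simp
      finally have RR: "(LINT s|lebesgue_on {0..t}. R (s + k) - R s) \<le> k * (c / 16)" .
      interpret finite_measure "lebesgue_on {0..t}" by (rule finite_measure_interval)
      have "measure (lebesgue_on {0..t}) (space (lebesgue_on {0..t})) = t" using t by (simp add: measure_restrict_space)
      then have const: "(LINT s|lebesgue_on {0..t}. e1 * k) = e1 * k * t" by simp
      have "(LINT s|lebesgue_on {0..t}. 2 * (R (s + k) - R s) + e1 * k)
          = (LINT s|lebesgue_on {0..t}. 2 * (R (s + k) - R s)) + (LINT s|lebesgue_on {0..t}. e1 * k)"
        by (rule Bochner_Integration.integral_add[OF integrable_mult_right[OF Rs(1)]]) simp
      also have "\<dots> = 2 * (LINT s|lebesgue_on {0..t}. R (s + k) - R s) + e1 * k * t"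
        unfolding const by (simp only: integral_mult_right_zero)
      also have "\<dots> \<le> 2 * (k * (c / 16)) + k * (\<tau> * e1)"
      proof -
        have "e1 * k * t = k * (t * e1)" by simp
        also have "\<dots> \<le> k * (\<tau> * e1)" using k0 e1 t\<tau> by (intro mult_left_mono mult_right_mono) auto
        finally show ?thesis using RR by linarith
      qed
      also have "\<dots> \<le> 2 * (k * (c / 16)) + k * (c / 8)" using mult_left_mono[OF e1(2) k0] by linarith
      also have "\<dots> = k * (c / 4)" by (simp add: field_simps)
      finally show ?thesis unfolding integral_mult_right_zero by (rule mult_left_mono[OF _ Nw])
    qed
    finally have A: "\<bar>(ip (Sg k (?P t)) w - ip (?P t) w) - (LINT s|lebesgue_on {0..t}. g (s + k) - g s)\<bar> \<le> N w * (k * (c / 4))" .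
    have near: "\<bar>g s - g a\<bar> \<le> c / 8 * N w" if s: "s \<in> {0..\<tau>}" "a \<in> {0..\<tau>}" "\<bar>s - a\<bar> < \<delta>'" for s a
    proof -
      have m: "?Y s \<in> S" "?Y a \<in> S" using mem s by auto
      have "\<bar>g s - g a\<bar> \<le> N (?Y s - ?Y a) * N w"
        unfolding g_def using Cauchy_Schwarz[OF memS(3)[OF m] w] m w by (simp add: ip_diff_left)
      also have "\<dots> \<le> c / 8 * N w" using \<delta>'(2) s Nw by (intro mult_right_mono) (auto simp: less_imp_le)
      finally show ?thesis .
    qed
    have gcont: "continuous_on {t..t+k} g" "continuous_on {0..0+k} g" "continuous_on {0..t+k} g"
      using sub by (auto intro: continuous_on_subset[OF gc])
    have B: "\<bar>integral {t..t+k} g - k * g t\<bar> \<le> k * (c / 8 * N w)"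
      by (rule integral_near_const[OF gcont(1) k0]) (use near sub tt k in auto)
    have D: "\<bar>integral {0..0+k} g - k * g 0\<bar> \<le> k * (c / 8 * N w)"
      by (rule integral_near_const[OF gcont(2) k0]) (use near sub tau k in auto)
    have gint: "(LINT s|lebesgue_on {0..t}. g (s + k) - g s) = integral {t..t+k} g - integral {0..k} g"
      unfolding gs(2) by (rule integral_shift_diff[OF gcont(3) t(1) k0])
    have z: "0 \<in> {0..\<tau>}" using tau by simp
    have g0: "g 0 = ip x0 w"
    proof -
      have "ip (X 0) w = ip x0 w" by (rule ip_eq_of_null[OF mem(1)[OF z] x0 w X_zero_null])
      moreover have "ip (?I 0) w = ip 0 w"
        by (rule ip_eq_of_null[OF mem(2)[OF z] _ w]) (use primitive_0[OF tau F_meas F_int] in auto)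
      ultimately show ?thesis unfolding g_def using mem[OF z] w by (simp add: ip_diff_left ip_zero_left[OF w w w])
    qed
    have gt: "ip (X t - ?I t - x0) w = g t - g 0"
      using mem[OF tt] x0 w unfolding g0 by (simp add: g_def ip_diff_left)
    have "ip (Sg k (?P t) - ?P t - k *\<^sub>R (X t - ?I t - x0)) w = (ip (Sg k (?P t)) w - ip (?P t) w) - k * (g t - g 0)"
    proof -
      have m: "Sg k (?P t) \<in> S" "?P t \<in> S" "X t - ?I t - x0 \<in> S" using mem[OF tt] k0 x0 by auto
      show ?thesis using ip_scale_left[OF m(3) m(3) w, of k] m w gt by (simp add: ip_diff_left[of "Sg k (?P t) - ?P t"] ip_diff_left[OF m(1,2) w])
    qed
    also have "\<dots> \<le> N w * (k * (c / 4)) + k * (c / 8 * N w) + k * (c / 8 * N w)"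
    proof -
      have "\<bar>integral {0..k} g - k * g 0\<bar> \<le> k * (c / 8 * N w)" using D by simp
      moreover have "k * (g t - g 0) = k * g t - k * g 0" by (rule right_diff_distrib)
      ultimately show ?thesis using A B unfolding gint abs_le_iff by linarith
    qed
    also have "\<dots> = k * (c / 2) * N w" by (simp add: field_simps)
    finally show "ip (Sg k (?P t) - ?P t - k *\<^sub>R (X t - ?I t - x0)) w \<le> k * (c / 2) * N w" .
  qed (use k c in auto)
  define d where "d = min (min \<delta> \<delta>') (\<tau> - t)"
  have d: "0 < d" using dC \<delta>' t by (simp add: d_def)
  have "dist (N ((1 / k) *\<^sub>R (Sg k (?P t) - ?P t) - (X t - ?I t - x0))) 0 < c" if k: "0 < k" "k < d" for k
  proof -
    have tt: "t \<in> {0..\<tau>}" using t by auto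
    have m: "Sg k (?P t) - ?P t - k *\<^sub>R (X t - ?I t - x0) \<in> S" using mem[OF tt] k x0 by auto
    have eq: "(1 / k) *\<^sub>R (Sg k (?P t) - ?P t) - (X t - ?I t - x0) = (1 / k) *\<^sub>R (Sg k (?P t) - ?P t - k *\<^sub>R (X t - ?I t - x0))"
      using k by (simp add: scaleR_diff_right)
    have "N ((1 / k) *\<^sub>R (Sg k (?P t) - ?P t) - (X t - ?I t - x0)) \<le> \<bar>1 / k\<bar> * (k * (c / 2))"
      unfolding eq scale[OF m] by (rule mult_left_mono[OF main]) (use k in \<open>auto simp: d_def\<close>)
    also have "\<dots> = c / 2" using k by simp
    finally have "N ((1 / k) *\<^sub>R (Sg k (?P t) - ?P t) - (X t - ?I t - x0)) \<le> c / 2" .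
    moreover have "0 \<le> N ((1 / k) *\<^sub>R (Sg k (?P t) - ?P t) - (X t - ?I t - x0))"
      unfolding eq using m by simp
    ultimately show ?thesis using c by simp
  qed
  then show "\<forall>\<^sub>F k in at_right 0. dist (N ((1 / k) *\<^sub>R (Sg k (?P t) - ?P t) - (X t - ?I t - x0))) 0 < c"
    unfolding eventually_at_right_field using d by (intro exI[of _ d]) auto
qed

lemma Sg_lincomb_null:
  assumes k: "0 \<le> k" and x: "x \<in> S" and y: "y \<in> S"
  shows "N (Sg k (c *\<^sub>R (x - y)) - c *\<^sub>R (Sg k x - Sg k y)) = 0"
proof -
  have m: "Sg k (c *\<^sub>R (x - y)) - c *\<^sub>R (Sg k x - Sg k y) \<in> S" using k x y by auto
  have "N (Sg k (c *\<^sub>R (x - y)) - c *\<^sub>R (Sg k x - Sg k y)) \<le> 0"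
  proof (rule norm_le_of_pairing[OF m])
    fix w assume w: "w \<in> S"
    note f = bounded_functional_simps[OF Sg_functional[OF k w]] and g = bounded_functional_simps[OF ip_bounded_functional[OF w]]
    have "ip (Sg k (c *\<^sub>R (x - y)) - c *\<^sub>R (Sg k x - Sg k y)) w = 0"
      using f(2)[of "x - y" c] f(3)[OF x y] g(2)[of "Sg k x - Sg k y" c] g(3)[of "Sg k x" "Sg k y"]
        g(3)[of "Sg k (c *\<^sub>R (x - y))" "c *\<^sub>R (Sg k x - Sg k y)"] k x y by auto
    then show "ip (Sg k (c *\<^sub>R (x - y)) - c *\<^sub>R (Sg k x - Sg k y)) w \<le> 0 * N w" by simp
  qed simp
  then show ?thesis using N_nonneg[OF m] by simp
qed

text \<open>The initial state cancels in the increment.\<close>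

lemma generator_of_increment:
  assumes a: "0 \<le> a" "a < \<tau>" and b: "0 \<le> b" "b < \<tau>"
  shows "((\<lambda>k. N ((1 / k) *\<^sub>R (Sg k (c *\<^sub>R (primitive X b - primitive X a)) - c *\<^sub>R (primitive X b - primitive X a))
      - c *\<^sub>R ((X b - X a) - (primitive F b - primitive F a)))) \<longlongrightarrow> 0) (at_right 0)"
proof -
  let ?P = "primitive X" and ?I = "primitive F"
  let ?D = "\<lambda>k t. (1 / k) *\<^sub>R (Sg k (?P t) - ?P t) - (X t - ?I t - x0)"
  have mem: "X s \<in> S" "?I s \<in> S" "?P s \<in> S" if "0 \<le> s" "s < \<tau>" for s
    using that uniform_path_mem[OF X_uniform_path, of s] uniform_path_mem[OF primitive_forcing(1), of s]
      uniform_path_mem[OF primitive_forcing(2), of s] by auto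
  note ma = mem[OF a] and mb = mem[OF b]
  have lim: "((\<lambda>k. \<bar>c\<bar> * (N (?D k b) + N (?D k a))) \<longlongrightarrow> 0) (at_right 0)"
    using generator_of_primitive[OF a] generator_of_primitive[OF b] by (auto intro!: tendsto_eq_intros)
  show ?thesis
  proof (rule Lim_null_comparison[OF _ lim])
    have "norm (N ((1 / k) *\<^sub>R (Sg k (c *\<^sub>R (?P b - ?P a)) - c *\<^sub>R (?P b - ?P a)) - c *\<^sub>R ((X b - X a) - (?I b - ?I a))))
      \<le> \<bar>c\<bar> * (N (?D k b) + N (?D k a))" if k: "0 < k" for k
    proof -
      have S1: "Sg k (?P a) \<in> S" "Sg k (?P b) \<in> S" "Sg k (c *\<^sub>R (?P b - ?P a)) \<in> S" using k ma mb by auto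
      let ?n = "Sg k (c *\<^sub>R (?P b - ?P a)) - c *\<^sub>R (Sg k (?P b) - Sg k (?P a))"
      have n: "?n \<in> S" "N ?n = 0" using S1 Sg_lincomb_null[of k "?P b" "?P a" c] k ma mb by auto
      have D: "?D k a \<in> S" "?D k b \<in> S" using S1 ma mb x0 by auto
      have "(1 / k) *\<^sub>R (Sg k (c *\<^sub>R (?P b - ?P a)) - c *\<^sub>R (?P b - ?P a)) - c *\<^sub>R ((X b - X a) - (?I b - ?I a))
          = (1 / k) *\<^sub>R ?n + c *\<^sub>R (?D k b - ?D k a)"
        by (simp add: algebra_simps)
      moreover have "N ((1 / k) *\<^sub>R ?n + c *\<^sub>R (?D k b - ?D k a)) \<le> \<bar>1/k\<bar> * N ?n + \<bar>c\<bar> * N (?D k b - ?D k a)"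
        using triangle[OF memS(4)[OF n(1), of "1 / k"] memS(4)[OF memS(3)[OF D(2,1)], of c]]
        by (simp only: scale[OF n(1)] scale[OF memS(3)[OF D(2,1)]])
      moreover have "\<bar>c\<bar> * N (?D k b - ?D k a) \<le> \<bar>c\<bar> * (N (?D k b) + N (?D k a))"
        by (intro mult_left_mono triangle_minus D) simp
      moreover have "0 \<le> N ((1 / k) *\<^sub>R ?n + c *\<^sub>R (?D k b - ?D k a))"
        by (intro N_nonneg memS n D)
      ultimately show ?thesis using n(2) by simp
    qed
    then show "\<forall>\<^sub>F k in at_right 0. norm (N ((1 / k) *\<^sub>R (Sg k (c *\<^sub>R (?P b - ?P a)) - c *\<^sub>R (?P b - ?P a)) - c *\<^sub>R ((X b - X a) - (?I b - ?I a))))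
      \<le> \<bar>c\<bar> * (N (?D k b) + N (?D k a))"
      unfolding eventually_at_right_field by (intro exI[of _ 1]) auto
  qed
qed

end

section \<open>The perturbed family of memory systems\<close>

context domain
begin

text \<open>By Poincare's inequality the seminorm of the gradient, and with it the energy norm of a coercive
  form, is equivalent to the norm of \<open>H10\<close>.\<close>

lemma coercive_semi_hilbert:
  assumes q: "symmetric_bilinear_on (H10 \<Omega>) q"
    and bd: "\<And>v. v \<in> H10 \<Omega> \<Longrightarrow> q v v \<le> C * (V_norm \<Omega> v)\<^sup>2"
    and co: "\<And>v. v \<in> H10 \<Omega> \<Longrightarrow> \<gamma> * (V_seminorm \<Omega> v)\<^sup>2 \<le> q v v" and \<gamma>: "0 < \<gamma>"
  obtains D where "semi_hilbert (H10 \<Omega>) q (\<lambda>v. sqrt (q v v))" "0 < D"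
    "\<forall>v\<in>H10 \<Omega>. V_norm \<Omega> v \<le> D * sqrt (q v v)" "\<forall>v\<in>H10 \<Omega>. sqrt (q v v) \<le> D * V_norm \<Omega> v"
proof -
  obtain P where P: "0 < P" "\<And>v. v \<in> H10 \<Omega> \<Longrightarrow> L2_norm \<Omega> v \<le> P * V_seminorm \<Omega> v"
    using Poincare by metis
  have nn: "0 \<le> q v v" if "v \<in> H10 \<Omega>" for v
    by (rule order_trans[OF mult_nonneg_nonneg co[OF that]]) (use \<gamma> in auto)
  interpret Q: semi_inner "H10 \<Omega>" q "\<lambda>v. sqrt (q v v)"
    by unfold_locales (use subspace_H10 q nn in auto)
  define D where "D = (P + 1) / sqrt \<gamma> + sqrt \<bar>C\<bar> + 1"
  have D: "0 < D" "(P + 1) / sqrt \<gamma> \<le> D" "sqrt \<bar>C\<bar> \<le> D" using P(1) \<gamma> by (auto simp: D_def add_pos_nonneg add_nonneg_pos)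
  have 1: "V_norm \<Omega> v \<le> D * sqrt (q v v)" if v: "v \<in> H10 \<Omega>" for v
  proof -
    have "sqrt (\<gamma> * (V_seminorm \<Omega> v)\<^sup>2) \<le> sqrt (q v v)" using co[OF v] by (rule real_sqrt_le_mono)
    then have s: "sqrt \<gamma> * V_seminorm \<Omega> v \<le> sqrt (q v v)" by (simp add: real_sqrt_mult)
    have "V_norm \<Omega> v \<le> (P + 1) * V_seminorm \<Omega> v"
      using V_norm_le_sum[of v] P(2)[OF v] by (simp add: algebra_simps)
    also have "\<dots> = (P + 1) / sqrt \<gamma> * (sqrt \<gamma> * V_seminorm \<Omega> v)" using \<gamma> by simp
    also have "\<dots> \<le> (P + 1) / sqrt \<gamma> * sqrt (q v v)" using s P(1) \<gamma> by (intro mult_left_mono) auto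
    also have "\<dots> \<le> D * sqrt (q v v)" using D(2) nn[OF v] by (intro mult_right_mono) auto
    finally show ?thesis .
  qed
  have 2: "sqrt (q v v) \<le> D * V_norm \<Omega> v" if v: "v \<in> H10 \<Omega>" for v
  proof -
    have "q v v \<le> \<bar>C\<bar> * (V_norm \<Omega> v)\<^sup>2" by (rule order_trans[OF bd[OF v] mult_right_mono]) auto
    then have "sqrt (q v v) \<le> sqrt (\<bar>C\<bar> * (V_norm \<Omega> v)\<^sup>2)" by (rule real_sqrt_le_mono)
    also have "\<dots> = sqrt \<bar>C\<bar> * V_norm \<Omega> v" using V.N_nonneg[OF v] by (simp add: real_sqrt_mult)
    also have "\<dots> \<le> D * V_norm \<Omega> v" using D(3) V.N_nonneg[OF v] by (intro mult_right_mono) auto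
    finally show ?thesis .
  qed
  have "complete_seminormed_space (H10 \<Omega>) (\<lambda>v. sqrt (q v v))"
    by (rule complete_equivalent_norm[OF V.complete_seminormed_space_axioms Q.seminormed 1 2 D(1) D(1)])
  then interpret Qc: complete_seminormed_space "H10 \<Omega>" "\<lambda>v. sqrt (q v v)" .
  have "semi_hilbert (H10 \<Omega>) q (\<lambda>v. sqrt (q v v))"
    by unfold_locales (rule Qc.complete)
  then show ?thesis using that D(1) 1 2 by blast
qed

end

locale memory_forms = domain \<Omega> for \<Omega> :: "(real^'d) set" +
  fixes a0 a1 av :: "(real^'d \<Rightarrow> real) \<Rightarrow> (real^'d \<Rightarrow> real) \<Rightarrow> real" and \<nu> :: "real measure" and C0 C1 Cv \<beta> \<beta>v :: real
  assumes a0_bilin: "symmetric_bilinear_on (H10 \<Omega>) a0" and a1_bilin: "symmetric_bilinear_on (H10 \<Omega>) a1"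
    and av_bilin: "symmetric_bilinear_on (H10 \<Omega>) av"
    and a0_bd: "\<And>v w. v \<in> H10 \<Omega> \<Longrightarrow> w \<in> H10 \<Omega> \<Longrightarrow> \<bar>a0 v w\<bar> \<le> C0 * V_norm \<Omega> v * V_norm \<Omega> w"
    and a1_bd: "\<And>v w. v \<in> H10 \<Omega> \<Longrightarrow> w \<in> H10 \<Omega> \<Longrightarrow> \<bar>a1 v w\<bar> \<le> C1 * V_norm \<Omega> v * V_norm \<Omega> w"
    and av_bd: "\<And>v w. v \<in> H10 \<Omega> \<Longrightarrow> w \<in> H10 \<Omega> \<Longrightarrow> \<bar>av v w\<bar> \<le> Cv * V_norm \<Omega> v * V_norm \<Omega> w"
    and a0_nn: "\<And>v. v \<in> H10 \<Omega> \<Longrightarrow> 0 \<le> a0 v v"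
    and a1_co: "\<And>v. v \<in> H10 \<Omega> \<Longrightarrow> \<beta> * (V_seminorm \<Omega> v)\<^sup>2 \<le> a1 v v" and \<beta>: "0 < \<beta>"
    and av_co: "\<And>v. v \<in> H10 \<Omega> \<Longrightarrow> \<beta>v * (V_seminorm \<Omega> v)\<^sup>2 \<le> av v v" and \<beta>v: "0 < \<beta>v"
    and sets_nu: "sets \<nu> = sets (restrict_space borel {0..})" and fin_nu: "emeasure \<nu> {0..} < \<infinity>"
begin

abbreviation "\<W> \<equiv> W_space \<Omega> a1 \<nu>"
abbreviation "\<N> \<equiv> W_norm \<Omega> a1 \<nu>"

lemma space_nu: "space \<nu> = {0..}"
  using sets_eq_imp_space_eq[OF sets_nu] by (simp add: space_restrict_space)

lemma finite_nu: "finite_measure \<nu>"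
  using fin_nu by (intro finite_measureI) (simp add: space_nu)

lemma a1_quadratic_bd: "v \<in> H10 \<Omega> \<Longrightarrow> a1 v v \<le> C1 * (V_norm \<Omega> v)\<^sup>2"
  using a1_bd[of v v] by (simp add: power2_eq_square mult.assoc)

lemma av_quadratic_bd: "v \<in> H10 \<Omega> \<Longrightarrow> av v v \<le> Cv * (V_norm \<Omega> v)\<^sup>2"
  using av_bd[of v v] by (simp add: power2_eq_square mult.assoc)

lemma a0_quadratic_bd: "v \<in> H10 \<Omega> \<Longrightarrow> a0 v v \<le> C0 * (V_norm \<Omega> v)\<^sup>2"
  using a0_bd[of v v] by (simp add: power2_eq_square mult.assoc)

sublocale A1: semi_hilbert "H10 \<Omega>" a1 "\<lambda>v. sqrt (a1 v v)"
  by (rule coercive_semi_hilbert[OF a1_bilin a1_quadratic_bd a1_co \<beta>])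

sublocale Av: semi_hilbert "H10 \<Omega>" av "\<lambda>v. sqrt (av v v)"
  by (rule coercive_semi_hilbert[OF av_bilin av_quadratic_bd av_co \<beta>v])

lemma V_norm_a1: obtains D where "0 < D" "\<forall>v\<in>H10 \<Omega>. V_norm \<Omega> v \<le> D * sqrt (a1 v v)" "\<forall>v\<in>H10 \<Omega>. sqrt (a1 v v) \<le> D * V_norm \<Omega> v"
  by (rule coercive_semi_hilbert[OF a1_bilin a1_quadratic_bd a1_co \<beta>])

lemma strongly_measurable_a1_iff:
  "strongly_measurable_in M (H10 \<Omega>) (\<lambda>v. sqrt (a1 v v)) \<zeta> \<longleftrightarrow> strongly_measurable_in M (H10 \<Omega>) (V_norm \<Omega>) \<zeta>"
proof -
  obtain D where D: "\<forall>v\<in>H10 \<Omega>. V_norm \<Omega> v \<le> D * sqrt (a1 v v)" "\<forall>v\<in>H10 \<Omega>. sqrt (a1 v v) \<le> D * V_norm \<Omega> v"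
    by (rule V_norm_a1)
  show ?thesis
    using strongly_measurable_equivalent_norm[OF A1.seminormed V.seminormed D(1)[rule_format]]
      strongly_measurable_equivalent_norm[OF V.seminormed A1.seminormed D(2)[rule_format]] by blast
qed

lemma strongly_measurable_av:
  assumes "strongly_measurable_in M (H10 \<Omega>) (V_norm \<Omega>) \<zeta>"
  shows "strongly_measurable_in M (H10 \<Omega>) (\<lambda>v. sqrt (av v v)) \<zeta>"
proof -
  obtain D where D: "\<forall>v\<in>H10 \<Omega>. sqrt (av v v) \<le> D * V_norm \<Omega> v"
    by (rule coercive_semi_hilbert[OF av_bilin av_quadratic_bd av_co \<beta>v])
  show ?thesis by (rule strongly_measurable_equivalent_norm[OF V.seminormed Av.seminormed D[rule_format] assms])
qed

lemma K_space_eq: "K_space \<Omega> a1 \<nu> = A1.BL2 \<nu>"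
  unfolding K_space_def A1.BL2_def strongly_measurable_a1_iff ..

sublocale K: semi_hilbert "K_space \<Omega> a1 \<nu>" "A1.BL2_inner \<nu>" "K_norm a1 \<nu>"
  unfolding K_space_eq by (rule A1.semi_hilbert_BL2[OF finite_nu])

definition W_inner where
  "W_inner x y = L2_inner \<Omega> (fst x) (fst y) + A1.BL2_inner \<nu> (snd x) (snd y)"

sublocale W: semi_hilbert "\<W>" W_inner "\<N>"
proof -
  have eqs: "W_inner = (\<lambda>x y. L2_inner \<Omega> (fst x) (fst y) + A1.BL2_inner \<nu> (snd x) (snd y))"
    "\<N> = (\<lambda>x. sqrt ((L2_norm \<Omega> (fst x))\<^sup>2 + (K_norm a1 \<nu> (snd x))\<^sup>2))"
    by (auto simp: fun_eq_iff W_inner_def W_norm_def)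
  show "semi_hilbert \<W> W_inner \<N>"
    unfolding W_space_def eqs by (rule semi_hilbert_product[OF H.semi_hilbert_axioms K.semi_hilbert_axioms])
qed

lemma mem_W: "x \<in> \<W> \<longleftrightarrow> fst x \<in> L2 \<Omega> \<and> snd x \<in> K_space \<Omega> a1 \<nu>"
  by (cases x) (simp add: W_space_def)

lemma K_AE: "\<zeta> \<in> K_space \<Omega> a1 \<nu> \<Longrightarrow> AE l in completion \<nu>. \<zeta> l \<in> H10 \<Omega>"
  unfolding K_space_eq by (rule A1.BL2_AE)

lemma K_integrable:
  "\<zeta> \<in> K_space \<Omega> a1 \<nu> \<Longrightarrow> \<eta> \<in> K_space \<Omega> a1 \<nu> \<Longrightarrow> integrable (completion \<nu>) (\<lambda>l. a1 (\<zeta> l) (\<eta> l))"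
  unfolding K_space_eq by (rule A1.BL2_integrable)

lemma E_op_mem: "v \<in> H10 \<Omega> \<Longrightarrow> E_op v \<in> K_space \<Omega> a1 \<nu>"
proof -
  assume v: "v \<in> H10 \<Omega>"
  interpret finite_measure \<nu> by (rule finite_nu)
  have "(\<integral>\<^sup>+l. ennreal (a1 v v) \<partial>\<nu>) < \<infinity>"
    by (simp add: ennreal_mult_less_top emeasure_eq_measure)
  then show ?thesis using v V.strongly_measurable_const[of v \<nu>] by (simp add: K_space_def E_op_def)
qed

text \<open>\<open>J_op\<close> is a choice, and enters only through its pairings with \<open>a1\<close>, which pass under the integral.\<close>

lemma J_op_pairing:
  assumes \<zeta>: "\<zeta> \<in> K_space \<Omega> a1 \<nu>" and v: "v \<in> H10 \<Omega>"
  shows "integrable (completion \<nu>) (\<lambda>l. a1 (\<zeta> l) v)" "a1 (J_op \<Omega> \<nu> \<zeta>) v = (LINT l|completion \<nu>. a1 (\<zeta> l) v)"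
    "J_op \<Omega> \<nu> \<zeta> \<in> H10 \<Omega>"
proof -
  obtain D where D: "0 < D" "\<forall>v\<in>H10 \<Omega>. V_norm \<Omega> v \<le> D * sqrt (a1 v v)"
    by (rule V_norm_a1)
  have sm: "strongly_measurable_in \<nu> (H10 \<Omega>) (V_norm \<Omega>) \<zeta>" using \<zeta> by (simp add: K_space_def)
  then have sm1: "strongly_measurable_in \<nu> (H10 \<Omega>) (\<lambda>v. sqrt (a1 v v)) \<zeta>" by (simp add: strongly_measurable_a1_iff)
  have "(\<integral>\<^sup>+l. ennreal ((sqrt (a1 (\<zeta> l) (\<zeta> l)))\<^sup>2) \<partial>\<nu>) < \<infinity>"
    using \<zeta> unfolding A1.nn_integral_ip_eq[OF sm1, symmetric] by (simp add: K_space_def)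
  then have fin1: "(\<integral>\<^sup>+l. ennreal (sqrt (a1 (\<zeta> l) (\<zeta> l))) \<partial>\<nu>) < \<infinity>"
    by (rule A1.L1_of_L2[OF finite_nu sm1])
  have "(\<integral>\<^sup>+l. ennreal (V_norm \<Omega> (\<zeta> l)) \<partial>completion \<nu>) \<le> (\<integral>\<^sup>+l. ennreal D * ennreal (sqrt (a1 (\<zeta> l) (\<zeta> l))) \<partial>completion \<nu>)"
    using K_AE[OF \<zeta>] by (intro nn_integral_mono_AE, eventually_elim) (use D in \<open>auto simp flip: ennreal_mult' intro!: ennreal_leI\<close>)
  also have "\<dots> = ennreal D * (\<integral>\<^sup>+l. ennreal (sqrt (a1 (\<zeta> l) (\<zeta> l))) \<partial>completion \<nu>)"
    using A1.strongly_measurable_norm[OF sm1] by (intro nn_integral_cmult) auto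
  also have "\<dots> < \<infinity>" using fin1 by (simp add: nn_integral_completion ennreal_mult_less_top)
  finally have fin: "(\<integral>\<^sup>+l. ennreal (V_norm \<Omega> (\<zeta> l)) \<partial>\<nu>) < \<infinity>" by (simp add: nn_integral_completion)
  have hb: "has_bochner_integral_in \<nu> (H10 \<Omega>) (V_norm \<Omega>) \<zeta> (J_op \<Omega> \<nu> \<zeta>)"
    unfolding J_op_def by (rule V.bochner_integral_exists[OF finite_nu sm fin])
  have l: "V.bounded_functional (\<lambda>x. a1 x v)"
    unfolding V.bounded_functional_def
    using v a1_bd by (auto simp: A1.ip_add_left A1.ip_scale_left[where y=v] mult.commute mult.left_commute intro!: exI[of _ "C1 * V_norm \<Omega> v"])
  show "integrable (completion \<nu>) (\<lambda>l. a1 (\<zeta> l) v)" "a1 (J_op \<Omega> \<nu> \<zeta>) v = (LINT l|completion \<nu>. a1 (\<zeta> l) v)"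
    using V.has_bochner_integral_in_functional[OF l hb] by auto
  show "J_op \<Omega> \<nu> \<zeta> \<in> H10 \<Omega>" using hb by (simp add: has_bochner_integral_in_def)
qed

definition memory_dissipation :: "(real \<Rightarrow> real^'d \<Rightarrow> real) \<Rightarrow> ennreal" where
  "memory_dissipation \<zeta> = (\<integral>\<^sup>+l. ennreal (l * a1 (\<zeta> l) (\<zeta> l)) \<partial>\<nu>)"

text \<open>The difference of two systems tested with the difference of the states: the coupling terms
  \<open>a1 (J z, e)\<close> and \<open>a1 (E e, z)\<close> cancel.\<close>

lemma dissipation_identity:
  assumes x: "((u, \<zeta>), (g, \<eta>)) \<in> A_graph \<Omega> (\<lambda>v w. a0 v w + \<epsilon> * av v w) a1 \<nu>"
    and x': "((u', \<zeta>'), (g', \<eta>')) \<in> A_graph \<Omega> (\<lambda>v w. a0 v w + 0 * av v w) a1 \<nu>"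
  shows "W_inner ((g, \<eta>) - (g', \<eta>')) ((u, \<zeta>) - (u', \<zeta>')) =
      - a0 (u - u') (u - u') - \<epsilon> * av u (u - u')
      - (LINT l|completion \<nu>. l * a1 ((\<zeta> - \<zeta>') l) ((\<zeta> - \<zeta>') l))"
    "memory_dissipation (\<zeta> - \<zeta>') = ennreal (LINT l|completion \<nu>. l * a1 ((\<zeta> - \<zeta>') l) ((\<zeta> - \<zeta>') l))"
    "0 \<le> (LINT l|completion \<nu>. l * a1 ((\<zeta> - \<zeta>') l) ((\<zeta> - \<zeta>') l))"
proof -
  let ?e = "u - u'" and ?z = "\<zeta> - \<zeta>'"
  have u: "u \<in> H10 \<Omega>" "u' \<in> H10 \<Omega>" "?e \<in> H10 \<Omega>" and \<zeta>: "\<zeta> \<in> K_space \<Omega> a1 \<nu>" "\<zeta>' \<in> K_space \<Omega> a1 \<nu>"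
    and g: "g \<in> L2 \<Omega>" "g' \<in> L2 \<Omega>" and \<eta>: "\<eta> \<in> K_space \<Omega> a1 \<nu>" "\<eta>' \<in> K_space \<Omega> a1 \<nu>"
    and k: "E_op u - Lambda_op \<zeta> \<in> K_space \<Omega> a1 \<nu>" "E_op u' - Lambda_op \<zeta>' \<in> K_space \<Omega> a1 \<nu>"
    and null: "K_norm a1 \<nu> (\<eta> - (E_op u - Lambda_op \<zeta>)) = 0" "K_norm a1 \<nu> (\<eta>' - (E_op u' - Lambda_op \<zeta>')) = 0"
    and H: "\<And>v. v \<in> H10 \<Omega> \<Longrightarrow> L2_inner \<Omega> g v = - (a0 u v + \<epsilon> * av u v) - a1 (J_op \<Omega> \<nu> \<zeta>) v"
      "\<And>v. v \<in> H10 \<Omega> \<Longrightarrow> L2_inner \<Omega> g' v = - (a0 u' v) - a1 (J_op \<Omega> \<nu> \<zeta>') v"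
    using x x' unfolding A_graph_def by auto
  have z: "?z \<in> K_space \<Omega> a1 \<nu>" using \<zeta> by simp
  have eL: "?e \<in> L2 \<Omega>" using H1_D(1)[OF H10_in_H1[OF u(3)]] .
  interpret a0: semi_inner "H10 \<Omega>" a0 "\<lambda>v. sqrt (a0 v v)"
    by unfold_locales (use subspace_H10 a0_bilin a0_nn in auto)
  define J where "J = a1 (J_op \<Omega> \<nu> \<zeta>) ?e - a1 (J_op \<Omega> \<nu> \<zeta>') ?e"
  have "L2_inner \<Omega> (g - g') ?e = L2_inner \<Omega> g ?e - L2_inner \<Omega> g' ?e" using g eL by (simp add: H.ip_diff_left)
  also have "\<dots> = - a0 ?e ?e - \<epsilon> * av u ?e - J"
    using H[OF u(3)] a0.ip_diff_left[OF u(1,2,3)] by (simp add: J_def)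
  finally have 1: "L2_inner \<Omega> (g - g') ?e = - a0 ?e ?e - \<epsilon> * av u ?e - J" .
  let ?k = "(E_op u - Lambda_op \<zeta>) - (E_op u' - Lambda_op \<zeta>')"
  have kK: "?k \<in> K_space \<Omega> a1 \<nu>" using k by simp
  have "A1.BL2_inner \<nu> (\<eta> - \<eta>') ?z = A1.BL2_inner \<nu> ?k ?z"
  proof -
    have "A1.BL2_inner \<nu> \<eta> ?z = A1.BL2_inner \<nu> (E_op u - Lambda_op \<zeta>) ?z"
      using K.ip_cong_right[OF z \<eta>(1) k(1) null(1)] K.ip_commute z \<eta> k by simp
    moreover have "A1.BL2_inner \<nu> \<eta>' ?z = A1.BL2_inner \<nu> (E_op u' - Lambda_op \<zeta>') ?z"
      using K.ip_cong_right[OF z \<eta>(2) k(2) null(2)] K.ip_commute z \<eta> k by simp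
    ultimately show ?thesis using K.ip_diff_left[OF \<eta> z] K.ip_diff_left[OF k z] by simp
  qed
  also have "\<dots> = (LINT l|completion \<nu>. a1 (?k l) (?z l))" by (simp add: A1.BL2_inner_def)
  finally have 2: "A1.BL2_inner \<nu> (\<eta> - \<eta>') ?z = (LINT l|completion \<nu>. a1 (?k l) (?z l))" .
  have ik: "integrable (completion \<nu>) (\<lambda>l. a1 (?k l) (?z l))" by (rule K_integrable[OF kK z])
  have ie: "integrable (completion \<nu>) (\<lambda>l. a1 ?e (?z l))" using K_integrable[OF E_op_mem[OF u(3)] z] by (simp add: E_op_def)
  have ptw: "AE l in completion \<nu>. l * a1 (?z l) (?z l) = a1 ?e (?z l) - a1 (?k l) (?z l)"
    using K_AE[OF \<zeta>(1)] K_AE[OF \<zeta>(2)]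
  proof eventually_elim
    case (elim l)
    have zl: "?z l \<in> H10 \<Omega>" using elim by simp
    have "?k l = ?e - l *\<^sub>R ?z l" by (simp add: E_op_def Lambda_op_def scaleR_diff_right)
    then show ?case using A1.ip_diff_left[OF u(3) V.mem_simps(4)[OF zl] zl, of l] A1.ip_scale_left[OF zl zl zl, of l] by simp
  qed
  have id: "integrable (completion \<nu>) (\<lambda>l. a1 ?e (?z l) - a1 (?k l) (?z l))" using ie ik by (rule Bochner_Integration.integrable_diff)
  have dm: "(\<lambda>l. l * a1 (?z l) (?z l)) \<in> borel_measurable (completion \<nu>)"
  proof (rule measurable_completion_AE)
    show "(\<lambda>l. a1 ?e (?z l) - a1 (?k l) (?z l)) \<in> borel_measurable (completion \<nu>)" using id by (rule borel_measurable_integrable)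
    show "AE l in \<nu>. l * a1 (?z l) (?z l) = a1 ?e (?z l) - a1 (?k l) (?z l)" using ptw by (simp add: AE_completion_iff)
  qed
  have il: "integrable (completion \<nu>) (\<lambda>l. l * a1 (?z l) (?z l))"
    using integrable_cong_AE[OF dm borel_measurable_integrable[OF id] ptw] id by simp
  have "(LINT l|completion \<nu>. l * a1 (?z l) (?z l)) = (LINT l|completion \<nu>. a1 ?e (?z l) - a1 (?k l) (?z l))"
    by (rule integral_cong_AE[OF dm borel_measurable_integrable[OF id] ptw])
  also have "\<dots> = (LINT l|completion \<nu>. a1 ?e (?z l)) - (LINT l|completion \<nu>. a1 (?k l) (?z l))" using ie ik by simp
  also have "(LINT l|completion \<nu>. a1 ?e (?z l)) = J"
  proof -
    have "(LINT l|completion \<nu>. a1 ?e (?z l)) = (LINT l|completion \<nu>. a1 (\<zeta> l) ?e - a1 (\<zeta>' l) ?e)"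
    proof (rule integral_cong_AE)
      show "AE l in completion \<nu>. a1 ?e (?z l) = a1 (\<zeta> l) ?e - a1 (\<zeta>' l) ?e"
        using K_AE[OF \<zeta>(1)] K_AE[OF \<zeta>(2)]
      proof eventually_elim
        case (elim l)
        then show ?case using A1.ip_commute[of ?e "?z l"] A1.ip_diff_left[OF elim u(3)] u(3) by simp
      qed
    qed (use ie J_op_pairing(1)[OF \<zeta>(1) u(3)] J_op_pairing(1)[OF \<zeta>(2) u(3)] in auto)
    then show ?thesis
      unfolding J_def using J_op_pairing[OF \<zeta>(1) u(3)] J_op_pairing[OF \<zeta>(2) u(3)] by simp
  qed
  finally have 3: "(LINT l|completion \<nu>. a1 (?k l) (?z l)) = J - (LINT l|completion \<nu>. l * a1 (?z l) (?z l))" by linarith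
  show "W_inner ((g, \<eta>) - (g', \<eta>')) ((u, \<zeta>) - (u', \<zeta>')) =
      - a0 ?e ?e - \<epsilon> * av u ?e - (LINT l|completion \<nu>. l * a1 (?z l) (?z l))"
    unfolding W_inner_def using 1 2 3 by simp
  have nn: "AE l in completion \<nu>. 0 \<le> l * a1 (?z l) (?z l)"
    using K_AE[OF z] AE_space
  proof eventually_elim
    case (elim l)
    then show ?case using A1.nonneg[of "?z l"] by (simp add: space_nu)
  qed
  then show "0 \<le> (LINT l|completion \<nu>. l * a1 (?z l) (?z l))" by (rule integral_nonneg_AE)
  show "memory_dissipation ?z = ennreal (LINT l|completion \<nu>. l * a1 (?z l) (?z l))"
    unfolding memory_dissipation_def using nn_integral_eq_integral[OF il nn] by (simp add: nn_integral_completion)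
qed

text \<open>Young's inequality absorbs half of the perturbation.\<close>

lemma dissipation_inequality:
  assumes x: "((u, \<zeta>), (g, \<eta>)) \<in> A_graph \<Omega> (\<lambda>v w. a0 v w + \<epsilon> * av v w) a1 \<nu>"
    and x': "((u', \<zeta>'), (g', \<eta>')) \<in> A_graph \<Omega> (\<lambda>v w. a0 v w + 0 * av v w) a1 \<nu>" and \<epsilon>: "0 \<le> \<epsilon>"
  shows "u - u' \<in> H10 \<Omega>" "u' \<in> H10 \<Omega>"
    "ennreal (2 * a0 (u - u') (u - u') + \<epsilon> * av (u - u') (u - u')) + 2 * memory_dissipation (\<zeta> - \<zeta>')
      \<le> ennreal (\<epsilon> * av u' u' - 2 * W_inner ((g, \<eta>) - (g', \<eta>')) ((u, \<zeta>) - (u', \<zeta>')))"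
    "0 \<le> \<epsilon> * av u' u' - 2 * W_inner ((g, \<eta>) - (g', \<eta>')) ((u, \<zeta>) - (u', \<zeta>'))"
proof -
  have u: "u \<in> H10 \<Omega>" "u' \<in> H10 \<Omega>" using x x' unfolding A_graph_def by auto
  then show e: "u - u' \<in> H10 \<Omega>" "u' \<in> H10 \<Omega>" by auto
  let ?e = "u - u'" and ?L = "LINT l|completion \<nu>. l * a1 ((\<zeta> - \<zeta>') l) ((\<zeta> - \<zeta>') l)"
  note d = dissipation_identity[OF x x']
  have "av u ?e = av ?e ?e + av u' ?e" using Av.ip_diff_left[OF u e(1)] by simp
  moreover have "0 \<le> av (?e + u') (?e + u')" by (intro Av.nonneg Av.memS e)
  then have "- 2 * av u' ?e \<le> av ?e ?e + av u' u'" using Av.ip_self_add[OF e] Av.ip_commute[OF e] by linarith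
  then have "\<epsilon> * (- 2 * av u' ?e) \<le> \<epsilon> * (av ?e ?e + av u' u')" using \<epsilon> by (rule mult_left_mono)
  ultimately have le: "2 * a0 ?e ?e + \<epsilon> * av ?e ?e + 2 * ?L \<le> \<epsilon> * av u' u' - 2 * W_inner ((g, \<eta>) - (g', \<eta>')) ((u, \<zeta>) - (u', \<zeta>'))"
    unfolding d(1) by (simp add: algebra_simps)
  have nn: "0 \<le> 2 * a0 ?e ?e + \<epsilon> * av ?e ?e" using a0_nn[OF e(1)] Av.nonneg[OF e(1)] \<epsilon> by simp
  show "0 \<le> \<epsilon> * av u' u' - 2 * W_inner ((g, \<eta>) - (g', \<eta>')) ((u, \<zeta>) - (u', \<zeta>'))"
    using le nn d(3) by linarith
  have "ennreal (2 * a0 ?e ?e + \<epsilon> * av ?e ?e + 2 * ?L) \<le> ennreal (\<epsilon> * av u' u' - 2 * W_inner ((g, \<eta>) - (g', \<eta>')) ((u, \<zeta>) - (u', \<zeta>')))"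
    using le by (rule ennreal_leI)
  then show "ennreal (2 * a0 ?e ?e + \<epsilon> * av ?e ?e) + 2 * memory_dissipation (\<zeta> - \<zeta>')
      \<le> ennreal (\<epsilon> * av u' u' - 2 * W_inner ((g, \<eta>) - (g', \<eta>')) ((u, \<zeta>) - (u', \<zeta>')))"
    using nn d(2,3) by (simp add: ennreal_plus ennreal_mult')
qed

end

section \<open>Lower semicontinuity\<close>

text \<open>Some subsequence stays below any number that exceeds the lower limit.\<close>

lemma le_liminf_of_closed_sublevels:
  fixes \<phi> :: "'a \<Rightarrow> ennreal" and y :: "nat \<Rightarrow> 'a"
  assumes closed: "\<And>c (r :: nat \<Rightarrow> nat). c < top \<Longrightarrow> strict_mono r \<Longrightarrow> (\<And>n. \<phi> (y (r n)) \<le> c) \<Longrightarrow> \<phi> x \<le> c"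
  shows "\<phi> x \<le> liminf (\<lambda>n. \<phi> (y n))"
proof (rule ccontr)
  assume "\<not> \<phi> x \<le> liminf (\<lambda>n. \<phi> (y n))"
  then obtain c where c: "liminf (\<lambda>n. \<phi> (y n)) < c" "c < \<phi> x" using dense[of "liminf (\<lambda>n. \<phi> (y n))" "\<phi> x"] by (auto simp: not_le)
  obtain r where r: "strict_mono r" "((\<lambda>n. \<phi> (y n)) \<circ> r) \<longlonglongrightarrow> liminf (\<lambda>n. \<phi> (y n))"
    using liminf_subseq_lim[of "\<lambda>n. \<phi> (y n)"] by blast
  have "\<forall>\<^sub>F n in sequentially. ((\<lambda>n. \<phi> (y n)) \<circ> r) n < c" using order_tendstoD(2)[OF r(2) c(1)] .
  then obtain k where k: "\<And>n. n \<ge> k \<Longrightarrow> \<phi> (y (r n)) < c" by (auto simp: eventually_sequentially)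
  have "\<phi> x \<le> c"
  proof (rule closed[where r="\<lambda>n. r (n + k)"])
    show "c < top" using c(2) by (metis less_le_trans top_greatest)
    show "strict_mono (\<lambda>n. r (n + k))" using r(1) by (auto simp: strict_mono_def)
    show "\<phi> (y (r (n + k))) \<le> c" for n using k[of "n + k"] by simp
  qed
  with c(2) show False by simp
qed

lemma liminf_add_ennreal:
  fixes f g :: "nat \<Rightarrow> ennreal"
  shows "liminf f + liminf g \<le> liminf (\<lambda>n. f n + g n)"
proof -
  have inc: "incseq (\<lambda>n. INF m\<in>{n..}. h m)" for h :: "nat \<Rightarrow> ennreal"
    unfolding incseq_def by (auto intro!: INF_superset_mono)
  have "liminf f + liminf g = (SUP n. (INF m\<in>{n..}. f m) + (INF m\<in>{n..}. g m))"
    unfolding liminf_SUP_INF by (rule ennreal_SUP_add[OF inc inc, symmetric])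
  also have "\<dots> \<le> (SUP n. INF m\<in>{n..}. f m + g m)"
    by (intro SUP_mono bexI[where x=n for n] INF_greatest add_mono INF_lower) auto
  finally show ?thesis unfolding liminf_SUP_INF .
qed

lemma measurable_of_closed_sublevels:
  fixes \<phi> :: "real \<Rightarrow> ennreal"
  assumes closed: "\<And>c s l. c < top \<Longrightarrow> (\<And>n::nat. s n \<in> {0..T}) \<Longrightarrow> (\<And>n. \<phi> (s n) \<le> c) \<Longrightarrow> s \<longlonglongrightarrow> l \<Longrightarrow> \<phi> l \<le> c"
  shows "\<phi> \<in> borel_measurable (lebesgue_on {0..T})"
proof (rule borel_measurableI_le)
  fix c
  show "{x \<in> space (lebesgue_on {0..T}). \<phi> x \<le> c} \<in> sets (lebesgue_on {0..T})"
  proof (cases "c = top")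
    case True
    then have "{x \<in> space (lebesgue_on {0..T}). \<phi> x \<le> c} = space (lebesgue_on {0..T})" by auto
    then show ?thesis by (simp only: sets.top)
  next
    case False
    have "closed {x \<in> {0..T}. \<phi> x \<le> c}"
      unfolding closed_sequential_limits
    proof (intro allI impI, elim conjE)
      fix s l assume s: "\<forall>n. s n \<in> {x \<in> {0..T}. \<phi> x \<le> c}" and l: "s \<longlonglongrightarrow> l"
      have "l \<in> {0..T}" using closed_sequentially[OF closed_atLeastAtMost _ l] s by auto
      moreover have "\<phi> l \<le> c" by (rule closed[where s=s]) (use s l False in \<open>auto simp: less_top\<close>)
      ultimately show "l \<in> {x \<in> {0..T}. \<phi> x \<le> c}" by simp
    qed
    then have leb: "{x \<in> {0..T}. \<phi> x \<le> c} \<in> sets lebesgue" by (intro borel_closed sets_completionI_sets) simp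
    have eq: "{x \<in> space (lebesgue_on {0..T}). \<phi> x \<le> c} = {x \<in> {0..T}. \<phi> x \<le> c}" by simp
    have iff: "({x \<in> {0..T}. \<phi> x \<le> c} \<in> sets (lebesgue_on {0..T})) = ({x \<in> {0..T}. \<phi> x \<le> c} \<subseteq> {0..T} \<and> {x \<in> {0..T}. \<phi> x \<le> c} \<in> sets lebesgue)"
      by (rule sets_restrict_space_iff) simp
    show ?thesis unfolding eq iff by (intro conjI leb) auto
  qed
qed

lemma (in semi_inner) uniform_path_LIMSEQ:
  assumes Y: "uniform_path \<tau> Y" and s: "\<And>n. s n \<in> {0..\<tau>}" and l: "l \<in> {0..\<tau>}" and lim: "s \<longlonglongrightarrow> l"
  shows "(\<lambda>n. N (Y (s n) - Y l)) \<longlonglongrightarrow> 0"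
proof (rule tendstoI)
  fix e :: real assume e: "0 < e"
  obtain d where d: "0 < d" "\<forall>s\<in>{0..\<tau>}. \<forall>t\<in>{0..\<tau>}. \<bar>s - t\<bar> < d \<longrightarrow> N (Y s - Y t) < e"
    by (rule uniform_pathE[OF Y e])
  have "\<forall>\<^sub>F n in sequentially. dist (s n) l < d" using tendstoD[OF lim d(1)] .
  then show "\<forall>\<^sub>F n in sequentially. dist (N (Y (s n) - Y l)) 0 < e"
  proof eventually_elim
    case (elim n)
    then have "N (Y (s n) - Y l) < e" using d(2) s[of n] l by (simp add: dist_real_def)
    moreover have "0 \<le> N (Y (s n) - Y l)" using uniform_path_mem[OF Y s] uniform_path_mem[OF Y l] by simp
    ultimately show ?case by simp
  qed
qed

context memory_forms
begin

text \<open>The value outside \<open>H10\<close> makes the energy lower semicontinuous for convergence in \<open>L2\<close>.\<close>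

definition form_energy :: "real \<Rightarrow> real \<Rightarrow> (real^'d \<Rightarrow> real) \<Rightarrow> ennreal" where
  "form_energy \<alpha> \<gamma> v = (if v \<in> H10 \<Omega> then ennreal (\<alpha> * a0 v v + \<gamma> * av v v) else top)"

text \<open>With \<open>\<gamma> > 0\<close> the form is an inner product that makes \<open>H10\<close> complete. A bound on the energies gives a
  limit in \<open>H10\<close>, which agrees with \<open>x\<close> up to a null function.\<close>

lemma form_energy_closed:
  assumes \<alpha>: "0 \<le> \<alpha>" and \<gamma>: "0 < \<gamma>" and c: "c < top" and y: "\<And>n::nat. form_energy \<alpha> \<gamma> (y n) \<le> c"
    and x: "x \<in> L2 \<Omega>" and lim: "(\<lambda>n. L2_norm \<Omega> (y n - x)) \<longlonglongrightarrow> 0"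
  shows "form_energy \<alpha> \<gamma> x \<le> c"
proof -
  have yH: "y n \<in> H10 \<Omega>" for n using y[of n] c by (auto simp: form_energy_def top_unique split: if_splits)
  obtain c' where c': "0 \<le> c'" "c = ennreal c'" using c by (cases c) auto
  interpret a0: semi_inner "H10 \<Omega>" a0 "\<lambda>v. sqrt (a0 v v)"
    by unfold_locales (use subspace_H10 a0_bilin a0_nn in auto)
  define q where "q v w = \<alpha> * a0 v w + \<gamma> * av v w" for v w
  have qb: "symmetric_bilinear_on (H10 \<Omega>) q"
  proof -
    have 1: "q (c *\<^sub>R v) w = c * q v w" if "v \<in> H10 \<Omega>" "w \<in> H10 \<Omega>" for c v w
      using that a0.ip_scale_left[OF that(1,1,2), of c] Av.ip_scale_left[OF that(1,1,2), of c] by (simp add: q_def algebra_simps)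
    have 2: "q v w = q w v" if "v \<in> H10 \<Omega>" "w \<in> H10 \<Omega>" for v w
      using a0.ip_commute[OF that] Av.ip_commute[OF that] by (simp add: q_def)
    have 3: "q (v + v') w = q v w + q v' w" if "v \<in> H10 \<Omega>" "v' \<in> H10 \<Omega>" "w \<in> H10 \<Omega>" for v v' w
      using a0.ip_add_left[OF that] Av.ip_add_left[OF that] by (simp add: q_def algebra_simps)
    show ?thesis unfolding symmetric_bilinear_on_def by (intro conjI ballI allI 1 2 3)
  qed
  have qbd: "q v v \<le> (\<alpha> * C0 + \<gamma> * Cv) * (V_norm \<Omega> v)\<^sup>2" if "v \<in> H10 \<Omega>" for v
  proof -
    have "\<alpha> * a0 v v \<le> \<alpha> * (C0 * (V_norm \<Omega> v)\<^sup>2)" by (rule mult_left_mono[OF a0_quadratic_bd[OF that] \<alpha>])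
    moreover have "\<gamma> * av v v \<le> \<gamma> * (Cv * (V_norm \<Omega> v)\<^sup>2)" by (rule mult_left_mono[OF av_quadratic_bd[OF that]]) (use \<gamma> in simp)
    ultimately show ?thesis unfolding q_def distrib_right mult.assoc by (rule add_mono)
  qed
  have qco: "(\<gamma> * \<beta>v) * (V_seminorm \<Omega> v)\<^sup>2 \<le> q v v" if "v \<in> H10 \<Omega>" for v
  proof -
    have "\<gamma> * (\<beta>v * (V_seminorm \<Omega> v)\<^sup>2) \<le> \<gamma> * av v v" by (rule mult_left_mono[OF av_co[OF that]]) (use \<gamma> in simp)
    then show ?thesis using mult_nonneg_nonneg[OF \<alpha> a0_nn[OF that]] unfolding q_def mult.assoc by linarith
  qed
  obtain D where sh: "semi_hilbert (H10 \<Omega>) q (\<lambda>v. sqrt (q v v))" and D: "0 < D"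
    "\<forall>v\<in>H10 \<Omega>. V_norm \<Omega> v \<le> D * sqrt (q v v)" "\<forall>v\<in>H10 \<Omega>. sqrt (q v v) \<le> D * V_norm \<Omega> v"
    by (rule coercive_semi_hilbert[OF qb qbd qco]) (use \<gamma> \<beta>v in auto)
  interpret Q: semi_hilbert "H10 \<Omega>" q "\<lambda>v. sqrt (q v v)" by (rule sh)
  have "\<exists>w\<in>H10 \<Omega>. q w w \<le> c' \<and> L2_norm \<Omega> (w - x) = 0"
  proof (rule Q.bounded_weak_limit[OF H.seminormed])
    show "H10 \<Omega> \<subseteq> L2 \<Omega>" using H10_in_H1 H1_D(1) by blast
    show "L2_norm \<Omega> v \<le> D * sqrt (q v v)" if "v \<in> H10 \<Omega>" for v
      using D(2) that L2_le_V_norm[of v] by fastforce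
    show "q (y n) (y n) \<le> c'" for n
      using y[of n] yH[of n] c' by (simp add: form_energy_def q_def ennreal_le_iff)
  qed (use yH x lim in auto)
  then obtain w where w: "w \<in> H10 \<Omega>" "q w w \<le> c'" "L2_norm \<Omega> (w - x) = 0" by blast
  note xH = H10_cong[OF w(1) x w(3)]
  have m: "w - x \<in> H10 \<Omega>" using w(1) xH(1) by simp
  have "sqrt (q (w - x) (w - x)) \<le> D * V_norm \<Omega> (w - x)" using D(3) m by blast
  then have "sqrt (q (w - x) (w - x)) = 0" using xH(2) Q.N_nonneg[OF m] by simp
  then have "q x w = q x x" "q w w = q w x"
    using Q.ip_cong_right[OF xH(1) w(1) xH(1)] Q.ip_cong_right[OF w(1) w(1) xH(1)] by auto
  then have "q x x \<le> c'" using w(2) Q.ip_commute[OF w(1) xH(1)] by simp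
  then show ?thesis using xH(1) c' by (simp add: form_energy_def q_def ennreal_leI)
qed

text \<open>Convergence in \<open>K\<close> gives convergence almost everywhere along a subsequence, and Fatou's lemma applies.\<close>

lemma memory_dissipation_closed:
  assumes y: "\<And>n::nat. y n \<in> K_space \<Omega> a1 \<nu>" and x: "x \<in> K_space \<Omega> a1 \<nu>"
    and lim: "(\<lambda>n. K_norm a1 \<nu> (y n - x)) \<longlonglongrightarrow> 0" and c: "\<And>n. memory_dissipation (y n) \<le> c"
  shows "memory_dissipation x \<le> c"
proof -
  have "\<exists>n. (K_norm a1 \<nu> (y n - x))\<^sup>2 \<le> 1 * (1/2)^k" for k
  proof -
    have "(\<lambda>n. (K_norm a1 \<nu> (y n - x))\<^sup>2) \<longlonglongrightarrow> 0\<^sup>2" by (intro tendsto_power lim)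
    then have "\<forall>\<^sub>F n in sequentially. (K_norm a1 \<nu> (y n - x))\<^sup>2 < 1 * (1/2)^k" by (rule order_tendstoD(2)) simp
    from eventually_happens'[OF sequentially_bot this] show ?thesis by (auto intro: less_imp_le)
  qed
  then obtain r where r: "\<And>k. (K_norm a1 \<nu> (y (r k) - x))\<^sup>2 \<le> 1 * (1/2)^k" by metis
  have d: "y n - x \<in> K_space \<Omega> a1 \<nu>" for n using y x by simp
  have "AE l in completion \<nu>. summable (\<lambda>k. max 0 (a1 ((y (r k) - x) l) ((y (r k) - x) l)))"
  proof (rule AE_summable_of_geometric_bound)
    show "(\<lambda>l. max 0 (a1 ((y (r k) - x) l) ((y (r k) - x) l))) \<in> borel_measurable (completion \<nu>)" for k
      using borel_measurable_integrable[OF K_integrable[OF d d]] by (intro borel_measurable_max) auto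
    show "(\<integral>\<^sup>+l. ennreal (max 0 (a1 ((y (r k) - x) l) ((y (r k) - x) l))) \<partial>completion \<nu>) \<le> ennreal (1 * (1/2)^k)" for k
    proof -
      have "(\<integral>\<^sup>+l. ennreal (max 0 (a1 ((y (r k) - x) l) ((y (r k) - x) l))) \<partial>completion \<nu>)
          = (\<integral>\<^sup>+l. ennreal (a1 ((y (r k) - x) l) ((y (r k) - x) l)) \<partial>\<nu>)"
        unfolding nn_integral_completion by (intro nn_integral_cong) (simp add: max_def ennreal_neg)
      also have "\<dots> = ennreal ((K_norm a1 \<nu> (y (r k) - x))\<^sup>2)"
        using A1.BL2_nn_integral(1)[OF d[of "r k", unfolded K_space_eq]] K.N_square[OF d[of "r k"]] by simp
      also have "\<dots> \<le> ennreal (1 * (1/2)^k)" by (rule ennreal_leI[OF r])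
      finally show ?thesis .
    qed
  qed auto
  then have sumAE: "AE l in \<nu>. summable (\<lambda>k. max 0 (a1 ((y (r k) - x) l) ((y (r k) - x) l)))" by (simp add: AE_completion_iff)
  have yAE: "AE l in \<nu>. \<forall>k. y (r k) l \<in> H10 \<Omega>" and xAE: "AE l in \<nu>. x l \<in> H10 \<Omega>"
    using K_AE[OF y] K_AE[OF x] by (auto simp: AE_all_countable AE_completion_iff)
  have ae: "AE l in \<nu>. ennreal (l * a1 (x l) (x l)) = liminf (\<lambda>k. ennreal (l * a1 (y (r k) l) (y (r k) l)))"
    using sumAE yAE xAE
  proof eventually_elim
    case (elim l)
    have "(\<lambda>k. max 0 (a1 ((y (r k) - x) l) ((y (r k) - x) l))) \<longlonglongrightarrow> 0" by (rule summable_LIMSEQ_zero[OF elim(1)])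
    from tendsto_real_sqrt[OF this]
    have "(\<lambda>k. sqrt (max 0 (a1 ((y (r k) - x) l) ((y (r k) - x) l)))) \<longlonglongrightarrow> 0" by simp
    moreover have "sqrt (max 0 (a1 ((y (r k) - x) l) ((y (r k) - x) l))) = sqrt (a1 (x l - y (r k) l) (x l - y (r k) l))" for k
      using A1.nonneg[of "y (r k) l - x l"] A1.N_commute[of "y (r k) l" "x l"] elim by simp
    ultimately have "(\<lambda>k. sqrt (a1 (x l - y (r k) l) (x l - y (r k) l))) \<longlonglongrightarrow> 0" by simp
    from A1.ip_tendsto[OF elim(2,3) this]
    have "(\<lambda>k. ennreal (l * a1 (y (r k) l) (y (r k) l))) \<longlonglongrightarrow> ennreal (l * a1 (x l) (x l))"
      by (intro tendsto_ennrealI tendsto_mult tendsto_const)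
    from lim_imp_Liminf[OF _ this] show ?case by simp
  qed
  have idm: "(\<lambda>l. l) \<in> borel_measurable (completion \<nu>)"
  proof -
    have "(\<lambda>l. l) \<in> borel_measurable (restrict_space borel {0..})" by (rule measurable_restrict_space1) simp
    then have "(\<lambda>l. l) \<in> borel_measurable \<nu>" using measurable_cong_sets[OF sets_nu refl] by blast
    then show ?thesis by (rule measurable_completion)
  qed
  have m: "(\<lambda>l. ennreal (l * a1 (y n l) (y n l))) \<in> borel_measurable (completion \<nu>)" for n
    using borel_measurable_integrable[OF K_integrable[OF y y]] idm by (intro measurable_compose[OF _ measurable_ennreal] borel_measurable_times)
  have "memory_dissipation x = (\<integral>\<^sup>+l. liminf (\<lambda>k. ennreal (l * a1 (y (r k) l) (y (r k) l))) \<partial>completion \<nu>)"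
    unfolding memory_dissipation_def nn_integral_completion by (rule nn_integral_cong_AE[OF ae])
  also have "\<dots> \<le> liminf (\<lambda>k. \<integral>\<^sup>+l. ennreal (l * a1 (y (r k) l) (y (r k) l)) \<partial>completion \<nu>)"
    by (rule nn_integral_liminf[OF m])
  also have "\<dots> \<le> c"
    using c unfolding memory_dissipation_def nn_integral_completion by (intro Liminf_le always_eventually) auto
  finally show ?thesis .
qed

lemma components_le_W: "L2_norm \<Omega> (fst x) \<le> \<N> x" "K_norm a1 \<nu> (snd x) \<le> \<N> x"
  by (auto simp: W_norm_def)

lemma components_tendsto:
  assumes y: "\<forall>n. y n \<in> \<W>" "x \<in> \<W>" and lim: "(\<lambda>n. \<N> (y n - x)) \<longlonglongrightarrow> 0"
  shows "(\<lambda>n. L2_norm \<Omega> (fst (y n) - fst x)) \<longlonglongrightarrow> 0" "(\<lambda>n. K_norm a1 \<nu> (snd (y n) - snd x)) \<longlonglongrightarrow> 0"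
proof -
  show "(\<lambda>n. L2_norm \<Omega> (fst (y n) - fst x)) \<longlonglongrightarrow> 0"
    by (rule tendsto_zero_dominated[OF lim]) (use components_le_W(1)[of "y n - x" for n] in simp)
  show "(\<lambda>n. K_norm a1 \<nu> (snd (y n) - snd x)) \<longlonglongrightarrow> 0"
  proof (rule tendsto_zero_dominated[OF lim])
    fix n
    have "snd (y n) - snd x \<in> K_space \<Omega> a1 \<nu>" using y mem_W by auto
    then show "\<bar>K_norm a1 \<nu> (snd (y n) - snd x)\<bar> \<le> \<N> (y n - x)"
      using components_le_W(2)[of "y n - x"] K.N_nonneg by simp
  qed
qed

lemma energy_lsc:
  assumes \<alpha>: "0 \<le> \<alpha>" and \<gamma>: "0 < \<gamma>" and y: "\<forall>n. y n \<in> \<W>" and x: "x \<in> \<W>"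
    and lim: "(\<lambda>n. \<N> (y n - x)) \<longlonglongrightarrow> 0"
  shows "form_energy \<alpha> \<gamma> (fst x) + 2 * memory_dissipation (snd x)
     \<le> liminf (\<lambda>n. form_energy \<alpha> \<gamma> (fst (y n)) + 2 * memory_dissipation (snd (y n)))"
proof -
  note ct = components_tendsto[OF y x lim]
  have 1: "form_energy \<alpha> \<gamma> (fst x) \<le> liminf (\<lambda>n. form_energy \<alpha> \<gamma> (fst (y n)))"
  proof (rule le_liminf_of_closed_sublevels)
    fix c and r :: "nat \<Rightarrow> nat" assume c: "c < top" and r: "strict_mono r" and le: "\<And>n. form_energy \<alpha> \<gamma> (fst (y (r n))) \<le> c"
    have "(\<lambda>n. L2_norm \<Omega> (fst (y (r n)) - fst x)) \<longlonglongrightarrow> 0" using LIMSEQ_subseq_LIMSEQ[OF ct(1) r] by (simp add: o_def)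
    then show "form_energy \<alpha> \<gamma> (fst x) \<le> c"
      by (rule form_energy_closed[OF \<alpha> \<gamma> c le, rotated]) (use x mem_W in auto)
  qed
  have 2: "memory_dissipation (snd x) \<le> liminf (\<lambda>n. memory_dissipation (snd (y n)))"
  proof (rule le_liminf_of_closed_sublevels)
    fix c and r :: "nat \<Rightarrow> nat" assume c: "c < top" and r: "strict_mono r" and le: "\<And>n. memory_dissipation (snd (y (r n))) \<le> c"
    have l: "(\<lambda>n. K_norm a1 \<nu> (snd (y (r n)) - snd x)) \<longlonglongrightarrow> 0" using LIMSEQ_subseq_LIMSEQ[OF ct(2) r] by (simp add: o_def)
    show "memory_dissipation (snd x) \<le> c"
      by (rule memory_dissipation_closed[OF _ _ l le]) (use x y mem_W in auto)
  qed
  show ?thesis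
    unfolding mult_2 by (rule order_trans[OF add_mono[OF 1 order_trans[OF add_mono[OF 2 2] liminf_add_ennreal]] liminf_add_ennreal])
qed

lemma path_measurable:
  assumes Y: "W.uniform_path T Y" and \<alpha>: "0 \<le> \<alpha>" and \<gamma>: "0 < \<gamma>"
  shows "(\<lambda>s. form_energy \<alpha> \<gamma> (fst (Y s))) \<in> borel_measurable (lebesgue_on {0..T})"
    "(\<lambda>s. memory_dissipation (snd (Y s))) \<in> borel_measurable (lebesgue_on {0..T})"
proof -
  have lim: "(\<lambda>n. L2_norm \<Omega> (fst (Y (s n)) - fst (Y l))) \<longlonglongrightarrow> 0" "(\<lambda>n. K_norm a1 \<nu> (snd (Y (s n)) - snd (Y l))) \<longlonglongrightarrow> 0"
     "Y l \<in> \<W>" "\<forall>n. Y (s n) \<in> \<W>"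
    if s: "\<And>n::nat. s n \<in> {0..T}" "s \<longlonglongrightarrow> l" for s l
  proof -
    have l: "l \<in> {0..T}" using closed_sequentially[OF closed_atLeastAtMost s] .
    show 1: "Y l \<in> \<W>" "\<forall>n. Y (s n) \<in> \<W>" using W.uniform_path_mem[OF Y] s l by auto
    from components_tendsto[OF 1(2,1) W.uniform_path_LIMSEQ[OF Y s(1) l s(2)]]
    show "(\<lambda>n. L2_norm \<Omega> (fst (Y (s n)) - fst (Y l))) \<longlonglongrightarrow> 0" "(\<lambda>n. K_norm a1 \<nu> (snd (Y (s n)) - snd (Y l))) \<longlonglongrightarrow> 0" .
  qed
  show "(\<lambda>s. form_energy \<alpha> \<gamma> (fst (Y s))) \<in> borel_measurable (lebesgue_on {0..T})"
  proof (rule measurable_of_closed_sublevels)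
    fix c s l assume c: "c < top" and s: "\<And>n::nat. s n \<in> {0..T}" and le: "\<And>n. form_energy \<alpha> \<gamma> (fst (Y (s n))) \<le> c" and sl: "s \<longlonglongrightarrow> l"
    note L = lim[OF s sl]
    show "form_energy \<alpha> \<gamma> (fst (Y l)) \<le> c"
      by (rule form_energy_closed[OF \<alpha> \<gamma> c le _ L(1)]) (use L(3) mem_W in auto)
  qed
  show "(\<lambda>s. memory_dissipation (snd (Y s))) \<in> borel_measurable (lebesgue_on {0..T})"
  proof (rule measurable_of_closed_sublevels)
    fix c s l assume c: "c < top" and s: "\<And>n::nat. s n \<in> {0..T}" and le: "\<And>n. memory_dissipation (snd (Y (s n))) \<le> c" and sl: "s \<longlonglongrightarrow> l"
    note L = lim[OF s sl]
    show "memory_dissipation (snd (Y l)) \<le> c"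
      by (rule memory_dissipation_closed[OF _ _ L(2) le]) (use L(3,4) mem_W in auto)
  qed
qed

end

section \<open>The energy estimate for two mild solutions\<close>

text \<open>The problem with index \<open>0\<close> is the unperturbed one. Initial state and forcing are arbitrary elements of
  the extended space, but common to both problems.\<close>

locale perturbed_pair = memory_forms \<Omega> a0 a1 av \<nu> C0 C1 Cv \<beta> \<beta>v
  for \<Omega> :: "(real^'d) set" and a0 a1 av \<nu> C0 C1 Cv \<beta> \<beta>v +
  fixes S0 S1 and F :: "real \<Rightarrow> (real^'d \<Rightarrow> real) \<times> (real \<Rightarrow> real^'d \<Rightarrow> real)" and x0 and T \<epsilon> :: real
  assumes T_pos: "0 < T" and eps: "0 < \<epsilon>"
    and problem0: "mild_problem \<W> W_inner \<N> S0 F x0 T"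
    and problem1: "mild_problem \<W> W_inner \<N> S1 F x0 T"
    and gen0: "generates \<W> \<N> (A_graph \<Omega> (\<lambda>v w. a0 v w + 0 * av v w) a1 \<nu>) S0"
    and gen1: "generates \<W> \<N> (A_graph \<Omega> (\<lambda>v w. a0 v w + \<epsilon> * av v w) a1 \<nu>) S1"
    and regular: "(\<lambda>t. fst (mild_solution \<W> \<N> S0 x0 F t))
       \<in> Bochner_Lp 2 (lebesgue_on {0..T}) (H10 \<Omega>) (V_norm \<Omega>)"
begin

sublocale P0: mild_problem "\<W>" W_inner "\<N>" S0 F x0 T by (rule problem0)
sublocale P1: mild_problem "\<W>" W_inner "\<N>" S1 F x0 T by (rule problem1)

abbreviation u where "u s \<equiv> fst (P0.X s)"

text \<open>\<open>Y\<close> is the error, \<open>G\<close> its time integral, \<open>d h s\<close> its average over \<open>[s, s + h]\<close>, and \<open>r h\<close> the derivative of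
  \<open>d h\<close>. The unperturbed energy \<open>\<Gamma>\<close> is what the estimate has on its right-hand side.\<close>

definition Y where "Y s = P1.X s - P0.X s"
definition G where "G s = W.primitive P1.X s - W.primitive P0.X s"
definition d where "d h s = (1 / h) *\<^sub>R (G (s + h) - G s)"
definition r where "r h s = (1 / h) *\<^sub>R (Y (s + h) - Y s)"
definition \<Gamma> where "\<Gamma> t = (LINT s|lebesgue_on {0..t}. av (u s) (u s))"

lemma Y_path: "W.uniform_path T Y"
  unfolding Y_def by (rule W.uniform_path_diff[OF P1.X_uniform_path P0.X_uniform_path])

lemma G_path: "W.uniform_path T G"
  unfolding G_def by (rule W.uniform_path_diff[OF P1.primitive_forcing(2) P0.primitive_forcing(2)])

lemma G_increment:
  assumes ab: "0 \<le> a" "a \<le> b" "b \<le> T" and w: "w \<in> \<W>"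
  shows "W_inner (G b - G a) w = integral {a..b} (\<lambda>s. W_inner (Y s) w)"
proof -
  note lw = W.ip_bounded_functional[OF w]
  note i1 = W.primitive_increment[OF P1.tau P1.X_regular lw ab]
  note i0 = W.primitive_increment[OF P1.tau P0.X_regular lw ab]
  have mem: "W.primitive P1.X s \<in> \<W>" "W.primitive P0.X s \<in> \<W>" if "s \<in> {0..T}" for s
    using W.uniform_path_mem[OF P1.primitive_forcing(2) that] W.uniform_path_mem[OF P0.primitive_forcing(2) that] by auto
  have memX: "P1.X s \<in> \<W>" "P0.X s \<in> \<W>" if "s \<in> {0..T}" for s
    using P1.X_mem P0.X_mem that by auto
  have t: "a \<in> {0..T}" "b \<in> {0..T}" using ab by auto
  have "continuous_on {a..b} (\<lambda>s. W_inner (Y s) w)"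
    by (rule continuous_on_subset[OF W.uniform_path_ip_continuous[OF Y_path W.uniform_path_const[OF w]]]) (use ab in auto)
  from LINT_continuous(2)[OF this]
  have "integral {a..b} (\<lambda>s. W_inner (Y s) w) = (LINT s|lebesgue_on {a..b}. W_inner (Y s) w)" by simp
  also have "\<dots> = (LINT s|lebesgue_on {a..b}. W_inner (P1.X s) w - W_inner (P0.X s) w)"
  proof (rule Bochner_Integration.integral_cong[OF refl])
    fix s assume "s \<in> space (lebesgue_on {a..b})"
    then have s: "s \<in> {0..T}" using ab by auto
    show "W_inner (Y s) w = W_inner (P1.X s) w - W_inner (P0.X s) w"
      unfolding Y_def by (rule W.ip_diff_left[OF memX[OF s] w])
  qed
  also have "\<dots> = (LINT s|lebesgue_on {a..b}. W_inner (P1.X s) w) - (LINT s|lebesgue_on {a..b}. W_inner (P0.X s) w)"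
    by (rule Bochner_Integration.integral_diff[OF i1(1) i0(1)])
  also have "\<dots> = W_inner (G b - G a) w"
    unfolding i1(2)[symmetric] i0(2)[symmetric] G_def using mem[OF t(1)] mem[OF t(2)] w by (simp add: W.ip_diff_left)
  finally show ?thesis by simp
qed

lemma d_path: assumes h: "0 < h" "\<sigma> + h \<le> T" shows "W.uniform_path \<sigma> (d h)"
  unfolding d_def
  by (intro W.uniform_path_scale W.uniform_path_diff W.uniform_path_shift[OF G_path] W.uniform_path_subset[OF G_path]) (use h in auto)

lemma r_path: assumes h: "0 < h" "\<sigma> + h \<le> T" shows "W.uniform_path \<sigma> (r h)"
  unfolding r_def
  by (intro W.uniform_path_scale W.uniform_path_diff W.uniform_path_shift[OF Y_path] W.uniform_path_subset[OF Y_path]) (use h in auto)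

lemma d_increment:
  assumes h: "0 < h" and ab: "0 \<le> a" "a \<le> b" "b + h \<le> T" and w: "w \<in> \<W>"
  shows "W_inner (d h b - d h a) w = integral {a..b} (\<lambda>s. W_inner (r h s) w)"
proof -
  have GS: "G s \<in> \<W>" "Y s \<in> \<W>" if "0 \<le> s" "s \<le> T" for s
    using W.uniform_path_mem[OF G_path] W.uniform_path_mem[OF Y_path] that by auto
  have m: "G a \<in> \<W>" "G b \<in> \<W>" "G (a + h) \<in> \<W>" "G (b + h) \<in> \<W>"
    using GS h ab by auto
  have gc: "continuous_on {0..T} (\<lambda>s. W_inner (Y s) w)"
    by (rule W.uniform_path_ip_continuous[OF Y_path W.uniform_path_const[OF w]])
  have c: "continuous_on {a..b} (\<lambda>s. W_inner (Y s) w)" "continuous_on {a+h..b+h} (\<lambda>s. W_inner (Y s) w)"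
    by (rule continuous_on_subset[OF gc], use h ab in auto)+
  have c': "continuous_on {a..b} (\<lambda>s. W_inner (Y (s + h)) w)"
    by (rule continuous_on_compose2[OF c(2), of _ "\<lambda>s. s + h"]) (auto intro!: continuous_intros)
  have D: "d h b - d h a = (1 / h) *\<^sub>R ((G (b + h) - G (a + h)) - (G b - G a))"
    unfolding d_def by (simp add: algebra_simps)
  have "W_inner (d h b - d h a) w = (1 / h) * W_inner ((G (b + h) - G (a + h)) - (G b - G a)) w"
    unfolding D by (rule W.ip_scale_left[OF _ w w]) (use m in auto)
  also have "W_inner ((G (b + h) - G (a + h)) - (G b - G a)) w = W_inner (G (b + h) - G (a + h)) w - W_inner (G b - G a) w"
    by (rule W.ip_diff_left[OF _ _ w]) (use m in auto)
  also have "W_inner (G (b + h) - G (a + h)) w = integral {a..b} (\<lambda>s. W_inner (Y (s + h)) w)"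
    using G_increment[of "a + h" "b + h" w] integral_translate[OF c(2)] h ab w by simp
  also have "W_inner (G b - G a) w = integral {a..b} (\<lambda>s. W_inner (Y s) w)"
    by (rule G_increment) (use h ab w in auto)
  also have "integral {a..b} (\<lambda>s. W_inner (Y (s + h)) w) - integral {a..b} (\<lambda>s. W_inner (Y s) w)
      = integral {a..b} (\<lambda>s. W_inner (Y (s + h)) w - W_inner (Y s) w)"
    by (rule integral_diff[symmetric]) (intro integrable_continuous_interval c c')+
  also have "(1 / h) * integral {a..b} (\<lambda>s. W_inner (Y (s + h)) w - W_inner (Y s) w)
      = integral {a..b} (\<lambda>s. (1 / h) * (W_inner (Y (s + h)) w - W_inner (Y s) w))"
    by (rule integral_mult_right[symmetric])
  also have "\<dots> = integral {a..b} (\<lambda>s. W_inner (r h s) w)"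
  proof (rule integral_cong)
    fix s assume "s \<in> {a..b}"
    then have y: "Y (s + h) \<in> \<W>" "Y s \<in> \<W>" using GS h ab by auto
    then have "W_inner (r h s) w = (1 / h) * W_inner (Y (s + h) - Y s) w"
      unfolding r_def by (intro W.ip_scale_left[OF _ w w]) auto
    then show "(1 / h) * (W_inner (Y (s + h)) w - W_inner (Y s) w) = W_inner (r h s) w"
      using W.ip_diff_left[OF y w] by simp
  qed
  finally show ?thesis .
qed

text \<open>The point \<open>s'\<close> may be anywhere in the interval of the average, so one bound covers the averages that
  start at a time and those that end there.\<close>

lemma averages_converge:
  assumes e: "0 < e"
  obtains \<delta> where "0 < \<delta>" "\<forall>h s s'. 0 < h \<longrightarrow> h < \<delta> \<longrightarrow> 0 \<le> s \<longrightarrow> s + h \<le> T \<longrightarrow> s' \<in> {s..s+h} \<longrightarrow> \<N> (d h s - Y s') \<le> e"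
proof -
  have GS: "G s \<in> \<W>" "Y s \<in> \<W>" if "s \<in> {0..T}" for s
    using W.uniform_path_mem[OF G_path] W.uniform_path_mem[OF Y_path] that by auto
  obtain \<delta> where \<delta>: "0 < \<delta>" "\<forall>a b s. 0 \<le> a \<longrightarrow> a \<le> b \<longrightarrow> b \<le> T \<longrightarrow> s \<in> {a..b} \<longrightarrow> b - a < \<delta> \<longrightarrow>
     \<N> (G b - G a - (b - a) *\<^sub>R Y s) \<le> (b - a) * e"
    by (rule W.weak_primitive_average[OF GS(1) Y_path G_increment e])
  have "\<N> (d h s - Y s') \<le> e"
    if h: "0 < h" "h < \<delta>" and s: "0 \<le> s" "s + h \<le> T" "s' \<in> {s..s+h}" for h s s'
  proof -
    have m: "G (s + h) - G s - h *\<^sub>R Y s' \<in> \<W>" using GS[of s] GS[of "s + h"] GS[of s'] h s by auto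
    have "d h s - Y s' = (1 / h) *\<^sub>R (G (s + h) - G s - h *\<^sub>R Y s')"
      unfolding d_def using h by (simp add: scaleR_diff_right)
    then have "\<N> (d h s - Y s') = (1 / h) * \<N> (G (s + h) - G s - h *\<^sub>R Y s')"
      using W.scale[OF m, of "1 / h"] h by simp
    also have "\<dots> \<le> (1 / h) * (h * e)"
      using \<delta>(2)[rule_format, of s "s + h" s'] h s by (intro mult_left_mono) auto
    finally show ?thesis using h by simp
  qed
  then show ?thesis by (intro that[OF \<delta>(1)]) blast
qed

lemma u_regular:
  shows u_strongly: "strongly_measurable_in (lebesgue_on {0..T}) (H10 \<Omega>) (V_norm \<Omega>) u"
    and u_L1: "(\<integral>\<^sup>+s. ennreal (V_norm \<Omega> (u s)) \<partial>lebesgue_on {0..T}) < \<infinity>"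
    and u_AE: "AE s in lebesgue_on {0..T}. u s \<in> H10 \<Omega>"
    and u_energy_integrable: "integrable (lebesgue_on {0..T}) (\<lambda>s. av (u s) (u s))"
proof -
  let ?M = "lebesgue_on {0..T}"
  have R: "u \<in> Bochner_Lp 2 ?M (H10 \<Omega>) (V_norm \<Omega>)" using regular unfolding P0.X_def .
  then show sm: "strongly_measurable_in ?M (H10 \<Omega>) (V_norm \<Omega>) u" by (simp add: Bochner_Lp_def)
  have L2: "(\<integral>\<^sup>+s. ennreal ((V_norm \<Omega> (u s))\<^sup>2) \<partial>?M) < \<infinity>" using R by (simp add: Bochner_Lp_def)
  show "(\<integral>\<^sup>+s. ennreal (V_norm \<Omega> (u s)) \<partial>?M) < \<infinity>" by (rule V.L1_of_L2[OF finite_measure_interval sm L2])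
  show ae: "AE s in ?M. u s \<in> H10 \<Omega>" using sm by (simp add: strongly_measurable_in_def)
  have nm: "(\<lambda>s. V_norm \<Omega> (u s)) \<in> borel_measurable ?M"
    using V.strongly_measurable_norm[OF sm] by (simp add: completion_lebesgue_on)
  have "(\<integral>\<^sup>+s. ennreal (av (u s) (u s)) \<partial>?M) \<le> (\<integral>\<^sup>+s. ennreal \<bar>Cv\<bar> * ennreal ((V_norm \<Omega> (u s))\<^sup>2) \<partial>?M)"
  proof (rule nn_integral_mono_AE, use ae in eventually_elim)
    case (elim s)
    have "av (u s) (u s) \<le> \<bar>Cv\<bar> * (V_norm \<Omega> (u s))\<^sup>2"
      by (rule order_trans[OF av_quadratic_bd[OF elim] mult_right_mono]) auto
    then show ?case by (simp flip: ennreal_mult' add: ennreal_leI)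
  qed
  also have "\<dots> = ennreal \<bar>Cv\<bar> * (\<integral>\<^sup>+s. ennreal ((V_norm \<Omega> (u s))\<^sup>2) \<partial>?M)"
    using nm by (intro nn_integral_cmult) measurable
  also have "\<dots> < \<infinity>" using L2 by (simp add: ennreal_mult_less_top)
  finally have "u \<in> Av.BL2 ?M" unfolding Av.BL2_def using strongly_measurable_av[OF sm] by simp
  from Av.BL2_integrable[OF this this] show "integrable ?M (\<lambda>s. av (u s) (u s))" by (simp add: completion_lebesgue_on)
qed

lemma \<Gamma>_increment:
  assumes ab: "0 \<le> a" "a \<le> b" "b \<le> T"
  shows "\<Gamma> b - \<Gamma> a = (LINT s|lebesgue_on {a..b}. av (u s) (u s))" "\<Gamma> a \<le> \<Gamma> b"
    "integrable (lebesgue_on {a..b}) (\<lambda>s. av (u s) (u s))" "AE s in lebesgue_on {a..b}. u s \<in> H10 \<Omega>"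
proof -
  have i0: "integrable (lebesgue_on {0..b}) (\<lambda>s. av (u s) (u s))"
    by (rule integrable_lebesgue_on_subset[OF u_energy_integrable]) (use ab in auto)
  show "integrable (lebesgue_on {a..b}) (\<lambda>s. av (u s) (u s))"
    by (rule integrable_lebesgue_on_subset[OF u_energy_integrable]) (use ab in auto)
  show ae: "AE s in lebesgue_on {a..b}. u s \<in> H10 \<Omega>"
    by (rule AE_lebesgue_on_subset[OF u_AE]) (use ab in auto)
  show eq: "\<Gamma> b - \<Gamma> a = (LINT s|lebesgue_on {a..b}. av (u s) (u s))"
    unfolding \<Gamma>_def using LINT_interval_combine[OF i0 ab(1,2)] by simp
  have "0 \<le> (LINT s|lebesgue_on {a..b}. av (u s) (u s))"
  proof (rule integral_nonneg_AE)
    show "AE s in lebesgue_on {a..b}. 0 \<le> av (u s) (u s)" using ae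
    proof eventually_elim
      case (elim s)
      then show ?case by (rule Av.nonneg)
    qed
  qed
  then show "\<Gamma> a \<le> \<Gamma> b" using eq by simp
qed

lemma \<Gamma>_0: "\<Gamma> 0 = 0"
proof -
  have "AE s in lebesgue_on {0..0::real}. av (u s) (u s) = 0"
  proof -
    have "AE s in lebesgue_on {0..0::real}. s \<noteq> 0" by (rule AE_lebesgue_on_neq) simp
    then show ?thesis using AE_space[of "lebesgue_on {0..0::real}"]
    proof eventually_elim
      case (elim s)
      then show ?case by simp
    qed
  qed
  then show ?thesis unfolding \<Gamma>_def by (rule integral_eq_zero_AE)
qed

lemma \<Gamma>_nonneg: "0 \<le> t \<Longrightarrow> t \<le> T \<Longrightarrow> 0 \<le> \<Gamma> t"
  using \<Gamma>_increment(2)[of 0 t] \<Gamma>_0 by simp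

lemma \<Gamma>_continuous: "continuous_on {0..T} \<Gamma>"
  unfolding \<Gamma>_def by (rule absolutely_continuous_primitive[OF u_energy_integrable])

text \<open>Jensen's inequality for \<open>av\<close>. The integral of the state in the extended space and the integral of \<open>u\<close> in
  \<open>H10\<close> have the same pairings with \<open>L2\<close>, hence differ by a null function, and functionals that are bounded
  on \<open>H10\<close> only, such as \<open>av _ U\<close>, may be taken under the integral.\<close>

lemma average_energy_le:
  assumes h: "0 < h" and s: "0 \<le> s" "s + h \<le> T"
    and U: "U = fst ((1 / h) *\<^sub>R (W.primitive P0.X (s + h) - W.primitive P0.X s))" and UH: "U \<in> H10 \<Omega>"
  shows "av U U \<le> (1 / h) * (\<Gamma> (s + h) - \<Gamma> s)"
proof -
  let ?P = "W.primitive P0.X" and ?p = "V.primitive u" and ?M = "lebesgue_on {s..s+h}"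
  have st: "0 \<le> s" "s \<le> s + h" "s + h \<le> T" using h s by auto
  have T0: "0 \<le> T" using T_pos by simp
  define p where "p = ?p (s + h) - ?p s"
  define q where "q = ?P (s + h) - ?P s"
  have pS: "?p (s + h) \<in> H10 \<Omega>" "?p s \<in> H10 \<Omega>"
    using V.primitive_mem[OF T0 u_strongly u_L1] st by auto
  then have p: "p \<in> H10 \<Omega>" by (simp add: p_def)
  have pL: "p \<in> L2 \<Omega>" using H1_D(1)[OF H10_in_H1[OF p]] .
  have PS: "?P (s + h) \<in> \<W>" "?P s \<in> \<W>"
    using W.uniform_path_mem[OF P0.primitive_forcing(2)] st by auto
  then have q: "q \<in> \<W>" by (simp add: q_def)
  then have qL: "fst q \<in> L2 \<Omega>" by (simp add: mem_W)
  have pair: "\<l> p = (LINT r|?M. \<l> (u r))" "integrable ?M (\<lambda>r. \<l> (u r))" if l: "V.bounded_functional \<l>" for \<l>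
    using V.primitive_increment[OF T0 u_strongly u_L1 l st] V.bounded_functional_simps(3)[OF l pS] by (auto simp: p_def)
  have "L2_inner \<Omega> (p - fst q) \<phi> = 0" if \<phi>: "\<phi> \<in> L2 \<Omega>" for \<phi>
  proof -
    have l: "V.bounded_functional (\<lambda>v. L2_inner \<Omega> v \<phi>)"
      unfolding V.bounded_functional_def
    proof (intro conjI exI[of _ "L2_norm \<Omega> \<phi>"] ballI allI)
      fix v assume v: "v \<in> H10 \<Omega>"
      have vL: "v \<in> L2 \<Omega>" using H1_D(1)[OF H10_in_H1[OF v]] .
      have "\<bar>L2_inner \<Omega> v \<phi>\<bar> \<le> L2_norm \<Omega> v * L2_norm \<Omega> \<phi>" by (rule H.Cauchy_Schwarz[OF vL \<phi>])
      also have "\<dots> \<le> V_norm \<Omega> v * L2_norm \<Omega> \<phi>" using L2_le_V_norm \<phi> by (intro mult_right_mono) auto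
      finally show "\<bar>L2_inner \<Omega> v \<phi>\<bar> \<le> L2_norm \<Omega> \<phi> * V_norm \<Omega> v" by (simp add: mult.commute)
      show "L2_inner \<Omega> (c *\<^sub>R v) \<phi> = c * L2_inner \<Omega> v \<phi>" for c by (rule H.ip_scale_left[OF vL vL \<phi>])
      fix v' assume "v' \<in> H10 \<Omega>"
      then have "v' \<in> L2 \<Omega>" using H1_D(1)[OF H10_in_H1] by blast
      then show "L2_inner \<Omega> (v + v') \<phi> = L2_inner \<Omega> v \<phi> + L2_inner \<Omega> v' \<phi>" using vL \<phi> by (simp add: H.ip_add_left)
    qed
    have K0: "(0 :: real \<Rightarrow> real^'d \<Rightarrow> real) \<in> K_space \<Omega> a1 \<nu>" by simp
    have w: "(\<phi>, 0) \<in> \<W>" using \<phi> K0 by (simp add: mem_W)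
    have W0: "W_inner x (\<phi>, 0) = L2_inner \<Omega> (fst x) \<phi>" if "x \<in> \<W>" for x
    proof -
      have "A1.BL2_inner \<nu> (snd x) 0 = 0" by (rule K.ip_null_right[OF _ K0]) (use that mem_W in auto)
      then show ?thesis by (simp add: W_inner_def)
    qed
    have "L2_inner \<Omega> (fst q) \<phi> = W_inner (?P (s + h)) (\<phi>, 0) - W_inner (?P s) (\<phi>, 0)"
      using W0[OF q] W.ip_diff_left[OF PS w] by (simp add: q_def)
    also have "\<dots> = (LINT r|?M. W_inner (P0.X r) (\<phi>, 0))"
      by (rule W.primitive_increment(2)[OF T0 P0.X_regular W.ip_bounded_functional[OF w] st])
    also have "\<dots> = (LINT r|?M. L2_inner \<Omega> (u r) \<phi>)"
      by (rule Bochner_Integration.integral_cong[OF refl], rule W0, rule P0.X_mem) (use st in auto)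
    also have "\<dots> = L2_inner \<Omega> p \<phi>" using pair(1)[OF l] by simp
    finally show ?thesis using H.ip_diff_left[OF pL qL \<phi>] by simp
  qed
  from this[of "p - fst q"] have "L2_norm \<Omega> (p - fst q) = 0" using pL qL by (simp add: L2_norm_def)
  note fq = H10_cong[OF p qL this]
  have l: "V.bounded_functional (\<lambda>v. av v U)"
    unfolding V.bounded_functional_def
    using UH av_bd by (auto simp: Av.ip_add_left Av.ip_scale_left[where y=U] mult.commute mult.left_commute intro!: exI[of _ "Cv * V_norm \<Omega> U"])
  have m: "p - fst q \<in> H10 \<Omega>" using p fq by simp
  have "\<bar>av (p - fst q) U\<bar> \<le> Cv * V_norm \<Omega> (p - fst q) * V_norm \<Omega> U" by (rule av_bd[OF m UH])
  then have pq: "av p U = av (fst q) U" using fq Av.ip_diff_left[OF p fq(1) UH] by simp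
  have Uq: "U = (1 / h) *\<^sub>R fst q" unfolding U q_def by simp
  have A: "av U U = (1 / h) * av (fst q) U"
  proof -
    have "av U U = av ((1 / h) *\<^sub>R fst q) U" using Uq by simp
    also have "\<dots> = (1 / h) * av (fst q) U" by (rule Av.ip_scale_left[OF fq(1) UH UH])
    finally show ?thesis .
  qed
  have "av (fst q) U = (LINT r|?M. av (u r) U)" using pq pair(1)[OF l] by simp
  also have "\<dots> \<le> (LINT r|?M. av (u r) (u r) / 2 + av U U / 2)"
  proof (rule integral_mono_AE[OF pair(2)[OF l]])
    interpret finite_measure ?M by (rule finite_measure_interval)
    show "integrable ?M (\<lambda>r. av (u r) (u r) / 2 + av U U / 2)"
      by (intro Bochner_Integration.integrable_add integrable_divide \<Gamma>_increment(3)[OF st]) simp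
    show "AE r in ?M. av (u r) U \<le> av (u r) (u r) / 2 + av U U / 2"
      using \<Gamma>_increment(4)[OF st]
    proof eventually_elim
      case (elim r)
      have "0 \<le> av (u r - U) (u r - U)" by (rule Av.nonneg) (use elim UH in simp)
      then show ?case using Av.ip_self_diff[OF elim UH] by simp
    qed
  qed
  also have "\<dots> = (\<Gamma> (s + h) - \<Gamma> s) / 2 + h * (av U U / 2)"
  proof -
    interpret finite_measure ?M by (rule finite_measure_interval)
    have "measure ?M (space ?M) = h" using h by (simp add: measure_restrict_space)
    then have c: "(LINT r|?M. av U U / 2) = h * (av U U / 2)" by simp
    have "(LINT r|?M. av (u r) (u r) / 2 + av U U / 2) = (LINT r|?M. av (u r) (u r) / 2) + (LINT r|?M. av U U / 2)"
      by (intro Bochner_Integration.integral_add integrable_divide \<Gamma>_increment(3)[OF st]) simp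
    also have "(LINT r|?M. av (u r) (u r) / 2) = (\<Gamma> (s + h) - \<Gamma> s) / 2" using \<Gamma>_increment(1)[OF st] by simp
    finally show ?thesis unfolding c .
  qed
  finally have "(1 / h) * av (fst q) U \<le> (1 / h) * ((\<Gamma> (s + h) - \<Gamma> s) / 2 + h * (av U U / 2))"
    using h by (intro mult_left_mono) auto
  also have "\<dots> = ((1 / h) * (\<Gamma> (s + h) - \<Gamma> s)) / 2 + av U U / 2" using h by (simp add: field_simps)
  finally have "av U U \<le> ((1 / h) * (\<Gamma> (s + h) - \<Gamma> s)) / 2 + av U U / 2" unfolding A[symmetric] .
  then show ?thesis by simp
qed

text \<open>The right-hand side of \<open>dissipation_inequality\<close> for the averages, with the energy of the average of
  \<open>u\<close> replaced by the average of the energy.\<close>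

definition budget where "budget h s = \<epsilon> * ((1 / h) * (\<Gamma> (s + h) - \<Gamma> s)) - 2 * W_inner (r h s) (d h s)"

text \<open>The averages lie in the domains of the two generators. The averaged forcing is the same for both, so
  the images differ by \<open>r h s\<close>.\<close>

lemma average_dissipation:
  assumes h: "0 < h" and s: "0 \<le> s" "s + h < T"
  shows "form_energy 2 \<epsilon> (fst (d h s)) + 2 * memory_dissipation (snd (d h s)) \<le> ennreal (budget h s)" "0 \<le> budget h s"
proof -
  define Q1 where "Q1 = (1 / h) *\<^sub>R (W.primitive P1.X (s + h) - W.primitive P1.X s)"
  define Q0 where "Q0 = (1 / h) *\<^sub>R (W.primitive P0.X (s + h) - W.primitive P0.X s)"
  define Z1 where "Z1 = (1 / h) *\<^sub>R ((P1.X (s + h) - P1.X s) - (W.primitive F (s + h) - W.primitive F s))"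
  define Z0 where "Z0 = (1 / h) *\<^sub>R ((P0.X (s + h) - P0.X s) - (W.primitive F (s + h) - W.primitive F s))"
  have t: "0 \<le> s" "s < T" "0 \<le> s + h" "s + h < T" using h s by auto
  have I: "W.primitive F t \<in> \<W>" "P0.X t \<in> \<W>" "P1.X t \<in> \<W>"
    "W.primitive P0.X t \<in> \<W>" "W.primitive P1.X t \<in> \<W>" if "t \<in> {0..T}" for t
    using W.uniform_path_mem[OF P0.primitive_forcing(1) that] W.uniform_path_mem[OF P0.primitive_forcing(2) that]
      W.uniform_path_mem[OF P1.primitive_forcing(2) that] P0.X_mem P1.X_mem that by auto
  have tt: "s \<in> {0..T}" "s + h \<in> {0..T}" using t by auto
  have m: "Q1 \<in> \<W>" "Q0 \<in> \<W>" "Z1 \<in> \<W>" "Z0 \<in> \<W>"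
    unfolding Q1_def Q0_def Z1_def Z0_def
    using I[OF tt(1)] I[OF tt(2)] by auto
  have g1: "(Q1, Z1) \<in> A_graph \<Omega> (\<lambda>v w. a0 v w + \<epsilon> * av v w) a1 \<nu>"
    using P1.generator_of_increment[OF t(1,2) t(3,4), of "1 / h"] m(1,3) gen1
    unfolding generates_def Q1_def Z1_def by simp
  have g0: "(Q0, Z0) \<in> A_graph \<Omega> (\<lambda>v w. a0 v w + 0 * av v w) a1 \<nu>"
    using P0.generator_of_increment[OF t(1,2) t(3,4), of "1 / h"] m(2,4) gen0
    unfolding generates_def Q0_def Z0_def by simp
  have dQ: "Q1 - Q0 = d h s" unfolding Q1_def Q0_def d_def G_def by (simp add: algebra_simps)
  have rZ: "Z1 - Z0 = r h s" unfolding Z1_def Z0_def r_def Y_def by (simp add: algebra_simps)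
  obtain u1 \<zeta>1 g1' \<eta>1 where q1: "Q1 = (u1, \<zeta>1)" "Z1 = (g1', \<eta>1)" by (metis surj_pair)
  obtain u2 \<zeta>2 g2' \<eta>2 where q2: "Q0 = (u2, \<zeta>2)" "Z0 = (g2', \<eta>2)" by (metis surj_pair)
  note D = dissipation_inequality[OF g1[unfolded q1] g0[unfolded q2] less_imp_le[OF eps]]
  have W: "W_inner ((g1', \<eta>1) - (g2', \<eta>2)) ((u1, \<zeta>1) - (u2, \<zeta>2)) = W_inner (r h s) (d h s)"
    using dQ rZ unfolding q1 q2 by simp
  have f: "fst (d h s) = u1 - u2" "snd (d h s) = \<zeta>1 - \<zeta>2" using dQ[symmetric] unfolding q1 q2 by auto
  have J: "av u2 u2 \<le> (1 / h) * (\<Gamma> (s + h) - \<Gamma> s)"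
    by (rule average_energy_le[OF h t(1) _ _ D(2)]) (use t q2 Q0_def in auto)
  have le: "\<epsilon> * av u2 u2 - 2 * W_inner ((g1', \<eta>1) - (g2', \<eta>2)) ((u1, \<zeta>1) - (u2, \<zeta>2)) \<le> budget h s"
    unfolding W budget_def using mult_left_mono[OF J less_imp_le[OF eps]] by linarith
  show "0 \<le> budget h s" using D(4) le by linarith
  show "form_energy 2 \<epsilon> (fst (d h s)) + 2 * memory_dissipation (snd (d h s)) \<le> ennreal (budget h s)"
    unfolding f form_energy_def using D(1) order_trans[OF D(3) ennreal_leI[OF le]] by simp
qed

text \<open>The difference quotient of \<open>\<Gamma>\<close> integrates to averages of \<open>\<Gamma>\<close> near the two ends of the interval, and
  \<open>\<Gamma>\<close> is monotone and nonnegative; the other term is covered by \<open>energy_identity\<close>.\<close>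

lemma budget_integral:
  assumes h: "0 < h" "h \<le> t" and t: "t \<le> T"
  shows "continuous_on {0..t-h} (budget h)"
    "(LINT s|lebesgue_on {0..t-h}. budget h s) \<le> \<epsilon> * \<Gamma> t - W_inner (d h (t-h)) (d h (t-h)) + W_inner (d h 0) (d h 0)"
proof -
  let ?\<sigma> = "t - h"
  have \<sigma>: "?\<sigma> + h \<le> T" "0 \<le> ?\<sigma>" using h t by auto
  have gc: "continuous_on {0..?\<sigma>} (\<lambda>s. \<Gamma> (s + h) - \<Gamma> s)"
  proof (intro continuous_on_diff)
    show "continuous_on {0..?\<sigma>} \<Gamma>" by (rule continuous_on_subset[OF \<Gamma>_continuous]) (use h t in auto)
    show "continuous_on {0..?\<sigma>} (\<lambda>s. \<Gamma> (s + h))"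
      by (rule continuous_on_compose2[OF \<Gamma>_continuous]) (use h t in \<open>auto intro!: continuous_intros\<close>)
  qed
  have ic: "continuous_on {0..?\<sigma>} (\<lambda>s. W_inner (r h s) (d h s))"
    by (rule W.uniform_path_ip_continuous[OF r_path[OF h(1) \<sigma>(1)] d_path[OF h(1) \<sigma>(1)]])
  show c: "continuous_on {0..?\<sigma>} (budget h)"
    unfolding budget_def by (intro continuous_intros gc ic)
  have e: "W_inner (d h ?\<sigma>) (d h ?\<sigma>) - W_inner (d h 0) (d h 0) = integral {0..?\<sigma>} (\<lambda>s. 2 * W_inner (r h s) (d h s))"
    by (rule W.energy_identity[OF d_path[OF h(1) \<sigma>(1)] r_path[OF h(1) \<sigma>(1)] d_increment[OF h(1)] \<sigma>(2)]) (use \<sigma> in auto)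
  define I where "I = integral {0..?\<sigma>} (\<lambda>s. \<Gamma> (s + h) - \<Gamma> s)"
  have "(LINT s|lebesgue_on {0..?\<sigma>}. budget h s) = integral {0..?\<sigma>} (budget h)" by (rule LINT_continuous(2)[OF c])
  also have "\<dots> = integral {0..?\<sigma>} (\<lambda>s. \<epsilon> * ((1 / h) * (\<Gamma> (s + h) - \<Gamma> s))) - integral {0..?\<sigma>} (\<lambda>s. 2 * W_inner (r h s) (d h s))"
    unfolding budget_def by (rule integral_diff) (intro integrable_continuous_interval continuous_intros gc ic)+
  also have "\<dots> = \<epsilon> * ((1 / h) * I) - (W_inner (d h ?\<sigma>) (d h ?\<sigma>) - W_inner (d h 0) (d h 0))"
    unfolding e I_def by (simp only: integral_mult_right)
  finally have L: "(LINT s|lebesgue_on {0..?\<sigma>}. budget h s) = \<epsilon> * ((1 / h) * I) - (W_inner (d h ?\<sigma>) (d h ?\<sigma>) - W_inner (d h 0) (d h 0))" .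
  have I: "I = integral {?\<sigma>..?\<sigma> + h} \<Gamma> - integral {0..h} \<Gamma>"
    unfolding I_def by (rule integral_shift_diff[OF continuous_on_subset[OF \<Gamma>_continuous]]) (use \<sigma> h t in auto)
  have I1: "0 \<le> integral {0..h} \<Gamma>"
    by (rule integral_nonneg) (use h t \<Gamma>_nonneg in \<open>auto intro!: integrable_continuous_interval continuous_on_subset[OF \<Gamma>_continuous]\<close>)
  have "integral {?\<sigma>..?\<sigma> + h} \<Gamma> \<le> integral {?\<sigma>..?\<sigma> + h} (\<lambda>_. \<Gamma> t)"
  proof (rule integral_le)
    show "\<Gamma> s \<le> \<Gamma> t" if "s \<in> {?\<sigma>..?\<sigma> + h}" for s using \<Gamma>_increment(2)[of s t] that h t by auto
    show "\<Gamma> integrable_on {?\<sigma>..?\<sigma> + h}"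
      by (rule integrable_continuous_interval[OF continuous_on_subset[OF \<Gamma>_continuous]]) (use h t in auto)
    show "(\<lambda>_. \<Gamma> t) integrable_on {?\<sigma>..?\<sigma> + h}" by (rule integrable_const_ivl)
  qed
  also have "integral {?\<sigma>..?\<sigma> + h} (\<lambda>_. \<Gamma> t) = h * \<Gamma> t" using h by simp
  finally have "I \<le> h * \<Gamma> t" using I I1 by linarith
  then have "(1 / h) * I \<le> (1 / h) * (h * \<Gamma> t)" by (rule mult_left_mono) (use h in auto)
  then have "(1 / h) * I \<le> \<Gamma> t" using h by simp
  from mult_left_mono[OF this less_imp_le[OF eps]]
  show "(LINT s|lebesgue_on {0..?\<sigma>}. budget h s) \<le> \<epsilon> * \<Gamma> t - W_inner (d h ?\<sigma>) (d h ?\<sigma>) + W_inner (d h 0) (d h 0)"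
    unfolding L by linarith
qed

lemma Y_0_null: "\<N> (Y 0) = 0"
proof -
  have m: "P1.X 0 \<in> \<W>" "P0.X 0 \<in> \<W>" using P0.X_mem P1.X_mem T_pos by auto
  have "Y 0 = (P1.X 0 - x0) - (P0.X 0 - x0)" by (simp add: Y_def)
  then have "\<N> (Y 0) \<le> \<N> (P1.X 0 - x0) + \<N> (P0.X 0 - x0)"
    using W.triangle_minus[of "P1.X 0 - x0" "P0.X 0 - x0"] m P0.x0 by simp
  moreover have "0 \<le> \<N> (Y 0)" using m by (simp add: Y_def)
  ultimately show ?thesis using P0.X_zero_null P1.X_zero_null by simp
qed

definition dissipation where "dissipation s = form_energy 2 \<epsilon> (fst (Y s)) + 2 * memory_dissipation (snd (Y s))"

text \<open>The half-open interval keeps \<open>s + h\<close> below \<open>T\<close>, where the generator identity is available.\<close>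

lemma nn_integral_budget:
  assumes h: "0 < h" "h \<le> t" and t: "t \<le> T"
  shows "(\<lambda>s. indicator {0..<t-h} s * ennreal (budget h s)) \<in> borel_measurable (lebesgue_on {0..t})"
    "(\<integral>\<^sup>+s. indicator {0..<t-h} s * ennreal (budget h s) \<partial>lebesgue_on {0..t}) = ennreal (LINT s|lebesgue_on {0..t-h}. budget h s)"
    "0 \<le> (LINT s|lebesgue_on {0..t-h}. budget h s)"
proof -
  let ?\<sigma> = "t - h"
  note c = budget_integral(1)[OF h t]
  have "(\<lambda>s. indicator {0..?\<sigma>} s *\<^sub>R budget h s) \<in> borel_measurable borel"
    by (rule borel_measurable_continuous_on_indicator[OF _ c]) simp
  then have mb: "(\<lambda>s. indicator {0..<?\<sigma>} s * ennreal (indicator {0..?\<sigma>} s *\<^sub>R budget h s)) \<in> borel_measurable borel"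
    by measurable
  have eq: "indicator {0..<?\<sigma>} s * ennreal (indicator {0..?\<sigma>} s *\<^sub>R budget h s) = indicator {0..<?\<sigma>} s * ennreal (budget h s)" for s
    by (auto simp: indicator_def)
  have mb': "(\<lambda>s. indicator {0..<?\<sigma>} s * ennreal (budget h s)) \<in> borel_measurable borel" using mb unfolding eq .
  then have ml: "(\<lambda>s. indicator {0..<?\<sigma>} s * ennreal (budget h s)) \<in> borel_measurable lebesgue" by (intro measurable_completion) simp
  then show "(\<lambda>s. indicator {0..<?\<sigma>} s * ennreal (budget h s)) \<in> borel_measurable (lebesgue_on {0..t})"
    by (rule measurable_restrict_space1)
  have ne: "AE s in lebesgue_on {0..?\<sigma>}. s \<noteq> ?\<sigma>"
    by (rule AE_lebesgue_on_neq) simp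
  have nn: "AE s in lebesgue_on {0..?\<sigma>}. 0 \<le> budget h s"
    using ne AE_space
  proof eventually_elim
    case (elim s)
    then show ?case using average_dissipation(2)[OF h(1), of s] t by auto
  qed
  then show "0 \<le> (LINT s|lebesgue_on {0..?\<sigma>}. budget h s)" by (rule integral_nonneg_AE)
  have "(\<integral>\<^sup>+s. indicator {0..<?\<sigma>} s * ennreal (budget h s) \<partial>lebesgue_on {0..t})
      = (\<integral>\<^sup>+s. indicator {0..<?\<sigma>} s * ennreal (budget h s) * indicator {0..t} s \<partial>lebesgue)"
    by (rule nn_integral_restrict_space) simp
  also have "\<dots> = (\<integral>\<^sup>+s. indicator {0..<?\<sigma>} s * ennreal (budget h s) * indicator {0..?\<sigma>} s \<partial>lebesgue)"
    by (rule nn_integral_cong) (use h in \<open>auto simp: indicator_def\<close>)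
  also have "\<dots> = (\<integral>\<^sup>+s. indicator {0..<?\<sigma>} s * ennreal (budget h s) \<partial>lebesgue_on {0..?\<sigma>})"
    by (rule nn_integral_restrict_space[symmetric]) simp
  also have "\<dots> = (\<integral>\<^sup>+s. ennreal (budget h s) \<partial>lebesgue_on {0..?\<sigma>})"
    by (rule nn_integral_cong_AE, use ne AE_space in eventually_elim) (auto simp: indicator_def)
  also have "\<dots> = ennreal (LINT s|lebesgue_on {0..?\<sigma>}. budget h s)"
    by (rule nn_integral_eq_integral[OF LINT_continuous(1)[OF c] nn])
  finally show "(\<integral>\<^sup>+s. indicator {0..<?\<sigma>} s * ennreal (budget h s) \<partial>lebesgue_on {0..t}) = ennreal (LINT s|lebesgue_on {0..?\<sigma>}. budget h s)" .
qed

text \<open>Fatou's lemma and lower semicontinuity for \<open>h\<close> tending to zero. The last average ends at \<open>t\<close> and tends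
  to \<open>Y t\<close>, the first one starts at \<open>0\<close> and tends to the null element \<open>Y 0\<close>.\<close>

lemma energy_estimate:
  assumes t: "t \<in> {0..T}"
  shows "(\<integral>\<^sup>+s. dissipation s \<partial>lebesgue_on {0..t}) \<le> ennreal (\<epsilon> * \<Gamma> t - (\<N> (Y t))\<^sup>2)"
    "(\<N> (Y t))\<^sup>2 \<le> \<epsilon> * \<Gamma> t"
proof -
  have "(\<integral>\<^sup>+s. dissipation s \<partial>lebesgue_on {0..t}) \<le> ennreal (\<epsilon> * \<Gamma> t - (\<N> (Y t))\<^sup>2)
    \<and> (\<N> (Y t))\<^sup>2 \<le> \<epsilon> * \<Gamma> t"
  proof (cases "t = 0")
    case True
    have "(\<integral>\<^sup>+s. dissipation s \<partial>lebesgue_on {0..0}) = 0"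
      by (subst nn_integral_restrict_space) (auto intro!: nn_integral_null_set simp: nn_integral_null_set)
    then show ?thesis unfolding True by (simp add: \<Gamma>_0 Y_0_null)
  next
    case False
    then have t: "0 < t" "t \<le> T" using t by auto
    \<comment> \<open>The offset \<open>2\<close> gives \<open>h n < t\<close> from the start.\<close>
    define h where "h n = t / real (n + 2)" for n
    have h: "0 < h n" "h n \<le> t" for n
      unfolding h_def using t by (auto simp: divide_le_eq_1 field_simps)
    have hlim: "h \<longlonglongrightarrow> 0"
      unfolding h_def using LIMSEQ_ignore_initial_segment[OF lim_const_over_n[of t], of 2] by simp
    have YS: "Y s \<in> \<W>" if "s \<in> {0..T}" for s using W.uniform_path_mem[OF Y_path that] .
    have dS: "d (h n) s \<in> \<W>" if "0 \<le> s" "s + h n \<le> T" for n s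
      using W.uniform_path_mem[OF d_path[OF h(1) that(2)], of s] that by simp
    have dlim: "(\<lambda>n. \<N> (d (h n) (s n) - Y l)) \<longlonglongrightarrow> 0"
      if s: "\<forall>n. 0 \<le> s n \<and> s n + h n \<le> T" "\<forall>n. l \<in> {s n..s n + h n}" for s l
    proof (rule tendstoI)
      fix e :: real assume e: "0 < e"
      then have "0 < e / 2" by simp
      then obtain \<delta> where \<delta>: "0 < \<delta>" "\<forall>h s s'. 0 < h \<longrightarrow> h < \<delta> \<longrightarrow> 0 \<le> s \<longrightarrow> s + h \<le> T \<longrightarrow> s' \<in> {s..s+h} \<longrightarrow> \<N> (d h s - Y s') \<le> e / 2"
        by (rule averages_converge)
      have "\<forall>\<^sub>F n in sequentially. h n < \<delta>" using order_tendstoD(2)[OF hlim \<delta>(1)] .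
      then show "\<forall>\<^sub>F n in sequentially. dist (\<N> (d (h n) (s n) - Y l)) 0 < e"
      proof eventually_elim
        case (elim n)
        have "\<N> (d (h n) (s n) - Y l) \<le> e / 2"
          using \<delta>(2) h(1)[of n] elim s by blast
        moreover have "l \<in> {0..T}" using s by (meson atLeastAtMost_iff order_trans)
        then have "0 \<le> \<N> (d (h n) (s n) - Y l)" using dS[of "s n" n] s YS[of l] by simp
        ultimately show ?case using e by simp
      qed
    qed
    have ht: "t - h n + h n \<le> T" "0 \<le> t - h n" "0 + h n \<le> T" for n using h[of n] t by auto
    have l1: "(\<lambda>n. W_inner (d (h n) (t - h n)) (d (h n) (t - h n))) \<longlonglongrightarrow> W_inner (Y t) (Y t)"
    proof (rule W.ip_tendsto_both)
      show "(\<lambda>n. \<N> (d (h n) (t - h n) - Y t)) \<longlonglongrightarrow> 0"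
        by (rule dlim) (use h t less_imp_le in auto)
      then show "(\<lambda>n. \<N> (d (h n) (t - h n) - Y t)) \<longlonglongrightarrow> 0" .
    qed (use dS ht YS t in auto)
    have l0: "(\<lambda>n. W_inner (d (h n) 0) (d (h n) 0)) \<longlonglongrightarrow> W_inner (Y 0) (Y 0)"
    proof (rule W.ip_tendsto_both)
      show "(\<lambda>n. \<N> (d (h n) 0 - Y 0)) \<longlonglongrightarrow> 0"
        by (rule dlim) (use h(1) ht(3) less_imp_le in auto)
      then show "(\<lambda>n. \<N> (d (h n) 0 - Y 0)) \<longlonglongrightarrow> 0" .
    qed (use dS[of 0] ht YS T_pos in auto)
    have Y0: "W_inner (Y 0) (Y 0) = 0" using W.N_square[OF YS[of 0]] Y_0_null T_pos by simp
    have Yt: "W_inner (Y t) (Y t) = (\<N> (Y t))\<^sup>2" using W.N_square[OF YS[of t]] t by simp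
    define B where "B n = \<epsilon> * \<Gamma> t - W_inner (d (h n) (t - h n)) (d (h n) (t - h n)) + W_inner (d (h n) 0) (d (h n) 0)" for n
    have Blim: "B \<longlonglongrightarrow> \<epsilon> * \<Gamma> t - (\<N> (Y t))\<^sup>2"
      using tendsto_add[OF tendsto_diff[OF tendsto_const[of "\<epsilon> * \<Gamma> t"] l1] l0] unfolding B_def Y0 Yt by simp
    have LB: "(LINT s|lebesgue_on {0..t - h n}. budget (h n) s) \<le> B n" for n
      unfolding B_def by (rule budget_integral(2)[OF h t(2)])
    have B0: "0 \<le> B n" for n using nn_integral_budget(3)[OF h t(2)] LB order_trans by blast
    have 1: "(\<N> (Y t))\<^sup>2 \<le> \<epsilon> * \<Gamma> t"
      using LIMSEQ_le_const[OF Blim, of 0] B0 by auto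
    let ?u = "\<lambda>n s. indicator {0..<t - h n} s * ennreal (budget (h n) s)"
    have "(\<integral>\<^sup>+s. dissipation s \<partial>lebesgue_on {0..t}) \<le> (\<integral>\<^sup>+s. liminf (\<lambda>n. ?u n s) \<partial>lebesgue_on {0..t})"
    proof (rule nn_integral_mono_AE)
      have ne: "AE s in lebesgue_on {0..t}. s \<noteq> t"
        by (rule AE_lebesgue_on_neq) simp
      show "AE s in lebesgue_on {0..t}. dissipation s \<le> liminf (\<lambda>n. ?u n s)"
        using ne AE_space
      proof eventually_elim
        case (elim s)
        then have s: "0 \<le> s" "s < t" by auto
        then have sT: "s \<in> {0..T}" using t by simp
        \<comment> \<open>Lower semicontinuity is stated for sequences in \<open>W\<close>, so the finitely many averages that reach beyond
          \<open>t\<close> are replaced.\<close>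
        define y where "y n = (if s + h n < t then d (h n) s else Y s)" for n
        have y: "\<forall>n. y n \<in> \<W>" using dS[OF s(1)] YS[OF sT] t by (simp add: y_def)
        have ev: "\<forall>\<^sub>F n in sequentially. h n < t - s" by (rule order_tendstoD(2)[OF hlim]) (use s in simp)
        have "(\<lambda>n. \<N> (y n - Y s)) \<longlonglongrightarrow> 0"
        proof (rule tendstoI)
          fix e :: real assume e: "0 < e"
          then have "0 < e / 2" by simp
          then obtain \<delta> where \<delta>: "0 < \<delta>" "\<forall>h s s'. 0 < h \<longrightarrow> h < \<delta> \<longrightarrow> 0 \<le> s \<longrightarrow> s + h \<le> T \<longrightarrow> s' \<in> {s..s+h} \<longrightarrow> \<N> (d h s - Y s') \<le> e / 2"
            by (rule averages_converge)
          have "\<forall>\<^sub>F n in sequentially. h n < \<delta>" using order_tendstoD(2)[OF hlim \<delta>(1)] .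
          then show "\<forall>\<^sub>F n in sequentially. dist (\<N> (y n - Y s)) 0 < e"
            using ev
          proof eventually_elim
            case (elim n)
            then have "y n = d (h n) s" by (simp add: y_def)
            moreover have "\<N> (d (h n) s - Y s) \<le> e / 2"
              using \<delta>(2)[rule_format, of "h n" s s] h(1)[of n] elim s t by simp
            moreover have "y n - Y s \<in> \<W>" using y YS[OF sT] by blast
            ultimately show ?case using e W.N_nonneg[of "y n - Y s"] by simp
          qed
        qed
        from energy_lsc[OF _ eps y YS[OF sT] this, of 2]
        have "dissipation s \<le> liminf (\<lambda>n. form_energy 2 \<epsilon> (fst (y n)) + 2 * memory_dissipation (snd (y n)))"
          unfolding dissipation_def by simp
        also have "\<dots> \<le> liminf (\<lambda>n. ?u n s)"
        proof (rule Liminf_mono, use ev in eventually_elim)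
          case (elim n)
          then have "y n = d (h n) s" "indicator {0..<t - h n} s = (1::ennreal)" using s by (auto simp: y_def)
          then show ?case using average_dissipation(1)[OF h(1) s(1), of n] elim t by simp
        qed
        finally show ?case .
      qed
    qed
    also have "\<dots> \<le> liminf (\<lambda>n. \<integral>\<^sup>+s. ?u n s \<partial>lebesgue_on {0..t})"
      by (rule nn_integral_liminf) (rule nn_integral_budget(1)[OF h t(2)])
    also have "\<dots> \<le> liminf (\<lambda>n. ennreal (B n))"
      unfolding nn_integral_budget(2)[OF h t(2)] by (intro Liminf_mono always_eventually allI ennreal_leI LB)
    also have "\<dots> = ennreal (\<epsilon> * \<Gamma> t - (\<N> (Y t))\<^sup>2)"
      by (rule lim_imp_Liminf[OF _ tendsto_ennrealI[OF Blim]]) simp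
    finally show ?thesis using 1 by blast
  qed
  then show "(\<integral>\<^sup>+s. dissipation s \<partial>lebesgue_on {0..t}) \<le> ennreal (\<epsilon> * \<Gamma> t - (\<N> (Y t))\<^sup>2)"
    "(\<N> (Y t))\<^sup>2 \<le> \<epsilon> * \<Gamma> t" by auto
qed

end

context memory_forms
begin

text \<open>Energies with a coercive part are measurable in time by lower semicontinuity; \<open>a0\<close> is a difference of
  two of them.\<close>

lemma energy_measurable:
  assumes Y: "W.uniform_path T Y" and ae: "AE s in lebesgue_on {0..T}. fst (Y s) \<in> H10 \<Omega>"
  shows "(\<lambda>s. a0 (fst (Y s)) (fst (Y s))) \<in> borel_measurable (lebesgue_on {0..T})"
    "(\<lambda>s. av (fst (Y s)) (fst (Y s))) \<in> borel_measurable (lebesgue_on {0..T})"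
proof -
  let ?M = "lebesgue_on {0..T}"
  have cl: "completion ?M = ?M" by (simp add: completion_lebesgue_on)
  have m: "(\<lambda>s. enn2real (form_energy 1 1 (fst (Y s))) - enn2real (form_energy 0 1 (fst (Y s)))) \<in> borel_measurable (completion ?M)"
    "(\<lambda>s. enn2real (form_energy 0 1 (fst (Y s)))) \<in> borel_measurable (completion ?M)"
    unfolding cl
    using path_measurable(1)[OF Y, of 1 1] path_measurable(1)[OF Y, of 0 1] by measurable
  have "AE s in ?M. a0 (fst (Y s)) (fst (Y s)) = enn2real (form_energy 1 1 (fst (Y s))) - enn2real (form_energy 0 1 (fst (Y s)))"
    using ae
  proof eventually_elim
    case (elim s)
    have "0 \<le> a0 (fst (Y s)) (fst (Y s)) + av (fst (Y s)) (fst (Y s))"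
      using a0_nn[OF elim] Av.nonneg[OF elim] by simp
    then show ?case using elim Av.nonneg[OF elim] by (simp add: form_energy_def)
  qed
  from measurable_completion_AE[OF m(1) this]
  show "(\<lambda>s. a0 (fst (Y s)) (fst (Y s))) \<in> borel_measurable ?M" unfolding cl .
  have "AE s in ?M. av (fst (Y s)) (fst (Y s)) = enn2real (form_energy 0 1 (fst (Y s)))"
    using ae
  proof eventually_elim
    case (elim s)
    then show ?case using Av.nonneg[OF elim] by (simp add: form_energy_def)
  qed
  from measurable_completion_AE[OF m(2) this]
  show "(\<lambda>s. av (fst (Y s)) (fst (Y s))) \<in> borel_measurable ?M" unfolding cl .
qed

lemma forcing_regular:
  assumes f: "f \<in> Bochner_Lp 1 M (L2 \<Omega>) (L2_norm \<Omega>)"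
  shows "strongly_measurable_in M \<W> \<N> (\<lambda>s. (f s, 0))"
    "(\<integral>\<^sup>+s. ennreal (\<N> (f s, 0)) \<partial>M) < \<infinity>"
proof -
  have L: "0 \<le> L2_norm \<Omega> g" for g :: "real^'d \<Rightarrow> real"
    by (simp add: L2_norm_def L2_inner_def Bochner_Integration.integral_nonneg)
  have W: "\<N> (g, 0) = L2_norm \<Omega> g" for g using L[of g] by (simp add: W_norm_def)
  have m: "(g, 0) \<in> \<W>" if "g \<in> L2 \<Omega>" for g using that by (simp add: mem_W)
  obtain s where s: "\<forall>i::nat. simple_function M (s i) \<and> s i ` space M \<subseteq> L2 \<Omega>"
    "AE x in M. (\<lambda>i. L2_norm \<Omega> (f x - s i x)) \<longlonglongrightarrow> 0" and fL: "AE x in M. f x \<in> L2 \<Omega>"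
    using f by (auto simp: Bochner_Lp_def strongly_measurable_in_def)
  show "strongly_measurable_in M \<W> \<N> (\<lambda>s. (f s, 0))"
  proof (rule W.strongly_measurableI[where s="\<lambda>i x. (s i x, 0)"])
    show "simple_function M (\<lambda>x. (s i x, 0))" for i
      using simple_function_compose1[of M "s i" "\<lambda>a. (a, 0)"] s(1) by blast
    show "(\<lambda>x. (s i x, 0)) ` space M \<subseteq> \<W>" for i
      by (intro image_subsetI m subsetD[OF conjunct2[OF s(1)[rule_format]] imageI])
    show "AE x in M. (f x, 0) \<in> \<W>" using fL
    proof eventually_elim
      case (elim x)
      then show ?case by (rule m)
    qed
    show "AE x in M. (\<lambda>i. \<N> ((f x, 0) - (s i x, 0))) \<longlonglongrightarrow> 0" using s(2) by (simp add: W)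
  qed
  show "(\<integral>\<^sup>+s. ennreal (\<N> (f s, 0)) \<partial>M) < \<infinity>"
    using f by (simp add: W Bochner_Lp_def)
qed

end

context perturbed_pair
begin

lemma dissipation_measurable: "dissipation \<in> borel_measurable (lebesgue_on {0..T})"
  unfolding dissipation_def
  using path_measurable(1)[OF Y_path _ eps, of 2] path_measurable(2)[OF Y_path order_refl eps] by simp

lemma error_H10: "AE s in lebesgue_on {0..T}. fst (Y s) \<in> H10 \<Omega>"
proof -
  have "(\<integral>\<^sup>+s. dissipation s \<partial>lebesgue_on {0..T}) \<noteq> \<infinity>"
    using energy_estimate(1)[of T] T_pos by (auto simp: top_unique)
  from nn_integral_PInf_AE[OF dissipation_measurable this] show ?thesis
  proof eventually_elim
    case (elim s)
    then show ?case by (auto simp: dissipation_def form_energy_def split: if_splits)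
  qed
qed

lemma W_norm_squared: "(\<N> x)\<^sup>2 = (L2_norm \<Omega> (fst x))\<^sup>2 + (K_norm a1 \<nu> (snd x))\<^sup>2"
  by (simp add: W_norm_def)

lemma error_energy_estimate:
  assumes t: "t \<in> {0..T}"
  shows "ennreal ((L2_norm \<Omega> (fst (Y t)))\<^sup>2 + (K_norm a1 \<nu> (snd (Y t)))\<^sup>2)
     + 2 * (\<integral>\<^sup>+s. ennreal (a0 (fst (Y s)) (fst (Y s))) \<partial>lebesgue_on {0..t})
     + ennreal \<epsilon> * (\<integral>\<^sup>+s. ennreal (av (fst (Y s)) (fst (Y s))) \<partial>lebesgue_on {0..t})
     + 2 * (\<integral>\<^sup>+s. memory_dissipation (snd (Y s)) \<partial>lebesgue_on {0..t}) \<le> ennreal (\<epsilon> * \<Gamma> t)"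
proof -
  let ?M = "lebesgue_on {0..t}"
  have sub: "{0..t} \<subseteq> {0..T}" using t by auto
  note m = energy_measurable[OF Y_path error_H10, THEN measurable_restrict_mono[OF _ sub]]
    path_measurable(2)[OF Y_path order_refl eps, THEN measurable_restrict_mono[OF _ sub]]
  have ae: "AE s in ?M. fst (Y s) \<in> H10 \<Omega>"
    by (rule AE_lebesgue_on_subset[OF error_H10 sub]) auto
  have "(\<integral>\<^sup>+s. dissipation s \<partial>?M)
      = (\<integral>\<^sup>+s. 2 * ennreal (a0 (fst (Y s)) (fst (Y s))) + ennreal \<epsilon> * ennreal (av (fst (Y s)) (fst (Y s))) + 2 * memory_dissipation (snd (Y s)) \<partial>?M)"
  proof (rule nn_integral_cong_AE, use ae in eventually_elim)
    case (elim s)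
    have "ennreal (2 * a0 (fst (Y s)) (fst (Y s)) + \<epsilon> * av (fst (Y s)) (fst (Y s)))
        = 2 * ennreal (a0 (fst (Y s)) (fst (Y s))) + ennreal \<epsilon> * ennreal (av (fst (Y s)) (fst (Y s)))"
      using a0_nn[OF elim] Av.nonneg[OF elim] eps by (simp add: ennreal_plus ennreal_mult')
    then show ?case using elim by (simp add: dissipation_def form_energy_def)
  qed
  also have "\<dots> = 2 * (\<integral>\<^sup>+s. ennreal (a0 (fst (Y s)) (fst (Y s))) \<partial>?M)
     + ennreal \<epsilon> * (\<integral>\<^sup>+s. ennreal (av (fst (Y s)) (fst (Y s))) \<partial>?M)
     + 2 * (\<integral>\<^sup>+s. memory_dissipation (snd (Y s)) \<partial>?M)"
    using m by (simp add: nn_integral_add nn_integral_cmult)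
  finally have eq: "(\<integral>\<^sup>+s. dissipation s \<partial>?M) = \<dots>" .
  have "ennreal ((\<N> (Y t))\<^sup>2) + (\<integral>\<^sup>+s. dissipation s \<partial>?M)
      \<le> ennreal ((\<N> (Y t))\<^sup>2) + ennreal (\<epsilon> * \<Gamma> t - (\<N> (Y t))\<^sup>2)"
    by (rule add_left_mono[OF energy_estimate(1)[OF t]])
  also have "\<dots> = ennreal (\<epsilon> * \<Gamma> t)" using energy_estimate(2)[OF t] by (subst ennreal_plus[symmetric]) auto
  finally show ?thesis unfolding eq W_norm_squared by (simp add: add.assoc)
qed

lemma error_bound:
  assumes t: "t \<in> {0..T}" shows "(\<N> (Y t))\<^sup>2 \<le> \<epsilon> * \<Gamma> T" "\<N> (Y t) \<le> sqrt \<epsilon> * sqrt (\<Gamma> T)"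
proof -
  have "\<epsilon> * \<Gamma> t \<le> \<epsilon> * \<Gamma> T" using \<Gamma>_increment(2)[of t T] t eps by simp
  then show 1: "(\<N> (Y t))\<^sup>2 \<le> \<epsilon> * \<Gamma> T" using energy_estimate(2)[OF t] by linarith
  then show "\<N> (Y t) \<le> sqrt \<epsilon> * sqrt (\<Gamma> T)" unfolding real_sqrt_mult[symmetric] by (rule real_le_rsqrt)
qed

end

lemma Sup_le_and_bdd:
  fixes g :: "real \<Rightarrow> real"
  assumes T: "0 < T" and le: "\<And>t. t \<in> {0..T} \<Longrightarrow> g t \<le> B"
  shows "bdd_above (g ` {0..T})" "(SUP t\<in>{0..T}. g t) \<le> B"
proof -
  show "bdd_above (g ` {0..T})" by (rule bdd_aboveI2[OF le])
  show "(SUP t\<in>{0..T}. g t) \<le> B" by (rule cSUP_least) (use T le in auto)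
qed

theorem corollary6p4:
  fixes \<Omega> :: "(real^'d) set"
    and A0 A1 :: "real^'d \<Rightarrow> real^'d^'d"
    and a0 a1 av :: "(real^'d \<Rightarrow> real) \<Rightarrow> (real^'d \<Rightarrow> real) \<Rightarrow> real"
    and \<nu> :: "real measure"
    and T Cv \<beta>v \<beta> :: real
    and u0 :: "real^'d \<Rightarrow> real"
    and f :: "real \<Rightarrow> real^'d \<Rightarrow> real"
    and S :: "real \<Rightarrow> real \<Rightarrow> (real^'d \<Rightarrow> real) \<times> (real \<Rightarrow> real^'d \<Rightarrow> real) \<Rightarrow>
                (real^'d \<Rightarrow> real) \<times> (real \<Rightarrow> real^'d \<Rightarrow> real)"
    and X :: "real \<Rightarrow> real \<Rightarrow> (real^'d \<Rightarrow> real) \<times> (real \<Rightarrow> real^'d \<Rightarrow> real)"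
    and u e :: "real \<Rightarrow> real \<Rightarrow> real^'d \<Rightarrow> real"
    and \<zeta> z :: "real \<Rightarrow> real \<Rightarrow> real \<Rightarrow> real^'d \<Rightarrow> real"
  assumes dim: "CARD('d) \<in> {1, 2, 3}"
    and domain: "bounded_lipschitz_domain \<Omega>"
    and T_pos: "T > 0"
    and A0: "symmetric_Linfty_field \<Omega> A0"
    and A1: "symmetric_Linfty_field \<Omega> A1"
    and A1_psd: "AE x in lebesgue_on \<Omega>. \<forall>\<xi>. 0 \<le> (A1 x *v \<xi>) \<bullet> \<xi>"
    and a0_def: "a0 = coeff_form \<Omega> A0"
    and a1_def: "a1 = coeff_form \<Omega> A1"
    and sets_nu: "sets \<nu> = sets (restrict_space borel {0..})"
    and av_bilinear: "symmetric_bilinear_on (H10 \<Omega>) av"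
    and Cv_pos: "Cv > 0"
    and av_bounded: "\<forall>v\<in>H10 \<Omega>. \<forall>w\<in>H10 \<Omega>. \<bar>av v w\<bar> \<le> Cv * V_norm \<Omega> v * V_norm \<Omega> w"
    and \<beta>v_pos: "\<beta>v > 0"
    and av_coercive: "\<forall>v\<in>H10 \<Omega>. av v v \<ge> \<beta>v * (V_seminorm \<Omega> v)\<^sup>2"
    and a0_bounded: "\<exists>C. \<forall>v\<in>H10 \<Omega>. \<forall>w\<in>H10 \<Omega>. \<bar>a0 v w\<bar> \<le> C * V_norm \<Omega> v * V_norm \<Omega> w"
    and a1_bounded: "\<exists>C. \<forall>v\<in>H10 \<Omega>. \<forall>w\<in>H10 \<Omega>. \<bar>a1 v w\<bar> \<le> C * V_norm \<Omega> v * V_norm \<Omega> w"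
    and a0_nonneg: "\<forall>v\<in>H10 \<Omega>. a0 v v \<ge> 0"
    and \<beta>_pos: "\<beta> > 0"
    and a1_coercive: "\<forall>v\<in>H10 \<Omega>. a1 v v \<ge> \<beta> * (V_seminorm \<Omega> v)\<^sup>2"
    and M0: "0 < emeasure \<nu> {0..}" "emeasure \<nu> {0..} < \<infinity>"
    and u0: "u0 \<in> L2 \<Omega>"
    and f: "f \<in> Bochner_Lp 1 (lebesgue_on {0..T}) (L2 \<Omega>) (L2_norm \<Omega>)"
    and S_semigroup:
      "\<forall>\<epsilon>\<in>{0..1}. contraction_semigroup (W_space \<Omega> a1 \<nu>) (W_norm \<Omega> a1 \<nu>) (S \<epsilon>)"
    and S_generator:
      "\<forall>\<epsilon>\<in>{0..1}. generates (W_space \<Omega> a1 \<nu>) (W_norm \<Omega> a1 \<nu>)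
         (A_graph \<Omega> (\<lambda>v w. a0 v w + \<epsilon> * av v w) a1 \<nu>) (S \<epsilon>)"
    and X_def:
      "X = (\<lambda>\<epsilon>. mild_solution (W_space \<Omega> a1 \<nu>) (W_norm \<Omega> a1 \<nu>) (S \<epsilon>) (u0, 0) (\<lambda>s. (f s, 0)))"
    and u_def: "u = (\<lambda>\<epsilon> t. fst (X \<epsilon> t))"
    and \<zeta>_def: "\<zeta> = (\<lambda>\<epsilon> t. snd (X \<epsilon> t))"
    and u0_regular: "u 0 \<in> Bochner_Lp 2 (lebesgue_on {0..T}) (H10 \<Omega>) (V_norm \<Omega>)"
    and e_def: "e = (\<lambda>\<epsilon> t. u \<epsilon> t - u 0 t)"
    and z_def: "z = (\<lambda>\<epsilon> t. \<zeta> \<epsilon> t - \<zeta> 0 t)"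
  shows
    "(\<forall>\<epsilon>\<in>{0..1}.
       \<comment> \<open>the terms of the estimates are well defined\<close>
       continuous_path_in T (W_space \<Omega> a1 \<nu>) (W_norm \<Omega> a1 \<nu>) (X \<epsilon>) \<and>
       (AE s in lebesgue_on {0..T}. e \<epsilon> s \<in> H10 \<Omega>) \<and>
       (\<lambda>s. a0 (e \<epsilon> s) (e \<epsilon> s)) \<in> borel_measurable (lebesgue_on {0..T}) \<and>
       (\<lambda>s. av (e \<epsilon> s) (e \<epsilon> s)) \<in> borel_measurable (lebesgue_on {0..T}) \<and>
       (\<lambda>s. \<integral>\<^sup>+l. ennreal (l * a1 (z \<epsilon> s l) (z \<epsilon> s l)) \<partial>\<nu>)
         \<in> borel_measurable (lebesgue_on {0..T}) \<and>
       integrable (lebesgue_on {0..T}) (\<lambda>s. av (u 0 s) (u 0 s)) \<and>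
       \<comment> \<open>the energy estimate\<close>
       (\<forall>t\<in>{0..T}.
          ennreal ((L2_norm \<Omega> (e \<epsilon> t))\<^sup>2 + (K_norm a1 \<nu> (z \<epsilon> t))\<^sup>2)
          + 2 * (\<integral>\<^sup>+s. ennreal (a0 (e \<epsilon> s) (e \<epsilon> s)) \<partial>lebesgue_on {0..t})
          + ennreal \<epsilon> * (\<integral>\<^sup>+s. ennreal (av (e \<epsilon> s) (e \<epsilon> s)) \<partial>lebesgue_on {0..t})
          + 2 * (\<integral>\<^sup>+s. (\<integral>\<^sup>+l. ennreal (l * a1 (z \<epsilon> s l) (z \<epsilon> s l)) \<partial>\<nu>) \<partial>lebesgue_on {0..t})
          \<le> ennreal (\<epsilon> * (LINT s|lebesgue_on {0..t}. av (u 0 s) (u 0 s)))) \<and>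
       \<comment> \<open>the supremum bound\<close>
       bdd_above ((\<lambda>t. (L2_norm \<Omega> (e \<epsilon> t))\<^sup>2 + (K_norm a1 \<nu> (z \<epsilon> t))\<^sup>2) ` {0..T}) \<and>
       (SUP t\<in>{0..T}. (L2_norm \<Omega> (e \<epsilon> t))\<^sup>2 + (K_norm a1 \<nu> (z \<epsilon> t))\<^sup>2)
         \<le> \<epsilon> * (LINT t|lebesgue_on {0..T}. av (u 0 t) (u 0 t)) \<and>
       \<comment> \<open>the bound in \<open>C([0,T];W)\<close>\<close>
       sup_norm_path T (W_norm \<Omega> a1 \<nu>) (\<lambda>t. X \<epsilon> t - X 0 t)
         \<le> sqrt \<epsilon> * sqrt (LINT t|lebesgue_on {0..T}. av (u 0 t) (u 0 t))) \<and>
     (\<lambda>\<epsilon>. sup_norm_path T (W_norm \<Omega> a1 \<nu>) (\<lambda>t. X \<epsilon> t - X 0 t)) \<in> O[at_right 0](sqrt)"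
proof -
  obtain C0 where C0: "\<forall>v\<in>H10 \<Omega>. \<forall>w\<in>H10 \<Omega>. \<bar>a0 v w\<bar> \<le> C0 * V_norm \<Omega> v * V_norm \<Omega> w" using a0_bounded by blast
  obtain C1 where C1: "\<forall>v\<in>H10 \<Omega>. \<forall>w\<in>H10 \<Omega>. \<bar>a1 v w\<bar> \<le> C1 * V_norm \<Omega> v * V_norm \<Omega> w" using a1_bounded by blast
  interpret domain \<Omega> by unfold_locales (use domain in \<open>auto simp: bounded_lipschitz_domain_def\<close>)
  have bilin: "symmetric_bilinear_on (H10 \<Omega>) a0" "symmetric_bilinear_on (H10 \<Omega>) a1"
    unfolding a0_def a1_def by (rule coeff_form_bilinear[OF A0], rule coeff_form_bilinear[OF A1])
  interpret memory_forms \<Omega> a0 a1 av \<nu> C0 C1 Cv \<beta> \<beta>v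
  proof unfold_locales
    show "\<bar>a0 v w\<bar> \<le> C0 * V_norm \<Omega> v * V_norm \<Omega> w" if "v \<in> H10 \<Omega>" "w \<in> H10 \<Omega>" for v w using C0 that by blast
    show "\<bar>a1 v w\<bar> \<le> C1 * V_norm \<Omega> v * V_norm \<Omega> w" if "v \<in> H10 \<Omega>" "w \<in> H10 \<Omega>" for v w using C1 that by blast
    show "\<bar>av v w\<bar> \<le> Cv * V_norm \<Omega> v * V_norm \<Omega> w" if "v \<in> H10 \<Omega>" "w \<in> H10 \<Omega>" for v w using av_bounded that by blast
    show "0 \<le> a0 v v" if "v \<in> H10 \<Omega>" for v using a0_nonneg that by blast
    show "\<beta> * (V_seminorm \<Omega> v)\<^sup>2 \<le> a1 v v" if "v \<in> H10 \<Omega>" for v using a1_coercive that by blast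
    show "\<beta>v * (V_seminorm \<Omega> v)\<^sup>2 \<le> av v v" if "v \<in> H10 \<Omega>" for v using av_coercive that by blast
  qed (fact bilin av_bilinear \<beta>_pos \<beta>v_pos sets_nu M0(2))+
  define F where "F = (\<lambda>s. (f s, 0 :: real \<Rightarrow> real^'d \<Rightarrow> real))"
  note F = forcing_regular[OF f, folded F_def]
  have x0: "(u0, 0) \<in> W_space \<Omega> a1 \<nu>" using u0 by (simp add: mem_W)
  have X: "X \<epsilon> t = mild_solution (W_space \<Omega> a1 \<nu>) (W_norm \<Omega> a1 \<nu>) (S \<epsilon>) (u0, 0) F t" for \<epsilon> t
    unfolding X_def F_def ..
  have problem: "mild_problem (W_space \<Omega> a1 \<nu>) W_inner (W_norm \<Omega> a1 \<nu>) (S \<epsilon>) F (u0, 0) T" if "\<epsilon> \<in> {0..1}" for \<epsilon>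
  proof -
    interpret contraction_semigroup_space "W_space \<Omega> a1 \<nu>" W_inner "W_norm \<Omega> a1 \<nu>" "S \<epsilon>"
      by unfold_locales (use S_semigroup that in blast)
    show ?thesis by unfold_locales (use T_pos x0 F in \<open>auto simp: F_def\<close>)
  qed
  have pair: "perturbed_pair \<Omega> a0 a1 av \<nu> C0 C1 Cv \<beta> \<beta>v (S 0) (S \<epsilon>) F (u0, 0) T \<epsilon>" if \<epsilon>: "0 < \<epsilon>" "\<epsilon> \<le> 1" for \<epsilon>
  proof (intro perturbed_pair.intro perturbed_pair_axioms.intro memory_forms_axioms)
    show "0 < T" "0 < \<epsilon>" by fact+
    show "mild_problem (W_space \<Omega> a1 \<nu>) W_inner (W_norm \<Omega> a1 \<nu>) (S 0) F (u0, 0) T"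
      "mild_problem (W_space \<Omega> a1 \<nu>) W_inner (W_norm \<Omega> a1 \<nu>) (S \<epsilon>) F (u0, 0) T"
      using problem \<epsilon> by auto
    show "generates (W_space \<Omega> a1 \<nu>) (W_norm \<Omega> a1 \<nu>) (A_graph \<Omega> (\<lambda>v w. a0 v w + 0 * av v w) a1 \<nu>) (S 0)"
      using bspec[OF S_generator, of 0] by simp
    show "generates (W_space \<Omega> a1 \<nu>) (W_norm \<Omega> a1 \<nu>) (A_graph \<Omega> (\<lambda>v w. a0 v w + \<epsilon> * av v w) a1 \<nu>) (S \<epsilon>)"
      using bspec[OF S_generator, of \<epsilon>] \<epsilon> by simp
    show "(\<lambda>t. fst (mild_solution (W_space \<Omega> a1 \<nu>) (W_norm \<Omega> a1 \<nu>) (S 0) (u0, 0) F t)) \<in> Bochner_Lp 2 (lebesgue_on {0..T}) (H10 \<Omega>) (V_norm \<Omega>)"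
      using u0_regular unfolding u_def X .
  qed
  define E\<^sub>0 where "E\<^sub>0 t = (LINT s|lebesgue_on {0..t}. av (u 0 s) (u 0 s))" for t
  have Y: "perturbed_pair.Y \<Omega> a1 \<nu> (S 0) (S \<epsilon>) F (u0, 0) s = X \<epsilon> s - X 0 s" if "0 < \<epsilon>" "\<epsilon> \<le> 1" for \<epsilon> s
  proof -
    interpret perturbed_pair \<Omega> a0 a1 av \<nu> C0 C1 Cv \<beta> \<beta>v "S 0" "S \<epsilon>" F "(u0, 0)" T \<epsilon> by (rule pair[OF that])
    show ?thesis unfolding Y_def P0.X_def P1.X_def X ..
  qed
  have G: "perturbed_pair.\<Gamma> \<Omega> a1 av \<nu> (S 0) F (u0, 0) t = E\<^sub>0 t" for t
  proof -
    interpret perturbed_pair \<Omega> a0 a1 av \<nu> C0 C1 Cv \<beta> \<beta>v "S 0" "S 1" F "(u0, 0)" T 1 by (rule pair) auto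
    show ?thesis unfolding \<Gamma>_def E\<^sub>0_def P0.X_def u_def X ..
  qed
  have u0_energy: "integrable (lebesgue_on {0..T}) (\<lambda>s. av (u 0 s) (u 0 s))"
  proof -
    interpret perturbed_pair \<Omega> a0 a1 av \<nu> C0 C1 Cv \<beta> \<beta>v "S 0" "S 1" F "(u0, 0)" T 1 by (rule pair) auto
    show ?thesis using u_energy_integrable unfolding P0.X_def u_def X .
  qed
  have E0_nonneg: "0 \<le> E\<^sub>0 T"
  proof -
    interpret perturbed_pair \<Omega> a0 a1 av \<nu> C0 C1 Cv \<beta> \<beta>v "S 0" "S 1" F "(u0, 0)" T 1 by (rule pair) auto
    show ?thesis using \<Gamma>_nonneg[of T] T_pos unfolding G by simp
  qed
  have path: "continuous_path_in T (W_space \<Omega> a1 \<nu>) (W_norm \<Omega> a1 \<nu>) (X \<epsilon>)" if \<epsilon>: "\<epsilon> \<in> {0..1}" for \<epsilon>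
  proof -
    interpret P: mild_problem "W_space \<Omega> a1 \<nu>" W_inner "W_norm \<Omega> a1 \<nu>" "S \<epsilon>" F "(u0, 0)" T by (rule problem[OF \<epsilon>])
    have "P.X = X \<epsilon>" by (rule ext) (simp only: P.X_def X)
    with P.X_uniform_path have "W.uniform_path T (X \<epsilon>)" by simp
    then show ?thesis
      unfolding continuous_path_in_def using W.uniform_path_mem W.uniform_path_tendsto by blast
  qed
  have ez: "e \<epsilon> s = fst (X \<epsilon> s - X 0 s)" "z \<epsilon> s = snd (X \<epsilon> s - X 0 s)" for \<epsilon> s
    unfolding e_def z_def u_def \<zeta>_def by auto
  have a0_zero: "a0 0 0 = 0" "a1 0 0 = 0"
  proof -
    have "(0 :: real^'d \<Rightarrow> real) \<in> H10 \<Omega>" by simp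
    then show "a0 0 0 = 0" "a1 0 0 = 0"
      using bilin unfolding symmetric_bilinear_on_def by (metis mult_zero_left scaleR_zero_left)+
  qed
  have errors: "(AE s in lebesgue_on {0..T}. e \<epsilon> s \<in> H10 \<Omega>) \<and>
    (\<lambda>s. a0 (e \<epsilon> s) (e \<epsilon> s)) \<in> borel_measurable (lebesgue_on {0..T}) \<and>
    (\<lambda>s. av (e \<epsilon> s) (e \<epsilon> s)) \<in> borel_measurable (lebesgue_on {0..T}) \<and>
    (\<lambda>s. \<integral>\<^sup>+l. ennreal (l * a1 (z \<epsilon> s l) (z \<epsilon> s l)) \<partial>\<nu>) \<in> borel_measurable (lebesgue_on {0..T}) \<and>
    (\<forall>t\<in>{0..T}. ennreal ((L2_norm \<Omega> (e \<epsilon> t))\<^sup>2 + (K_norm a1 \<nu> (z \<epsilon> t))\<^sup>2)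
        + 2 * (\<integral>\<^sup>+s. ennreal (a0 (e \<epsilon> s) (e \<epsilon> s)) \<partial>lebesgue_on {0..t})
        + ennreal \<epsilon> * (\<integral>\<^sup>+s. ennreal (av (e \<epsilon> s) (e \<epsilon> s)) \<partial>lebesgue_on {0..t})
        + 2 * (\<integral>\<^sup>+s. (\<integral>\<^sup>+l. ennreal (l * a1 (z \<epsilon> s l) (z \<epsilon> s l)) \<partial>\<nu>) \<partial>lebesgue_on {0..t})
        \<le> ennreal (\<epsilon> * E\<^sub>0 t)) \<and>
    (\<forall>t\<in>{0..T}. (L2_norm \<Omega> (e \<epsilon> t))\<^sup>2 + (K_norm a1 \<nu> (z \<epsilon> t))\<^sup>2 \<le> \<epsilon> * E\<^sub>0 T) \<and>
    (\<forall>t\<in>{0..T}. W_norm \<Omega> a1 \<nu> (X \<epsilon> t - X 0 t) \<le> sqrt \<epsilon> * sqrt (E\<^sub>0 T))"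
    if \<epsilon>1: "\<epsilon> \<in> {0..1}" for \<epsilon>
  proof (cases "\<epsilon> = 0")
    case True
    \<comment> \<open>For \<open>\<epsilon> = 0\<close> the two problems coincide.\<close>
    have "e 0 s = 0" "z 0 s = 0" "X 0 s - X 0 s = 0" for s unfolding e_def z_def by auto
    then show ?thesis unfolding True by (simp add: a0_zero)
  next
    case False
    then have \<epsilon>: "0 < \<epsilon>" "\<epsilon> \<le> 1" using \<epsilon>1 by auto
    interpret perturbed_pair \<Omega> a0 a1 av \<nu> C0 C1 Cv \<beta> \<beta>v "S 0" "S \<epsilon>" F "(u0, 0)" T \<epsilon> by (rule pair[OF \<epsilon>])
    note Y' = Y[OF \<epsilon>]
    have 1: "AE s in lebesgue_on {0..T}. fst (X \<epsilon> s - X 0 s) \<in> H10 \<Omega>" using error_H10 unfolding Y' .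
    note 2 = energy_measurable[OF Y_path error_H10, unfolded Y']
    have 3: "(\<lambda>s. memory_dissipation (snd (X \<epsilon> s - X 0 s))) \<in> borel_measurable (lebesgue_on {0..T})"
      using path_measurable(2)[OF Y_path order_refl \<epsilon>(1)] unfolding Y' .
    note 4 = error_energy_estimate[unfolded Y' G] and 5 = error_bound[unfolded Y' G]
    show ?thesis
      unfolding ez using 1 2 3 4 5 by (auto simp: memory_dissipation_def W_norm_squared)
  qed
  note err = errors[THEN conjunct1]
    errors[THEN conjunct2, THEN conjunct1]
    errors[THEN conjunct2, THEN conjunct2, THEN conjunct1]
    errors[THEN conjunct2, THEN conjunct2, THEN conjunct2, THEN conjunct1]
    errors[THEN conjunct2, THEN conjunct2, THEN conjunct2, THEN conjunct2, THEN conjunct1]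
    errors[THEN conjunct2, THEN conjunct2, THEN conjunct2, THEN conjunct2, THEN conjunct2, THEN conjunct1]
    errors[THEN conjunct2, THEN conjunct2, THEN conjunct2, THEN conjunct2, THEN conjunct2, THEN conjunct2]
  have sup: "sup_norm_path T (W_norm \<Omega> a1 \<nu>) (\<lambda>t. X \<epsilon> t - X 0 t) \<le> sqrt \<epsilon> * sqrt (E\<^sub>0 T)"
    "0 \<le> sup_norm_path T (W_norm \<Omega> a1 \<nu>) (\<lambda>t. X \<epsilon> t - X 0 t)" if "\<epsilon> \<in> {0..1}" for \<epsilon>
  proof -
    note b = Sup_le_and_bdd[OF T_pos err(7)[OF that, rule_format]]
    show "sup_norm_path T (W_norm \<Omega> a1 \<nu>) (\<lambda>t. X \<epsilon> t - X 0 t) \<le> sqrt \<epsilon> * sqrt (E\<^sub>0 T)"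
      unfolding sup_norm_path_def by (rule b(2))
    have "0 \<le> W_norm \<Omega> a1 \<nu> (X \<epsilon> 0 - X 0 0)" by (simp add: W_norm_def)
    also have "\<dots> \<le> (SUP t\<in>{0..T}. W_norm \<Omega> a1 \<nu> (X \<epsilon> t - X 0 t))" by (rule cSUP_upper[OF _ b(1)]) (use T_pos in simp)
    finally show "0 \<le> sup_norm_path T (W_norm \<Omega> a1 \<nu>) (\<lambda>t. X \<epsilon> t - X 0 t)" unfolding sup_norm_path_def .
  qed
  have "(\<lambda>\<epsilon>. sup_norm_path T (W_norm \<Omega> a1 \<nu>) (\<lambda>t. X \<epsilon> t - X 0 t)) \<in> O[at_right 0](sqrt)"
  proof (rule bigoI[where c="sqrt (E\<^sub>0 T)"])
    have "norm (sup_norm_path T (W_norm \<Omega> a1 \<nu>) (\<lambda>t. X \<epsilon> t - X 0 t)) \<le> sqrt (E\<^sub>0 T) * norm (sqrt \<epsilon>)" if "0 < \<epsilon>" "\<epsilon> < 1" for \<epsilon>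
      using sup[of \<epsilon>] that by (simp add: mult.commute)
    then show "\<forall>\<^sub>F \<epsilon> in at_right 0. norm (sup_norm_path T (W_norm \<Omega> a1 \<nu>) (\<lambda>t. X \<epsilon> t - X 0 t)) \<le> sqrt (E\<^sub>0 T) * norm (sqrt \<epsilon>)"
      unfolding eventually_at_right_field by (intro exI[of _ 1]) auto
  qed
  moreover note Sup_le_and_bdd[OF T_pos err(6)[rule_format]]
  ultimately show ?thesis
    unfolding E\<^sub>0_def[symmetric] by (intro conjI ballI path err(1-4) u0_energy err(5)[rule_format] sup(1)) auto
qed

end
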